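(* The only constant mean curvature proper biharmonic (connected) surfaces in Thurston's eight 3-dimensional geometries $\mathbb{R}^3$, $S^3$, $H^3$, $S^2\times\mathbb{R}$, $H^2\times\mathbb{R}$, $\widetilde{SL}(2,\mathbb{R})$, $\mathrm{Nil}$, $\mathrm{Sol}$ are a part of $S^2(1/\sqrt{2})$ in $S^3$, or a part of $S^1(1/\sqrt{2})\times\mathbb{R}$ in $S^2\times\mathbb{R}$. That is, a constant mean curvature surface in one of these spaces is proper biharmonic if and only if it is of one of these two kinds.
   Context: All manifolds and maps are smooth. A map $\varphi:(M,g)\to(N,h)$ of Riemannian manifolds is biharmonic if for every compact $\Omega\subset M$ it is a critical point of the bienergy $E^2(\varphi,\Omega)=\frac12\int_\Omega|\tau(\varphi)|^2dx$, where $\tau(\varphi)=\mathrm{Trace}_g\nabla d\varphi$ is the tension field; equivalently $\mathrm{Trace}_{g}(\nabla^{\varphi}\nabla^{\varphi}-\nabla^{\varphi}_{\nabla^{M}})\tau(\varphi)-\mathrm{Trace}_{g}R^{N}(d\varphi,\tau(\varphi))d\varphi=0$, with $R^N(X,Y)Z=[\nabla^N_X,\nabla^N_Y]Z-\nabla^N_{[X,Y]}Z$. A surface (immersed 2-dimensional submanifold with induced metric) is biharmonic if its isometric immersion is a biharmonic map, and proper biharmonic if it is biharmonic but not minimal. With $\xi$ a local unit normal and $A$ the shape operator, the mean curvature is $H=\frac12\mathrm{trace}\,A$. Here $\mathbb{R}^3,S^3,H^3$ are the space forms of curvature $0,1,-1$; $S^2\times\mathbb{R}$ and $H^2\times\mathbb{R}$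 are Riemannian products with $S^2$, $H^2$ of curvature $1$, $-1$; $\mathrm{Sol}=(\mathbb{R}^3,e^{2z}dx^2+e^{-2z}dy^2+dz^2)$; $\mathrm{Nil}$ and $\widetilde{SL}(2,\mathbb{R})$ are the Bianchi-Cartan-Vranceanu spaces $\{1+m(x^2+y^2)>0\}\subset\mathbb{R}^3$ with metric $\frac{dx^2+dy^2}{[1+m(x^2+y^2)]^2}+\left[dz+\frac{l}{2}\frac{y\,dx-x\,dy}{1+m(x^2+y^2)}\right]^2$ with $m=0,l\neq0$ and with $m<0,l\ne0$, respectively. $S^2(1/\sqrt2)\subset S^3$ is the intersection of the unit sphere $S^3\subset\mathbb{R}^4$ with a hyperplane at distance $1/\sqrt2$ from the origin, and $S^1(1/\sqrt2)\subset S^2$ is a circle of Euclidean radius $1/\sqrt2$ in the unit sphere $S^2\subset\mathbb{R}^3$. "A part of" means an open piece. *)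

theory Defs
  imports "HOL-Analysis.Analysis"
begin

section \<open>Smooth functions between Euclidean spaces\<close>

text \<open>All uses of \<open>smooth_on\<close> below are on open sets, where \<open>differentiable_on\<close> is
  ordinary differentiability.\<close>

primrec Ck_on :: "nat \<Rightarrow> ('a::euclidean_space \<Rightarrow> 'b::real_normed_vector) \<Rightarrow> 'a set \<Rightarrow> bool" where
  "Ck_on 0 f S \<longleftrightarrow> continuous_on S f"
| "Ck_on (Suc k) f S \<longleftrightarrow>
     f differentiable_on S \<and> (\<forall>v. Ck_on k (\<lambda>x. frechet_derivative f (at x) v) S)"

definition smooth_on :: "('a::euclidean_space \<Rightarrow> 'b::real_normed_vector) \<Rightarrow> 'a set \<Rightarrow> bool" where
  "smooth_on f S \<longleftrightarrow> (\<forall>k. Ck_on k f S)"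

definition pd :: "'n::finite \<Rightarrow> (real^'n \<Rightarrow> 'b::real_normed_vector) \<Rightarrow> real^'n \<Rightarrow> 'b" where
  "pd i f u = frechet_derivative f (at u) (axis i 1)"

section \<open>Riemannian manifolds\<close>

text \<open>A Riemannian manifold is a topological space with a smooth atlas in which every chart
  \<open>coord : cdom \<rightarrow> \<real>\<^sup>n\<close> comes with the Gram matrix \<open>gram\<close> of the metric in these
  coordinates, as a function of the coordinates. The atlas need not be maximal.\<close>

record ('a, 'n::finite) rchart =
  cdom :: "'a set"
  coord :: "'a \<Rightarrow> real^'n"
  gram :: "real^'n \<Rightarrow> real^'n^'n"

record ('a, 'n::finite) rmanifold =
  top_space :: "'a topology"
  atlas :: "('a, 'n) rchart set"

definition chart_inv :: "('a, 'n::finite) rchart \<Rightarrow> real^'n \<Rightarrow> 'a" where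
  "chart_inv c = inv_into (cdom c) (coord c)"

definition metric_ip :: "real^'n^'n \<Rightarrow> real^'n \<Rightarrow> real^'n \<Rightarrow> real" where
  "metric_ip G v w = (\<Sum>a\<in>UNIV. \<Sum>b\<in>UNIV. G $ a $ b * v $ a * w $ b)"

definition second_countable_space :: "'a topology \<Rightarrow> bool" where
  "second_countable_space X \<longleftrightarrow>
     (\<exists>B. countable B \<and> (\<forall>V\<in>B. openin X V) \<and> (\<forall>U. openin X U \<longrightarrow> (\<exists>C\<subseteq>B. U = \<Union>C)))"

definition riemannian_chart :: "'a topology \<Rightarrow> ('a, 'n::finite) rchart \<Rightarrow> bool" where
  "riemannian_chart X c \<longleftrightarrow>
     openin X (cdom c) \<and> open (coord c ` cdom c) \<and>
     homeomorphic_map (subtopology X (cdom c)) (top_of_set (coord c ` cdom c)) (coord c) \<and>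
     smooth_on (gram c) (coord c ` cdom c) \<and>
     (\<forall>u\<in>coord c ` cdom c. transpose (gram c u) = gram c u \<and>
        (\<forall>v. v \<noteq> 0 \<longrightarrow> metric_ip (gram c u) v v > 0))"

definition compatible_charts :: "('a, 'n::finite) rchart \<Rightarrow> ('a, 'n) rchart \<Rightarrow> bool" where
  "compatible_charts c d \<longleftrightarrow>
     (let T = coord d \<circ> chart_inv c; W = coord c ` (cdom c \<inter> cdom d) in
        smooth_on T W \<and>
        (\<forall>u\<in>W. \<forall>i j. gram c u $ i $ j = metric_ip (gram d (T u)) (pd i T u) (pd j T u)))"

definition riemannian_manifold :: "('a, 'n::finite) rmanifold \<Rightarrow> bool" where
  "riemannian_manifold M \<longleftrightarrow>
     Hausdorff_space (top_space M) \<and> second_countable_space (top_space M) \<and>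
     (\<Union>c\<in>atlas M. cdom c) = topspace (top_space M) \<and>
     (\<forall>c\<in>atlas M. riemannian_chart (top_space M) c) \<and>
     (\<forall>c\<in>atlas M. \<forall>d\<in>atlas M. compatible_charts c d)"

section \<open>Connection, tension field and bitension field in coordinates\<close>

text \<open>\<open>christoffel G u k i j\<close> is the symbol \<open>\<Gamma>\<^sup>k\<^sub>i\<^sub>j\<close> of the Levi-Civita connection of \<open>G\<close>.\<close>

definition christoffel ::
    "(real^'n \<Rightarrow> real^'n^'n) \<Rightarrow> real^'n \<Rightarrow> 'n \<Rightarrow> 'n \<Rightarrow> 'n::finite \<Rightarrow> real" where
  "christoffel G u k i j =
     (\<Sum>l\<in>UNIV. matrix_inv (G u) $ k $ l *
        (pd i (\<lambda>x. G x $ j $ l) u + pd j (\<lambda>x. G x $ i $ l) u - pd l (\<lambda>x. G x $ i $ j) u) / 2)"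

text \<open>The curvature \<open>R(X,Y)Z = [\<nabla>\<^sub>X,\<nabla>\<^sub>Y]Z - \<nabla>\<^bsub>[X,Y]\<^esub>Z\<close>.\<close>

definition riemann ::
    "(real^'n \<Rightarrow> real^'n^'n) \<Rightarrow> real^'n \<Rightarrow> real^'n \<Rightarrow> real^'n \<Rightarrow> real^'n \<Rightarrow> real^('n::finite)" where
  "riemann G u X Y Z = (\<chi> d. \<Sum>a\<in>UNIV. \<Sum>b\<in>UNIV. \<Sum>c\<in>UNIV. X $ a * Y $ b * Z $ c *
     (pd a (\<lambda>x. christoffel G x d b c) u - pd b (\<lambda>x. christoffel G x d a c) u +
      (\<Sum>e\<in>UNIV. christoffel G u d a e * christoffel G u e b c
              - christoffel G u d b e * christoffel G u e a c)))"

text \<open>In the following, \<open>F\<close> is a map between coordinate domains with metrics \<open>G\<close> (source)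
  and \<open>H\<close> (target), and \<open>V\<close> is a vector field along \<open>F\<close>. \<open>pullback_cov H F i V\<close> is
  \<open>\<nabla>\<^sup>\<phi>V\<close> in the direction of the \<open>i\<close>-th coordinate vector field, and
  \<open>second_fundamental_form\<close> is \<open>\<nabla>d\<phi>\<close>.\<close>

definition pullback_cov ::
    "(real^'n \<Rightarrow> real^'n^'n) \<Rightarrow> (real^'m \<Rightarrow> real^'n) \<Rightarrow> 'm::finite \<Rightarrow>
     (real^'m \<Rightarrow> real^'n) \<Rightarrow> real^'m \<Rightarrow> real^('n::finite)" where
  "pullback_cov H F i V u = (\<chi> a. pd i V u $ a +
     (\<Sum>b\<in>UNIV. \<Sum>c\<in>UNIV. christoffel H (F u) a b c * pd i F u $ b * V u $ c))"

definition second_fundamental_form ::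
    "(real^'m \<Rightarrow> real^'m^'m) \<Rightarrow> (real^'n \<Rightarrow> real^'n^'n) \<Rightarrow> (real^'m \<Rightarrow> real^'n) \<Rightarrow>
     'm::finite \<Rightarrow> 'm \<Rightarrow> real^'m \<Rightarrow> real^('n::finite)" where
  "second_fundamental_form G H F i j u =
     pullback_cov H F i (pd j F) u - (\<Sum>k\<in>UNIV. christoffel G u k i j *\<^sub>R pd k F u)"

definition tension ::
    "(real^'m::finite \<Rightarrow> real^'m^'m) \<Rightarrow> (real^'n \<Rightarrow> real^'n^'n) \<Rightarrow> (real^'m \<Rightarrow> real^'n) \<Rightarrow>
     real^'m \<Rightarrow> real^('n::finite)" where
  "tension G H F u =
     (\<Sum>i\<in>UNIV. \<Sum>j\<in>UNIV. matrix_inv (G u) $ i $ j *\<^sub>R second_fundamental_form G H F i j u)"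

text \<open>\<open>Trace\<^sub>g(\<nabla>\<^sup>\<phi>\<nabla>\<^sup>\<phi> - \<nabla>\<^sup>\<phi>\<^bsub>\<nabla>\<^esub>)\<tau>(\<phi>) - Trace\<^sub>g R(d\<phi>,\<tau>(\<phi>))d\<phi>\<close>\<close>

definition bitension ::
    "(real^'m::finite \<Rightarrow> real^'m^'m) \<Rightarrow> (real^'n \<Rightarrow> real^'n^'n) \<Rightarrow> (real^'m \<Rightarrow> real^'n) \<Rightarrow>
     real^'m \<Rightarrow> real^('n::finite)" where
  "bitension G H F u =
     (let \<tau> = tension G H F in
      (\<Sum>i\<in>UNIV. \<Sum>j\<in>UNIV. matrix_inv (G u) $ i $ j *\<^sub>R
         (pullback_cov H F i (pullback_cov H F j \<tau>) u
          - (\<Sum>k\<in>UNIV. christoffel G u k i j *\<^sub>R pullback_cov H F k \<tau> u)))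
      - (\<Sum>i\<in>UNIV. \<Sum>j\<in>UNIV. matrix_inv (G u) $ i $ j *\<^sub>R
           riemann H (F u) (pd i F u) (\<tau> u) (pd j F u)))"

section \<open>Maps, immersed surfaces, mean curvature\<close>

definition local_rep ::
    "('a, 'm::finite) rchart \<Rightarrow> ('b, 'n::finite) rchart \<Rightarrow> ('a \<Rightarrow> 'b) \<Rightarrow> real^'m \<Rightarrow> real^'n" where
  "local_rep c d \<phi> = coord d \<circ> \<phi> \<circ> chart_inv c"

definition rep_dom ::
    "('a, 'm::finite) rchart \<Rightarrow> ('b, 'n::finite) rchart \<Rightarrow> ('a \<Rightarrow> 'b) \<Rightarrow> (real^'m) set" where
  "rep_dom c d \<phi> = coord c ` (cdom c \<inter> \<phi> -` cdom d)"

definition smooth_map ::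
    "('a, 'm::finite) rmanifold \<Rightarrow> ('b, 'n::finite) rmanifold \<Rightarrow> ('a \<Rightarrow> 'b) \<Rightarrow> bool" where
  "smooth_map M N \<phi> \<longleftrightarrow> continuous_map (top_space M) (top_space N) \<phi> \<and>
     (\<forall>c\<in>atlas M. \<forall>d\<in>atlas N. smooth_on (local_rep c d \<phi>) (rep_dom c d \<phi>))"

definition biharmonic ::
    "('a, 'm::finite) rmanifold \<Rightarrow> ('b, 'n::finite) rmanifold \<Rightarrow> ('a \<Rightarrow> 'b) \<Rightarrow> bool" where
  "biharmonic M N \<phi> \<longleftrightarrow> smooth_map M N \<phi> \<and>
     (\<forall>c\<in>atlas M. \<forall>d\<in>atlas N. \<forall>u\<in>rep_dom c d \<phi>.
        bitension (gram c) (gram d) (local_rep c d \<phi>) u = 0)"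

text \<open>Injectivity of the differential follows from positivity of the metric of the source.
  For \<open>M\<close> ranging over all Riemannian manifolds, the condition says that \<open>M\<close> is an
  immersed submanifold carrying the induced metric.\<close>

definition isometric_immersion ::
    "('a, 'm::finite) rmanifold \<Rightarrow> ('b, 'n::finite) rmanifold \<Rightarrow> ('a \<Rightarrow> 'b) \<Rightarrow> bool" where
  "isometric_immersion M N \<phi> \<longleftrightarrow> smooth_map M N \<phi> \<and>
     (\<forall>c\<in>atlas M. \<forall>d\<in>atlas N. \<forall>u\<in>rep_dom c d \<phi>. \<forall>i j.
        gram c u $ i $ j =
          metric_ip (gram d (local_rep c d \<phi> u)) (pd i (local_rep c d \<phi>) u) (pd j (local_rep c d \<phi>) u))"

definition local_unit_normal ::
    "(real^'n \<Rightarrow> real^'n^'n) \<Rightarrow> (real^'m \<Rightarrow> real^'n) \<Rightarrow> (real^'m) set \<Rightarrow>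
     (real^'m::finite \<Rightarrow> real^('n::finite)) \<Rightarrow> bool" where
  "local_unit_normal H F W \<xi> \<longleftrightarrow> open W \<and> smooth_on \<xi> W \<and>
     (\<forall>u\<in>W. metric_ip (H (F u)) (\<xi> u) (\<xi> u) = 1 \<and>
        (\<forall>i. metric_ip (H (F u)) (\<xi> u) (pd i F u) = 0))"

text \<open>Half the trace of the shape operator \<open>A\<close>, where \<open>d\<phi>(A X) = - \<nabla>\<^sup>\<phi>\<^sub>X \<xi>\<close>.\<close>

definition mean_curvature ::
    "(real^2 \<Rightarrow> real^2^2) \<Rightarrow> (real^3 \<Rightarrow> real^3^3) \<Rightarrow> (real^2 \<Rightarrow> real^3) \<Rightarrow>
     (real^2 \<Rightarrow> real^3) \<Rightarrow> real^2 \<Rightarrow> real" where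
  "mean_curvature G H F \<xi> u =
     (\<Sum>i\<in>UNIV. \<Sum>j\<in>UNIV. matrix_inv (G u) $ i $ j *
        metric_ip (H (F u)) (- pullback_cov H F i \<xi> u) (pd j F u)) / 2"

text \<open>The sign of the mean curvature depends on the choice of the local unit normal, and no
  global choice need exist. For one and the same local unit normal on a connected set,
  constancy of the absolute value is constancy of the mean curvature, by continuity.\<close>

definition has_abs_mean_curvature ::
    "('a, 2) rmanifold \<Rightarrow> ('b, 3) rmanifold \<Rightarrow> ('a \<Rightarrow> 'b) \<Rightarrow> real \<Rightarrow> bool" where
  "has_abs_mean_curvature M N \<phi> k \<longleftrightarrow>
     (\<forall>c\<in>atlas M. \<forall>d\<in>atlas N. \<forall>W \<subseteq> rep_dom c d \<phi>. \<forall>\<xi>.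
        local_unit_normal (gram d) (local_rep c d \<phi>) W \<xi> \<longrightarrow>
        (\<forall>u\<in>W. \<bar>mean_curvature (gram c) (gram d) (local_rep c d \<phi>) \<xi> u\<bar> = k))"

definition cmc_surface :: "('a, 2) rmanifold \<Rightarrow> ('b, 3) rmanifold \<Rightarrow> ('a \<Rightarrow> 'b) \<Rightarrow> bool" where
  "cmc_surface M N \<phi> \<longleftrightarrow> isometric_immersion M N \<phi> \<and> (\<exists>k. has_abs_mean_curvature M N \<phi> k)"

definition minimal_surface :: "('a, 2) rmanifold \<Rightarrow> ('b, 3) rmanifold \<Rightarrow> ('a \<Rightarrow> 'b) \<Rightarrow> bool" where
  "minimal_surface M N \<phi> \<longleftrightarrow> isometric_immersion M N \<phi> \<and> has_abs_mean_curvature M N \<phi> 0"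

definition proper_biharmonic :: "('a, 2) rmanifold \<Rightarrow> ('b, 3) rmanifold \<Rightarrow> ('a \<Rightarrow> 'b) \<Rightarrow> bool" where
  "proper_biharmonic M N \<phi> \<longleftrightarrow>
     isometric_immersion M N \<phi> \<and> biharmonic M N \<phi> \<and> \<not> minimal_surface M N \<phi>"

definition part_of :: "('a, 'm::finite) rmanifold \<Rightarrow> ('a \<Rightarrow> 'b::topological_space) \<Rightarrow> 'b set \<Rightarrow> bool" where
  "part_of M \<phi> S \<longleftrightarrow> openin (top_of_set S) (\<phi> ` topspace (top_space M))"

section \<open>The eight geometries\<close>

definition open_manifold :: "(real^'n) set \<Rightarrow> (real^'n \<Rightarrow> real^'n^'n) \<Rightarrow> (real^'n, 'n::finite) rmanifold" where
  "open_manifold D G =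
     \<lparr>top_space = top_of_set D, atlas = {\<lparr>cdom = D, coord = id, gram = G\<rparr>}\<rparr>"

definition euclidean_manifold :: "(real^'n, 'n::finite) rmanifold" where
  "euclidean_manifold = open_manifold UNIV (\<lambda>_. mat 1)"

text \<open>The upper half-space model, with height coordinate \<open>k\<close>.\<close>

definition hyperbolic :: "'n \<Rightarrow> (real^'n, 'n::finite) rmanifold" where
  "hyperbolic k = open_manifold {u. u $ k > 0} (\<lambda>u. (1 / (u $ k)\<^sup>2) *\<^sub>R mat 1)"

text \<open>The unit sphere of \<open>\<real>\<^sup>n \<times> \<real> = \<real>\<^bsup>n+1\<^esup>\<close> with the metric induced from the ambient
  space. Its atlas consists of the stereographic projections from the poles \<open>(0, s)\<close> with
  \<open>s = 1\<close> and \<open>s = - 1\<close>.\<close>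

definition sphere_dom :: "real \<Rightarrow> ((real^'n) \<times> real) set" where
  "sphere_dom s = sphere 0 1 - {(0, s)}"

definition stereographic :: "real \<Rightarrow> (real^'n) \<times> real \<Rightarrow> real^'n" where
  "stereographic s p = fst p /\<^sub>R (1 - s * snd p)"

definition sphere_chart :: "real \<Rightarrow> ((real^'n) \<times> real, 'n::finite) rchart" where
  "sphere_chart s =
     \<lparr>cdom = sphere_dom s, coord = stereographic s,
      gram = (\<lambda>u. let \<psi> = inv_into (sphere_dom s) (stereographic s) in
                  \<chi> i j. pd i \<psi> u \<bullet> pd j \<psi> u)\<rparr>"

definition round_sphere :: "((real^'n) \<times> real, 'n::finite) rmanifold" where
  "round_sphere = \<lparr>top_space = top_of_set (sphere 0 1), atlas = {sphere_chart 1, sphere_chart (- 1)}\<rparr>"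

text \<open>The Riemannian product of a surface with the real line.\<close>

definition chart_times_line :: "('a, 2) rchart \<Rightarrow> ('a \<times> real, 3) rchart" where
  "chart_times_line c =
     \<lparr>cdom = cdom c \<times> UNIV,
      coord = (\<lambda>(p, t). vector [coord c p $ 1, coord c p $ 2, t]),
      gram = (\<lambda>u. let g = gram c (vector [u $ 1, u $ 2]) in
                  vector [vector [g $ 1 $ 1, g $ 1 $ 2, 0],
                          vector [g $ 2 $ 1, g $ 2 $ 2, 0],
                          vector [0, 0, 1]])\<rparr>"

definition times_line :: "('a, 2) rmanifold \<Rightarrow> ('a \<times> real, 3) rmanifold" where
  "times_line M =
     \<lparr>top_space = prod_topology (top_space M) euclideanreal, atlas = chart_times_line ` atlas M\<rparr>"

definition Sol :: "(real^3, 3) rmanifold" where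
  "Sol = open_manifold UNIV (\<lambda>u.
     vector [vector [exp (2 * u $ 3), 0, 0],
             vector [0, exp (- 2 * u $ 3), 0],
             vector [0, 0, 1]])"

text \<open>The Bianchi-Cartan-Vranceanu spaces; \<open>\<theta>\<close> is the coefficient vector of the one-form
  \<open>dz + (l/2) (y dx - x dy) / (1 + m (x\<^sup>2 + y\<^sup>2))\<close>.\<close>

definition BCV :: "real \<Rightarrow> real \<Rightarrow> (real^3, 3) rmanifold" where
  "BCV m l = open_manifold {u. 1 + m * ((u $ 1)\<^sup>2 + (u $ 2)\<^sup>2) > 0} (\<lambda>u.
     let D = 1 + m * ((u $ 1)\<^sup>2 + (u $ 2)\<^sup>2);
         \<theta> = (vector [l / 2 * (u $ 2 / D), - (l / 2 * (u $ 1 / D)), 1] :: real^3)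
     in \<chi> i j. (if i = j \<and> i \<noteq> 3 then 1 / D\<^sup>2 else 0) + \<theta> $ i * \<theta> $ j)"

section \<open>The two exceptional surfaces\<close>

definition small_sphere :: "(real^3) \<times> real \<Rightarrow> ((real^3) \<times> real) set" where
  "small_sphere n = sphere 0 1 \<inter> {p. n \<bullet> p = 1 / sqrt 2}"

definition circle :: "'e::euclidean_space \<Rightarrow> 'e \<Rightarrow> real \<Rightarrow> 'e set" where
  "circle n a r = {p. n \<bullet> (p - a) = 0 \<and> dist a p = r}"

text \<open>For a unit vector \<open>n\<close>, the hyperplane in \<open>small_sphere n\<close> has distance \<open>1 / sqrt 2\<close>
  from the origin; \<open>circle n a r\<close> is used in the three-dimensional space \<open>\<real>\<^sup>2 \<times> \<real>\<close>.\<close>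

definition part_of_small_sphere :: "('a, 2) rmanifold \<Rightarrow> ('a \<Rightarrow> (real^3) \<times> real) \<Rightarrow> bool" where
  "part_of_small_sphere M \<phi> \<longleftrightarrow> (\<exists>n. norm n = 1 \<and> part_of M \<phi> (small_sphere n))"

definition part_of_small_circle_times_line ::
    "('a, 2) rmanifold \<Rightarrow> ('a \<Rightarrow> ((real^2) \<times> real) \<times> real) \<Rightarrow> bool" where
  "part_of_small_circle_times_line M \<phi> \<longleftrightarrow>
     (\<exists>n a. norm n = 1 \<and> circle n a (1 / sqrt 2) \<subseteq> sphere 0 1 \<and>
        part_of M \<phi> (circle n a (1 / sqrt 2) \<times> UNIV))"

end

theory Submission
  imports Defs
begin

text \<open>A surface with constant mean curvature \<open>H \<noteq> 0\<close> is biharmonic iff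
  \<open>|A|\<^sup>2 = Ric(\<xi>, \<xi>)\<close> and the tangential part of \<open>Ric(\<xi>)\<close> vanishes, where \<open>Ric\<close> is
  \<open>2\<kappa> + \<beta>\<close> plus \<open>\<beta>\<close> times the projection onto a unit field \<open>E\<close>, in each of the eight geometries.
  If \<open>Ric(\<xi>, \<xi>) \<le> 0\<close>, then \<open>A = 0\<close>, which contradicts \<open>H \<noteq> 0\<close>. In the BCV spaces \<open>E\<close> would
  have to be normal or tangent to the surface: the contact plane field has no integral surfaces, and if
  \<open>E\<close> is tangent, then the Ricci curvature of the normal is \<open>4m - l\<^sup>2/2 \<le> 0\<close>.
  For \<open>S\<^sup>3\<close> and \<open>S\<^sup>2 \<times> \<real>\<close> consider the surface \<open>X\<close> in \<open>\<real>\<^sup>4\<close>, with axis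
  \<open>e = 0\<close> or the unit vector \<open>e\<close> of the line factor, and let \<open>P\<close> be the projection along \<open>e\<close>.
  The equations force \<open>d\<xi> = - P dX\<close> up to the sign of \<open>\<xi>\<close>, so that \<open>P X + \<xi>\<close> is a constant vector
  of length \<open>\<surd>2\<close> and \<open>X\<close> lies in a hyperplane. In \<open>S\<^sup>3\<close> this needs that the surface is umbilic:
  otherwise it is isoparametric and flat, with principal curvatures of product \<open>-1\<close>, and
  \<open>|A|\<^sup>2 = 2\<close> then gives \<open>H = 0\<close>.\<close>

section \<open>Calculus of smooth functions\<close>

text \<open>All notions are given in arbitrary charts, so the surface equations are derived without
  orthonormal or principal frames: inverse Gram matrices are cleared by the factor
  \<open>gdet\<close>, and polynomial identities remain. The tangential equation comes from Codazzi:
  constant mean curvature kills the trace of the derivative of the second fundamental form over its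
  last two slots, and exchanging slots costs exactly the axis part of the curvature. The
  isoparametric step usually takes smooth principal directions; the fields d\<xi> + q dX, with q a
  principal curvature, replace them and are smooth without any choice. The hyperplane is found only
  on a coordinate ball, with a local normal whose sign is arbitrary. It becomes global because two
  admissible hyperplanes never contain a common open piece of surface, so that connectedness
  applies. That the image is open in the exceptional surface, and not merely a subset, needs a
  separate argument: an orthogonal projection that is injective on a piece of the slice, together
  with an open mapping theorem.\<close>

lemma Ck_on_cong:
  assumes "open S" "\<And>x. x \<in> S \<Longrightarrow> f x = g x" "Ck_on k f S"
  shows "Ck_on k g S"
  using assms
proof (induction k arbitrary: f g)
  case 0
  then show ?case using continuous_on_cong by (metis Ck_on.simps(1))
next
  case (Suc k)
  have d: "f differentiable_on S" using Suc.prems by simp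
  have fr: "frechet_derivative f (at x) = frechet_derivative g (at x)" if "x \<in> S" for x
    using frechet_derivative_transform_within_open[of f x S g] d Suc.prems that
    by (auto simp: differentiable_on_eq_differentiable_at)
  have "g differentiable_on S"
    unfolding differentiable_on_def
  proof
    fix x assume x: "x \<in> S"
    then have "f differentiable (at x within S)" using d by (simp add: differentiable_on_def)
    then show "g differentiable (at x within S)"
      by (rule differentiable_transform_within[OF _ zero_less_one x]) (use Suc.prems(2) in auto)
  qed
  moreover have "Ck_on k (\<lambda>x. frechet_derivative g (at x) v) S" for v
    by (rule Suc.IH[of "\<lambda>x. frechet_derivative f (at x) v"])
      (use Suc.prems fr in auto)
  ultimately show ?case by simp
qed

lemma Ck_on_Suc_imp: "Ck_on (Suc k) f S \<Longrightarrow> Ck_on k f S"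
  by (induction k arbitrary: f) (auto intro: differentiable_imp_continuous_on)

lemma Ck_on_subset:
  assumes "open S" "open T" "T \<subseteq> S" "Ck_on k f S"
  shows "Ck_on k f T"
  using assms(4)
  by (induction k arbitrary: f) (use assms in \<open>auto intro: continuous_on_subset differentiable_on_subset\<close>)

lemma Ck_on_const: "Ck_on k (\<lambda>x. c) S"
  by (induction k arbitrary: c) auto

lemma Ck_on_bounded_linear:
  assumes "open S" "bounded_linear L" "Ck_on k f S"
  shows "Ck_on k (\<lambda>x. L (f x)) S"
  using assms(3)
proof (induction k arbitrary: f)
  case 0
  then show ?case using assms(2) by (simp add: bounded_linear.continuous_on)
next
  case (Suc k)
  have d: "(f has_derivative frechet_derivative f (at x)) (at x)" if "x \<in> S" for x
    using Suc.prems assms(1) that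
    by (auto simp: differentiable_on_eq_differentiable_at frechet_derivative_works)
  have d2: "((\<lambda>x. L (f x)) has_derivative (\<lambda>v. L (frechet_derivative f (at x) v))) (at x)" if "x \<in> S" for x
    by (rule bounded_linear.has_derivative[OF assms(2) d[OF that]])
  have "(\<lambda>x. L (f x)) differentiable_on S"
    using assms(1) d2 by (auto simp: differentiable_on_eq_differentiable_at differentiable_def)
  moreover have "Ck_on k (\<lambda>x. frechet_derivative (\<lambda>x. L (f x)) (at x) v) S" for v
  proof (rule Ck_on_cong[OF assms(1)])
    show "Ck_on k (\<lambda>x. L (frechet_derivative f (at x) v)) S"
      using Suc by simp
    show "L (frechet_derivative f (at x) v) = frechet_derivative (\<lambda>x. L (f x)) (at x) v" if "x \<in> S" for x
      by (simp flip: frechet_derivative_at[OF d2[OF that]])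
  qed
  ultimately show ?case by simp
qed

lemma Ck_on_add:
  assumes "open S" "Ck_on k f S" "Ck_on k g S"
  shows "Ck_on k (\<lambda>x. f x + g x) S"
  using assms(2,3)
proof (induction k arbitrary: f g)
  case 0
  then show ?case by (simp add: continuous_on_add)
next
  case (Suc k)
  have d2: "((\<lambda>x. f x + g x) has_derivative
      (\<lambda>v. frechet_derivative f (at x) v + frechet_derivative g (at x) v)) (at x)" if "x \<in> S" for x
    by (rule has_derivative_add)
      (use Suc.prems assms(1) that in
        \<open>auto simp: differentiable_on_eq_differentiable_at frechet_derivative_works\<close>)
  have "(\<lambda>x. f x + g x) differentiable_on S"
    using assms(1) d2 by (auto simp: differentiable_on_eq_differentiable_at differentiable_def)
  moreover have "Ck_on k (\<lambda>x. frechet_derivative (\<lambda>x. f x + g x) (at x) v) S" for v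
  proof (rule Ck_on_cong[OF assms(1)])
    show "Ck_on k (\<lambda>x. frechet_derivative f (at x) v + frechet_derivative g (at x) v) S"
      using Suc by simp
    show "frechet_derivative f (at x) v + frechet_derivative g (at x) v =
        frechet_derivative (\<lambda>x. f x + g x) (at x) v" if "x \<in> S" for x
      by (simp flip: frechet_derivative_at[OF d2[OF that]])
  qed
  ultimately show ?case by simp
qed

text \<open>The product rule leaves one factor undifferentiated; \<open>Ck_on_Suc_imp\<close> lowers
  its order so that the induction hypothesis covers both summands.\<close>

lemma Ck_on_bilinear:
  assumes "open S" "bounded_bilinear B" "Ck_on k f S" "Ck_on k g S"
  shows "Ck_on k (\<lambda>x. B (f x) (g x)) S"
  using assms(3,4)
proof (induction k arbitrary: f g)
  case 0
  then show ?case using bounded_bilinear.continuous_on[OF assms(2)] by simp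
next
  case (Suc k)
  have d2: "((\<lambda>x. B (f x) (g x)) has_derivative
      (\<lambda>v. B (f x) (frechet_derivative g (at x) v) + B (frechet_derivative f (at x) v) (g x))) (at x)"
    if "x \<in> S" for x
    by (rule bounded_bilinear.FDERIV[OF assms(2)])
      (use Suc.prems assms(1) that in
        \<open>auto simp: differentiable_on_eq_differentiable_at frechet_derivative_works\<close>)
  have "(\<lambda>x. B (f x) (g x)) differentiable_on S"
    using assms(1) d2 by (auto simp: differentiable_on_eq_differentiable_at differentiable_def)
  moreover have "Ck_on k (\<lambda>x. frechet_derivative (\<lambda>x. B (f x) (g x)) (at x) v) S" for v
  proof (rule Ck_on_cong[OF assms(1)])
    show "Ck_on k (\<lambda>x. B (f x) (frechet_derivative g (at x) v) + B (frechet_derivative f (at x) v) (g x)) S"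
      by (intro Ck_on_add assms(1) Suc.IH Suc.prems(1,2)[THEN Ck_on_Suc_imp]) (use Suc.prems in auto)
    show "B (f x) (frechet_derivative g (at x) v) + B (frechet_derivative f (at x) v) (g x) =
        frechet_derivative (\<lambda>x. B (f x) (g x)) (at x) v" if "x \<in> S" for x
      by (simp flip: frechet_derivative_at[OF d2[OF that]])
  qed
  ultimately show ?case by simp
qed

lemma Ck_on_sum:
  assumes "open S" "\<And>i. i \<in> I \<Longrightarrow> Ck_on k (f i) S"
  shows "Ck_on k (\<lambda>x. \<Sum>i\<in>I. f i x) S"
  using assms(2)
  by (induction I rule: infinite_finite_induct) (auto intro: Ck_on_const Ck_on_add[OF assms(1)])

lemma Ck_on_compose:
  fixes f :: "'a::euclidean_space \<Rightarrow> 'b::euclidean_space"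
  assumes "open S" "open T" "f ` S \<subseteq> T" "Ck_on k f S" "Ck_on k g T"
  shows "Ck_on k (\<lambda>x. g (f x)) S"
  using assms(4,5)
proof (induction k arbitrary: g)
  case 0
  then show ?case using assms(3) by (auto intro: continuous_on_compose2)
next
  case (Suc k)
  have df: "(f has_derivative frechet_derivative f (at x)) (at x)" if "x \<in> S" for x
    using Suc.prems assms(1) that
    by (auto simp: differentiable_on_eq_differentiable_at frechet_derivative_works)
  have dg: "(g has_derivative frechet_derivative g (at y)) (at y)" if "y \<in> T" for y
    using Suc.prems assms(2) that
    by (auto simp: differentiable_on_eq_differentiable_at frechet_derivative_works)
  \<comment> \<open>In this form only derivatives of \<open>g\<close> in fixed directions
    \<open>b\<close> are composed with \<open>f\<close>, so the induction hypothesis applies to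
    them; the moving direction \<open>frechet_derivative f (at x) v\<close> would block it.\<close>
  have d2: "((\<lambda>x. g (f x)) has_derivative (\<lambda>v. \<Sum>b\<in>Basis. (frechet_derivative f (at x) v \<bullet> b) *\<^sub>R
      frechet_derivative g (at (f x)) b)) (at x)" if "x \<in> S" for x
  proof -
    have fx: "f x \<in> T" using that assms(3) by auto
    have lin: "linear (frechet_derivative g (at (f x)))"
      using dg[OF fx] has_derivative_linear by blast
    have "frechet_derivative g (at (f x)) (frechet_derivative f (at x) v) =
      (\<Sum>b\<in>Basis. (frechet_derivative f (at x) v \<bullet> b) *\<^sub>R frechet_derivative g (at (f x)) b)" for v
      by (subst euclidean_representation[of "frechet_derivative f (at x) v", symmetric])
        (simp add: linear_sum[OF lin] linear_cmul[OF lin])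
    with has_derivative_compose[OF df[OF that] dg[OF fx]] show ?thesis by simp
  qed
  have "(\<lambda>x. g (f x)) differentiable_on S"
    using assms(1) d2 by (auto simp: differentiable_on_eq_differentiable_at differentiable_def)
  moreover have "Ck_on k (\<lambda>x. frechet_derivative (\<lambda>x. g (f x)) (at x) v) S" for v
  proof (rule Ck_on_cong[OF assms(1)])
    show "Ck_on k (\<lambda>x. \<Sum>b\<in>Basis. (frechet_derivative f (at x) v \<bullet> b) *\<^sub>R
      frechet_derivative g (at (f x)) b) S"
      by (intro Ck_on_sum Ck_on_bilinear[OF _ bounded_bilinear_scaleR] assms(1) Suc.IH
          Ck_on_bounded_linear[OF _ bounded_linear_inner_left] Ck_on_Suc_imp[OF Suc.prems(1)])
        (use Suc.prems in auto)
    show "(\<Sum>b\<in>Basis. (frechet_derivative f (at x) v \<bullet> b) *\<^sub>R frechet_derivative g (at (f x)) b) =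
        frechet_derivative (\<lambda>x. g (f x)) (at x) v" if "x \<in> S" for x
      by (simp flip: frechet_derivative_at[OF d2[OF that]])
  qed
  ultimately show ?case by simp
qed

text \<open>Real powers are closed under differentiation, so one induction with arbitrary
  \<open>a\<close> serves both reciprocals (exponent -1) and the normalisation of a vector field
  (exponent -1/2).\<close>

lemma Ck_on_powr:
  fixes a :: real
  shows "Ck_on k (\<lambda>x. x powr a) {0<..}"
proof (induction k arbitrary: a)
  case 0
  then show ?case by (auto intro!: continuous_intros)
next
  case (Suc k)
  have d: "((\<lambda>x. x powr a) has_derivative (\<lambda>v. (a * v) *\<^sub>R x powr (a - 1))) (at x)" if "x \<in> {0<..}" for x
    using that by (auto intro!: derivative_eq_intros simp: powr_diff field_simps)
  have "(\<lambda>x. x powr a) differentiable_on {0<..}"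
    using d by (auto simp: differentiable_on_eq_differentiable_at differentiable_def)
  moreover have "Ck_on k (\<lambda>x. frechet_derivative (\<lambda>x. x powr a) (at x) v) {0<..}" for v
  proof (rule Ck_on_cong)
    show "Ck_on k (\<lambda>x. (a * v) *\<^sub>R x powr (a - 1)) {0<..}"
      by (intro Ck_on_bounded_linear[OF _ bounded_linear_scaleR_right] Suc.IH) auto
    show "(a * v) *\<^sub>R x powr (a - 1) = frechet_derivative (\<lambda>x. x powr a) (at x) v" if "x \<in> {0<..}" for x
      by (simp flip: frechet_derivative_at[OF d[OF that]])
  qed auto
  ultimately show ?case by simp
qed

lemma Ck_on_linear:
  assumes "bounded_linear L" "open S"
  shows "Ck_on k L S"
proof (cases k)
  case 0
  then show ?thesis using assms by (simp add: linear_continuous_on)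
next
  case (Suc j)
  have "frechet_derivative L (at x) = L" for x
    using assms(1) by (metis frechet_derivative_at bounded_linear_imp_has_derivative)
  then show ?thesis using Suc assms
    by (auto intro: Ck_on_const simp: bounded_linear_imp_differentiable_on)
qed

lemma smooth_on_cong:
  "open S \<Longrightarrow> smooth_on f S \<Longrightarrow> (\<And>x. x \<in> S \<Longrightarrow> f x = g x) \<Longrightarrow> smooth_on g S"
  unfolding smooth_on_def by (intro allI, rule Ck_on_cong; blast)

lemma smooth_on_subset: "smooth_on f S \<Longrightarrow> open S \<Longrightarrow> open T \<Longrightarrow> T \<subseteq> S \<Longrightarrow> smooth_on f T"
  unfolding smooth_on_def by (intro allI, rule Ck_on_subset; blast)

lemma smooth_on_differentiable: "smooth_on f S \<Longrightarrow> open S \<Longrightarrow> x \<in> S \<Longrightarrow> f differentiable (at x)"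
  unfolding smooth_on_def by (metis Ck_on.simps(2) differentiable_on_eq_differentiable_at)

lemma smooth_on_continuous_on: "smooth_on f S \<Longrightarrow> continuous_on S f"
  unfolding smooth_on_def by (metis Ck_on.simps(1))

lemma smooth_on_pd: "smooth_on f S \<Longrightarrow> smooth_on (pd j f) S"
  unfolding smooth_on_def pd_def by (metis Ck_on.simps(2))

lemma smooth_on_const: "smooth_on (\<lambda>x. c) S"
  unfolding smooth_on_def by (simp add: Ck_on_const)

lemma smooth_on_linear: "bounded_linear L \<Longrightarrow> open S \<Longrightarrow> smooth_on L S"
  unfolding smooth_on_def by (intro allI, rule Ck_on_linear; blast)

lemma smooth_on_bounded_linear: "bounded_linear L \<Longrightarrow> open S \<Longrightarrow> smooth_on f S \<Longrightarrow> smooth_on (\<lambda>x. L (f x)) S"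
  unfolding smooth_on_def by (intro allI, rule Ck_on_bounded_linear; blast)

lemma smooth_on_add: "open S \<Longrightarrow> smooth_on f S \<Longrightarrow> smooth_on g S \<Longrightarrow> smooth_on (\<lambda>x. f x + g x) S"
  unfolding smooth_on_def by (intro allI, rule Ck_on_add; blast)

lemma smooth_on_sum: "open S \<Longrightarrow> (\<And>i. i \<in> I \<Longrightarrow> smooth_on (f i) S) \<Longrightarrow> smooth_on (\<lambda>x. \<Sum>i\<in>I. f i x) S"
  unfolding smooth_on_def by (intro allI, rule Ck_on_sum; blast)

lemma smooth_on_bilinear:
  "bounded_bilinear B \<Longrightarrow> open S \<Longrightarrow> smooth_on f S \<Longrightarrow> smooth_on g S \<Longrightarrow> smooth_on (\<lambda>x. B (f x) (g x)) S"
  unfolding smooth_on_def by (intro allI, rule Ck_on_bilinear; blast)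

lemmas smooth_on_scaleR = smooth_on_bilinear[OF bounded_bilinear_scaleR]
lemmas smooth_on_mult = smooth_on_bilinear[OF bounded_bilinear_mult]
lemmas smooth_on_nth = smooth_on_bounded_linear[OF bounded_linear_vec_nth]

lemma smooth_on_diff:
  assumes "open S" "smooth_on f S" "smooth_on g S" shows "smooth_on (\<lambda>x. f x - g x) S"
  using smooth_on_add[OF assms(1,2) smooth_on_bounded_linear[OF bounded_linear_minus[OF bounded_linear_ident] assms(1,3)]]
  by simp

lemma smooth_on_compose:
  fixes f :: "'a::euclidean_space \<Rightarrow> 'b::euclidean_space"
  shows "smooth_on g T \<Longrightarrow> smooth_on f S \<Longrightarrow> open S \<Longrightarrow> open T \<Longrightarrow> f ` S \<subseteq> T \<Longrightarrow> smooth_on (\<lambda>x. g (f x)) S"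
  unfolding smooth_on_def by (intro allI, rule Ck_on_compose; blast)

lemma smooth_on_powr:
  fixes f :: "'a::euclidean_space \<Rightarrow> real"
  assumes "open S" "smooth_on f S" "\<And>x. x \<in> S \<Longrightarrow> f x > 0"
  shows "smooth_on (\<lambda>x. f x powr a) S"
  by (rule smooth_on_compose[of "\<lambda>t. t powr a" "{0<..}"])
    (use assms in \<open>auto simp: smooth_on_def Ck_on_powr\<close>)

section \<open>Rules for partial derivatives\<close>

lemma pd_eq: "(f has_derivative f') (at u) \<Longrightarrow> pd i f u = f' (axis i 1)"
  unfolding pd_def by (metis frechet_derivative_at)

lemma has_derivative_pd:
  fixes f :: "real^'n::finite \<Rightarrow> 'b::real_normed_vector"
  assumes "f differentiable (at u)"
  shows "(f has_derivative (\<lambda>v. \<Sum>i\<in>UNIV. v $ i *\<^sub>R pd i f u)) (at u)"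
proof -
  let ?f' = "frechet_derivative f (at u)"
  have d: "(f has_derivative ?f') (at u)" using assms frechet_derivative_works by blast
  then have lin: "linear ?f'" by (rule has_derivative_linear)
  have "?f' v = (\<Sum>i\<in>UNIV. v $ i *\<^sub>R pd i f u)" for v
  proof -
    have "?f' v = ?f' (\<Sum>i\<in>UNIV. v $ i *\<^sub>R axis i 1)"
      using basis_expansion[of v] by (simp add: scalar_mult_eq_scaleR)
    then show ?thesis by (simp add: linear_sum[OF lin] linear_cmul[OF lin] pd_def)
  qed
  then have "?f' = (\<lambda>v. \<Sum>i\<in>UNIV. v $ i *\<^sub>R pd i f u)" by (rule ext)
  then show ?thesis using d by simp
qed

lemma differentiable_cong_open:
  assumes "open W" "u \<in> W" "\<And>x. x \<in> W \<Longrightarrow> f x = g x" "f differentiable (at u)"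
  shows "g differentiable (at u)"
  using assms unfolding differentiable_def by (meson has_derivative_transform_within_open)

text \<open>No differentiability is assumed: \<open>frechet_derivative\<close> is a choice among the
  derivatives at \<open>u\<close>, and both functions have the same ones.\<close>

lemma pd_cong_open:
  assumes "open W" "u \<in> W" "\<And>x. x \<in> W \<Longrightarrow> f x = g x"
  shows "pd i f u = pd i g u"
proof -
  have *: "(f has_derivative f') (at u) \<longleftrightarrow> (g has_derivative f') (at u)" for f'
    using has_derivative_transform_within_open[OF _ assms(1,2), of f f' UNIV g]
      has_derivative_transform_within_open[OF _ assms(1,2), of g f' UNIV f] assms(3) by auto
  show ?thesis unfolding pd_def frechet_derivative_def * ..
qed

lemma pd_const [simp]: "pd i (\<lambda>x. c) u = 0"
  by (simp add: pd_def)

lemmas frechet_works = frechet_derivative_works[THEN iffD1]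

lemma pd_add:
  "f differentiable (at u) \<Longrightarrow> g differentiable (at u) \<Longrightarrow> pd i (\<lambda>x. f x + g x) u = pd i f u + pd i g u"
  by (subst pd_eq[OF has_derivative_add[OF frechet_works frechet_works]]) (simp_all add: pd_def)

lemma pd_diff:
  "f differentiable (at u) \<Longrightarrow> g differentiable (at u) \<Longrightarrow> pd i (\<lambda>x. f x - g x) u = pd i f u - pd i g u"
  by (subst pd_eq[OF has_derivative_diff[OF frechet_works frechet_works]]) (simp_all add: pd_def)

lemma pd_minus: "f differentiable (at u) \<Longrightarrow> pd i (\<lambda>x. - f x) u = - pd i f u"
  by (subst pd_eq[OF has_derivative_minus[OF frechet_works]]) (simp_all add: pd_def)

lemma pd_bounded_linear:
  "bounded_linear L \<Longrightarrow> f differentiable (at u) \<Longrightarrow> pd i (\<lambda>x. L (f x)) u = L (pd i f u)"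
  by (subst pd_eq[OF bounded_linear.has_derivative[OF _ frechet_works]]) (simp_all add: pd_def)

lemma pd_bilinear:
  "bounded_bilinear B \<Longrightarrow> f differentiable (at u) \<Longrightarrow> g differentiable (at u) \<Longrightarrow>
    pd i (\<lambda>x. B (f x) (g x)) u = B (pd i f u) (g u) + B (f u) (pd i g u)"
  by (subst pd_eq[OF bounded_bilinear.FDERIV[OF _ frechet_works frechet_works]]) (simp_all add: pd_def)

lemma differentiable_bilinear:
  "bounded_bilinear B \<Longrightarrow> f differentiable (at u) \<Longrightarrow> g differentiable (at u) \<Longrightarrow>
    (\<lambda>x. B (f x) (g x)) differentiable (at u)"
  by (drule (2) bounded_bilinear.FDERIV[OF _ frechet_works frechet_works]) (rule differentiableI)

lemma differentiable_bounded_linear: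
  "bounded_linear L \<Longrightarrow> f differentiable (at u) \<Longrightarrow> (\<lambda>x. L (f x)) differentiable (at u)"
  by (drule (1) bounded_linear.has_derivative[OF _ frechet_works]) (rule differentiableI)

lemma pd_mult:
  fixes f g :: "real^'n::finite \<Rightarrow> real"
  shows "f differentiable (at u) \<Longrightarrow> g differentiable (at u) \<Longrightarrow>
    pd i (\<lambda>x. f x * g x) u = pd i f u * g u + f u * pd i g u"
  by (rule pd_bilinear[OF bounded_bilinear_mult])

lemma pd_scaleR:
  "f differentiable (at u) \<Longrightarrow> g differentiable (at u) \<Longrightarrow>
    pd i (\<lambda>x. f x *\<^sub>R g x) u = pd i f u *\<^sub>R g u + f u *\<^sub>R pd i g u"
  by (rule pd_bilinear[OF bounded_bilinear_scaleR])

lemma pd_inner: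
  "f differentiable (at u) \<Longrightarrow> g differentiable (at u) \<Longrightarrow>
    pd i (\<lambda>x. f x \<bullet> g x) u = pd i f u \<bullet> g u + f u \<bullet> pd i g u"
  by (rule pd_bilinear[OF bounded_bilinear_inner])

lemma pd_power2:
  fixes f :: "real^'n::finite \<Rightarrow> real"
  shows "f differentiable (at u) \<Longrightarrow> pd i (\<lambda>x. (f x)\<^sup>2) u = 2 * f u * pd i f u"
  by (simp add: power2_eq_square pd_mult)

lemma pd_sum:
  assumes "\<And>j. j \<in> I \<Longrightarrow> f j differentiable (at u)"
  shows "pd i (\<lambda>x. \<Sum>j\<in>I. f j x) u = (\<Sum>j\<in>I. pd i (f j) u)"
  using assms
proof (induction I rule: infinite_finite_induct)
  case (insert j I)
  then show ?case by (simp add: pd_add differentiable_sum)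
qed auto

lemma differentiable_nth: "V differentiable (at u) \<Longrightarrow> (\<lambda>x. V x $ a) differentiable (at u)"
  by (rule differentiable_bounded_linear[OF bounded_linear_vec_nth])

lemma pd_nth: "V differentiable (at u) \<Longrightarrow> pd i (\<lambda>x. V x $ a) u = pd i V u $ a"
  by (rule pd_bounded_linear[OF bounded_linear_vec_nth])

lemma differentiable_vec:
  fixes V :: "real^'m::finite \<Rightarrow> real^'n::finite"
  assumes "\<And>a. (\<lambda>x. V x $ a) differentiable (at u)"
  shows "V differentiable (at u)"
proof -
  have "(\<lambda>x. \<Sum>a\<in>UNIV. V x $ a *\<^sub>R (axis a 1 :: real^'n)) differentiable (at u)"
    by (intro differentiable_sum ballI finite differentiable_bilinear[OF bounded_bilinear_scaleR] assms
        differentiable_const)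
  moreover have "(\<lambda>x. \<Sum>i\<in>UNIV. V x $ i *\<^sub>R (axis i 1 :: real^'n)) = V"
    using basis_expansion by (auto simp: fun_eq_iff simp flip: scalar_mult_eq_scaleR)
  ultimately show ?thesis by simp
qed

lemma pd_coord [simp]: "pd i (\<lambda>x. x $ j) u = (if i = j then 1 else 0)"
  by (subst pd_eq[OF bounded_linear_imp_has_derivative[OF bounded_linear_vec_nth]]) (simp add: axis_def)

lemma differentiable_coord [simp]: "(\<lambda>x. x $ j) differentiable (at u)"
  by (rule bounded_linear_imp_differentiable[OF bounded_linear_vec_nth])

lemma pd_compose:
  fixes f :: "real^'n::finite \<Rightarrow> 'b::real_normed_vector" and F :: "real^'m::finite \<Rightarrow> real^'n"
  assumes "F differentiable (at u)" "f differentiable (at (F u))"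
  shows "pd i (\<lambda>x. f (F x)) u = (\<Sum>a\<in>UNIV. pd i F u $ a *\<^sub>R pd a f (F u))"
  using pd_eq[OF has_derivative_compose[OF has_derivative_pd[OF assms(1)] has_derivative_pd[OF assms(2)]], of i]
  by (simp add: axis_def if_distrib[of "\<lambda>x. x *\<^sub>R _"] sum.delta cong: if_cong)

lemma differentiable_compose_at:
  "F differentiable (at u) \<Longrightarrow> f differentiable (at (F u)) \<Longrightarrow> (\<lambda>x. f (F x)) differentiable (at u)"
  by (drule (1) has_derivative_compose[OF frechet_works frechet_works]) (rule differentiableI)

lemma pd_compose_real:
  fixes f :: "real \<Rightarrow> real" and F :: "real^'m::finite \<Rightarrow> real"
  assumes "F differentiable (at u)" "(f has_field_derivative d) (at (F u))"
  shows "pd i (\<lambda>x. f (F x)) u = d * pd i F u"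
proof -
  have "(F has_derivative frechet_derivative F (at u)) (at u)"
    using assms(1) frechet_derivative_works by blast
  from pd_eq[OF has_derivative_compose[OF this assms(2)[unfolded has_field_derivative_def]], of i]
  show ?thesis by (simp add: pd_def)
qed

text \<open>The mean value theorem along \<open>v\<close>, applied to the difference of
  \<open>f\<close> and its translate by \<open>s *\<^sub>R w\<close>, reduces the second difference
  to a first difference of \<open>f' _ v\<close>, which \<open>D\<close> approximates. The second
  difference is symmetric in \<open>v\<close> and \<open>w\<close>; this is what makes it useful for
  mixed derivatives.\<close>

lemma second_difference_quotient:
  fixes f :: "'a::real_normed_vector \<Rightarrow> real"
  assumes W: "open W" "u \<in> W"
    and f: "\<And>x. x \<in> W \<Longrightarrow> (f has_derivative f' x) (at x)"
    and d: "((\<lambda>x. f' x v) has_derivative D) (at u)"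
    and e: "e > 0"
  shows "\<exists>\<delta>>0. \<forall>s. 0 < s \<and> s < \<delta> \<longrightarrow>
    \<bar>f (u + s *\<^sub>R v + s *\<^sub>R w) - f (u + s *\<^sub>R v) - f (u + s *\<^sub>R w) + f u - s\<^sup>2 * D w\<bar> \<le> e * s\<^sup>2"
proof -
  \<comment> \<open>\<open>s * K\<close> bounds every displacement that occurs, and
    \<open>e'\<close> is chosen so that two errors \<open>e' * (s * K)\<close> add up to
    \<open>e * s\<close>.\<close>
  define K where "K = 2 * (norm v + norm w) + 1"
  have "norm v \<ge> 0" "norm w \<ge> 0" by simp_all
  then have K: "K > 0" "norm v + norm w < K" "norm v < K"
    unfolding K_def by argo+
  define e' where "e' = e / (2 * K)"
  have e': "e' > 0" using e K by (simp add: e'_def)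
  from W obtain r where r: "r > 0" "ball u r \<subseteq> W" using open_contains_ball by blast
  from d e' obtain q where q: "q > 0"
    "\<And>y. norm (y - u) < q \<Longrightarrow> norm (f' y v - f' u v - D (y - u)) \<le> e' * norm (y - u)"
    unfolding has_derivative_at_alt by blast
  have linD: "linear D" using d has_derivative_linear by blast
  define \<delta> where "\<delta> = min r q / K"
  show ?thesis
  proof (intro exI[of _ \<delta>] conjI allI impI)
    show "\<delta> > 0" using r q K by (simp add: \<delta>_def)
    fix s assume s: "0 < s \<and> s < \<delta>"
    have sK: "s * K < r" "s * K < q" using s K by (auto simp: \<delta>_def field_simps)
    have near: "norm (t *\<^sub>R v + c *\<^sub>R w) \<le> s * K" if "0 \<le> t" "t \<le> s" "0 \<le> c" "c \<le> s" for t c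
    proof -
      have "norm (t *\<^sub>R v + c *\<^sub>R w) \<le> t * norm v + c * norm w"
        using norm_triangle_ineq[of "t *\<^sub>R v" "c *\<^sub>R w"] that by simp
      also have "\<dots> \<le> s * norm v + s * norm w" using that by (intro add_mono mult_right_mono) auto
      also have "\<dots> \<le> s * K" using K s by (simp flip: distrib_left)
      finally show ?thesis .
    qed
    have inW: "u + t *\<^sub>R v + c *\<^sub>R w \<in> W" if "0 \<le> t" "t \<le> s" "0 \<le> c" "c \<le> s" for t c
    proof (rule subsetD[OF r(2)])
      have "dist u (u + t *\<^sub>R v + c *\<^sub>R w) = norm (t *\<^sub>R v + c *\<^sub>R w)"
        by (metis add.assoc add_diff_cancel_left' dist_commute dist_norm)
      then show "u + t *\<^sub>R v + c *\<^sub>R w \<in> ball u r" using near[OF that] sK(1) by simp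
    qed
    have inW0: "u + t *\<^sub>R v \<in> W" if "0 \<le> t" "t \<le> s" for t
      using inW[OF that, of 0] s by simp
    define \<phi> where "\<phi> = (\<lambda>t. f (u + t *\<^sub>R v + s *\<^sub>R w) - f (u + t *\<^sub>R v))"
    define \<phi>' where "\<phi>' = (\<lambda>t. f' (u + t *\<^sub>R v + s *\<^sub>R w) v - f' (u + t *\<^sub>R v) v)"
    have der: "(\<phi> has_derivative (\<lambda>h. h * \<phi>' t)) (at t)" if "0 \<le> t" "t \<le> s" for t
    proof -
      have lin1: "linear (f' (u + t *\<^sub>R v + s *\<^sub>R w))" and lin2: "linear (f' (u + t *\<^sub>R v))"
        using f[OF inW[OF that, of s]] f[OF inW0[OF that]] s has_derivative_linear by auto
      have "((\<lambda>t. f (u + t *\<^sub>R v + s *\<^sub>R w)) has_derivative (\<lambda>h. f' (u + t *\<^sub>R v + s *\<^sub>R w) (h *\<^sub>R v))) (at t)"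
        by (rule has_derivative_compose[of "\<lambda>t. u + t *\<^sub>R v + s *\<^sub>R w", OF _ f[OF inW[OF that]]])
          (use s in \<open>auto intro!: derivative_eq_intros\<close>)
      moreover have "((\<lambda>t. f (u + t *\<^sub>R v)) has_derivative (\<lambda>h. f' (u + t *\<^sub>R v) (h *\<^sub>R v))) (at t)"
        by (rule has_derivative_compose[of "\<lambda>t. u + t *\<^sub>R v", OF _ f[OF inW0[OF that]]])
          (use s in \<open>auto intro!: derivative_eq_intros\<close>)
      ultimately have "(\<phi> has_derivative (\<lambda>h. f' (u + t *\<^sub>R v + s *\<^sub>R w) (h *\<^sub>R v) - f' (u + t *\<^sub>R v) (h *\<^sub>R v))) (at t)"
        unfolding \<phi>_def by (rule has_derivative_diff)
      then show ?thesis
        by (simp add: \<phi>'_def linear_cmul[OF lin1] linear_cmul[OF lin2] right_diff_distrib)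
    qed
    have "\<exists>t\<in>{0<..<s}. \<phi> s - \<phi> 0 = (\<lambda>h. h * \<phi>' t) (s - 0)"
    proof (rule mvt_simple)
      show "0 < s" using s by simp
      show "(\<phi> has_derivative (\<lambda>h. h * \<phi>' t)) (at t within {0..s})" if "0 \<le> t" "t \<le> s" for t
        by (rule has_derivative_at_withinI[OF der[OF that]])
    qed
    then obtain t where t: "0 < t" "t < s" "\<phi> s - \<phi> 0 = s * \<phi>' t" by auto
    have near': "\<bar>f' (u + x) v - f' u v - D x\<bar> \<le> e' * (s * K)" if "norm x \<le> s * K" for x
    proof -
      have "norm (f' (u + x) v - f' u v - D x) \<le> e' * norm x"
        using q(2)[of "u + x"] that sK by simp
      also have "\<dots> \<le> e' * (s * K)" using that e' by (intro mult_left_mono) auto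
      finally show ?thesis by simp
    qed
    have 1: "\<bar>f' (u + t *\<^sub>R v + s *\<^sub>R w) v - f' u v - D (t *\<^sub>R v + s *\<^sub>R w)\<bar> \<le> e' * (s * K)"
      using near'[OF near[of t s]] t by (simp add: add.assoc)
    have 2: "\<bar>f' (u + t *\<^sub>R v) v - f' u v - D (t *\<^sub>R v)\<bar> \<le> e' * (s * K)"
      using near'[OF near[of t 0]] t by simp
    have "\<phi>' t - s * D w = (f' (u + t *\<^sub>R v + s *\<^sub>R w) v - f' u v - D (t *\<^sub>R v + s *\<^sub>R w))
        - (f' (u + t *\<^sub>R v) v - f' u v - D (t *\<^sub>R v))"
      by (simp add: \<phi>'_def linear_add[OF linD] linear_cmul[OF linD])
    then have "\<bar>\<phi>' t - s * D w\<bar> \<le> 2 * (e' * (s * K))" using 1 2 by linarith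
    also have "\<dots> = e * s" using K by (simp add: e'_def)
    finally have "s * \<bar>\<phi>' t - s * D w\<bar> \<le> s * (e * s)" using s by (intro mult_left_mono) auto
    moreover have "s * \<bar>\<phi>' t - s * D w\<bar> = \<bar>s * \<phi>' t - s\<^sup>2 * D w\<bar>"
    proof -
      have "s * \<phi>' t - s\<^sup>2 * D w = s * (\<phi>' t - s * D w)" by (simp add: power2_eq_square algebra_simps)
      then show ?thesis using s by (simp add: abs_mult)
    qed
    ultimately have "\<bar>\<phi> s - \<phi> 0 - s\<^sup>2 * D w\<bar> \<le> e * s\<^sup>2"
      using t(3) by (simp add: power2_eq_square mult_ac)
    then show "\<bar>f (u + s *\<^sub>R v + s *\<^sub>R w) - f (u + s *\<^sub>R v) - f (u + s *\<^sub>R w) + f u - s\<^sup>2 * D w\<bar> \<le> e * s\<^sup>2"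
      by (simp add: \<phi>_def algebra_simps)
  qed
qed

lemma mixed_derivatives_eq:
  fixes f :: "'a::real_normed_vector \<Rightarrow> real"
  assumes W: "open W" "u \<in> W"
    and f: "\<And>x. x \<in> W \<Longrightarrow> (f has_derivative f' x) (at x)"
    and d: "((\<lambda>x. f' x v) has_derivative D) (at u)" "((\<lambda>x. f' x w) has_derivative D') (at u)"
  shows "D w = D' v"
proof (rule ccontr)
  assume "D w \<noteq> D' v"
  \<comment> \<open>Two errors of size \<open>e\<close> cannot bridge a gap of
    \<open>3 * e\<close>.\<close>
  define e where "e = \<bar>D w - D' v\<bar> / 3"
  have e: "e > 0" using \<open>D w \<noteq> D' v\<close> by (simp add: e_def)
  obtain a where a: "a > 0" "\<And>s. 0 < s \<and> s < a \<Longrightarrow>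
    \<bar>f (u + s *\<^sub>R v + s *\<^sub>R w) - f (u + s *\<^sub>R v) - f (u + s *\<^sub>R w) + f u - s\<^sup>2 * D w\<bar> \<le> e * s\<^sup>2"
    using second_difference_quotient[OF W f d(1) e, of w] by blast
  obtain b where b: "b > 0" "\<And>s. 0 < s \<and> s < b \<Longrightarrow>
    \<bar>f (u + s *\<^sub>R w + s *\<^sub>R v) - f (u + s *\<^sub>R w) - f (u + s *\<^sub>R v) + f u - s\<^sup>2 * D' v\<bar> \<le> e * s\<^sup>2"
    using second_difference_quotient[OF W f d(2) e, of v] by blast
  define s where "s = min a b / 2"
  have s: "0 < s" "s < a" "s < b" using a(1) b(1) by (auto simp: s_def min_def)
  have "f (u + s *\<^sub>R w + s *\<^sub>R v) = f (u + s *\<^sub>R v + s *\<^sub>R w)" by (simp add: add_ac)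
  then have "\<bar>s\<^sup>2 * D w - s\<^sup>2 * D' v\<bar> \<le> 2 * (e * s\<^sup>2)"
    using a(2)[of s] b(2)[of s] s by linarith
  moreover have "\<bar>s\<^sup>2 * D w - s\<^sup>2 * D' v\<bar> = s\<^sup>2 * (3 * e)"
    by (simp add: e_def abs_mult flip: right_diff_distrib)
  ultimately show False using s e by (simp add: mult_less_0_iff)
qed

lemma pd_pd_commute:
  fixes f :: "real^'n::finite \<Rightarrow> 'b::euclidean_space"
  assumes "open W" "u \<in> W" "smooth_on f W"
  shows "pd i (pd j f) u = pd j (pd i f) u"
proof (rule euclidean_eqI)
  fix b :: 'b
  have L: "bounded_linear (\<lambda>y. y \<bullet> b)" by (rule bounded_linear_inner_left)
  have d: "(f has_derivative frechet_derivative f (at x)) (at x)" if "x \<in> W" for x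
    using smooth_on_differentiable[OF assms(3,1) that] frechet_derivative_works by blast
  have d2: "(pd k f has_derivative frechet_derivative (pd k f) (at u)) (at u)" for k
    using smooth_on_differentiable[OF smooth_on_pd[OF assms(3)] assms(1,2)] frechet_derivative_works by blast
  have "frechet_derivative (pd i f) (at u) (axis j 1) \<bullet> b = frechet_derivative (pd j f) (at u) (axis i 1) \<bullet> b"
    by (rule mixed_derivatives_eq[OF assms(1,2), where f="\<lambda>x. f x \<bullet> b"
          and f'="\<lambda>x v. frechet_derivative f (at x) v \<bullet> b"])
      (use bounded_linear.has_derivative[OF L d] bounded_linear.has_derivative[OF L d2[unfolded pd_def]]
        in \<open>auto simp: pd_def[abs_def]\<close>)
  then show "pd i (pd j f) u \<bullet> b = pd j (pd i f) u \<bullet> b" by (simp add: pd_def)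
qed

section \<open>The Levi-Civita connection in coordinates\<close>

lemma metric_ip_inner: "metric_ip G v w = v \<bullet> (G *v w)"
  by (simp add: metric_ip_def inner_vec_def matrix_vector_mult_def sum_distrib_left mult_ac)

lemma metric_ip_add_left: "metric_ip G (v + v') w = metric_ip G v w + metric_ip G v' w"
  and metric_ip_add_right: "metric_ip G w (v + v') = metric_ip G w v + metric_ip G w v'"
  and metric_ip_diff_left: "metric_ip G (v - v') w = metric_ip G v w - metric_ip G v' w"
  and metric_ip_diff_right: "metric_ip G w (v - v') = metric_ip G w v - metric_ip G w v'"
  and metric_ip_minus_left: "metric_ip G (- v) w = - metric_ip G v w"
  and metric_ip_minus_right: "metric_ip G v (- w) = - metric_ip G v w"
  and metric_ip_scaleR_left: "metric_ip G (c *\<^sub>R v) w = c * metric_ip G v w"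
  and metric_ip_scaleR_right: "metric_ip G v (c *\<^sub>R w) = c * metric_ip G v w"
  and metric_ip_zero_left [simp]: "metric_ip G 0 w = 0"
  and metric_ip_zero_right [simp]: "metric_ip G v 0 = 0"
  by (simp_all add: metric_ip_inner inner_add_left inner_add_right inner_diff_left inner_diff_right
      matrix_vector_right_distrib matrix_vector_mult_diff_distrib
      linear_cmul[OF matrix_vector_mul_linear] linear_neg[OF matrix_vector_mul_linear])

lemma metric_ip_sum_left: "metric_ip G (\<Sum>i\<in>I. f i) w = (\<Sum>i\<in>I. metric_ip G (f i) w)"
  by (simp add: metric_ip_inner inner_sum_left)

lemma metric_ip_sum_right: "metric_ip G w (\<Sum>i\<in>I. f i) = (\<Sum>i\<in>I. metric_ip G w (f i))"
  by (induction I rule: infinite_finite_induct) (auto simp: metric_ip_add_right)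

lemmas metric_ip_simps = metric_ip_add_left metric_ip_add_right metric_ip_diff_left metric_ip_diff_right
  metric_ip_minus_left metric_ip_minus_right metric_ip_scaleR_left metric_ip_scaleR_right
  metric_ip_sum_left metric_ip_sum_right

lemma transpose_eq_iff: "transpose G = G \<longleftrightarrow> (\<forall>a b. G $ a $ b = G $ b $ a)"
  by (auto simp: transpose_def vec_eq_iff)

lemma metric_ip_commute: "transpose G = G \<Longrightarrow> metric_ip G v w = metric_ip G w v"
  unfolding metric_ip_def by (subst sum.swap) (simp add: transpose_eq_iff mult_ac)

lemma matrix_inv_unique:
  fixes A B :: "real^'n::finite^'n"
  assumes "A ** B = mat 1"
  shows "matrix_inv A = B"
proof -
  have BA: "B ** A = mat 1" using assms matrix_left_right_inverse by blast
  have "A ** matrix_inv A = mat 1 \<and> matrix_inv A ** A = mat 1"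
    unfolding matrix_inv_def by (rule someI[of _ B]) (use assms BA in simp)
  then show ?thesis by (metis BA matrix_mul_assoc matrix_mul_lid matrix_mul_rid)
qed

lemma matrix_inv_posdef:
  fixes G :: "real^'n::finite^'n"
  assumes "\<And>v. v \<noteq> 0 \<Longrightarrow> metric_ip G v v > 0"
  shows "G ** matrix_inv G = mat 1"
proof -
  have "v = 0" if "G *v v = 0" for v
    using assms[of v] that by (auto simp: metric_ip_inner)
  then obtain B where "B ** G = mat 1" using matrix_left_invertible_ker by blast
  then have "G ** B = mat 1" using matrix_left_right_inverse by blast
  then show ?thesis using matrix_inv_unique by metis
qed

text \<open>Lowering the upper index cancels \<open>matrix_inv\<close>. Metric compatibility and the
  comparison of connections below use this Koszul form.\<close>

lemma christoffel_lower:
  fixes H :: "real^'n::finite \<Rightarrow> real^'n^'n"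
  assumes "\<And>v. v \<noteq> 0 \<Longrightarrow> metric_ip (H u) v v > 0"
  shows "(\<Sum>k\<in>UNIV. H u $ l $ k * christoffel H u k i j) =
    (pd i (\<lambda>x. H x $ j $ l) u + pd j (\<lambda>x. H x $ i $ l) u - pd l (\<lambda>x. H x $ i $ j) u) / 2"
proof -
  have inv: "(\<Sum>k\<in>UNIV. H u $ l $ k * matrix_inv (H u) $ k $ q) = (if l = q then 1 else 0)" for q
    using arg_cong[OF matrix_inv_posdef[OF assms], of "\<lambda>A. A $ l $ q"]
    by (simp add: matrix_matrix_mult_def mat_def)
  define K where "K q = (pd i (\<lambda>x. H x $ j $ q) u + pd j (\<lambda>x. H x $ i $ q) u - pd q (\<lambda>x. H x $ i $ j) u) / 2" for q
  have "(\<Sum>k\<in>UNIV. H u $ l $ k * christoffel H u k i j) =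
      (\<Sum>k\<in>UNIV. \<Sum>q\<in>UNIV. H u $ l $ k * matrix_inv (H u) $ k $ q * K q)"
    by (simp add: christoffel_def K_def sum_distrib_left mult.assoc)
  also have "\<dots> = (\<Sum>q\<in>UNIV. (\<Sum>k\<in>UNIV. H u $ l $ k * matrix_inv (H u) $ k $ q) * K q)"
    by (subst sum.swap) (simp add: sum_distrib_right)
  also have "\<dots> = K l" by (simp add: inv if_distrib[of "\<lambda>x. x * _"] cong: if_cong)
  finally show ?thesis by (simp add: K_def)
qed

text \<open>A positive definite matrix has trivial kernel, so the Koszul identity determines the
  symbols. Explicit symbols can thus be verified without computing an inverse.\<close>

lemma christoffel_eqI:
  fixes H :: "real^'n::finite \<Rightarrow> real^'n^'n"
  assumes pos: "\<And>v. v \<noteq> 0 \<Longrightarrow> metric_ip (H u) v v > 0"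
    and C: "\<And>l. (\<Sum>k\<in>UNIV. H u $ l $ k * C k) =
    (pd i (\<lambda>x. H x $ j $ l) u + pd j (\<lambda>x. H x $ i $ l) u - pd l (\<lambda>x. H x $ i $ j) u) / 2"
  shows "christoffel H u k i j = C k"
proof -
  define v where "v = (\<chi> k. christoffel H u k i j - C k)"
  have "(H u *v v) $ l = 0" for l
    using christoffel_lower[of H u, OF pos, of l i j] C[of l]
    by (simp add: matrix_vector_mult_def v_def right_diff_distrib sum_subtractf)
  then have "H u *v v = 0" by (simp add: vec_eq_iff)
  then have "v = 0" using pos[of v] by (auto simp: metric_ip_inner)
  then show ?thesis by (simp add: v_def vec_eq_iff)
qed

text \<open>Differentiability of the Christoffel symbols is an assumption, so that
  \<open>matrix_inv\<close> is never differentiated; each geometry supplies it from explicit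
  symbols.\<close>

locale riemannian_domain =
  fixes D :: "(real^'n::finite) set" and H :: "real^'n \<Rightarrow> real^'n^'n"
  assumes open_domain: "open D"
    and metric_symmetric: "x \<in> D \<Longrightarrow> transpose (H x) = H x"
    and metric_positive: "x \<in> D \<Longrightarrow> v \<noteq> 0 \<Longrightarrow> metric_ip (H x) v v > 0"
    and metric_differentiable: "x \<in> D \<Longrightarrow> (\<lambda>y. H y $ i $ j) differentiable (at x)"
    and christoffel_differentiable: "x \<in> D \<Longrightarrow> (\<lambda>y. christoffel H y k i j) differentiable (at x)"
begin

lemma metric_entry_sym: "x \<in> D \<Longrightarrow> H x $ i $ j = H x $ j $ i"
  using metric_symmetric transpose_eq_iff by blast

lemma pd_metric_sym: "x \<in> D \<Longrightarrow> pd k (\<lambda>y. H y $ i $ j) x = pd k (\<lambda>y. H y $ j $ i) x"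
  by (rule pd_cong_open[OF open_domain]) (auto intro: metric_entry_sym)

lemma christoffel_sym: "x \<in> D \<Longrightarrow> christoffel H x k i j = christoffel H x k j i"
  unfolding christoffel_def using pd_metric_sym by (simp add: add.commute)

text \<open>Metric compatibility in components: in the sum of the two Koszul expressions everything
  cancels except the derivative in direction \<open>c\<close>.\<close>

lemma metric_derivative:
  assumes "x \<in> D"
  shows "(\<Sum>k\<in>UNIV. H x $ b $ k * christoffel H x k c a) + (\<Sum>k\<in>UNIV. H x $ a $ k * christoffel H x k c b)
    = pd c (\<lambda>y. H y $ a $ b) x"
proof -
  have low: "(\<Sum>k\<in>UNIV. H x $ l $ k * christoffel H x k i j) =
    (pd i (\<lambda>y. H y $ j $ l) x + pd j (\<lambda>y. H y $ i $ l) x - pd l (\<lambda>y. H y $ i $ j) x) / 2" for l i j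
    by (rule christoffel_lower) (rule metric_positive[OF assms])
  show ?thesis
    using pd_metric_sym[OF assms, of a b c] pd_metric_sym[OF assms, of b a c] pd_metric_sym[OF assms, of c a b]
    unfolding low by (simp add: field_simps)
qed

definition chr :: "real^'n \<Rightarrow> real^'n \<Rightarrow> real^'n \<Rightarrow> real^'n" where
  "chr x v w = (\<chi> a. \<Sum>b\<in>UNIV. \<Sum>c\<in>UNIV. christoffel H x a b c * v $ b * w $ c)"

lemma chr_commute: "x \<in> D \<Longrightarrow> chr x v w = chr x w v"
  unfolding chr_def
  by (subst sum.swap) (simp add: christoffel_sym[of x _ _ _] mult_ac vec_eq_iff; metis (no_types, lifting) christoffel_sym sum.cong)

lemma metric_ip_chr:
  assumes "x \<in> D"
  shows "metric_ip (H x) (chr x v w) y =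
    (\<Sum>b\<in>UNIV. \<Sum>c\<in>UNIV. \<Sum>d\<in>UNIV. (\<Sum>k\<in>UNIV. H x $ d $ k * christoffel H x k b c) * v $ b * w $ c * y $ d)"
proof -
  have "metric_ip (H x) (chr x v w) y =
    (\<Sum>a\<in>UNIV. \<Sum>d\<in>UNIV. \<Sum>b\<in>UNIV. \<Sum>c\<in>UNIV. H x $ d $ a * christoffel H x a b c * v $ b * w $ c * y $ d)"
    unfolding metric_ip_def chr_def
    by (simp add: sum_distrib_left sum_distrib_right mult_ac metric_entry_sym[OF assms])
  also have "\<dots> = (\<Sum>b\<in>UNIV. \<Sum>c\<in>UNIV. \<Sum>d\<in>UNIV. \<Sum>a\<in>UNIV. H x $ d $ a * christoffel H x a b c * v $ b * w $ c * y $ d)"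
  proof -
    have "(\<Sum>a\<in>UNIV. \<Sum>d\<in>UNIV. \<Sum>b\<in>UNIV. \<Sum>c\<in>UNIV. g a d b c) =
      (\<Sum>b\<in>UNIV. \<Sum>c\<in>UNIV. \<Sum>d\<in>UNIV. \<Sum>a\<in>UNIV. g a d b c)" for g :: "'n \<Rightarrow> 'n \<Rightarrow> 'n \<Rightarrow> 'n \<Rightarrow> real"
      by (simp only: sum.cartesian_product)
        (rule sum.reindex_bij_witness[of _ "\<lambda>(b, c, d, a). (a, d, b, c)" "\<lambda>(a, d, b, c). (b, c, d, a)"], auto)
    then show ?thesis .
  qed
  finally show ?thesis by (simp add: sum_distrib_right)
qed

lemma metric_ip_chr_chr:
  assumes "x \<in> D"
  shows "metric_ip (H x) (chr x f v) y + metric_ip (H x) v (chr x f y) =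
    (\<Sum>a\<in>UNIV. \<Sum>b\<in>UNIV. (\<Sum>c\<in>UNIV. f $ c * pd c (\<lambda>y. H y $ a $ b) x) * v $ a * y $ b)"
proof -
  have 1: "metric_ip (H x) (chr x f v) y =
    (\<Sum>c\<in>UNIV. \<Sum>a\<in>UNIV. \<Sum>b\<in>UNIV. (\<Sum>k\<in>UNIV. H x $ b $ k * christoffel H x k c a) * f $ c * v $ a * y $ b)"
    by (rule metric_ip_chr[OF assms])
  have 2: "metric_ip (H x) v (chr x f y) =
    (\<Sum>c\<in>UNIV. \<Sum>a\<in>UNIV. \<Sum>b\<in>UNIV. (\<Sum>k\<in>UNIV. H x $ a $ k * christoffel H x k c b) * f $ c * v $ a * y $ b)"
    by (subst metric_ip_commute[OF metric_symmetric[OF assms]], subst metric_ip_chr[OF assms],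
        rule sum.cong[OF refl], subst sum.swap) (simp add: mult_ac)
  have "metric_ip (H x) (chr x f v) y + metric_ip (H x) v (chr x f y) =
    (\<Sum>c\<in>UNIV. \<Sum>a\<in>UNIV. \<Sum>b\<in>UNIV. f $ c * pd c (\<lambda>y. H y $ a $ b) x * v $ a * y $ b)"
    unfolding 1 2 metric_derivative[OF assms, symmetric]
    by (simp add: sum.distrib algebra_simps)
  also have "\<dots> = (\<Sum>a\<in>UNIV. \<Sum>b\<in>UNIV. \<Sum>c\<in>UNIV. f $ c * pd c (\<lambda>y. H y $ a $ b) x * v $ a * y $ b)"
    by (simp only: sum.cartesian_product)
      (rule sum.reindex_bij_witness[of _ "\<lambda>(a, b, c). (c, a, b)" "\<lambda>(c, a, b). (a, b, c)"], auto)
  finally show ?thesis by (simp add: sum_distrib_right)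
qed

end

lemma pullback_cov_eq:
  assumes "riemannian_domain D H"
  shows "pullback_cov H F i V u = pd i V u + riemannian_domain.chr H (F u) (pd i F u) (V u)"
  by (simp add: pullback_cov_def riemannian_domain.chr_def[OF assms] vec_eq_iff)

context riemannian_domain begin

lemma chr_linear:
  "chr x (v + v') w = chr x v w + chr x v' w" "chr x v (w + w') = chr x v w + chr x v w'"
  "chr x (c *\<^sub>R v) w = c *\<^sub>R chr x v w" "chr x v (c *\<^sub>R w) = c *\<^sub>R chr x v w"
  by (simp_all add: chr_def vec_eq_iff algebra_simps sum.distrib sum_distrib_left)

end

locale riemannian_map = riemannian_domain D H
  for D :: "(real^'n::finite) set" and H :: "real^'n \<Rightarrow> real^'n^'n" +
  fixes W :: "(real^'m::finite) set" and F :: "real^'m \<Rightarrow> real^'n"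
  assumes open_source: "open W"
    and map_smooth: "smooth_on F W"
    and map_into: "u \<in> W \<Longrightarrow> F u \<in> D"
begin

abbreviation ip :: "real^'m \<Rightarrow> real^'n \<Rightarrow> real^'n \<Rightarrow> real" where
  "ip u \<equiv> metric_ip (H (F u))"

abbreviation cov :: "'m \<Rightarrow> (real^'m \<Rightarrow> real^'n) \<Rightarrow> real^'m \<Rightarrow> real^'n" where
  "cov \<equiv> pullback_cov H F"

lemma cov_eq: "cov i V u = pd i V u + chr (F u) (pd i F u) (V u)"
  by (rule pullback_cov_eq) (rule riemannian_domain_axioms)

lemma ip_commute: "u \<in> W \<Longrightarrow> ip u v w = ip u w v"
  by (rule metric_ip_commute[OF metric_symmetric[OF map_into]])

lemma map_differentiable: "u \<in> W \<Longrightarrow> F differentiable (at u)"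
  by (rule smooth_on_differentiable[OF map_smooth open_source])

lemma pd_map_smooth: "smooth_on (pd i F) W"
  by (rule smooth_on_pd[OF map_smooth])

lemma pd_map_differentiable: "u \<in> W \<Longrightarrow> pd i F differentiable (at u)"
  by (rule smooth_on_differentiable[OF pd_map_smooth open_source])

lemma ip_differentiable:
  assumes "u \<in> W" "V differentiable (at u)" "Y differentiable (at u)"
  shows "(\<lambda>x. ip x (V x) (Y x)) differentiable (at u)"
  unfolding metric_ip_def
  by (intro differentiable_sum ballI finite differentiable_mult differentiable_nth assms
      differentiable_compose_at[OF map_differentiable[OF assms(1)] metric_differentiable[OF map_into]])

text \<open>Metric compatibility of the pullback connection: the chain rule differentiates the Gram
  entries along \<open>F\<close>, and \<open>metric_ip_chr_chr\<close> identifies the result with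
  the two connection terms.\<close>

lemma pd_ip:
  assumes "u \<in> W" "V differentiable (at u)" "Y differentiable (at u)"
  shows "pd i (\<lambda>x. ip x (V x) (Y x)) u = ip u (cov i V u) (Y u) + ip u (V u) (cov i Y u)"
proof -
  note d = differentiable_nth[OF assms(2)] differentiable_nth[OF assms(3)]
  have dH: "(\<lambda>x. H (F x) $ a $ b) differentiable (at u)" for a b
    by (rule differentiable_compose_at[OF map_differentiable[OF assms(1)] metric_differentiable[OF map_into[OF assms(1)]]])
  have pdH: "pd i (\<lambda>x. H (F x) $ a $ b) u = (\<Sum>c\<in>UNIV. pd i F u $ c * pd c (\<lambda>y. H y $ a $ b) (F u))" for a b
    using pd_compose[OF map_differentiable[OF assms(1)] metric_differentiable[OF map_into[OF assms(1)]], of i a b]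
    by simp
  have "pd i (\<lambda>x. ip x (V x) (Y x)) u =
    (\<Sum>a\<in>UNIV. \<Sum>b\<in>UNIV. (\<Sum>c\<in>UNIV. pd i F u $ c * pd c (\<lambda>y. H y $ a $ b) (F u)) * V u $ a * Y u $ b)
    + ip u (pd i V u) (Y u) + ip u (V u) (pd i Y u)"
    unfolding metric_ip_def
    by (simp add: pd_sum pd_mult differentiable_sum differentiable_mult dH d pdH pd_nth assms(2,3)
        sum.distrib algebra_simps)
  then show ?thesis
    by (simp add: cov_eq metric_ip_simps metric_ip_chr_chr[OF map_into[OF assms(1)], symmetric])
qed

lemma chr_differentiable:
  assumes "u \<in> W" "V differentiable (at u)" "Y differentiable (at u)"
  shows "(\<lambda>x. chr (F x) (V x) (Y x)) differentiable (at u)"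
  unfolding chr_def
  by (rule differentiable_vec, simp, intro differentiable_sum ballI finite differentiable_mult differentiable_nth assms
      differentiable_compose_at[OF map_differentiable[OF assms(1)] christoffel_differentiable[OF map_into]])

lemma pd_chr:
  assumes "u \<in> W" "V differentiable (at u)" "Y differentiable (at u)"
  shows "pd i (\<lambda>x. chr (F x) (V x) (Y x)) u =
    (\<chi> a. \<Sum>b\<in>UNIV. \<Sum>c\<in>UNIV. (\<Sum>e\<in>UNIV. pd i F u $ e * pd e (\<lambda>y. christoffel H y a b c) (F u)) * V u $ b * Y u $ c)
     + chr (F u) (pd i V u) (Y u) + chr (F u) (V u) (pd i Y u)"
proof -
  note d = differentiable_nth[OF assms(2)] differentiable_nth[OF assms(3)]
  have dC: "(\<lambda>x. christoffel H (F x) a b c) differentiable (at u)" for a b c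
    by (rule differentiable_compose_at[OF map_differentiable[OF assms(1)] christoffel_differentiable[OF map_into[OF assms(1)]]])
  have pdC: "pd i (\<lambda>x. christoffel H (F x) a b c) u = (\<Sum>e\<in>UNIV. pd i F u $ e * pd e (\<lambda>y. christoffel H y a b c) (F u))" for a b c
    using pd_compose[OF map_differentiable[OF assms(1)] christoffel_differentiable[OF map_into[OF assms(1)]], of i a b c]
    by simp
  have "pd i (\<lambda>x. chr (F x) (V x) (Y x)) u $ a = pd i (\<lambda>x. chr (F x) (V x) (Y x) $ a) u" for a
    by (rule pd_nth[symmetric], rule chr_differentiable[OF assms])
  then show ?thesis
    by (simp add: vec_eq_iff chr_def pd_sum pd_mult differentiable_sum differentiable_mult dC d pdC pd_nth assms(2,3)
        sum.distrib algebra_simps)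
qed

lemma cov_differentiable:
  assumes "u \<in> W" "smooth_on V W"
  shows "cov i V differentiable (at u)"
  unfolding cov_eq[abs_def]
  by (intro differentiable_add chr_differentiable assms pd_map_differentiable
      smooth_on_differentiable[OF assms(2) open_source] smooth_on_differentiable[OF smooth_on_pd[OF assms(2)] open_source])

lemma cov_cong:
  assumes "u \<in> W" "\<And>x. x \<in> W \<Longrightarrow> V x = Y x"
  shows "cov i V u = cov i Y u"
  using assms pd_cong_open[OF open_source assms(1), of V Y] by (simp add: cov_eq)

lemma cov_scaleR:
  assumes "V differentiable (at u)"
  shows "cov i (\<lambda>x. c *\<^sub>R V x) u = c *\<^sub>R cov i V u"
  by (simp add: cov_eq pd_scaleR[OF differentiable_const assms] chr_linear scaleR_right_distrib)

text \<open>Torsion-freeness along the map: symmetric Christoffel symbols meet symmetric second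
  partial derivatives.\<close>

lemma cov_pd_commute: "u \<in> W \<Longrightarrow> cov i (pd j F) u = cov j (pd i F) u"
  using pd_pd_commute[OF open_source _ map_smooth] chr_commute[OF map_into] by (simp add: cov_eq)

text \<open>Coordinate fields commute, so there is no bracket term. Second derivatives of
  \<open>V\<close> and \<open>F\<close> cancel by symmetry; what survives are differentiated
  Christoffel symbols and products of two of them, the two halves of \<open>riemann\<close>.\<close>

lemma cov_commutator:
  assumes u: "u \<in> W" and V: "smooth_on V W"
  shows "cov i (cov j V) u - cov j (cov i V) u = riemann H (F u) (pd i F u) (pd j F u) (V u)"
proof -
  \<comment> \<open>The part of the second covariant derivative in which the Christoffel symbols
    themselves are differentiated.\<close>
  define T :: "'m \<Rightarrow> 'm \<Rightarrow> real^'n" where "T i j = (\<chi> a. \<Sum>b\<in>UNIV. \<Sum>c\<in>UNIV.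
    (\<Sum>e\<in>UNIV. pd i F u $ e * pd e (\<lambda>y. christoffel H y a b c) (F u)) * pd j F u $ b * V u $ c)" for i j
  have dV: "V differentiable (at u)" "pd k V differentiable (at u)" for k
    using smooth_on_differentiable[OF V open_source u] smooth_on_differentiable[OF smooth_on_pd[OF V] open_source u] by auto
  have cc: "cov i (cov j V) u = pd i (pd j V) u + (T i j + chr (F u) (pd i (pd j F) u) (V u)
     + chr (F u) (pd j F u) (pd i V u)) + chr (F u) (pd i F u) (pd j V u)
     + chr (F u) (pd i F u) (chr (F u) (pd j F u) (V u))" for i j
  proof -
    have "pd i (cov j V) u = pd i (\<lambda>x. pd j V x + chr (F x) (pd j F x) (V x)) u"
      by (simp add: cov_eq[abs_def])
    also have "\<dots> = pd i (pd j V) u + pd i (\<lambda>x. chr (F x) (pd j F x) (V x)) u"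
      by (intro pd_add dV chr_differentiable u pd_map_differentiable)
    finally show ?thesis
      by (simp add: cov_eq[of i "cov j V"] cov_eq[of j V] T_def chr_linear
          pd_chr[OF u pd_map_differentiable[OF u] dV(1)])
  qed
  have 1: "cov i (cov j V) u - cov j (cov i V) u = T i j - T j i +
     (chr (F u) (pd i F u) (chr (F u) (pd j F u) (V u)) - chr (F u) (pd j F u) (chr (F u) (pd i F u) (V u)))"
    unfolding cc using pd_pd_commute[OF open_source u V, of i j] pd_pd_commute[OF open_source u map_smooth, of i j]
    by simp
  have T: "T i j $ d = (\<Sum>a\<in>UNIV. \<Sum>b\<in>UNIV. \<Sum>c\<in>UNIV. pd i F u $ a * pd j F u $ b * V u $ c *
      pd a (\<lambda>x. christoffel H x d b c) (F u))" for i j d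
    unfolding T_def sum_distrib_right vec_lambda_beta
    by (simp only: sum.cartesian_product)
      (rule sum.reindex_bij_witness[of _ "\<lambda>(a, b, c). (b, c, a)" "\<lambda>(b, c, a). (a, b, c)"], auto)
  have T': "T j i $ d = (\<Sum>a\<in>UNIV. \<Sum>b\<in>UNIV. \<Sum>c\<in>UNIV. pd i F u $ a * pd j F u $ b * V u $ c *
      pd b (\<lambda>x. christoffel H x d a c) (F u))" for d
    unfolding T by (subst sum.swap) (simp add: mult_ac)
  have C: "chr (F u) (pd i F u) (chr (F u) (pd j F u) (V u)) $ d =
     (\<Sum>a\<in>UNIV. \<Sum>b\<in>UNIV. \<Sum>c\<in>UNIV. pd i F u $ a * pd j F u $ b * V u $ c *
      (\<Sum>e\<in>UNIV. christoffel H (F u) d a e * christoffel H (F u) e b c))" for i j d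
    unfolding chr_def vec_lambda_beta sum_distrib_left
    by (simp only: sum.cartesian_product)
      (rule sum.reindex_bij_witness[of _ "\<lambda>(a, b, c, e). (a, e, b, c)" "\<lambda>(a, e, b, c). (a, b, c, e)"], auto)
  have C': "chr (F u) (pd j F u) (chr (F u) (pd i F u) (V u)) $ d =
     (\<Sum>a\<in>UNIV. \<Sum>b\<in>UNIV. \<Sum>c\<in>UNIV. pd i F u $ a * pd j F u $ b * V u $ c *
      (\<Sum>e\<in>UNIV. christoffel H (F u) d b e * christoffel H (F u) e a c))" for d
    unfolding C by (subst sum.swap) (simp add: mult_ac)
  show ?thesis
    unfolding 1 by (simp add: vec_eq_iff riemann_def T[of i j] T' C[of i j] C'
        ring_distribs sum.distrib sum_subtractf)
qed

end

section \<open>Surfaces of constant mean curvature\<close>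

lemma matrix_inv_2:
  fixes G :: "real^2^2"
  assumes "transpose G = G" "d = G$1$1 * G$2$2 - G$1$2 * G$1$2" "d \<noteq> 0"
  shows "matrix_inv G $ 1 $ 1 = G$2$2 / d" "matrix_inv G $ 1 $ 2 = - G$1$2 / d"
    "matrix_inv G $ 2 $ 1 = - G$1$2 / d" "matrix_inv G $ 2 $ 2 = G$1$1 / d"
proof -
  have s: "G$2$1 = G$1$2" using assms(1) transpose_eq_iff by blast
  have "G ** vector [vector [G$2$2 / d, - G$1$2 / d], vector [- G$1$2 / d, G$1$1 / d]] = mat 1"
    using assms(3) unfolding vec_eq_iff forall_2 matrix_matrix_mult_def mat_def
    by (simp add: sum_2 s divide_simps) (simp add: assms(2) algebra_simps)
  then have "matrix_inv G = vector [vector [G$2$2 / d, - G$1$2 / d], vector [- G$1$2 / d, G$1$1 / d]]"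
    by (rule matrix_inv_unique)
  then show "matrix_inv G $ 1 $ 1 = G$2$2 / d" "matrix_inv G $ 1 $ 2 = - G$1$2 / d"
    "matrix_inv G $ 2 $ 1 = - G$1$2 / d" "matrix_inv G $ 2 $ 2 = G$1$1 / d" by simp_all
qed

lemma posdef_2:
  fixes G :: "real^2^2"
  assumes "transpose G = G" "\<And>v. v \<noteq> 0 \<Longrightarrow> metric_ip G v v > 0"
  shows "G$1$1 > 0" "G$2$2 > 0" "G$1$1 * G$2$2 - G$1$2 * G$1$2 > 0"
proof -
  have s: "G$2$1 = G$1$2" using assms(1) transpose_eq_iff by blast
  have *: "G$1$1 * x\<^sup>2 + 2 * G$1$2 * x * y + G$2$2 * y\<^sup>2 > 0" if "x \<noteq> 0 \<or> y \<noteq> 0" for x y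
    using assms(2)[of "vector [x, y]"] that
    by (simp add: metric_ip_def sum_2 s vec_eq_iff forall_2 power2_eq_square algebra_simps)
  show 1: "G$1$1 > 0" using *[of 1 0] by simp
  show "G$2$2 > 0" using *[of 0 1] by simp
  \<comment> \<open>At the vector with entries \<open>- G$1$2\<close> and \<open>G$1$1\<close> the
    form equals \<open>G$1$1\<close> times the determinant.\<close>
  have "G$1$1 * (G$1$1 * G$2$2 - G$1$2 * G$1$2) > 0"
    using *[of "- G$1$2" "G$1$1"] 1 by (simp add: power2_eq_square algebra_simps)
  then show "G$1$1 * G$2$2 - G$1$2 * G$1$2 > 0" using 1 by (simp add: zero_less_mult_iff)
qed

text \<open>All eight geometries have a curvature tensor of the following form. Its Ricci operator is
  \<open>2\<kappa> + \<beta>\<close> plus \<open>\<beta>\<close> times the projection onto the unit vector field \<open>E\<close>;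
  the normalisation is required only where \<open>\<beta> \<noteq> 0\<close>.\<close>

locale geometry_domain = riemannian_domain D H
  for D :: "(real^3) set" and H :: "real^3 \<Rightarrow> real^3^3" +
  fixes \<kappa> \<beta> :: real and E :: "real^3 \<Rightarrow> real^3"
  assumes curvature: "x \<in> D \<Longrightarrow> riemann H x X Y Z =
      \<kappa> *\<^sub>R (metric_ip (H x) Y Z *\<^sub>R X - metric_ip (H x) X Z *\<^sub>R Y)
      + \<beta> *\<^sub>R ((metric_ip (H x) (E x) Y * metric_ip (H x) (E x) Z) *\<^sub>R X
          - (metric_ip (H x) (E x) X * metric_ip (H x) (E x) Z) *\<^sub>R Y
          + (metric_ip (H x) Y Z * metric_ip (H x) (E x) X) *\<^sub>R E x
          - (metric_ip (H x) X Z * metric_ip (H x) (E x) Y) *\<^sub>R E x)"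
    and metric_smooth: "smooth_on (\<lambda>y. H y $ i $ j) D"
    and axis_unit: "x \<in> D \<Longrightarrow> \<beta> * metric_ip (H x) (E x) (E x) = \<beta>"

text \<open>\<open>G\<close> is the Gram matrix of the source chart. It stays separate from the
  induced metric because \<open>bitension\<close> and \<open>mean_curvature\<close> take it as an
  argument; \<open>first_form\<close> identifies the two on \<open>W\<close>.\<close>

locale surface_patch = geometry_domain D H \<kappa> \<beta> E + riemannian_map D H W F
  for D H \<kappa> \<beta> E and W :: "(real^2) set" and F :: "real^2 \<Rightarrow> real^3" +
  fixes G :: "real^2 \<Rightarrow> real^2^2" and \<xi> :: "real^2 \<Rightarrow> real^3"
  assumes first_form: "u \<in> W \<Longrightarrow> G u $ i $ j = metric_ip (H (F u)) (pd i F u) (pd j F u)"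
    and first_form_positive: "u \<in> W \<Longrightarrow> v \<noteq> 0 \<Longrightarrow> metric_ip (G u) v v > 0"
    and normal_smooth: "smooth_on \<xi> W"
    and normal_unit: "u \<in> W \<Longrightarrow> metric_ip (H (F u)) (\<xi> u) (\<xi> u) = 1"
    and normal_orthogonal: "u \<in> W \<Longrightarrow> metric_ip (H (F u)) (\<xi> u) (pd i F u) = 0"
begin

definition g11 where "g11 u = ip u (pd 1 F u) (pd 1 F u)"
definition g12 where "g12 u = ip u (pd 1 F u) (pd 2 F u)"
definition g22 where "g22 u = ip u (pd 2 F u) (pd 2 F u)"
definition gdet where "gdet u = g11 u * g22 u - g12 u * g12 u"

text \<open>The second fundamental form, taken from the derivative of the normal because
  \<open>mean_curvature\<close> is defined that way; \<open>second_form\<close> gives the expression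
  through second derivatives of \<open>F\<close>.\<close>

definition b :: "real^2 \<Rightarrow> 2 \<Rightarrow> 2 \<Rightarrow> real" where
  "b u i j = - ip u (cov i \<xi> u) (pd j F u)"

definition \<eta> :: "real^2 \<Rightarrow> real^3 \<Rightarrow> real" where
  "\<eta> u v = ip u (E (F u)) v"

definition \<Gamma> :: "real^2 \<Rightarrow> 2 \<Rightarrow> 2 \<Rightarrow> 2 \<Rightarrow> real" where
  "\<Gamma> u k i j = christoffel G u k i j"

lemma first_form_eqs:
  assumes "u \<in> W"
  shows "G u $ 1 $ 1 = g11 u" "G u $ 1 $ 2 = g12 u" "G u $ 2 $ 1 = g12 u" "G u $ 2 $ 2 = g22 u"
  using first_form[OF assms] ip_commute[OF assms] by (simp_all add: g11_def g12_def g22_def)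

lemma first_form_sym: "u \<in> W \<Longrightarrow> transpose (G u) = G u"
  unfolding transpose_eq_iff forall_2 by (simp add: first_form_eqs)

lemma g_pos:
  assumes "u \<in> W"
  shows "g11 u > 0" "g22 u > 0" "gdet u > 0"
  using posdef_2[of "G u", OF first_form_sym[OF assms] first_form_positive[OF assms]]
  by (simp_all add: first_form_eqs assms gdet_def)

lemma ip_pd_pd:
  assumes "u \<in> W"
  shows "ip u (pd 1 F u) (pd 1 F u) = g11 u" "ip u (pd 1 F u) (pd 2 F u) = g12 u"
    "ip u (pd 2 F u) (pd 1 F u) = g12 u" "ip u (pd 2 F u) (pd 2 F u) = g22 u"
  using ip_commute[OF assms] by (simp_all add: g11_def g12_def g22_def)

lemma matrix_inv_G:
  assumes "u \<in> W"
  shows "matrix_inv (G u) $ 1 $ 1 = g22 u / gdet u" "matrix_inv (G u) $ 1 $ 2 = - g12 u / gdet u"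
    "matrix_inv (G u) $ 2 $ 1 = - g12 u / gdet u" "matrix_inv (G u) $ 2 $ 2 = g11 u / gdet u"
  using matrix_inv_2[OF first_form_sym[OF assms], of "gdet u"] g_pos[OF assms]
  by (simp_all add: first_form_eqs assms gdet_def)

lemma normal_orthogonal': "u \<in> W \<Longrightarrow> ip u (pd i F u) (\<xi> u) = 0"
  using normal_orthogonal ip_commute by simp

text \<open>The normal and the two coordinate vectors are independent because the Gram determinant
  is positive. An injective linear self-map of 3-space is onto, so they span, and \<open>v\<close>
  is orthogonal to itself.\<close>

lemma frame_zero:
  assumes u: "u \<in> W" and v: "ip u v (\<xi> u) = 0" "ip u v (pd 1 F u) = 0" "ip u v (pd 2 F u) = 0"
  shows "v = 0"
proof -
  define L :: "real^3 \<Rightarrow> real^3" where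
    "L c = c$3 *\<^sub>R \<xi> u + (c$1 *\<^sub>R pd 1 F u + c$2 *\<^sub>R pd 2 F u)" for c
  have lin: "linear L"
    by (rule linearI) (simp_all add: L_def algebra_simps)
  have "c = 0" if "L c = 0" for c
  proof -
    have "ip u (L c) (\<xi> u) = c$3" "ip u (L c) (pd 1 F u) = c$1 * g11 u + c$2 * g12 u"
      "ip u (L c) (pd 2 F u) = c$1 * g12 u + c$2 * g22 u"
      by (simp_all add: L_def metric_ip_simps normal_unit[OF u] normal_orthogonal[OF u]
          normal_orthogonal'[OF u] ip_pd_pd[OF u])
    then have c: "c$3 = 0" "c$1 * g11 u + c$2 * g12 u = 0" "c$1 * g12 u + c$2 * g22 u = 0"
      using that by simp_all
    have "c$1 * gdet u = 0" "c$2 * gdet u = 0"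
      using c(2,3) unfolding gdet_def by algebra+
    then show ?thesis using g_pos[OF u] c(1) by (simp add: vec_eq_iff forall_3)
  qed
  then have "surj L" using linear_injective_imp_surjective[OF lin] linear_injective_0[OF lin] by blast
  then obtain c where "v = L c" by (metis surjD)
  then have "ip u v v = 0" using v by (simp add: L_def metric_ip_simps)
  then show ?thesis using metric_positive[OF map_into[OF u], of v] by force
qed

lemma frame_eqI:
  assumes "u \<in> W" "ip u v (\<xi> u) = ip u w (\<xi> u)" "\<And>l. ip u v (pd l F u) = ip u w (pd l F u)"
  shows "v = w"
  using frame_zero[of u "v - w"] assms by (simp add: metric_ip_simps)

text \<open>The tangential coefficients are Cramer's rule for the first fundamental form.\<close>

lemma frame_expand:
  assumes u: "u \<in> W"
  shows "v = ip u v (\<xi> u) *\<^sub>R \<xi> u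
    + ((g22 u * ip u v (pd 1 F u) - g12 u * ip u v (pd 2 F u)) / gdet u) *\<^sub>R pd 1 F u
    + ((g11 u * ip u v (pd 2 F u) - g12 u * ip u v (pd 1 F u)) / gdet u) *\<^sub>R pd 2 F u"
proof (rule frame_eqI[OF u])
  have gd: "gdet u \<noteq> 0" using g_pos[OF u] by simp
  have 1: "(g22 u * x - g12 u * y) / gdet u * g11 u + (g11 u * y - g12 u * x) / gdet u * g12 u = x"
    and 2: "(g22 u * x - g12 u * y) / gdet u * g12 u + (g11 u * y - g12 u * x) / gdet u * g22 u = y" for x y
  proof -
    have "(g22 u * x - g12 u * y) * g11 u + (g11 u * y - g12 u * x) * g12 u = x * gdet u"
      "(g22 u * x - g12 u * y) * g12 u + (g11 u * y - g12 u * x) * g22 u = y * gdet u"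
      by (simp_all add: gdet_def algebra_simps)
    then show "(g22 u * x - g12 u * y) / gdet u * g11 u + (g11 u * y - g12 u * x) / gdet u * g12 u = x"
      "(g22 u * x - g12 u * y) / gdet u * g12 u + (g11 u * y - g12 u * x) / gdet u * g22 u = y"
      using gd by (simp_all add: divide_simps)
  qed
  fix l :: 2
  have "l = 1 \<or> l = 2" using exhaust_2 by blast
  then show "ip u v (pd l F u) = ip u (ip u v (\<xi> u) *\<^sub>R \<xi> u
    + ((g22 u * ip u v (pd 1 F u) - g12 u * ip u v (pd 2 F u)) / gdet u) *\<^sub>R pd 1 F u
    + ((g11 u * ip u v (pd 2 F u) - g12 u * ip u v (pd 1 F u)) / gdet u) *\<^sub>R pd 2 F u) (pd l F u)"
    using 1 2 by (elim disjE) (simp_all add: metric_ip_simps normal_orthogonal[OF u] ip_pd_pd[OF u])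
qed (simp_all add: metric_ip_simps normal_unit[OF u] normal_orthogonal'[OF u])

lemma normal_differentiable: "u \<in> W \<Longrightarrow> \<xi> differentiable (at u)"
  by (rule smooth_on_differentiable[OF normal_smooth open_source])

lemma ip_cov_normal: assumes u: "u \<in> W" shows "ip u (cov i \<xi> u) (\<xi> u) = 0"
proof -
  have "pd i (\<lambda>x. ip x (\<xi> x) (\<xi> x)) u = pd i (\<lambda>x. 1 :: real) u"
    by (rule pd_cong_open[OF open_source u]) (rule normal_unit)
  then show ?thesis
    using pd_ip[OF u normal_differentiable[OF u] normal_differentiable[OF u], of i] ip_commute[OF u] by simp
qed

text \<open>Differentiating the orthogonality of the normal and the coordinate vectors moves the
  derivative to \<open>F\<close>; together with \<open>cov_pd_commute\<close> this makes
  \<open>b\<close> symmetric.\<close>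

lemma second_form: assumes u: "u \<in> W" shows "ip u (\<xi> u) (cov i (pd j F) u) = b u i j"
proof -
  have "pd i (\<lambda>x. ip x (\<xi> x) (pd j F x)) u = pd i (\<lambda>x. 0 :: real) u"
    by (rule pd_cong_open[OF open_source u]) (rule normal_orthogonal)
  then show ?thesis
    using pd_ip[OF u normal_differentiable[OF u] pd_map_differentiable[OF u], of i j] by (simp add: b_def)
qed

lemma b_sym: "u \<in> W \<Longrightarrow> b u i j = b u j i"
  using second_form cov_pd_commute by metis

lemma pd_first_form:
  assumes u: "u \<in> W"
  shows "pd l (\<lambda>x. G x $ i $ j) u = ip u (cov l (pd i F) u) (pd j F u) + ip u (pd i F u) (cov l (pd j F) u)"
proof -
  have "pd l (\<lambda>x. G x $ i $ j) u = pd l (\<lambda>x. ip x (pd i F x) (pd j F x)) u"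
    by (rule pd_cong_open[OF open_source u]) (rule first_form)
  then show ?thesis by (simp add: pd_ip[OF u pd_map_differentiable[OF u] pd_map_differentiable[OF u]])
qed

text \<open>The tangential part of the ambient connection satisfies the Koszul identity of the
  induced metric, hence is its Levi-Civita connection.\<close>

lemma tangential_part:
  assumes u: "u \<in> W"
  shows "ip u (cov i (pd j F) u) (pd l F u) = (\<Sum>k\<in>UNIV. \<Gamma> u k i j * ip u (pd k F u) (pd l F u))"
proof -
  have "(\<Sum>k\<in>UNIV. G u $ l $ k * christoffel G u k i j) = ip u (cov i (pd j F) u) (pd l F u)"
    by (subst christoffel_lower, rule first_form_positive[OF u], assumption)
      (simp add: pd_first_form[OF u] ip_commute[OF u, of "pd _ F u"] cov_pd_commute[OF u, of j i]
        cov_pd_commute[OF u, of l i] cov_pd_commute[OF u, of l j])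
  then show ?thesis
    by (simp add: \<Gamma>_def first_form[OF u] ip_commute[OF u, of "pd l F u"] mult.commute)
qed

lemma gauss_formula:
  assumes u: "u \<in> W"
  shows "cov i (pd j F) u = (\<Sum>k\<in>UNIV. \<Gamma> u k i j *\<^sub>R pd k F u) + b u i j *\<^sub>R \<xi> u"
proof (rule frame_eqI[OF u])
  show "ip u (cov i (pd j F) u) (\<xi> u) = ip u ((\<Sum>k\<in>UNIV. \<Gamma> u k i j *\<^sub>R pd k F u) + b u i j *\<^sub>R \<xi> u) (\<xi> u)"
    using second_form[OF u, of i j] ip_commute[OF u, of "\<xi> u" "cov i (pd j F) u"]
    by (simp add: metric_ip_simps normal_orthogonal'[OF u] normal_unit[OF u])
qed (simp add: tangential_part[OF u] metric_ip_simps normal_orthogonal[OF u])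

lemma second_fundamental_form_eq:
  "u \<in> W \<Longrightarrow> second_fundamental_form G H F i j u = b u i j *\<^sub>R \<xi> u"
  by (simp add: second_fundamental_form_def gauss_formula \<Gamma>_def)

lemma mean_curvature_eq:
  assumes u: "u \<in> W"
  shows "mean_curvature G H F \<xi> u = (g22 u * b u 1 1 - 2 * g12 u * b u 1 2 + g11 u * b u 2 2) / (2 * gdet u)"
  using g_pos(3)[OF u] b_sym[OF u, of 1 2]
  by (simp add: mean_curvature_def sum_2 matrix_inv_G[OF u] metric_ip_simps b_def[symmetric] field_simps)

lemma tension_eq:
  assumes u: "u \<in> W"
  shows "tension G H F u = (2 * mean_curvature G H F \<xi> u) *\<^sub>R \<xi> u"
  using g_pos(3)[OF u] b_sym[OF u, of 1 2]
  by (simp add: tension_def sum_2 matrix_inv_G[OF u] second_fundamental_form_eq[OF u] mean_curvature_eq[OF u]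
      flip: scaleR_left_distrib) (simp add: field_simps)

text \<open>The squared norm |A|^2 of the shape operator: the trace of the third fundamental form
  with both inverse Gram matrices written out, each contributing one factor \<open>gdet\<close> to
  the denominator.\<close>

definition shape_norm2 :: "real^2 \<Rightarrow> real" where
  "shape_norm2 u = (g22 u * (g22 u * (b u 1 1)\<^sup>2 - 2 * g12 u * b u 1 1 * b u 1 2 + g11 u * (b u 1 2)\<^sup>2)
    - 2 * g12 u * (g22 u * b u 1 1 * b u 1 2 - g12 u * (b u 1 1 * b u 2 2 + (b u 1 2)\<^sup>2) + g11 u * b u 1 2 * b u 2 2)
    + g11 u * (g22 u * (b u 1 2)\<^sup>2 - 2 * g12 u * b u 1 2 * b u 2 2 + g11 u * (b u 2 2)\<^sup>2)) / (gdet u)\<^sup>2"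

text \<open>\<open>N u l i j\<close> is \<open>- (\<nabla>\<^sub>l b)\<^sub>i\<^sub>j\<close>.\<close>

definition N :: "real^2 \<Rightarrow> 2 \<Rightarrow> 2 \<Rightarrow> 2 \<Rightarrow> real" where
  "N u l i j = ip u (cov l (cov i \<xi>) u) (pd j F u) + (\<Sum>m\<in>UNIV. \<Gamma> u m l i * b u m j)"

lemma cov_normal_differentiable: "u \<in> W \<Longrightarrow> cov i \<xi> differentiable (at u)"
  by (rule cov_differentiable[OF _ normal_smooth])

lemma b_differentiable: "u \<in> W \<Longrightarrow> (\<lambda>x. b x i j) differentiable (at u)"
  unfolding b_def by (intro differentiable_minus ip_differentiable cov_normal_differentiable pd_map_differentiable)

lemma g_differentiable:
  assumes "u \<in> W"
  shows "g11 differentiable (at u)" "g12 differentiable (at u)" "g22 differentiable (at u)" "gdet differentiable (at u)"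
proof -
  show *: "g11 differentiable (at u)" "g12 differentiable (at u)" "g22 differentiable (at u)"
    unfolding g11_def[abs_def] g12_def[abs_def] g22_def[abs_def]
    by (intro ip_differentiable pd_map_differentiable assms)+
  show "gdet differentiable (at u)"
    unfolding gdet_def[abs_def] by (intro differentiable_diff differentiable_mult *)
qed

lemma mean_curvature_continuous: "continuous_on W (mean_curvature G H F \<xi>)"
proof -
  have "continuous_on W (\<lambda>u. (g22 u * b u 1 1 - 2 * g12 u * b u 1 2 + g11 u * b u 2 2) / (2 * gdet u))"
    by (intro continuous_intros differentiable_imp_continuous_on[OF iffD2[OF differentiable_on_eq_differentiable_at[OF open_source]]]
        ballI g_differentiable b_differentiable) (use g_pos(3) in force)+
  then show ?thesis by (rule continuous_on_cong[THEN iffD1, rotated 2]) (auto simp: mean_curvature_eq)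
qed

lemma pd_b:
  assumes u: "u \<in> W"
  shows "pd l (\<lambda>x. b x i j) u = - N u l i j + (\<Sum>m\<in>UNIV. \<Gamma> u m l i * b u m j) + (\<Sum>m\<in>UNIV. \<Gamma> u m l j * b u i m)"
proof -
  have "pd l (\<lambda>x. b x i j) u = - (ip u (cov l (cov i \<xi>) u) (pd j F u) + ip u (cov i \<xi> u) (cov l (pd j F) u))"
    unfolding b_def
    by (subst pd_minus) (intro ip_differentiable cov_normal_differentiable pd_map_differentiable u,
        simp add: pd_ip[OF u cov_normal_differentiable[OF u] pd_map_differentiable[OF u]])
  then show ?thesis
    by (simp add: gauss_formula[OF u] metric_ip_simps ip_cov_normal[OF u] N_def b_def sum_2)
qed

lemma N_sym: assumes u: "u \<in> W" shows "N u l i j = N u l j i"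
proof -
  have "pd l (\<lambda>x. b x i j) u = pd l (\<lambda>x. b x j i) u"
    by (rule pd_cong_open[OF open_source u]) (rule b_sym)
  then show ?thesis unfolding pd_b[OF u] by (simp add: sum_2 b_sym[OF u, of _ i] b_sym[OF u, of _ j])
qed

lemma christoffel_source_sym: assumes u: "u \<in> W" shows "\<Gamma> u k i j = \<Gamma> u k j i"
proof -
  have "pd l (\<lambda>x. G x $ i $ j) u = pd l (\<lambda>x. G x $ j $ i) u" for l i j
    by (rule pd_cong_open[OF open_source u]) (simp add: first_form ip_commute)
  then show ?thesis unfolding \<Gamma>_def christoffel_def by (simp add: add.commute)
qed

text \<open>\<open>cov_commutator\<close> for the normal field. The \<open>\<kappa>\<close> part of
  the curvature vanishes because the normal is orthogonal to the coordinate vectors, so only the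
  axis contributes.\<close>

lemma codazzi:
  assumes u: "u \<in> W"
  shows "N u i j l - N u j i l = \<beta> * \<eta> u (\<xi> u) *
    (\<eta> u (pd j F u) * ip u (pd i F u) (pd l F u) - \<eta> u (pd i F u) * ip u (pd j F u) (pd l F u))"
proof -
  have "N u i j l - N u j i l = ip u (cov i (cov j \<xi>) u - cov j (cov i \<xi>) u) (pd l F u)"
    by (simp add: N_def metric_ip_simps christoffel_source_sym[OF u, of _ i j])
  then show ?thesis
    by (simp add: cov_commutator[OF u normal_smooth] curvature[OF map_into[OF u]] metric_ip_simps
        normal_orthogonal'[OF u] \<eta>_def algebra_simps)
qed

text \<open>The squared length of \<open>E\<close> split into its normal and tangential parts. The
  factor \<open>\<beta>\<close> stays because \<open>axis_unit\<close> normalises \<open>E\<close>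
  only up to it.\<close>

lemma axis_norm:
  assumes u: "u \<in> W"
  shows "\<beta> * ((g22 u * (\<eta> u (pd 1 F u))\<^sup>2 - 2 * g12 u * \<eta> u (pd 1 F u) * \<eta> u (pd 2 F u)
    + g11 u * (\<eta> u (pd 2 F u))\<^sup>2) / gdet u) = \<beta> * (1 - (\<eta> u (\<xi> u))\<^sup>2)"
proof -
  let ?E = "E (F u)"
  have "ip u ?E ?E = ip u ?E (ip u ?E (\<xi> u) *\<^sub>R \<xi> u
    + ((g22 u * ip u ?E (pd 1 F u) - g12 u * ip u ?E (pd 2 F u)) / gdet u) *\<^sub>R pd 1 F u
    + ((g11 u * ip u ?E (pd 2 F u) - g12 u * ip u ?E (pd 1 F u)) / gdet u) *\<^sub>R pd 2 F u)"
    using frame_expand[OF u, of ?E] by simp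
  also have "\<dots> = (\<eta> u (\<xi> u))\<^sup>2 + (g22 u * (\<eta> u (pd 1 F u))\<^sup>2 - 2 * g12 u * \<eta> u (pd 1 F u) * \<eta> u (pd 2 F u)
    + g11 u * (\<eta> u (pd 2 F u))\<^sup>2) / gdet u"
    using g_pos(3)[OF u] by (simp add: metric_ip_simps \<eta>_def[symmetric] power2_eq_square field_simps)
  finally show ?thesis using axis_unit[OF map_into[OF u]] by (simp add: algebra_simps)
qed

lemma third_form:
  assumes u: "u \<in> W"
  shows "ip u (cov i \<xi> u) (cov j \<xi> u) =
    ((g22 u * b u i 1 - g12 u * b u i 2) * b u j 1 + (g11 u * b u i 2 - g12 u * b u i 1) * b u j 2) / gdet u"
proof -
  have e: "cov i \<xi> u = ((- (g22 u * b u i 1) + g12 u * b u i 2) / gdet u) *\<^sub>R pd 1 F u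
    + ((- (g11 u * b u i 2) + g12 u * b u i 1) / gdet u) *\<^sub>R pd 2 F u" (is "_ = ?r")
    using frame_expand[OF u, of "cov i \<xi> u"] by (simp add: ip_cov_normal[OF u] b_def algebra_simps)
  have "ip u (cov i \<xi> u) (cov j \<xi> u) = ip u ?r (cov j \<xi> u)" using e by simp
  also have "\<dots> = ((- (g22 u * b u i 1) + g12 u * b u i 2) / gdet u) * - b u j 1
     + ((- (g11 u * b u i 2) + g12 u * b u i 1) / gdet u) * - b u j 2"
    by (simp add: metric_ip_simps b_def ip_commute[OF u, of "pd _ F u"])
  finally show ?thesis by (simp add: add_divide_distrib diff_divide_distrib algebra_simps)
qed

end

section \<open>The bitension field of a surface of constant mean curvature\<close>

locale cmc_patch = surface_patch +
  fixes h :: real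
  assumes mean_curvature_const: "u \<in> W \<Longrightarrow> mean_curvature G H F \<xi> u = h"
begin

lemma trace_b:
  assumes u: "u \<in> W"
  shows "g22 u * b u 1 1 - 2 * g12 u * b u 1 2 + g11 u * b u 2 2 = 2 * h * gdet u"
  using mean_curvature_const[OF u] g_pos(3)[OF u] by (simp add: mean_curvature_eq[OF u] field_simps)

lemma pd_g:
  assumes u: "u \<in> W"
  shows "pd l g11 u = 2 * (\<Gamma> u 1 l 1 * g11 u + \<Gamma> u 2 l 1 * g12 u)"
    "pd l g12 u = \<Gamma> u 1 l 1 * g12 u + \<Gamma> u 2 l 1 * g22 u + \<Gamma> u 1 l 2 * g11 u + \<Gamma> u 2 l 2 * g12 u"
    "pd l g22 u = 2 * (\<Gamma> u 1 l 2 * g12 u + \<Gamma> u 2 l 2 * g22 u)"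
proof -
  have p: "pd l (\<lambda>x. ip x (pd i F x) (pd j F x)) u =
    (\<Sum>k\<in>UNIV. \<Gamma> u k l i * ip u (pd k F u) (pd j F u)) + (\<Sum>k\<in>UNIV. \<Gamma> u k l j * ip u (pd i F u) (pd k F u))" for i j
    by (simp add: pd_ip[OF u pd_map_differentiable[OF u] pd_map_differentiable[OF u]]
      gauss_formula[OF u] metric_ip_simps normal_orthogonal[OF u] normal_orthogonal'[OF u])
  have "pd l g11 u = pd l (\<lambda>x. ip x (pd 1 F x) (pd 1 F x)) u"
    "pd l g12 u = pd l (\<lambda>x. ip x (pd 1 F x) (pd 2 F x)) u"
    "pd l g22 u = pd l (\<lambda>x. ip x (pd 2 F x) (pd 2 F x)) u"
    by (simp_all add: g11_def[abs_def] g12_def[abs_def] g22_def[abs_def])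
  then show "pd l g11 u = 2 * (\<Gamma> u 1 l 1 * g11 u + \<Gamma> u 2 l 1 * g12 u)"
    "pd l g12 u = \<Gamma> u 1 l 1 * g12 u + \<Gamma> u 2 l 1 * g22 u + \<Gamma> u 1 l 2 * g11 u + \<Gamma> u 2 l 2 * g12 u"
    "pd l g22 u = 2 * (\<Gamma> u 1 l 2 * g12 u + \<Gamma> u 2 l 2 * g22 u)"
    unfolding p sum_2 ip_pd_pd[OF u] by simp_all
qed

text \<open>The metric is parallel, so the derivative of a trace is the trace of the covariant
  derivative; the trace of the shape operator is constant.\<close>

lemma trace_N:
  assumes u: "u \<in> W"
  shows "g22 u * N u l 1 1 - 2 * g12 u * N u l 1 2 + g11 u * N u l 2 2 = 0"
proof -
  note d = g_differentiable[OF u] b_differentiable[OF u]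
  \<comment> \<open>The trace equation is differentiated after clearing the denominator
    \<open>gdet\<close>; the terms from differentiating \<open>gdet\<close> are absorbed by
    \<open>trace_b\<close>.\<close>
  have "pd l (\<lambda>x. g22 x * b x 1 1 - 2 * (g12 x * b x 1 2) + g11 x * b x 2 2 - 2 * h * (g11 x * g22 x - g12 x * g12 x)) u
    = pd l (\<lambda>x. 0 :: real) u"
    by (rule pd_cong_open[OF open_source u]) (use trace_b in \<open>simp add: gdet_def mult.assoc\<close>)
  then have "pd l g22 u * b u 1 1 + g22 u * pd l (\<lambda>x. b x 1 1) u
    - 2 * (pd l g12 u * b u 1 2 + g12 u * pd l (\<lambda>x. b x 1 2) u)
    + (pd l g11 u * b u 2 2 + g11 u * pd l (\<lambda>x. b x 2 2) u)
    - 2 * h * (pd l g11 u * g22 u + g11 u * pd l g22 u - (pd l g12 u * g12 u + g12 u * pd l g12 u)) = 0"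
    by (simp add: pd_add pd_diff pd_mult d differentiable_add differentiable_diff differentiable_mult)
  moreover have "b u 2 1 = b u 1 2" by (rule b_sym[OF u])
  ultimately show ?thesis
    using trace_b[OF u] unfolding pd_g[OF u] pd_b[OF u] sum_2 gdet_def by simp algebra
qed

text \<open>The tension field is the constant multiple \<open>2 * h\<close> of the normal, and the
  operator in \<open>bitension\<close> is linear in it.\<close>

lemma bitension_eq:
  assumes u: "u \<in> W"
  shows "bitension G H F u = (2 * h) *\<^sub>R
    ((\<Sum>i\<in>UNIV. \<Sum>j\<in>UNIV. matrix_inv (G u) $ i $ j *\<^sub>R
        (cov i (cov j \<xi>) u - (\<Sum>k\<in>UNIV. \<Gamma> u k i j *\<^sub>R cov k \<xi> u)))
     - (\<Sum>i\<in>UNIV. \<Sum>j\<in>UNIV. matrix_inv (G u) $ i $ j *\<^sub>R riemann H (F u) (pd i F u) (\<xi> u) (pd j F u)))"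
proof -
  have t: "tension G H F x = (2 * h) *\<^sub>R \<xi> x" if "x \<in> W" for x
    by (simp add: tension_eq[OF that] mean_curvature_const[OF that])
  have c: "cov j (tension G H F) x = (2 * h) *\<^sub>R cov j \<xi> x" if "x \<in> W" for x j
    using cov_cong[OF that t] cov_scaleR[OF normal_differentiable[OF that]] by simp
  have cc: "cov i (cov j (tension G H F)) u = (2 * h) *\<^sub>R cov i (cov j \<xi>) u" for i j
    using cov_cong[OF u c] cov_scaleR[OF cov_normal_differentiable[OF u]] by simp
  have r: "riemann H (F u) X ((2 * h) *\<^sub>R Y) Z = (2 * h) *\<^sub>R riemann H (F u) X Y Z" for X Y Z
    by (simp add: curvature[OF map_into[OF u]] metric_ip_simps algebra_simps)
  show ?thesis
    unfolding bitension_def Let_def cc c[OF u] t[OF u] r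
    by (simp add: \<Gamma>_def sum_2 scaleR_diff_right scaleR_add_right mult_ac)
qed

text \<open>The derivative of the normal is orthogonal to the normal. Differentiating this once more
  turns the normal part of the second derivatives into -|A|^2 (fact \<open>1\<close>); the curvature
  trace is the Ricci curvature of the normal (facts \<open>2\<close> and \<open>3\<close>).\<close>

lemma bitension_normal:
  assumes u: "u \<in> W"
  shows "ip u (bitension G H F u) (\<xi> u) = 2 * h * (2 * \<kappa> + \<beta> + \<beta> * (\<eta> u (\<xi> u))\<^sup>2 - shape_norm2 u)"
proof -
  have n: "ip u (cov i (cov j \<xi>) u) (\<xi> u) = - ip u (cov j \<xi> u) (cov i \<xi> u)" for i j
  proof -
    have "pd i (\<lambda>x. ip x (cov j \<xi> x) (\<xi> x)) u = pd i (\<lambda>x. 0 :: real) u"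
      by (rule pd_cong_open[OF open_source u]) (rule ip_cov_normal)
    then show ?thesis
      using pd_ip[OF u cov_normal_differentiable[OF u] normal_differentiable[OF u], of i j] by simp
  qed
  have gd: "gdet u \<noteq> 0" using g_pos(3)[OF u] by simp
  have r: "ip u (riemann H (F u) (pd i F u) (\<xi> u) (pd j F u)) (\<xi> u) =
    - (\<kappa> * ip u (pd i F u) (pd j F u)) - \<beta> * (\<eta> u (pd i F u) * \<eta> u (pd j F u))
    - \<beta> * (\<eta> u (\<xi> u))\<^sup>2 * ip u (pd i F u) (pd j F u)" for i j
    by (simp add: curvature[OF map_into[OF u]] metric_ip_simps normal_orthogonal[OF u] normal_orthogonal'[OF u]
        normal_unit[OF u] \<eta>_def power2_eq_square algebra_simps)
  have b21: "b u 2 1 = b u 1 2" by (rule b_sym[OF u])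
  have 1: "(\<Sum>i\<in>UNIV. \<Sum>j\<in>UNIV. matrix_inv (G u) $ i $ j * ip u (cov j \<xi> u) (cov i \<xi> u)) = shape_norm2 u"
    using gd by (simp add: sum_2 matrix_inv_G[OF u] third_form[OF u] shape_norm2_def b21 power2_eq_square)
      (simp add: divide_simps, simp add: algebra_simps)
  have 2: "(\<Sum>i\<in>UNIV. \<Sum>j\<in>UNIV. matrix_inv (G u) $ i $ j * ip u (pd i F u) (pd j F u)) = 2"
    using gd by (simp add: sum_2 matrix_inv_G[OF u] ip_pd_pd[OF u] divide_simps) (simp add: gdet_def algebra_simps)
  have 3: "\<beta> * (\<Sum>i\<in>UNIV. \<Sum>j\<in>UNIV. matrix_inv (G u) $ i $ j * (\<eta> u (pd i F u) * \<eta> u (pd j F u))) = \<beta> * (1 - (\<eta> u (\<xi> u))\<^sup>2)"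
    unfolding axis_norm[OF u, symmetric]
    by (simp add: sum_2 matrix_inv_G[OF u] power2_eq_square add_divide_distrib diff_divide_distrib algebra_simps)
  have "ip u (bitension G H F u) (\<xi> u) = 2 * h *
    (- (\<Sum>i\<in>UNIV. \<Sum>j\<in>UNIV. matrix_inv (G u) $ i $ j * ip u (cov j \<xi> u) (cov i \<xi> u))
     + (\<kappa> + \<beta> * (\<eta> u (\<xi> u))\<^sup>2) * (\<Sum>i\<in>UNIV. \<Sum>j\<in>UNIV. matrix_inv (G u) $ i $ j * ip u (pd i F u) (pd j F u))
     + \<beta> * (\<Sum>i\<in>UNIV. \<Sum>j\<in>UNIV. matrix_inv (G u) $ i $ j * (\<eta> u (pd i F u) * \<eta> u (pd j F u))))"
    unfolding bitension_eq[OF u]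
    by (simp add: metric_ip_simps ip_cov_normal[OF u] n r sum_2 algebra_simps)
  then show ?thesis unfolding 1 2 3 by (simp add: algebra_simps)
qed

text \<open>The divergence of the second fundamental form and the curvature trace contribute the
  same amount, which is why the factor is 4 where \<open>bitension_normal\<close> has 2.\<close>

lemma bitension_tangent:
  assumes u: "u \<in> W"
  shows "ip u (bitension G H F u) (pd l F u) = 4 * h * \<beta> * \<eta> u (\<xi> u) * \<eta> u (pd l F u)"
proof -
  have gd: "gdet u \<noteq> 0" using g_pos(3)[OF u] by simp
  have r: "ip u (riemann H (F u) (pd i F u) (\<xi> u) (pd j F u)) (pd l F u) = \<beta> * \<eta> u (\<xi> u) *
    (\<eta> u (pd j F u) * ip u (pd i F u) (pd l F u) - \<eta> u (pd l F u) * ip u (pd i F u) (pd j F u))" for i j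
    by (simp add: curvature[OF map_into[OF u]] metric_ip_simps normal_orthogonal[OF u] normal_orthogonal'[OF u]
        normal_unit[OF u] \<eta>_def power2_eq_square algebra_simps)
  have 1: "ip u (cov i (cov j \<xi>) u - (\<Sum>k\<in>UNIV. \<Gamma> u k i j *\<^sub>R cov k \<xi> u)) (pd l F u) = N u i j l" for i j
    by (simp add: metric_ip_simps N_def b_def sum_2)
  have *: "ip u (bitension G H F u) (pd l F u) = 2 * h *
    ((\<Sum>i\<in>UNIV. \<Sum>j\<in>UNIV. matrix_inv (G u) $ i $ j * N u i j l)
     - (\<Sum>i\<in>UNIV. \<Sum>j\<in>UNIV. matrix_inv (G u) $ i $ j * (\<beta> * \<eta> u (\<xi> u) *
    (\<eta> u (pd j F u) * ip u (pd i F u) (pd l F u) - \<eta> u (pd l F u) * ip u (pd i F u) (pd j F u)))))"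
    unfolding bitension_eq[OF u] by (simp add: metric_ip_scaleR_left metric_ip_diff_left[of _ "sum _ _"] metric_ip_sum_left 1 r)
  define c where "c = \<beta> * \<eta> u (\<xi> u)"
  have l: "l = 1 \<or> l = 2" using exhaust_2 by blast
  have sy: "N u 1 2 1 = N u 1 1 2" "N u 2 2 1 = N u 2 1 2" by (rule N_sym[OF u])+
  have co: "N u 2 1 l - N u 1 2 l = c * (\<eta> u (pd 1 F u) * ip u (pd 2 F u) (pd l F u)
    - \<eta> u (pd 2 F u) * ip u (pd 1 F u) (pd l F u))" for l
    unfolding c_def by (rule codazzi[OF u])
  \<comment> \<open>The first index is exchanged with the last by \<open>codazzi\<close> and
    \<open>N_sym\<close>, after which \<open>trace_N\<close> applies; the right-hand side is the
    cost of the exchange.\<close>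
  have a: "g22 u * N u 1 1 l - g12 u * N u 1 2 l - g12 u * N u 2 1 l + g11 u * N u 2 2 l = c * \<eta> u (pd l F u) * gdet u"
  proof -
    have t: "g22 u * N u 1 1 1 = 2 * (g12 u * N u 1 1 2) - g11 u * N u 1 2 2"
      "g11 u * N u 2 2 2 = 2 * (g12 u * N u 2 1 2) - g22 u * N u 2 1 1"
      using trace_N[OF u, of 1] trace_N[OF u, of 2] by simp_all
    have c1: "N u 2 1 1 = N u 1 1 2 + c * (\<eta> u (pd 1 F u) * g12 u - \<eta> u (pd 2 F u) * g11 u)"
      and c2: "N u 2 1 2 = N u 1 2 2 + c * (\<eta> u (pd 1 F u) * g22 u - \<eta> u (pd 2 F u) * g12 u)"
      using co[of 1] co[of 2] sy by (simp_all add: ip_pd_pd[OF u])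
    show ?thesis
      using l by (elim disjE)
        (simp_all only: t sy, simp_all only: c1 c2 gdet_def, simp_all add: algebra_simps)
  qed
  have 2: "(\<Sum>i\<in>UNIV. \<Sum>j\<in>UNIV. matrix_inv (G u) $ i $ j * N u i j l) = c * \<eta> u (pd l F u)"
  proof -
    have "(\<Sum>i\<in>UNIV. \<Sum>j\<in>UNIV. matrix_inv (G u) $ i $ j * N u i j l) =
      (g22 u * N u 1 1 l - g12 u * N u 1 2 l - g12 u * N u 2 1 l + g11 u * N u 2 2 l) / gdet u"
      by (simp add: sum_2 matrix_inv_G[OF u] add_divide_distrib diff_divide_distrib)
    then show ?thesis using gd by (simp only: a) simp
  qed
  have e: "g22 u * (\<eta> u (pd 1 F u) * ip u (pd 1 F u) (pd l F u) - \<eta> u (pd l F u) * g11 u)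
     - g12 u * (\<eta> u (pd 2 F u) * ip u (pd 1 F u) (pd l F u) - \<eta> u (pd l F u) * g12 u)
     - g12 u * (\<eta> u (pd 1 F u) * ip u (pd 2 F u) (pd l F u) - \<eta> u (pd l F u) * g12 u)
     + g11 u * (\<eta> u (pd 2 F u) * ip u (pd 2 F u) (pd l F u) - \<eta> u (pd l F u) * g22 u) = - (\<eta> u (pd l F u) * gdet u)"
    using l unfolding gdet_def by (elim disjE) (simp_all add: ip_pd_pd[OF u] algebra_simps)
  have "(\<Sum>i\<in>UNIV. \<Sum>j\<in>UNIV. matrix_inv (G u) $ i $ j *
    (\<eta> u (pd j F u) * ip u (pd i F u) (pd l F u) - \<eta> u (pd l F u) * ip u (pd i F u) (pd j F u))) =
    (g22 u * (\<eta> u (pd 1 F u) * ip u (pd 1 F u) (pd l F u) - \<eta> u (pd l F u) * g11 u)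
     - g12 u * (\<eta> u (pd 2 F u) * ip u (pd 1 F u) (pd l F u) - \<eta> u (pd l F u) * g12 u)
     - g12 u * (\<eta> u (pd 1 F u) * ip u (pd 2 F u) (pd l F u) - \<eta> u (pd l F u) * g12 u)
     + g11 u * (\<eta> u (pd 2 F u) * ip u (pd 2 F u) (pd l F u) - \<eta> u (pd l F u) * g22 u)) / gdet u"
    unfolding sum_2 matrix_inv_G[OF u] ip_pd_pd[OF u] add_divide_distrib diff_divide_distrib by simp
  also have "\<dots> = - \<eta> u (pd l F u)" using gd by (simp only: e) simp
  finally have 3: "(\<Sum>i\<in>UNIV. \<Sum>j\<in>UNIV. matrix_inv (G u) $ i $ j * (c *
    (\<eta> u (pd j F u) * ip u (pd i F u) (pd l F u) - \<eta> u (pd l F u) * ip u (pd i F u) (pd j F u)))) = c * - \<eta> u (pd l F u)"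
    by (simp add: mult.left_commute[of _ c] flip: sum_distrib_left)
  show ?thesis unfolding * 2 3[unfolded c_def] by (simp add: c_def)
qed

lemma bitension_zero_iff:
  assumes u: "u \<in> W" and h: "h \<noteq> 0"
  shows "bitension G H F u = 0 \<longleftrightarrow>
    shape_norm2 u = 2 * \<kappa> + \<beta> + \<beta> * (\<eta> u (\<xi> u))\<^sup>2 \<and> (\<forall>l. \<beta> * \<eta> u (\<xi> u) * \<eta> u (pd l F u) = 0)"
proof -
  have "bitension G H F u = 0 \<longleftrightarrow>
    ip u (bitension G H F u) (\<xi> u) = 0 \<and> (\<forall>l. ip u (bitension G H F u) (pd l F u) = 0)"
    using frame_zero[OF u] by auto
  then show ?thesis
    unfolding bitension_normal[OF u] bitension_tangent[OF u] using h by auto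
qed

end

section \<open>Principal curvatures: umbilic points and pointwise inequalities\<close>

context surface_patch begin

text \<open>For an operator in dimension two, the trace of the square is the squared trace minus
  twice the determinant.\<close>

lemma shape_norm2_eq:
  assumes "u \<in> W"
  shows "shape_norm2 u = (2 * mean_curvature G H F \<xi> u)\<^sup>2 - 2 * (b u 1 1 * b u 2 2 - (b u 1 2)\<^sup>2) / gdet u"
proof -
  have gd: "gdet u \<noteq> 0" using g_pos(3)[OF assms] by simp
  have key: "x = (t / d)\<^sup>2 - 2 * e / d" if "x * d\<^sup>2 = t\<^sup>2 - 2 * d * e" "d \<noteq> 0" for x t d e :: real
    using that by (simp add: field_simps power2_eq_square)
  have "shape_norm2 u * (gdet u)\<^sup>2 =
    (g22 u * b u 1 1 - 2 * g12 u * b u 1 2 + g11 u * b u 2 2)\<^sup>2 - 2 * gdet u * (b u 1 1 * b u 2 2 - (b u 1 2)\<^sup>2)"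
    unfolding shape_norm2_def using gd by (simp add: power2_eq_square) (simp add: gdet_def algebra_simps)
  then have "shape_norm2 u = ((g22 u * b u 1 1 - 2 * g12 u * b u 1 2 + g11 u * b u 2 2) / gdet u)\<^sup>2
      - 2 * (b u 1 1 * b u 2 2 - (b u 1 2)\<^sup>2) / gdet u"
    using key[OF _ gd] by blast
  moreover have "2 * (x / (2 * y)) = x / y" for x y :: real by simp
  ultimately show ?thesis by (simp only: mean_curvature_eq[OF assms])
qed

text \<open>The inner factor on the left is \<open>(gdet u)\<^sup>2\<close> times the squared
  difference of the principal curvatures. Multiplying by \<open>(g11 u)\<^sup>2\<close> completes
  the square: the right side consists of two nonnegative terms that vanish together only if
  \<open>b\<close> is proportional to the metric.\<close>

lemma discriminant:
  assumes "u \<in> W"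
  shows "(g11 u)\<^sup>2 * (2 * (gdet u)\<^sup>2 * (shape_norm2 u - 2 * (mean_curvature G H F \<xi> u)\<^sup>2)) =
    (g11 u * (g11 u * b u 2 2 - g22 u * b u 1 1) - 2 * g12 u * (g11 u * b u 1 2 - g12 u * b u 1 1))\<^sup>2
    + 4 * gdet u * (g11 u * b u 1 2 - g12 u * b u 1 1)\<^sup>2"
proof -
  have gd: "gdet u \<noteq> 0" using g_pos(3)[OF assms] by simp
  define t where "t = g22 u * b u 1 1 - 2 * g12 u * b u 1 2 + g11 u * b u 2 2"
  define e where "e = b u 1 1 * b u 2 2 - (b u 1 2)\<^sup>2"
  have m: "2 * mean_curvature G H F \<xi> u * gdet u = t"
    using gd by (simp add: mean_curvature_eq[OF assms] t_def)
  have "2 * (gdet u)\<^sup>2 * (shape_norm2 u - 2 * (mean_curvature G H F \<xi> u)\<^sup>2) =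
     (2 * mean_curvature G H F \<xi> u * gdet u)\<^sup>2 - 4 * gdet u * e"
    unfolding shape_norm2_eq[OF assms] e_def[symmetric] using gd by (simp add: field_simps power2_eq_square)
  then have *: "2 * (gdet u)\<^sup>2 * (shape_norm2 u - 2 * (mean_curvature G H F \<xi> u)\<^sup>2) = t\<^sup>2 - 4 * gdet u * e"
    unfolding m .
  show ?thesis unfolding * unfolding t_def e_def gdet_def by (simp add: power2_eq_square algebra_simps)
qed

lemma shape_norm2_ge:
  assumes "u \<in> W"
  shows "shape_norm2 u \<ge> 2 * (mean_curvature G H F \<xi> u)\<^sup>2"
proof -
  have "0 \<le> (g11 u)\<^sup>2 * (2 * (gdet u)\<^sup>2 * (shape_norm2 u - 2 * (mean_curvature G H F \<xi> u)\<^sup>2))"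
    unfolding discriminant[OF assms] using g_pos(3)[OF assms] by simp
  then show ?thesis using g_pos[OF assms] by (simp add: zero_le_mult_iff)
qed

lemma umbilic:
  assumes u: "u \<in> W" and "shape_norm2 u = 2 * (mean_curvature G H F \<xi> u)\<^sup>2"
  shows "b u i j = mean_curvature G H F \<xi> u * ip u (pd i F u) (pd j F u)"
proof -
  let ?x = "g11 u * b u 1 2 - g12 u * b u 1 1" and ?y = "g11 u * b u 2 2 - g22 u * b u 1 1"
  have gp: "g11 u > 0" "gdet u > 0" using g_pos[OF u] by auto
  have "(g11 u * ?y - 2 * g12 u * ?x)\<^sup>2 + 4 * gdet u * ?x\<^sup>2 = 0"
    unfolding discriminant[OF u, symmetric] using assms(2) by simp
  moreover have "4 * gdet u * ?x\<^sup>2 \<ge> 0" using gp by simp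
  ultimately have "4 * gdet u * ?x\<^sup>2 = 0" "(g11 u * ?y - 2 * g12 u * ?x)\<^sup>2 = 0"
    by (smt (verit) zero_le_power2)+
  then have x: "?x = 0" and y: "?y = 0" using gp by auto
  define s where "s = b u 1 1 / g11 u"
  have b: "b u 1 1 = s * g11 u" "b u 1 2 = s * g12 u" "b u 2 2 = s * g22 u"
    using x y gp by (simp_all add: s_def field_simps)
  have "mean_curvature G H F \<xi> u = s * (2 * gdet u) / (2 * gdet u)"
    unfolding mean_curvature_eq[OF u] b by (simp add: gdet_def algebra_simps)
  then have "mean_curvature G H F \<xi> u = s" using gp by simp
  moreover have "b u 2 1 = b u 1 2" by (rule b_sym[OF u])
  moreover have "(i = 1 \<or> i = 2) \<and> (j = 1 \<or> j = 2)" using exhaust_2 by blast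
  ultimately show ?thesis using b by (auto simp: ip_pd_pd[OF u])
qed

text \<open>Completing the square shows that the tangential part of the axis has nonnegative squared
  length; \<open>\<beta> > 0\<close> allows the factor in \<open>axis_norm\<close> to be
  cancelled.\<close>

lemma axis_normal_le:
  assumes u: "u \<in> W" and "\<beta> > 0"
  shows "(\<eta> u (\<xi> u))\<^sup>2 \<le> 1"
proof -
  let ?x = "\<eta> u (pd 1 F u)" and ?y = "\<eta> u (pd 2 F u)"
  have gp: "g11 u > 0" "gdet u > 0" using g_pos[OF u] by auto
  let ?q = "g22 u * ?x\<^sup>2 - 2 * g12 u * ?x * ?y + g11 u * ?y\<^sup>2"
  have "g11 u * ?q = (g11 u * ?y - g12 u * ?x)\<^sup>2 + gdet u * ?x\<^sup>2"
    by (simp add: gdet_def power2_eq_square algebra_simps)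
  then have "g11 u * ?q \<ge> 0" using gp by simp
  then have "?q \<ge> 0" using gp by (simp add: zero_le_mult_iff)
  then have "?q / gdet u \<ge> 0" using gp by simp
  moreover have "?q / gdet u = 1 - (\<eta> u (\<xi> u))\<^sup>2"
    using axis_norm[OF u] \<open>\<beta> > 0\<close> mult_left_cancel by (metis less_irrefl)
  ultimately show ?thesis by simp
qed

end

context cmc_patch begin

lemma not_biharmonic:
  assumes "u \<in> W" "h \<noteq> 0" "2 * \<kappa> + \<beta> + \<beta> * (\<eta> u (\<xi> u))\<^sup>2 \<le> 0"
  shows "bitension G H F u \<noteq> 0"
proof
  assume "bitension G H F u = 0"
  then have "shape_norm2 u \<le> 0" using assms bitension_zero_iff by simp
  moreover have "2 * h\<^sup>2 \<le> shape_norm2 u"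
    using shape_norm2_ge[OF assms(1)] mean_curvature_const[OF assms(1)] by simp
  moreover have "h\<^sup>2 > 0" using assms(2) by simp
  ultimately show False by linarith
qed

end

text \<open>Only the absolute value of the mean curvature is prescribed; reversing the normal makes
  the mean curvature itself nonnegative.\<close>

lemma surface_patch_flip:
  assumes "surface_patch D H \<kappa> \<beta> E W F G \<xi>"
  shows "surface_patch D H \<kappa> \<beta> E W F G (\<lambda>u. - \<xi> u)"
    and "u \<in> W \<Longrightarrow> mean_curvature G H F (\<lambda>u. - \<xi> u) u = - mean_curvature G H F \<xi> u"
proof -
  interpret surface_patch D H \<kappa> \<beta> E W F G \<xi> by fact
  have "smooth_on (\<lambda>u. - \<xi> u) W"
    using smooth_on_bounded_linear[OF bounded_linear_minus[OF bounded_linear_ident] open_source normal_smooth] .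
  then show "surface_patch D H \<kappa> \<beta> E W F G (\<lambda>u. - \<xi> u)"
    by unfold_locales (simp_all add: first_form first_form_positive normal_unit normal_orthogonal metric_ip_simps)
  assume u: "u \<in> W"
  show "mean_curvature G H F (\<lambda>u. - \<xi> u) u = - mean_curvature G H F \<xi> u"
    using cov_scaleR[OF normal_differentiable[OF u], of _ "-1"]
    by (simp add: mean_curvature_def metric_ip_simps sum_2) (simp add: field_simps)
qed

lemma not_in_span_of_two:
  fixes v w :: "real^3"
  shows "\<exists>x. x \<notin> span {v, w}"
proof (rule ccontr)
  assume "\<not> (\<exists>x. x \<notin> span {v, w})"
  then have "span {v, w} = UNIV" by auto
  then have "dim (UNIV :: (real^3) set) \<le> card {v, w}" by (metis dim_le_card' dim_span finite.emptyI finite_insert)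
  also have "\<dots> \<le> 2" by (simp add: card_insert_if)
  finally show False by simp
qed

text \<open>Orthogonalisation of a fixed vector \<open>v\<close> that is transversal to the surface
  at \<open>p\<close>. By continuity it stays transversal nearby, so small balls carry a smooth unit
  normal without any question of orientation.\<close>

lemma unit_normal_exists:
  assumes "geometry_domain D H \<kappa> \<beta> E" "riemannian_map D H W (F :: real^2 \<Rightarrow> real^3)"
    and G: "\<And>u i j. u \<in> W \<Longrightarrow> G u $ i $ j = metric_ip (H (F u)) (pd i F u) (pd j F u)"
    and pos: "\<And>u v. u \<in> W \<Longrightarrow> v \<noteq> 0 \<Longrightarrow> metric_ip (G u) v v > 0"
    and p: "p \<in> W"
  obtains r \<xi> where "r > 0" "ball p r \<subseteq> W" "surface_patch D H \<kappa> \<beta> E (ball p r) F G \<xi>"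
proof -
  interpret geometry_domain D H \<kappa> \<beta> E by fact
  interpret riemannian_map D H W F by fact
  obtain v where v: "v \<notin> span {pd 1 F p, pd 2 F p}" using not_in_span_of_two by blast
  define d where "d u = ip u (pd 1 F u) (pd 1 F u) * ip u (pd 2 F u) (pd 2 F u)
    - ip u (pd 1 F u) (pd 2 F u) * ip u (pd 1 F u) (pd 2 F u)" for u
  define a where "a u i = ip u v (pd i F u)" for u i
  \<comment> \<open>The Gram determinant times the normal part of \<open>v\<close>; the factor
    avoids a division.\<close>
  define \<nu> where "\<nu> u = d u *\<^sub>R v
    - (ip u (pd 2 F u) (pd 2 F u) * a u 1 - ip u (pd 1 F u) (pd 2 F u) * a u 2) *\<^sub>R pd 1 F u
    - (ip u (pd 1 F u) (pd 1 F u) * a u 2 - ip u (pd 1 F u) (pd 2 F u) * a u 1) *\<^sub>R pd 2 F u" for u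
  define q where "q u = ip u (\<nu> u) (\<nu> u)" for u
  have ips: "smooth_on (\<lambda>u. ip u (V u) (Y u)) W" if "smooth_on V W" "smooth_on Y W" for V Y
    unfolding metric_ip_def
    by (intro smooth_on_sum smooth_on_mult smooth_on_nth open_source that
        smooth_on_compose[OF metric_smooth map_smooth open_source open_domain]) (use map_into in auto)
  have ds: "smooth_on d W" and as: "smooth_on (\<lambda>u. a u i) W" for i
    unfolding d_def a_def
    by (intro smooth_on_diff smooth_on_mult ips pd_map_smooth open_source smooth_on_const)+
  have \<nu>s: "smooth_on \<nu> W"
    unfolding \<nu>_def
    by (intro smooth_on_diff smooth_on_scaleR smooth_on_mult ips ds as pd_map_smooth open_source smooth_on_const)
  have qs: "smooth_on q W" unfolding q_def by (intro ips \<nu>s)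
  have orth: "ip u (\<nu> u) (pd i F u) = 0" if u: "u \<in> W" for u i
  proof -
    have "i = 1 \<or> i = 2" using exhaust_2 by blast
    then show ?thesis
      by (elim disjE) (simp_all add: \<nu>_def metric_ip_simps a_def d_def ip_commute[OF u, of "pd 2 F u" "pd 1 F u"] algebra_simps)
  qed
  have dp: "d p > 0"
  proof -
    have "transpose (G p) = G p"
      unfolding transpose_eq_iff using G[OF p] ip_commute[OF p] by simp
    then show ?thesis using posdef_2(3)[of "G p", OF _ pos[OF p]] by (simp add: d_def G[OF p])
  qed
  have "\<nu> p \<noteq> 0"
  proof
    assume "\<nu> p = 0"
    then have "d p *\<^sub>R v = (ip p (pd 2 F p) (pd 2 F p) * a p 1 - ip p (pd 1 F p) (pd 2 F p) * a p 2) *\<^sub>R pd 1 F p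
      + (ip p (pd 1 F p) (pd 1 F p) * a p 2 - ip p (pd 1 F p) (pd 2 F p) * a p 1) *\<^sub>R pd 2 F p" (is "_ = ?r")
      by (simp add: \<nu>_def algebra_simps)
    moreover have "?r \<in> span {pd 1 F p, pd 2 F p}"
      by (intro span_add span_scale span_base) auto
    ultimately have "(1 / d p) *\<^sub>R (d p *\<^sub>R v) \<in> span {pd 1 F p, pd 2 F p}" by (metis span_scale)
    then show False using v dp by simp
  qed
  then have qp: "q p > 0" unfolding q_def by (rule metric_positive[OF map_into[OF p]])
  have "open {u \<in> W. q u > 0}"
    using continuous_open_preimage[OF smooth_on_continuous_on[OF qs] open_source, of "{0<..}"]
    by (simp add: vimage_def Int_def)
  then obtain r where r: "r > 0" "ball p r \<subseteq> {u \<in> W. q u > 0}"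
    using p qp open_contains_ball by blast
  then have rW: "ball p r \<subseteq> W" and rq: "u \<in> ball p r \<Longrightarrow> q u > 0" for u by auto
  \<comment> \<open>The exponent -1/2 replaces the division by a square root, since smoothness is
    available for \<open>powr\<close> on positive functions.\<close>
  define \<xi> where "\<xi> u = (q u powr (-1/2)) *\<^sub>R \<nu> u" for u
  have "surface_patch D H \<kappa> \<beta> E (ball p r) F G \<xi>"
  proof unfold_locales
    show "open (ball p r)" by simp
    show "smooth_on F (ball p r)" using smooth_on_subset[OF map_smooth open_source _ rW] by simp
    show "smooth_on \<xi> (ball p r)"
      unfolding \<xi>_def
      by (intro smooth_on_scaleR smooth_on_powr smooth_on_subset[OF qs open_source _ rW]
          smooth_on_subset[OF \<nu>s open_source _ rW] rq) auto
    fix u assume u: "u \<in> ball p r"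
    then have uW: "u \<in> W" using rW by auto
    show "F u \<in> D" using map_into[OF uW] .
    show "G u $ i $ j = ip u (pd i F u) (pd j F u)" for i j by (rule G[OF uW])
    show "metric_ip (G u) v v > 0" if "v \<noteq> 0" for v by (rule pos[OF uW that])
    show "ip u (\<xi> u) (pd i F u) = 0" for i by (simp add: \<xi>_def metric_ip_simps orth[OF uW])
    have "ip u (\<xi> u) (\<xi> u) = (q u powr (-1/2) * q u powr (-1/2)) * q u"
      by (simp add: \<xi>_def metric_ip_simps q_def)
    also have "\<dots> = 1" using rq[OF u] by (simp add: powr_minus field_simps flip: powr_add)
    finally show "ip u (\<xi> u) (\<xi> u) = 1" .
  qed
  then show ?thesis using r rW that by blast
qed

section \<open>Curvature of the eight geometries\<close>

lemma smooth_on_inverse: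
  fixes f :: "'a::euclidean_space \<Rightarrow> real"
  assumes "open S" "smooth_on f S" "\<And>x. x \<in> S \<Longrightarrow> f x > 0"
  shows "smooth_on (\<lambda>x. 1 / f x) S"
  by (rule smooth_on_cong[OF assms(1) smooth_on_powr[OF assms, of "-1"]])
    (use assms(3) in \<open>auto simp: powr_minus_divide less_imp_le\<close>)

lemma smooth_on_coord: "open S \<Longrightarrow> smooth_on (\<lambda>x. x $ i) S"
  by (rule smooth_on_linear[OF bounded_linear_vec_nth])

lemma smooth_on_exp:
  fixes f :: "'a::euclidean_space \<Rightarrow> real"
  assumes "open S" "smooth_on f S"
  shows "smooth_on (\<lambda>x. exp (f x)) S"
proof -
  have "Ck_on k (\<lambda>x. c * exp x) UNIV" for k and c :: real
  proof (induction k arbitrary: c)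
    case 0
    then show ?case by (auto intro!: continuous_intros)
  next
    case (Suc k)
    have d: "((\<lambda>x. c * exp x) has_derivative (\<lambda>v. (c * v) * exp x)) (at x)" for x
      by (auto intro!: derivative_eq_intros)
    have "(\<lambda>x. c * exp x) differentiable_on UNIV"
      using d by (auto simp: differentiable_on_def differentiable_def)
    then show ?case using Suc by (simp flip: frechet_derivative_at[OF d])
  qed
  from this[of _ 1] have "smooth_on (exp :: real \<Rightarrow> real) UNIV" by (simp add: smooth_on_def)
  from smooth_on_compose[OF this assms(2,1)] show ?thesis by simp
qed

lemma pd_reciprocal:
  fixes g :: "real^'n::finite \<Rightarrow> real"
  assumes "g differentiable (at u)" "g u \<noteq> 0"
  shows "pd i (\<lambda>x. 1 / g x) u = - pd i g u / (g u)\<^sup>2"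
    and "(\<lambda>x. 1 / g x) differentiable (at u)"
proof -
  have "((\<lambda>x. 1 / x) has_field_derivative - (1 / (g u)\<^sup>2)) (at (g u))"
    using assms(2) by (auto intro!: derivative_eq_intros simp: power2_eq_square)
  from pd_compose_real[OF assms(1) this] show "pd i (\<lambda>x. 1 / g x) u = - pd i g u / (g u)\<^sup>2" by simp
  show "(\<lambda>x. 1 / g x) differentiable (at u)"
    using assms by (intro differentiable_divide) auto
qed

lemma differentiable_if: "f differentiable F \<Longrightarrow> (\<lambda>x. if P then f x else 0) differentiable F"
  by (cases P) auto

text \<open>Both sides are linear in \<open>X\<close>, \<open>Y\<close> and \<open>Z\<close>, so a
  comparison on coordinate vectors suffices; \<open>R\<close> states it for the coefficients that
  occur in \<open>riemann\<close>.\<close>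

lemma curvature_from_components:
  fixes H :: "real^3 \<Rightarrow> real^3^3"
  assumes sym: "transpose (H x) = H x"
    and R: "\<And>a b c d. pd a (\<lambda>y. christoffel H y d b c) x - pd b (\<lambda>y. christoffel H y d a c) x
      + (\<Sum>e\<in>UNIV. christoffel H x d a e * christoffel H x e b c - christoffel H x d b e * christoffel H x e a c)
      = \<kappa> * ((if d = a then H x $ b $ c else 0) - (if d = b then H x $ a $ c else 0))
      + \<beta> * ((if d = a then (H x *v E) $ b * (H x *v E) $ c else 0) - (if d = b then (H x *v E) $ a * (H x *v E) $ c else 0)
       + H x $ b $ c * (H x *v E) $ a * E $ d - H x $ a $ c * (H x *v E) $ b * E $ d)"
  shows "riemann H x X Y Z =
      \<kappa> *\<^sub>R (metric_ip (H x) Y Z *\<^sub>R X - metric_ip (H x) X Z *\<^sub>R Y)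
      + \<beta> *\<^sub>R ((metric_ip (H x) E Y * metric_ip (H x) E Z) *\<^sub>R X
          - (metric_ip (H x) E X * metric_ip (H x) E Z) *\<^sub>R Y
          + (metric_ip (H x) Y Z * metric_ip (H x) E X) *\<^sub>R E
          - (metric_ip (H x) X Z * metric_ip (H x) E Y) *\<^sub>R E)"
proof (subst vec_eq_iff, rule allI)
  fix d :: 3
  let ?h = "H x *v E"
  have \<eta>: "metric_ip (H x) E v = (\<Sum>a\<in>UNIV. ?h $ a * v $ a)" for v
    by (subst metric_ip_commute[OF sym]) (simp add: metric_ip_inner inner_vec_def mult.commute)
  have 1: "(\<Sum>a\<in>UNIV. \<Sum>b\<in>UNIV. \<Sum>c\<in>UNIV. X $ a * Y $ b * Z $ c * (if d = a then H x $ b $ c else 0)) = metric_ip (H x) Y Z * X $ d"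
    unfolding metric_ip_def using exhaust_3[of d] by (auto simp: sum_3 algebra_simps)
  have 2: "(\<Sum>a\<in>UNIV. \<Sum>b\<in>UNIV. \<Sum>c\<in>UNIV. X $ a * Y $ b * Z $ c * (if d = b then H x $ a $ c else 0)) = metric_ip (H x) X Z * Y $ d"
    unfolding metric_ip_def using exhaust_3[of d] by (auto simp: sum_3 algebra_simps)
  have 3: "(\<Sum>a\<in>UNIV. \<Sum>b\<in>UNIV. \<Sum>c\<in>UNIV. X $ a * Y $ b * Z $ c * (if d = a then ?h $ b * ?h $ c else 0)) =
      metric_ip (H x) E Y * metric_ip (H x) E Z * X $ d"
    unfolding \<eta> using exhaust_3[of d] by (auto simp: sum_3 algebra_simps)
  have 4: "(\<Sum>a\<in>UNIV. \<Sum>b\<in>UNIV. \<Sum>c\<in>UNIV. X $ a * Y $ b * Z $ c * (if d = b then ?h $ a * ?h $ c else 0)) =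
      metric_ip (H x) E X * metric_ip (H x) E Z * Y $ d"
    unfolding \<eta> using exhaust_3[of d] by (auto simp: sum_3 algebra_simps)
  have 5: "(\<Sum>a\<in>UNIV. \<Sum>b\<in>UNIV. \<Sum>c\<in>UNIV. X $ a * Y $ b * Z $ c * (H x $ b $ c * ?h $ a * E $ d)) =
      metric_ip (H x) Y Z * metric_ip (H x) E X * E $ d"
    unfolding \<eta> metric_ip_def[of "H x" Y Z] by (simp add: sum_3 algebra_simps)
  have 6: "(\<Sum>a\<in>UNIV. \<Sum>b\<in>UNIV. \<Sum>c\<in>UNIV. X $ a * Y $ b * Z $ c * (H x $ a $ c * ?h $ b * E $ d)) =
      metric_ip (H x) X Z * metric_ip (H x) E Y * E $ d"
    unfolding \<eta> metric_ip_def[of "H x" X Z] by (simp add: sum_3 algebra_simps)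
  have "riemann H x X Y Z $ d = \<kappa> * ((\<Sum>a\<in>UNIV. \<Sum>b\<in>UNIV. \<Sum>c\<in>UNIV. X $ a * Y $ b * Z $ c * (if d = a then H x $ b $ c else 0))
       - (\<Sum>a\<in>UNIV. \<Sum>b\<in>UNIV. \<Sum>c\<in>UNIV. X $ a * Y $ b * Z $ c * (if d = b then H x $ a $ c else 0)))
     + \<beta> * ((\<Sum>a\<in>UNIV. \<Sum>b\<in>UNIV. \<Sum>c\<in>UNIV. X $ a * Y $ b * Z $ c * (if d = a then ?h $ b * ?h $ c else 0))
       - (\<Sum>a\<in>UNIV. \<Sum>b\<in>UNIV. \<Sum>c\<in>UNIV. X $ a * Y $ b * Z $ c * (if d = b then ?h $ a * ?h $ c else 0))
       + (\<Sum>a\<in>UNIV. \<Sum>b\<in>UNIV. \<Sum>c\<in>UNIV. X $ a * Y $ b * Z $ c * (H x $ b $ c * ?h $ a * E $ d))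
       - (\<Sum>a\<in>UNIV. \<Sum>b\<in>UNIV. \<Sum>c\<in>UNIV. X $ a * Y $ b * Z $ c * (H x $ a $ c * ?h $ b * E $ d)))"
    unfolding riemann_def vec_lambda_beta R
    by (simp only: sum_distrib_left flip: sum.distrib sum_subtractf) (intro sum.cong refl, simp only: ring_distribs mult.left_commute)
  then show "riemann H x X Y Z $ d = (\<kappa> *\<^sub>R (metric_ip (H x) Y Z *\<^sub>R X - metric_ip (H x) X Z *\<^sub>R Y)
      + \<beta> *\<^sub>R ((metric_ip (H x) E Y * metric_ip (H x) E Z) *\<^sub>R X
          - (metric_ip (H x) E X * metric_ip (H x) E Z) *\<^sub>R Y
          + (metric_ip (H x) Y Z * metric_ip (H x) E X) *\<^sub>R E
          - (metric_ip (H x) X Z * metric_ip (H x) E Y) *\<^sub>R E)) $ d"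
    unfolding 1 2 3 4 5 6 by simp
qed

text \<open>The symbols \<open>C\<close> are guessed and then justified by \<open>koszul\<close>.
  Antisymmetry in \<open>a\<close> and \<open>b\<close> leaves three index pairs for the curvature
  identity.\<close>

lemma geometry_domainI:
  fixes H :: "real^3 \<Rightarrow> real^3^3" and C :: "real^3 \<Rightarrow> 3 \<Rightarrow> 3 \<Rightarrow> 3 \<Rightarrow> real"
  assumes "open D"
    and sym: "\<And>x. x \<in> D \<Longrightarrow> transpose (H x) = H x"
    and pos: "\<And>x v. x \<in> D \<Longrightarrow> v \<noteq> 0 \<Longrightarrow> metric_ip (H x) v v > 0"
    and smooth: "\<And>i j. smooth_on (\<lambda>y. H y $ i $ j) D"
    and koszul: "\<And>x i j l. x \<in> D \<Longrightarrow> (\<Sum>k\<in>UNIV. H x $ l $ k * C x k i j) =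
      (pd i (\<lambda>y. H y $ j $ l) x + pd j (\<lambda>y. H y $ i $ l) x - pd l (\<lambda>y. H y $ i $ j) x) / 2"
    and diff: "\<And>x k i j. x \<in> D \<Longrightarrow> (\<lambda>y. C y k i j) differentiable (at x)"
    and R: "\<And>x a b c d. x \<in> D \<Longrightarrow> (a, b) \<in> {(1, 2), (1, 3), (2, 3)} \<Longrightarrow>
      pd a (\<lambda>y. C y d b c) x - pd b (\<lambda>y. C y d a c) x
      + (\<Sum>e\<in>UNIV. C x d a e * C x e b c - C x d b e * C x e a c)
      = \<kappa> * ((if d = a then H x $ b $ c else 0) - (if d = b then H x $ a $ c else 0))
      + \<beta> * ((if d = a then (H x *v E x) $ b * (H x *v E x) $ c else 0) - (if d = b then (H x *v E x) $ a * (H x *v E x) $ c else 0)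
       + H x $ b $ c * (H x *v E x) $ a * E x $ d - H x $ a $ c * (H x *v E x) $ b * E x $ d)"
    and unit: "\<And>x. x \<in> D \<Longrightarrow> \<beta> * metric_ip (H x) (E x) (E x) = \<beta>"
  shows "geometry_domain D H \<kappa> \<beta> E"
proof -
  have C: "christoffel H x k i j = C x k i j" if "x \<in> D" for x k i j
    by (rule christoffel_eqI) (use pos[OF that] koszul[OF that] in auto)
  have C': "pd a (\<lambda>y. christoffel H y d b c) x = pd a (\<lambda>y. C y d b c) x" if "x \<in> D" for x a b c d
    by (rule pd_cong_open[OF assms(1) that]) (rule C)
  have R': "pd a (\<lambda>y. C y d b c) x - pd b (\<lambda>y. C y d a c) x
      + (\<Sum>e\<in>UNIV. C x d a e * C x e b c - C x d b e * C x e a c)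
      = \<kappa> * ((if d = a then H x $ b $ c else 0) - (if d = b then H x $ a $ c else 0))
      + \<beta> * ((if d = a then (H x *v E x) $ b * (H x *v E x) $ c else 0) - (if d = b then (H x *v E x) $ a * (H x *v E x) $ c else 0)
       + H x $ b $ c * (H x *v E x) $ a * E x $ d - H x $ a $ c * (H x *v E x) $ b * E x $ d)" (is "?L a b = ?R a b")
    if x: "x \<in> D" for x a b c d
  proof -
    have L: "?L a b = - ?L b a" for a b by (simp add: sum_subtractf)
    have R: "?R a b = - ?R b a" for a b by (simp add: algebra_simps)
    consider "a = b" | "(a, b) \<in> {(1, 2), (1, 3), (2, 3)}" | "(b, a) \<in> {(1, 2), (1, 3), (2, 3)}"
      using exhaust_3[of a] exhaust_3[of b] by auto
    then show ?thesis
    proof cases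
      case 1
      then show ?thesis using L[of b b] R[of b b] by simp
    next
      case 2
      then show ?thesis by (rule assms(7)[OF x])
    next
      case 3
      then show ?thesis using assms(7)[OF x 3, of d c] L[of a b] R[of a b] by simp
    qed
  qed
  show ?thesis
  proof unfold_locales
    fix x i j k X Y Z assume x: "x \<in> D"
    show "(\<lambda>y. H y $ i $ j) differentiable at x"
      by (rule smooth_on_differentiable[OF smooth assms(1) x])
    show "(\<lambda>y. christoffel H y k i j) differentiable at x"
      by (rule differentiable_cong_open[OF assms(1) x _ diff[OF x]]) (simp add: C)
    show "riemann H x X Y Z =
      \<kappa> *\<^sub>R (metric_ip (H x) Y Z *\<^sub>R X - metric_ip (H x) X Z *\<^sub>R Y)
      + \<beta> *\<^sub>R ((metric_ip (H x) (E x) Y * metric_ip (H x) (E x) Z) *\<^sub>R X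
          - (metric_ip (H x) (E x) X * metric_ip (H x) (E x) Z) *\<^sub>R Y
          + (metric_ip (H x) Y Z * metric_ip (H x) (E x) X) *\<^sub>R E x
          - (metric_ip (H x) X Z * metric_ip (H x) (E x) Y) *\<^sub>R E x)"
      by (rule curvature_from_components[of H x, OF sym[OF x]]) (simp only: C[OF x] C'[OF x] R'[OF x])
  qed (use assms in auto)
qed

text \<open>If f = exp (2 s), then \<open>\<phi> i\<close> is the i-th partial derivative of s, and
  \<open>C\<close> below is the standard formula for the symbols of a conformally flat metric. The
  Hessian equation \<open>eq\<close> expresses constant curvature \<open>\<kappa>\<close>.\<close>

lemma geometry_domain_conformal:
  fixes \<phi> :: "3 \<Rightarrow> real^3 \<Rightarrow> real"
  assumes D: "open D" and f: "smooth_on f D" "\<And>x. x \<in> D \<Longrightarrow> f x > 0"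
    and H: "\<And>x. H x = f x *\<^sub>R mat 1"
    and df: "\<And>x i. x \<in> D \<Longrightarrow> pd i f x = 2 * f x * \<phi> i x"
    and d\<phi>: "\<And>x i. x \<in> D \<Longrightarrow> \<phi> i differentiable (at x)"
    and eq: "\<And>x a b. x \<in> D \<Longrightarrow> pd a (\<phi> b) x = \<phi> a x * \<phi> b x
      - (if a = b then ((\<phi> 1 x)\<^sup>2 + (\<phi> 2 x)\<^sup>2 + (\<phi> 3 x)\<^sup>2 + \<kappa> * f x) / 2 else 0)"
  shows "geometry_domain D H \<kappa> 0 (\<lambda>_. 0)"
proof (rule geometry_domainI[OF D])
  have Hij: "H y $ i $ j = (if i = j then f y else 0)" for y i j
    by (simp add: H mat_def)
  define C where "C x k i j = (if k = i then \<phi> j x else 0) + (if k = j then \<phi> i x else 0)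
    - (if i = j then \<phi> k x else 0)" for x k i j
  fix x i j k l assume x: "x \<in> D"
  show "transpose (H x) = H x" by (simp add: transpose_eq_iff Hij)
  have "metric_ip (H x) v v = f x * (v \<bullet> v)" for v
    by (simp add: metric_ip_inner H flip: scaleR_matrix_vector_assoc)
  then show "metric_ip (H x) v v > 0" if "v \<noteq> 0" for v using that f(2)[OF x] by simp
  show "(\<Sum>k\<in>UNIV. H x $ l $ k * C x k i j) =
      (pd i (\<lambda>y. H y $ j $ l) x + pd j (\<lambda>y. H y $ i $ l) x - pd l (\<lambda>y. H y $ i $ j) x) / 2"
  proof -
    have 1: "pd l (\<lambda>y. if i = j then f y else 0) x = (if i = j then pd l f x else 0)" for l i j :: 3 by auto
    have 2: "(\<Sum>k\<in>UNIV. (if l = k then f x else 0) * C x k i j) = f x * C x l i j"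
      by (simp add: if_distrib[of "\<lambda>z. z * _"] cong: if_cong)
    show ?thesis unfolding Hij 1 2 by (auto simp: C_def df[OF x] field_simps)
  qed
  show "(\<lambda>y. C y k i j) differentiable at x"
    unfolding C_def by (intro differentiable_add differentiable_diff differentiable_if d\<phi>[OF x])
  fix a b c d :: 3 assume ab: "(a, b) \<in> {(1, 2), (1, 3), (2, 3)}"
  have pC: "pd a (\<lambda>y. C y k i j) x = (if k = i then pd a (\<phi> j) x else 0) + (if k = j then pd a (\<phi> i) x else 0)
    - (if i = j then pd a (\<phi> k) x else 0)" for a k i j
    unfolding C_def by (auto simp: pd_add pd_diff pd_minus d\<phi>[OF x] differentiable_add differentiable_diff)
  have ab': "a = 1 \<and> b = 2 \<or> a = 1 \<and> b = 3 \<or> a = 2 \<and> b = 3" using ab by auto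
  have cd: "(c = 1 \<or> c = 2 \<or> c = 3) \<and> (d = 1 \<or> d = 2 \<or> d = 3)" using exhaust_3 by blast
  show "pd a (\<lambda>y. C y d b c) x - pd b (\<lambda>y. C y d a c) x
      + (\<Sum>e\<in>UNIV. C x d a e * C x e b c - C x d b e * C x e a c)
      = \<kappa> * ((if d = a then H x $ b $ c else 0) - (if d = b then H x $ a $ c else 0))
      + 0 * ((if d = a then (H x *v 0) $ b * (H x *v 0) $ c else 0) - (if d = b then (H x *v 0) $ a * (H x *v 0) $ c else 0)
       + H x $ b $ c * (H x *v 0) $ a * 0 $ d - H x $ a $ c * (H x *v 0) $ b * 0 $ d)"
  proof -
    define q where "q = ((\<phi> 1 x)\<^sup>2 + (\<phi> 2 x)\<^sup>2 + (\<phi> 3 x)\<^sup>2 + \<kappa> * f x) / 2"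
    have q: "\<kappa> * f x = 2 * q - \<phi> 1 x * \<phi> 1 x - \<phi> 2 x * \<phi> 2 x - \<phi> 3 x * \<phi> 3 x"
      by (simp add: q_def power2_eq_square field_simps)
    have eq': "pd a (\<phi> b) x = \<phi> a x * \<phi> b x - (if a = b then q else 0)" for a b
      using eq[OF x] by (simp add: q_def)
    show ?thesis
      unfolding pC eq' sum_3 Hij
      using q ab' cd by (elim conjE disjE)
        (simp_all (no_asm_simp) only: C_def, simp_all add: algebra_simps)
  qed
qed (auto simp: H mat_def f smooth_on_const)


text \<open>A conformally flat surface metric times a line. \<open>eq\<close> is Liouville's
  curvature equation for the surface factor; the second coefficient \<open>- \<kappa>\<close> makes
  the curvature of planes containing the axis vanish.\<close>

lemma geometry_domain_product:
  fixes \<phi> :: "3 \<Rightarrow> real^3 \<Rightarrow> real"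
  assumes D: "open D" and f: "smooth_on f D" "\<And>x. x \<in> D \<Longrightarrow> f x > 0"
    and H: "\<And>x. H x = vector [vector [f x, 0, 0], vector [0, f x, 0], vector [0, 0, 1]]"
    and df: "\<And>x i. x \<in> D \<Longrightarrow> pd i f x = 2 * f x * \<phi> i x"
    and d\<phi>: "\<And>x i. x \<in> D \<Longrightarrow> \<phi> i differentiable (at x)"
    and \<phi>3: "\<And>x. \<phi> 3 x = 0" "\<And>x i. x \<in> D \<Longrightarrow> pd 3 (\<phi> i) x = 0"
    and \<phi>12: "\<And>x. x \<in> D \<Longrightarrow> pd 1 (\<phi> 2) x = pd 2 (\<phi> 1) x"
    and eq: "\<And>x. x \<in> D \<Longrightarrow> pd 1 (\<phi> 1) x = - pd 2 (\<phi> 2) x - \<kappa> * f x"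
  shows "geometry_domain D H \<kappa> (- \<kappa>) (\<lambda>_. axis 3 1)"
proof (rule geometry_domainI[OF D])
  have Hij: "H y $ i $ j = (if i = j then if i = 3 then 1 else f y else 0)" for y i j
    using exhaust_3[of i] exhaust_3[of j] by (auto simp: H)
  define C where "C x k i j = (if k = 3 \<or> i = 3 \<or> j = 3 then 0 else (if k = i then \<phi> j x else 0) + (if k = j then \<phi> i x else 0)
    - (if i = j then \<phi> k x else 0))" for x k i j
  fix x i j k l assume x: "x \<in> D"
  have HE: "(H x *v axis 3 1) $ i = (if i = 3 then 1 else 0)" for i
    by (simp add: matrix_vector_mult_def Hij axis_def if_distrib[of "\<lambda>z. _ * z"] cong: if_cong)
  have axE: "axis 3 (1 :: real) $ i = (if i = 3 then 1 else 0)" for i :: 3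
    by (simp add: axis_def)
  show "transpose (H x) = H x" by (simp add: transpose_eq_iff Hij)
  have "metric_ip (H x) v v = f x * ((v $ 1)\<^sup>2 + (v $ 2)\<^sup>2) + (v $ 3)\<^sup>2" for v
    unfolding metric_ip_def sum_3 Hij by (simp add: power2_eq_square algebra_simps)
  note ip = this
  show "metric_ip (H x) v v > 0" if "v \<noteq> 0" for v
  proof (cases "v $ 3 = 0")
    case True
    then have "(v $ 1)\<^sup>2 + (v $ 2)\<^sup>2 > 0"
      using that by (auto simp: vec_eq_iff forall_3 sum_power2_gt_zero_iff)
    then show ?thesis using ip[of v] True f(2)[OF x] by simp
  next
    case False
    then have "(v $ 3)\<^sup>2 > 0" by simp
    moreover have "f x * ((v $ 1)\<^sup>2 + (v $ 2)\<^sup>2) \<ge> 0" using f(2)[OF x] by simp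
    ultimately show ?thesis using ip[of v] by (smt (verit))
  qed
  show "(\<Sum>k\<in>UNIV. H x $ l $ k * C x k i j) =
      (pd i (\<lambda>y. H y $ j $ l) x + pd j (\<lambda>y. H y $ i $ l) x - pd l (\<lambda>y. H y $ i $ j) x) / 2"
  proof -
    have 1: "pd l (\<lambda>y. if i = j then if i = 3 then 1 else f y else 0) x = (if i = j \<and> i \<noteq> 3 then pd l f x else 0)"
      for l i j :: 3 by (auto cong: if_cong)
    have 2: "(\<Sum>k\<in>UNIV. (if l = k then if l = 3 then 1 else f x else 0) * C x k i j) = (if l = 3 then 1 else f x) * C x l i j"
      by (simp add: if_distrib[of "\<lambda>z. z * _"] cong: if_cong)
    show ?thesis unfolding Hij 1 2
      using exhaust_3[of i] exhaust_3[of j] exhaust_3[of l] by (elim disjE) (simp_all add: C_def df[OF x] \<phi>3(1))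
  qed
  show "(\<lambda>y. C y k i j) differentiable at x"
    unfolding C_def by (cases "k = 3 \<or> i = 3 \<or> j = 3")
      (auto intro!: differentiable_add differentiable_diff differentiable_if d\<phi>[OF x])
  fix a b c d :: 3 assume ab: "(a, b) \<in> {(1, 2), (1, 3), (2, 3)}"
  have pC: "pd a (\<lambda>y. C y k i j) x = (if k = 3 \<or> i = 3 \<or> j = 3 then 0 else (if k = i then pd a (\<phi> j) x else 0)
    + (if k = j then pd a (\<phi> i) x else 0) - (if i = j then pd a (\<phi> k) x else 0))" for a k i j
    unfolding C_def by (auto simp: pd_add pd_diff pd_minus d\<phi>[OF x] differentiable_add differentiable_diff)
  have ab': "a = 1 \<and> b = 2 \<or> a = 1 \<and> b = 3 \<or> a = 2 \<and> b = 3" using ab by auto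
  have cd: "(c = 1 \<or> c = 2 \<or> c = 3) \<and> (d = 1 \<or> d = 2 \<or> d = 3)" using exhaust_3 by blast
  show "pd a (\<lambda>y. C y d b c) x - pd b (\<lambda>y. C y d a c) x
      + (\<Sum>e\<in>UNIV. C x d a e * C x e b c - C x d b e * C x e a c)
      = \<kappa> * ((if d = a then H x $ b $ c else 0) - (if d = b then H x $ a $ c else 0))
      + - \<kappa> * ((if d = a then (H x *v axis 3 1) $ b * (H x *v axis 3 1) $ c else 0)
       - (if d = b then (H x *v axis 3 1) $ a * (H x *v axis 3 1) $ c else 0)
       + H x $ b $ c * (H x *v axis 3 1) $ a * axis 3 1 $ d - H x $ a $ c * (H x *v axis 3 1) $ b * axis 3 1 $ d)"
    unfolding pC sum_3 Hij HE axE
    using ab' cd by (elim conjE disjE)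
      (simp_all (no_asm_simp) only: C_def, simp_all add: \<phi>3(1) \<phi>3(2)[OF x] \<phi>12[OF x] eq[OF x] algebra_simps)
next
  fix x assume "x \<in> D"
  have Hij: "H y $ i $ j = (if i = j then if i = 3 then 1 else f y else 0)" for y i j
    using exhaust_3[of i] exhaust_3[of j] by (auto simp: H)
  show "- \<kappa> * metric_ip (H x) (axis 3 1) (axis 3 1) = - \<kappa>"
    by (simp add: metric_ip_def sum_3 Hij axis_def)
next
  fix i j
  have Hij: "H y $ i $ j = (if i = j then if i = 3 then 1 else f y else 0)" for y i j
    using exhaust_3[of i] exhaust_3[of j] by (auto simp: H)
  show "smooth_on (\<lambda>y. H y $ i $ j) D" unfolding Hij
    by (cases "i = j"; cases "i = 3") (simp_all add: f smooth_on_const)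
qed

lemma geometry_domain_euclidean: "geometry_domain UNIV (\<lambda>_. mat 1) 0 0 (\<lambda>_. 0)"
  by (rule geometry_domain_conformal[where f = "\<lambda>_. 1" and \<phi> = "\<lambda>_ _. 0"]) (auto simp: smooth_on_const)

lemma norm_sq_3: "(norm (x :: real^3))\<^sup>2 = (x $ 1)\<^sup>2 + (x $ 2)\<^sup>2 + (x $ 3)\<^sup>2"
  unfolding power2_norm_eq_inner by (simp add: inner_vec_def sum_3 power2_eq_square)

lemma geometry_domain_sphere:
  "geometry_domain UNIV (\<lambda>u. (4 / (1 + (norm u)\<^sup>2)\<^sup>2) *\<^sub>R mat 1) 1 0 (\<lambda>_. 0)"
proof -
  \<comment> \<open>In terms of \<open>w\<close> the metric and its derivatives are polynomial, and
    \<open>rel\<close> turns the curvature equation into an identity.\<close>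
  define w where "w x = 1 / (1 + ((x $ 1)\<^sup>2 + (x $ 2)\<^sup>2 + (x $ 3)\<^sup>2))" for x :: "real^3"
  have p: "1 + ((x $ 1)\<^sup>2 + (x $ 2)\<^sup>2 + (x $ 3)\<^sup>2) > 0" for x :: "real^3"
    by (smt (verit) zero_le_power2)
  have w: "w x > 0" for x using p[of x] by (simp add: w_def)
  have ws: "smooth_on w UNIV"
    unfolding w_def power2_eq_square
    by (intro smooth_on_inverse smooth_on_add smooth_on_mult smooth_on_const smooth_on_coord open_UNIV)
      (use p in \<open>auto simp: power2_eq_square\<close>)
  have wd: "w differentiable (at x)" for x by (rule smooth_on_differentiable[OF ws]) auto
  have rel: "w x * (1 + ((x $ 1)\<^sup>2 + (x $ 2)\<^sup>2 + (x $ 3)\<^sup>2)) = 1" for x using p[of x] by (simp add: w_def)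
  have pw: "pd i w x = - 2 * x $ i * (w x)\<^sup>2" for i x
  proof -
    have "pd i (\<lambda>x. 1 + ((x $ 1)\<^sup>2 + (x $ 2)\<^sup>2 + (x $ 3)\<^sup>2)) x = 2 * x $ i"
      using exhaust_3[of i] by (auto simp: pd_add pd_power2 differentiable_add differentiable_power)
    then show ?thesis
      using pd_reciprocal(1)[of "\<lambda>x. 1 + ((x $ 1)\<^sup>2 + (x $ 2)\<^sup>2 + (x $ 3)\<^sup>2)" x i] p[of x]
      by (simp add: w_def[abs_def] differentiable_add differentiable_power power_divide)
  qed
  show ?thesis
  proof (rule geometry_domain_conformal[where f = "\<lambda>x. 4 * (w x * w x)" and \<phi> = "\<lambda>i x. - 2 * (x $ i * w x)"])
    show "smooth_on (\<lambda>x. 4 * (w x * w x)) UNIV"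
      by (intro smooth_on_mult smooth_on_const ws open_UNIV)
    show "(4 / (1 + (norm x)\<^sup>2)\<^sup>2) *\<^sub>R mat 1 = (4 * (w x * w x)) *\<^sub>R (mat 1 :: real^3^3)" for x :: "real^3"
      unfolding norm_sq_3 by (simp add: w_def power2_eq_square)
    fix x :: "real^3" and a b :: 3
    show "pd a (\<lambda>x. 4 * (w x * w x)) x = 2 * (4 * (w x * w x)) * (- 2 * (x $ a * w x))"
      by (simp add: pd_mult wd differentiable_mult pw power2_eq_square)
    show "pd a (\<lambda>x. - 2 * (x $ b * w x)) x = - 2 * (x $ a * w x) * (- 2 * (x $ b * w x)) -
       (if a = b then ((- 2 * (x $ 1 * w x))\<^sup>2 + (- 2 * (x $ 2 * w x))\<^sup>2 + (- 2 * (x $ 3 * w x))\<^sup>2 + 1 * (4 * (w x * w x))) / 2 else 0)"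
    proof -
      have 1: "pd a (\<lambda>x. - 2 * (x $ b * w x)) x = - 2 * ((if a = b then w x else 0) - 2 * (x $ a * x $ b * (w x * w x)))"
        by (simp add: pd_mult pd_minus wd differentiable_mult pw power2_eq_square)
      have "w x * w x * (1 + ((x $ 1)\<^sup>2 + (x $ 2)\<^sup>2 + (x $ 3)\<^sup>2)) = w x * 1"
        unfolding mult.assoc by (simp only: rel)
      then have "2 * w x = ((- 2 * (x $ 1 * w x))\<^sup>2 + (- 2 * (x $ 2 * w x))\<^sup>2 + (- 2 * (x $ 3 * w x))\<^sup>2 + 1 * (4 * (w x * w x))) / 2"
        by (simp add: power2_eq_square algebra_simps)
      then show ?thesis unfolding 1 by (simp add: power2_eq_square)
    qed
  qed (use w in \<open>auto intro!: differentiable_mult differentiable_minus wd\<close>)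
qed

lemma geometry_domain_hyperbolic:
  "geometry_domain {u. u $ 3 > 0} (\<lambda>u. (1 / (u $ 3)\<^sup>2) *\<^sub>R mat 1) (- 1) 0 (\<lambda>_. 0)"
proof -
  have D: "open {u :: real^3. u $ 3 > 0}"
    by (intro open_Collect_less continuous_intros)
  show ?thesis
  proof (rule geometry_domain_conformal[OF D, where f = "\<lambda>x. 1 / (x $ 3)\<^sup>2"
        and \<phi> = "\<lambda>i x. (if i = 3 then - 1 else 0) * (1 / x $ 3)"])
    show "smooth_on (\<lambda>x. 1 / (x $ 3)\<^sup>2) {u :: real^3. u $ 3 > 0}"
      unfolding power2_eq_square
      by (intro smooth_on_inverse smooth_on_mult smooth_on_coord D) auto
    fix x :: "real^3" and a b :: 3 assume x: "x \<in> {u. u $ 3 > 0}"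
    then have x3: "x $ 3 \<noteq> 0" by simp
    show "pd a (\<lambda>x. 1 / (x $ 3)\<^sup>2) x = 2 * (1 / (x $ 3)\<^sup>2) * ((if a = 3 then - 1 else 0) * (1 / x $ 3))"
      using x3 pd_reciprocal(1)[of "\<lambda>x. (x $ 3)\<^sup>2" x a]
      by (simp add: pd_power2 differentiable_power) (simp add: power2_eq_square power4_eq_xxxx field_simps)
    show "(\<lambda>x. (if a = 3 then - 1 else 0) * (1 / x $ 3)) differentiable at x"
      by (intro differentiable_mult pd_reciprocal(2)) (use x3 in auto)
    have "pd a (\<lambda>x. (if b = 3 then - 1 else 0) * (1 / x $ 3)) x = (if b = 3 then - 1 else 0) * (- (if a = 3 then 1 else 0) / (x $ 3)\<^sup>2)"
      using pd_mult[of "\<lambda>x. if b = 3 then - 1 else 0" x "\<lambda>x. 1 / x $ 3" a] pd_reciprocal[of "\<lambda>x. x $ 3" x] x3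
      by simp
    then show "pd a (\<lambda>x. (if b = 3 then - 1 else 0) * (1 / x $ 3)) x =
       (if a = 3 then - 1 else 0) * (1 / x $ 3) * ((if b = 3 then - 1 else 0) * (1 / x $ 3)) -
       (if a = b then (((if 1 = (3::3) then - 1 else 0) * (1 / x $ 3))\<^sup>2 + ((if 2 = (3::3) then - 1 else 0) * (1 / x $ 3))\<^sup>2
         + ((if (3::3) = 3 then - 1 else 0) * (1 / x $ 3))\<^sup>2 + - 1 * (1 / (x $ 3)\<^sup>2)) / 2 else 0)"
      by (auto simp: power2_eq_square)
  qed auto
qed


lemma geometry_domain_hyperbolic_product:
  "geometry_domain {u. u $ 2 > 0} (\<lambda>u. vector [vector [1 / (u $ 2)\<^sup>2, 0, 0], vector [0, 1 / (u $ 2)\<^sup>2, 0], vector [0, 0, 1]])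
    (- 1) 1 (\<lambda>_. axis 3 1)"
proof -
  have D: "open {u :: real^3. u $ 2 > 0}"
    by (intro open_Collect_less continuous_intros)
  have "geometry_domain {u. u $ 2 > 0} (\<lambda>u. vector [vector [1 / (u $ 2)\<^sup>2, 0, 0], vector [0, 1 / (u $ 2)\<^sup>2, 0], vector [0, 0, 1]])
    (- 1) (- (- 1)) (\<lambda>_. axis 3 1)"
  proof (rule geometry_domain_product[OF D, where f = "\<lambda>x. 1 / (x $ 2)\<^sup>2"
        and \<phi> = "\<lambda>i x. (if i = 2 then - 1 else 0) * (1 / x $ 2)"])
    show "smooth_on (\<lambda>x. 1 / (x $ 2)\<^sup>2) {u :: real^3. u $ 2 > 0}"
      unfolding power2_eq_square
      by (intro smooth_on_inverse smooth_on_mult smooth_on_coord D) auto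
    fix x :: "real^3" and a :: 3 assume x: "x \<in> {u. u $ 2 > 0}"
    then have x2: "x $ 2 \<noteq> 0" by simp
    show "pd a (\<lambda>x. 1 / (x $ 2)\<^sup>2) x = 2 * (1 / (x $ 2)\<^sup>2) * ((if a = 2 then - 1 else 0) * (1 / x $ 2))"
      using x2 pd_reciprocal(1)[of "\<lambda>x. (x $ 2)\<^sup>2" x a]
      by (simp add: pd_power2 differentiable_power) (simp add: power2_eq_square power4_eq_xxxx field_simps)
    show "(\<lambda>x. (if a = 2 then - 1 else 0) * (1 / x $ 2)) differentiable at x"
      by (intro differentiable_mult pd_reciprocal(2)) (use x2 in auto)
    have p: "pd a (\<lambda>x. (if b = 2 then - 1 else 0) * (1 / x $ 2)) x = (if b = 2 then - 1 else 0) * (- (if a = 2 then 1 else 0) / (x $ 2)\<^sup>2)"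
      for a b :: 3
      using pd_mult[of "\<lambda>x. if b = 2 then - 1 else 0" x "\<lambda>x. 1 / x $ 2" a] pd_reciprocal[of "\<lambda>x. x $ 2" x] x2
      by simp
    show "pd 3 (\<lambda>x. (if a = 2 then - 1 else 0) * (1 / x $ 2)) x = 0"
      "pd 1 (\<lambda>x. (if (2::3) = 2 then - 1 else 0) * (1 / x $ 2)) x = pd 2 (\<lambda>x. (if (1::3) = 2 then - 1 else 0) * (1 / x $ 2)) x"
      "pd 1 (\<lambda>x. (if (1::3) = 2 then - 1 else 0) * (1 / x $ 2)) x
        = - pd 2 (\<lambda>x. (if (2::3) = 2 then - 1 else 0) * (1 / x $ 2)) x - - 1 * (1 / (x $ 2)\<^sup>2)"
      unfolding p by simp_all
  qed auto
  then show ?thesis by simp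
qed

text \<open>Since only two coordinates occur, the product of the sphere with a line is the same
  computation as for the sphere, with the sum of squares truncated.\<close>

lemma geometry_domain_sphere_product:
  "geometry_domain UNIV (\<lambda>u. vector [vector [4 / (1 + ((u $ 1)\<^sup>2 + (u $ 2)\<^sup>2))\<^sup>2, 0, 0],
      vector [0, 4 / (1 + ((u $ 1)\<^sup>2 + (u $ 2)\<^sup>2))\<^sup>2, 0], vector [0, 0, 1]]) 1 (- 1) (\<lambda>_. axis 3 1)"
proof -
  define w where "w x = 1 / (1 + ((x $ 1)\<^sup>2 + (x $ 2)\<^sup>2))" for x :: "real^3"
  have p: "1 + ((x $ 1)\<^sup>2 + (x $ 2)\<^sup>2) > 0" for x :: "real^3"
    by (smt (verit) zero_le_power2)
  have w: "w x > 0" for x using p[of x] by (simp add: w_def)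
  have ws: "smooth_on w UNIV"
    unfolding w_def power2_eq_square
    by (intro smooth_on_inverse smooth_on_add smooth_on_mult smooth_on_const smooth_on_coord open_UNIV)
      (use p in \<open>auto simp: power2_eq_square\<close>)
  have wd: "w differentiable (at x)" for x by (rule smooth_on_differentiable[OF ws]) auto
  have rel: "w x * (1 + ((x $ 1)\<^sup>2 + (x $ 2)\<^sup>2)) = 1" for x using p[of x] by (simp add: w_def)
  have pw: "pd i w x = (if i = 3 then 0 else - 2 * x $ i * (w x)\<^sup>2)" for i x
  proof -
    have "pd i (\<lambda>x. 1 + ((x $ 1)\<^sup>2 + (x $ 2)\<^sup>2)) x = (if i = 3 then 0 else 2 * x $ i)"
      using exhaust_3[of i] by (auto simp: pd_add pd_power2 differentiable_add differentiable_power)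
    then show ?thesis
      using pd_reciprocal(1)[of "\<lambda>x. 1 + ((x $ 1)\<^sup>2 + (x $ 2)\<^sup>2)" x i] p[of x]
      by (simp add: w_def[abs_def] differentiable_add differentiable_power power_divide)
  qed
  define \<phi> where "\<phi> i x = (if i = 3 then 0 else - 2 * (x $ i * w x))" for i :: 3 and x
  have p\<phi>: "pd a (\<phi> b) x = (if b = 3 then 0 else - 2 * ((if a = b then w x else 0) + x $ b * pd a w x))" for a b x
    by (cases "b = 3") (simp_all add: \<phi>_def[abs_def] pd_mult pd_minus wd differentiable_mult)
  show ?thesis
  proof (rule geometry_domain_product[where f = "\<lambda>x. 4 * (w x * w x)" and \<phi> = \<phi>])
    show "smooth_on (\<lambda>x. 4 * (w x * w x)) UNIV"
      by (intro smooth_on_mult smooth_on_const ws open_UNIV)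
    fix x :: "real^3" and a b :: 3
    show "vector [vector [4 / (1 + ((x $ 1)\<^sup>2 + (x $ 2)\<^sup>2))\<^sup>2, 0, 0],
      vector [0, 4 / (1 + ((x $ 1)\<^sup>2 + (x $ 2)\<^sup>2))\<^sup>2, 0], vector [0, 0, 1]] =
      (vector [vector [4 * (w x * w x), 0, 0], vector [0, 4 * (w x * w x), 0], vector [0, 0, 1]] :: real^3^3)"
      by (simp add: w_def power2_eq_square)
    show "pd a (\<lambda>x. 4 * (w x * w x)) x = 2 * (4 * (w x * w x)) * \<phi> a x"
      by (simp add: pd_mult wd differentiable_mult pw power2_eq_square \<phi>_def)
    show "\<phi> a differentiable at x"
      unfolding \<phi>_def by (cases "a = 3") (auto intro!: differentiable_mult differentiable_minus wd)
    show "pd 1 (\<phi> 2) x = pd 2 (\<phi> 1) x" by (simp add: p\<phi> pw)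
    show "pd 3 (\<phi> a) x = 0" by (simp add: p\<phi> pw)
    have "w x * w x * (1 + ((x $ 1)\<^sup>2 + (x $ 2)\<^sup>2)) = w x * 1"
      unfolding mult.assoc by (simp only: rel)
    then show "pd 1 (\<phi> 1) x = - pd 2 (\<phi> 2) x - 1 * (4 * (w x * w x))"
      by (simp add: p\<phi> pw power2_eq_square algebra_simps)
  qed (use w in \<open>auto simp: \<phi>_def\<close>)
qed

text \<open>The coefficients 1 and -2 encode sectional curvature 1 orthogonally to the z-axis and 1
  - 2 = -1 for planes containing it; the Ricci curvature is then 0 across the axis and -4 + 2 = -2
  along it.\<close>

lemma geometry_domain_Sol:
  "geometry_domain UNIV (\<lambda>u. vector [vector [exp (2 * u $ 3), 0, 0], vector [0, exp (- 2 * u $ 3), 0], vector [0, 0, 1]])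
    1 (- 2) (\<lambda>_. axis 3 1)"
proof -
  define H :: "real^3 \<Rightarrow> real^3^3" where
    "H u = vector [vector [exp (2 * u $ 3), 0, 0], vector [0, exp (- 2 * u $ 3), 0], vector [0, 0, 1]]" for u
  define p where "p x = exp (2 * x $ 3)" for x :: "real^3"
  define q where "q x = exp (- 2 * x $ 3)" for x :: "real^3"
  have Hij: "H y $ i $ j = (if i = j then if i = 1 then p y else if i = 2 then q y else 1 else 0)" for y i j
    using exhaust_3[of i] exhaust_3[of j] by (auto simp: H_def p_def q_def)
  have ps: "smooth_on p UNIV" and qs: "smooth_on q UNIV"
    unfolding p_def[abs_def] q_def[abs_def]
    by (intro smooth_on_exp smooth_on_mult smooth_on_const smooth_on_coord open_UNIV)+
  have pd[simp]: "p differentiable (at x)" and qd[simp]: "q differentiable (at x)" for x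
    by (rule smooth_on_differentiable[OF ps], auto) (rule smooth_on_differentiable[OF qs], auto)
  have pp: "pd i p x = (if i = 3 then 2 * p x else 0)" and pq: "pd i q x = (if i = 3 then - 2 * q x else 0)" for i x
    using pd_compose_real[of "\<lambda>x. 2 * x $ 3" x exp "p x" i] pd_compose_real[of "\<lambda>x. - 2 * x $ 3" x exp "q x" i]
    by (simp_all add: p_def[abs_def] q_def[abs_def] DERIV_exp pd_mult pd_minus differentiable_mult)
  have pos: "p x > 0" "q x > 0" for x by (simp_all add: p_def q_def)
  have rel: "p x * q x = 1" for x by (simp add: p_def q_def flip: exp_add)
  define C :: "real^3 \<Rightarrow> 3 \<Rightarrow> 3 \<Rightarrow> 3 \<Rightarrow> real" where
    "C x k i j = (if k = 1 then if (i, j) \<in> {(1, 3), (3, 1)} then 1 else 0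
      else if k = 2 then if (i, j) \<in> {(2, 3), (3, 2)} then - 1 else 0
      else if (i, j) = (1, 1) then - p x else if (i, j) = (2, 2) then q x else 0)" for x k i j
  have HE: "(H x *v axis 3 1) $ i = (if i = 3 then 1 else 0)" for x i
    using exhaust_3[of i] by (auto simp: matrix_vector_mult_def Hij axis_def sum_3)
  have axE: "axis 3 (1 :: real) $ i = (if i = 3 then 1 else 0)" for i :: 3
    by (simp add: axis_def)
  have "geometry_domain UNIV H 1 (- 2) (\<lambda>_. axis 3 1)"
  proof (rule geometry_domainI)
    fix x :: "real^3" and i j k l :: 3
    show "transpose (H x) = H x" by (simp add: transpose_eq_iff Hij)
    show "smooth_on (\<lambda>y. H y $ i $ j) UNIV"
      unfolding Hij by (cases "i = j"; cases "i = 1"; cases "i = 2") (simp_all add: ps qs smooth_on_const)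
    have ip: "metric_ip (H x) v v = p x * (v $ 1)\<^sup>2 + q x * (v $ 2)\<^sup>2 + (v $ 3)\<^sup>2" for v
      unfolding metric_ip_def sum_3 Hij by (simp add: power2_eq_square)
    have nn: "p x * (v $ 1)\<^sup>2 \<ge> 0" "q x * (v $ 2)\<^sup>2 \<ge> 0" "(v $ 3)\<^sup>2 \<ge> 0" for v using pos by (simp_all add: less_imp_le)
    show "metric_ip (H x) v v > 0" if "v \<noteq> 0" for v
    proof -
      have "v $ 1 \<noteq> 0 \<or> v $ 2 \<noteq> 0 \<or> v $ 3 \<noteq> 0" using that by (simp add: vec_eq_iff forall_3)
      then have "p x * (v $ 1)\<^sup>2 > 0 \<or> q x * (v $ 2)\<^sup>2 > 0 \<or> (v $ 3)\<^sup>2 > 0"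
        by (auto simp: zero_less_mult_iff pos)
      then show ?thesis unfolding ip using nn[of v] by linarith
    qed
    show "(\<Sum>k\<in>UNIV. H x $ l $ k * C x k i j) =
      (pd i (\<lambda>y. H y $ j $ l) x + pd j (\<lambda>y. H y $ i $ l) x - pd l (\<lambda>y. H y $ i $ j) x) / 2"
      unfolding Hij sum_3
      using exhaust_3[of i] exhaust_3[of j] exhaust_3[of l]
      by (elim disjE) (simp_all (no_asm_simp) only: C_def, simp_all add: pp pq)
    show "(\<lambda>y. C y k i j) differentiable at x"
      unfolding C_def
      using exhaust_3[of i] exhaust_3[of j] exhaust_3[of k]
      by (elim disjE) (simp_all add: differentiable_minus)
    fix a b c d :: 3 assume ab: "(a, b) \<in> {(1, 2), (1, 3), (2, 3)}"
    have ab': "a = 1 \<and> b = 2 \<or> a = 1 \<and> b = 3 \<or> a = 2 \<and> b = 3" using ab by auto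
    have cd: "(c = 1 \<or> c = 2 \<or> c = 3) \<and> (d = 1 \<or> d = 2 \<or> d = 3)" using exhaust_3 by blast
    show "pd a (\<lambda>y. C y d b c) x - pd b (\<lambda>y. C y d a c) x
      + (\<Sum>e\<in>UNIV. C x d a e * C x e b c - C x d b e * C x e a c)
      = 1 * ((if d = a then H x $ b $ c else 0) - (if d = b then H x $ a $ c else 0))
      + - 2 * ((if d = a then (H x *v axis 3 1) $ b * (H x *v axis 3 1) $ c else 0)
       - (if d = b then (H x *v axis 3 1) $ a * (H x *v axis 3 1) $ c else 0)
       + H x $ b $ c * (H x *v axis 3 1) $ a * axis 3 1 $ d - H x $ a $ c * (H x *v axis 3 1) $ b * axis 3 1 $ d)"
      unfolding sum_3 Hij HE axE
      using ab' cd by (elim conjE disjE)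
        (simp_all (no_asm_simp) only: C_def, simp_all add: pp pq pd_minus rel)
  next
    fix x
    show "- 2 * metric_ip (H x) (axis 3 1) (axis 3 1) = - 2"
      by (simp add: metric_ip_def sum_3 Hij axis_def)
  qed auto
  then show ?thesis by (simp add: H_def[abs_def])
qed

text \<open>In the functions \<open>p\<close>, \<open>q\<close> and \<open>w\<close> below, the
  symbols and all derivatives are polynomial, and the single relation \<open>rel\<close> links the
  three. The Ricci curvature along the axis comes out as l^2/2.\<close>

lemma geometry_domain_BCV:
  fixes m l :: real
  defines "D \<equiv> {u :: real^3. 1 + m * ((u $ 1)\<^sup>2 + (u $ 2)\<^sup>2) > 0}"
  shows "geometry_domain D (\<lambda>u.
     let D = 1 + m * ((u $ 1)\<^sup>2 + (u $ 2)\<^sup>2);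
         \<theta> = (vector [l / 2 * (u $ 2 / D), - (l / 2 * (u $ 1 / D)), 1] :: real^3)
     in \<chi> i j. (if i = j \<and> i \<noteq> 3 then 1 / D\<^sup>2 else 0) + \<theta> $ i * \<theta> $ j)
    (4 * m - 3 * l\<^sup>2 / 4) (l\<^sup>2 - 4 * m) (\<lambda>_. axis 3 1)" (is "geometry_domain D ?H _ _ _")
proof -
  define a where "a = l / 2"
  define w where "w u = 1 / (1 + m * ((u $ 1)\<^sup>2 + (u $ 2)\<^sup>2))" for u :: "real^3"
  define p where "p u = u $ 1 * w u" for u :: "real^3"
  define q where "q u = u $ 2 * w u" for u :: "real^3"
  define \<theta> where "\<theta> i u = (if i = 1 then a * q u else if i = 2 then - (a * p u) else 1)" for i :: 3 and u
  define H where "H = ?H"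
  have Hij: "H y $ i $ j = (if i = j \<and> i \<noteq> 3 then w y * w y else 0) + \<theta> i y * \<theta> j y" for y i j
    using exhaust_3[of i] exhaust_3[of j]
    unfolding H_def by (auto simp: Let_def \<theta>_def a_def p_def q_def w_def power2_eq_square)
  have D: "open D" unfolding D_def by (intro open_Collect_less continuous_intros)
  have Dp: "1 + m * ((x $ 1)\<^sup>2 + (x $ 2)\<^sup>2) > 0" if "x \<in> D" for x using that by (simp add: D_def)
  have w: "w x > 0" if "x \<in> D" for x using Dp[OF that] by (simp add: w_def)
  have ws: "smooth_on w D"
    unfolding w_def[abs_def] power2_eq_square
    by (intro smooth_on_inverse smooth_on_add smooth_on_mult smooth_on_const smooth_on_coord D)
      (use Dp in \<open>auto simp: power2_eq_square\<close>)
  have ps: "smooth_on p D" and qs: "smooth_on q D"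
    unfolding p_def[abs_def] q_def[abs_def] by (intro smooth_on_mult smooth_on_coord ws D)+
  have rel: "w x = w x * w x + m * (p x * p x + q x * q x)" if "x \<in> D" for x
  proof -
    have "w x * (1 + m * ((x $ 1)\<^sup>2 + (x $ 2)\<^sup>2)) = 1" using Dp[OF that] by (simp add: w_def)
    then have "w x * (w x * (1 + m * ((x $ 1)\<^sup>2 + (x $ 2)\<^sup>2))) = w x" by simp
    then show ?thesis by (simp add: p_def q_def power2_eq_square algebra_simps)
  qed
  have wd: "w differentiable (at x)" and pd: "p differentiable (at x)" and qd: "q differentiable (at x)" if "x \<in> D" for x
    by (rule smooth_on_differentiable[OF ws D that] smooth_on_differentiable[OF ps D that] smooth_on_differentiable[OF qs D that])+
  have pw: "pd i w x = (if i = 1 then - 2 * m * p x * w x else if i = 2 then - 2 * m * q x * w x else 0)" if "x \<in> D" for i x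
  proof -
    have "pd i (\<lambda>x. 1 + m * ((x $ 1)\<^sup>2 + (x $ 2)\<^sup>2)) x = (if i = 3 then 0 else 2 * m * x $ i)"
      using exhaust_3[of i] by (auto simp: pd_add pd_mult pd_power2 differentiable_add differentiable_mult differentiable_power)
    then show ?thesis
      using pd_reciprocal(1)[of "\<lambda>x. 1 + m * ((x $ 1)\<^sup>2 + (x $ 2)\<^sup>2)" x i] Dp[OF that] exhaust_3[of i]
      by (auto simp: w_def[abs_def] p_def q_def differentiable_add differentiable_mult differentiable_power power2_eq_square)
  qed
  have pp: "pd i p x = (if i = 1 then w x - 2 * m * p x * p x else if i = 2 then - 2 * m * p x * q x else 0)"
    and pq: "pd i q x = (if i = 1 then - 2 * m * p x * q x else if i = 2 then w x - 2 * m * q x * q x else 0)"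
    if "x \<in> D" for i x
    using exhaust_3[of i] by (auto simp: p_def[abs_def] q_def[abs_def] pd_mult wd[OF that] pw[OF that])
  have \<theta>s: "smooth_on (\<theta> i) D" for i
    unfolding \<theta>_def[abs_def]
    by (cases "i = 1"; cases "i = 2")
      (simp_all add: smooth_on_const smooth_on_mult ps qs D smooth_on_bounded_linear[OF bounded_linear_minus[OF bounded_linear_ident]])
  have \<theta>d: "\<theta> i differentiable (at x)" if "x \<in> D" for i x by (rule smooth_on_differentiable[OF \<theta>s D that])
  have p\<theta>: "pd k (\<theta> i) x = (if i = 1 then a * pd k q x else if i = 2 then - (a * pd k p x) else 0)" if "x \<in> D" for k i x
    unfolding \<theta>_def[abs_def]
    by (cases "i = 1"; cases "i = 2") (simp_all add: pd_mult pd_minus pd[OF that] qd[OF that] differentiable_mult)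
  have pH: "pd k (\<lambda>y. H y $ i $ j) x = (if i = j \<and> i \<noteq> 3 then 2 * w x * pd k w x else 0)
    + pd k (\<theta> i) x * \<theta> j x + \<theta> i x * pd k (\<theta> j) x" if "x \<in> D" for k i j x
    unfolding Hij by (cases "i = j"; cases "i = 3")
      (simp_all add: pd_add pd_mult wd[OF that] \<theta>d[OF that] differentiable_mult)
  define C where "C x k i j =
    (if k = 1 then if (i, j) = (1, 1) then - 2 * m * p x else if (i, j) \<in> {(1, 2), (2, 1)} then (a\<^sup>2 - 2 * m) * q x
        else if (i, j) = (2, 2) then (2 * m - 2 * a\<^sup>2) * p x else if (i, j) \<in> {(2, 3), (3, 2)} then a else 0
     else if k = 2 then if (i, j) = (1, 1) then (2 * m - 2 * a\<^sup>2) * q x else if (i, j) \<in> {(1, 2), (2, 1)} then (a\<^sup>2 - 2 * m) * p x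
        else if (i, j) = (2, 2) then - 2 * m * q x else if (i, j) \<in> {(1, 3), (3, 1)} then - a else 0
     else if (i, j) = (1, 1) then 2 * a * (m - a\<^sup>2) * (p x * q x) else if (i, j) \<in> {(1, 2), (2, 1)} then a * (a\<^sup>2 - m) * (p x * p x - q x * q x)
        else if (i, j) = (2, 2) then 2 * a * (a\<^sup>2 - m) * (p x * q x) else if (i, j) \<in> {(1, 3), (3, 1)} then - a\<^sup>2 * p x
        else if (i, j) \<in> {(2, 3), (3, 2)} then - a\<^sup>2 * q x else 0)" for x and k i j :: 3
  have HE: "(H x *v axis 3 1) $ i = \<theta> i x" for x i
    using exhaust_3[of i] by (auto simp: matrix_vector_mult_def Hij axis_def sum_3 \<theta>_def)
  have axE: "axis 3 (1 :: real) $ i = (if i = 3 then 1 else 0)" for i :: 3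
    by (simp add: axis_def)
  have coeff: "4 * m - 3 * l\<^sup>2 / 4 = 4 * m - 3 * a\<^sup>2" "l\<^sup>2 - 4 * m = 4 * a\<^sup>2 - 4 * m"
    by (simp_all add: a_def power2_eq_square)
  have ne: "(1::3) \<noteq> 2" "(1::3) \<noteq> 3" "(2::3) \<noteq> 1" "(2::3) \<noteq> 3" "(3::3) \<noteq> 1" "(3::3) \<noteq> 2" by simp_all
  have "geometry_domain D H (4 * m - 3 * a\<^sup>2) (4 * a\<^sup>2 - 4 * m) (\<lambda>_. axis 3 1)"
  proof (rule geometry_domainI[OF D])
    fix x :: "real^3" and i j k l :: 3
    show "smooth_on (\<lambda>y. H y $ i $ j) D"
      unfolding Hij by (cases "i = j"; cases "i = 3") (simp_all add: smooth_on_add smooth_on_mult D \<theta>s ws)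
    assume x: "x \<in> D"
    show "transpose (H x) = H x" by (auto simp: transpose_eq_iff Hij)
    have ip: "metric_ip (H x) v v = (w x)\<^sup>2 * ((v $ 1)\<^sup>2 + (v $ 2)\<^sup>2) + (\<theta> 1 x * v $ 1 + \<theta> 2 x * v $ 2 + \<theta> 3 x * v $ 3)\<^sup>2" for v
      unfolding metric_ip_def sum_3 Hij by (simp add: power2_eq_square algebra_simps)
    show "metric_ip (H x) v v > 0" if "v \<noteq> 0" for v
    proof (cases "v $ 1 = 0 \<and> v $ 2 = 0")
      case True
      then have "v $ 3 \<noteq> 0" using that by (simp add: vec_eq_iff forall_3)
      then show ?thesis using True by (simp add: ip \<theta>_def)
    next
      case False
      then have "(v $ 1)\<^sup>2 + (v $ 2)\<^sup>2 > 0" by (simp add: sum_power2_gt_zero_iff)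
      then have "(w x)\<^sup>2 * ((v $ 1)\<^sup>2 + (v $ 2)\<^sup>2) > 0" using w[OF x] by simp
      then show ?thesis unfolding ip by (rule add_pos_nonneg) simp
    qed
    show "(\<lambda>y. C y k i j) differentiable at x"
    proof -
      note d = pd[OF x] qd[OF x]
      show ?thesis
        using exhaust_3[of i] exhaust_3[of j] exhaust_3[of k]
        by (elim disjE) (simp_all add: C_def differentiable_mult differentiable_diff differentiable_minus d)
    qed
    \<comment> \<open>\<open>rel\<close> is oriented so as to eliminate squares of \<open>w\<close>;
      \<open>r2\<close> is the same rule inside a longer product.\<close>
    have r: "w x = w x * w x + m * (p x * p x + q x * q x)" by (rule rel[OF x])
    have r1: "w x * w x = w x - m * (p x * p x) - m * (q x * q x)" using r by (simp add: algebra_simps)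
    have r2: "w x * (w x * z) = w x * z - m * (p x * (p x * z)) - m * (q x * (q x * z))" for z
      unfolding mult.assoc[symmetric] by (simp only: r1 left_diff_distrib)
    show "(\<Sum>k\<in>UNIV. H x $ l $ k * C x k i j) =
      (pd i (\<lambda>y. H y $ j $ l) x + pd j (\<lambda>y. H y $ i $ l) x - pd l (\<lambda>y. H y $ i $ j) x) / 2"
    proof -
      have "2 * (\<Sum>k\<in>UNIV. H x $ l $ k * C x k i j) =
        pd i (\<lambda>y. H y $ j $ l) x + pd j (\<lambda>y. H y $ i $ l) x - pd l (\<lambda>y. H y $ i $ j) x"
        unfolding pH[OF x] sum_3 unfolding p\<theta>[OF x] pw[OF x] pp[OF x] pq[OF x] unfolding Hij \<theta>_def
        using exhaust_3[of i] exhaust_3[of j] exhaust_3[of l]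
        by (elim disjE; simp only: C_def ne if_True if_False simp_thms prod.inject insert_iff empty_iff)
            (simp_all add: power2_eq_square r1 r2 algebra_simps)
      then show ?thesis by simp
    qed
    fix b c d e :: 3 assume ab: "(b, c) \<in> {(1, 2), (1, 3), (2, 3)}"
    show "pd b (\<lambda>y. C y e c d) x - pd c (\<lambda>y. C y e b d) x
      + (\<Sum>f\<in>UNIV. C x e b f * C x f c d - C x e c f * C x f b d)
      = (4 * m - 3 * a\<^sup>2) * ((if e = b then H x $ c $ d else 0) - (if e = c then H x $ b $ d else 0))
      + (4 * a\<^sup>2 - 4 * m) * ((if e = b then (H x *v axis 3 1) $ c * (H x *v axis 3 1) $ d else 0)
       - (if e = c then (H x *v axis 3 1) $ b * (H x *v axis 3 1) $ d else 0)
       + H x $ c $ d * (H x *v axis 3 1) $ b * axis 3 1 $ e - H x $ b $ d * (H x *v axis 3 1) $ c * axis 3 1 $ e)"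
      (is "?L = ?R")
    proof -
      have ab': "b = 1 \<and> c = 2 \<or> b = 1 \<and> c = 3 \<or> b = 2 \<and> c = 3" using ab by auto
      have de: "(d = 1 \<or> d = 2 \<or> d = 3) \<and> (e = 1 \<or> e = 2 \<or> e = 3)" using exhaust_3 by blast
      note d = pd[OF x] qd[OF x]
      have pC: "pd b (\<lambda>y. C y k i j) x =
        (if k = 1 then if (i, j) = (1, 1) then - 2 * m * pd b p x else if (i, j) \<in> {(1, 2), (2, 1)} then (a\<^sup>2 - 2 * m) * pd b q x
            else if (i, j) = (2, 2) then (2 * m - 2 * a\<^sup>2) * pd b p x else 0
         else if k = 2 then if (i, j) = (1, 1) then (2 * m - 2 * a\<^sup>2) * pd b q x else if (i, j) \<in> {(1, 2), (2, 1)} then (a\<^sup>2 - 2 * m) * pd b p x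
            else if (i, j) = (2, 2) then - 2 * m * pd b q x else 0
         else if (i, j) = (1, 1) then 2 * a * (m - a\<^sup>2) * (pd b p x * q x + p x * pd b q x)
            else if (i, j) \<in> {(1, 2), (2, 1)} then a * (a\<^sup>2 - m) * (2 * p x * pd b p x - 2 * q x * pd b q x)
            else if (i, j) = (2, 2) then 2 * a * (a\<^sup>2 - m) * (pd b p x * q x + p x * pd b q x)
            else if (i, j) \<in> {(1, 3), (3, 1)} then - a\<^sup>2 * pd b p x
            else if (i, j) \<in> {(2, 3), (3, 2)} then - a\<^sup>2 * pd b q x else 0)" for b k i j
        using exhaust_3[of i] exhaust_3[of j] exhaust_3[of k]
        by (elim disjE) (simp_all add: C_def pd_mult pd_diff pd_minus d differentiable_mult differentiable_diff differentiable_minus)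
      show ?thesis
        unfolding sum_3 HE axE pC unfolding pp[OF x] pq[OF x] Hij \<theta>_def
        using ab' de
        by (elim conjE disjE; simp only: C_def ne if_True if_False simp_thms prod.inject insert_iff empty_iff)
          (simp_all add: power2_eq_square r1 r2 algebra_simps)
    qed
  next
    fix x
    show "(4 * a\<^sup>2 - 4 * m) * metric_ip (H x) (axis 3 1) (axis 3 1) = 4 * a\<^sup>2 - 4 * m"
      by (simp add: metric_ip_def sum_3 Hij axis_def \<theta>_def)
  qed
  then show ?thesis unfolding coeff H_def .
qed

section \<open>Stereographic projection\<close>

definition stereographic_inv :: "real \<Rightarrow> real^'n::finite \<Rightarrow> (real^'n) \<times> real" where
  "stereographic_inv s u = ((2 / (1 + u \<bullet> u)) *\<^sub>R u, s * (1 - 2 / (1 + u \<bullet> u)))"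

lemma one_plus_inner_pos: fixes u :: "'a::real_inner" shows "1 + u \<bullet> u > (0 :: real)"
  using inner_ge_zero[of u] by linarith

text \<open>The hypothesis \<open>s * s = 1\<close> treats the poles \<open>s = 1\<close> and
  \<open>s = - 1\<close> at once.\<close>

lemma stereographic_inv:
  fixes u :: "real^'n::finite"
  assumes s: "s * s = 1"
  shows "stereographic_inv s u \<in> sphere_dom s" "stereographic s (stereographic_inv s u) = u"
proof -
  define d where "d = 1 + u \<bullet> u"
  have d: "d > 0" unfolding d_def by (rule one_plus_inner_pos)
  have "s * (1 - 2 / d) \<noteq> s" using s d by auto
  moreover have "((2 / d) *\<^sub>R u) \<bullet> ((2 / d) *\<^sub>R u) + (s * (1 - 2 / d)) * (s * (1 - 2 / d)) = 1"
  proof -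
    have "((2 / d) *\<^sub>R u) \<bullet> ((2 / d) *\<^sub>R u) = 4 / (d * d) * (d - 1)" by (simp add: d_def)
    moreover have "(s * (1 - 2 / d)) * (s * (1 - 2 / d)) = (1 - 2 / d) * (1 - 2 / d)"
      using s by (metis (no_types, lifting) mult.assoc mult.left_commute mult_1)
    ultimately show ?thesis using d by (simp add: field_simps)
  qed
  ultimately show "stereographic_inv s u \<in> sphere_dom s"
    by (simp add: stereographic_inv_def sphere_dom_def d_def[symmetric] norm_eq_1)
  have "1 - s * (s * (1 - 2 / d)) = 2 / d" using s by (simp add: mult.assoc[symmetric])
  then show "stereographic s (stereographic_inv s u) = u"
    using d by (simp add: stereographic_def stereographic_inv_def d_def[symmetric])
qed

lemma stereographic_inv_stereographic:
  fixes p :: "(real^'n::finite) \<times> real"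
  assumes s: "s * s = 1" and p: "p \<in> sphere_dom s"
  shows "stereographic_inv s (stereographic s p) = p"
proof -
  obtain x t where xt: "p = (x, t)" by (cases p)
  have n: "x \<bullet> x + t * t = 1" using p by (simp add: xt sphere_dom_def norm_eq_1)
  \<comment> \<open>\<open>k\<close> vanishes only at the pole, and the sphere equation becomes
    \<open>x \<bullet> x = k * (2 - k)\<close>, so that the denominator in
    \<open>stereographic_inv\<close> is \<open>2 / k\<close>.\<close>
  define k where "k = 1 - s * t"
  have k: "k \<noteq> 0"
  proof
    assume "k = 0"
    then have "s * t = 1" by (simp add: k_def)
    then have "t = s" using s by (metis mult.assoc mult.left_commute mult.right_neutral mult_1)
    then have "x = 0" using n s by simp
    then show False using p \<open>t = s\<close> by (simp add: xt sphere_dom_def)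
  qed
  have xx: "x \<bullet> x = k * (2 - k)"
  proof -
    have "(s * t) * (s * t) = (s * s) * (t * t)" by (simp add: mult_ac)
    then have e: "(s * t) * (s * t) = t * t" using s by simp
    have "x \<bullet> x = 1 - (s * t) * (s * t)" unfolding e using n by simp
    then show ?thesis by (simp add: k_def algebra_simps)
  qed
  have 1: "1 + stereographic s p \<bullet> stereographic s p = 2 / k"
    using k by (simp add: stereographic_def xt k_def[symmetric] xx field_simps)
  have "s * (1 - k) = t" using s by (simp add: k_def mult.assoc[symmetric])
  then show ?thesis
    using k unfolding stereographic_inv_def 1 by (simp add: stereographic_def xt k_def[symmetric])
qed

lemma inj_on_stereographic: "s * s = 1 \<Longrightarrow> inj_on (stereographic s) (sphere_dom s)"
  by (rule inj_on_inverseI) (rule stereographic_inv_stereographic)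

lemma inv_stereographic:
  "s * s = 1 \<Longrightarrow> inv_into (sphere_dom s) (stereographic s) = stereographic_inv s"
  by (rule ext) (intro inv_into_f_eq inj_on_stereographic stereographic_inv)

lemma stereographic_image: "s * s = 1 \<Longrightarrow> stereographic s ` sphere_dom s = UNIV"
  using stereographic_inv by (metis UNIV_eq_I image_eqI)

lemma smooth_on_Pair:
  assumes "open S" "smooth_on f S" "smooth_on g S"
  shows "smooth_on (\<lambda>x. (f x, g x)) S"
proof -
  have "bounded_linear (\<lambda>y. (y, 0))" "bounded_linear (\<lambda>y. (0, y))"
    by (auto intro: bounded_linear_Pair bounded_linear_ident bounded_linear_zero)
  then have "smooth_on (\<lambda>x. (f x, 0) + (0, g x)) S"
    using assms by (intro smooth_on_add) (auto intro: smooth_on_bounded_linear[of "\<lambda>y. (y, 0)"] smooth_on_bounded_linear[of "\<lambda>y. (0, y)"])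
  then show ?thesis by simp
qed

lemma pd_Pair:
  assumes "f differentiable (at u)" "g differentiable (at u)"
  shows "pd i (\<lambda>x. (f x, g x)) u = (pd i f u, pd i g u)"
  by (subst pd_eq[OF has_derivative_Pair[OF frechet_works[OF assms(1)] frechet_works[OF assms(2)]]]) (simp add: pd_def)

lemma smooth_on_inner: "open S \<Longrightarrow> smooth_on f S \<Longrightarrow> smooth_on g S \<Longrightarrow> smooth_on (\<lambda>x. f x \<bullet> g x) S"
  by (rule smooth_on_bilinear[OF bounded_bilinear_inner])

lemma smooth_on_ident: "open S \<Longrightarrow> smooth_on (\<lambda>x. x) S"
  by (rule smooth_on_linear[OF bounded_linear_ident])

lemma smooth_stereographic_inv: "smooth_on (stereographic_inv s) UNIV"
proof -
  have w: "smooth_on (\<lambda>u :: real^'n. 1 / (1 + u \<bullet> u)) UNIV"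
    by (intro smooth_on_inverse smooth_on_add smooth_on_inner smooth_on_const smooth_on_ident open_UNIV one_plus_inner_pos)
  have "smooth_on (\<lambda>u :: real^'n. ((2 * (1 / (1 + u \<bullet> u))) *\<^sub>R u, s * (1 - 2 * (1 / (1 + u \<bullet> u))))) UNIV"
    by (intro smooth_on_Pair smooth_on_scaleR smooth_on_mult smooth_on_diff smooth_on_const smooth_on_ident w open_UNIV)
  then show ?thesis by (simp add: stereographic_inv_def[abs_def])
qed

lemma pd_stereographic_inv:
  fixes u :: "real^'n::finite"
  shows "pd i (stereographic_inv s) u =
    ((2 / (1 + u \<bullet> u)) *\<^sub>R axis i 1 - (4 * u $ i / (1 + u \<bullet> u)\<^sup>2) *\<^sub>R u, s * (4 * u $ i / (1 + u \<bullet> u)\<^sup>2))"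
proof -
  have c: "1 + u \<bullet> u \<noteq> 0" using one_plus_inner_pos[of u] by simp
  have d: "(\<lambda>x :: real^'n. x \<bullet> x) differentiable (at u)"
    by (intro differentiable_bilinear[OF bounded_bilinear_inner]) auto
  have pi: "pd i (\<lambda>x :: real^'n. x) u = axis i 1" by (simp add: pd_def)
  have p: "pd i (\<lambda>x :: real^'n. 1 + x \<bullet> x) u = 2 * u $ i"
    by (simp add: pd_add d pd_inner pi inner_axis inner_axis')
  have w: "pd i (\<lambda>x. 1 / (1 + x \<bullet> x)) u = - (2 * u $ i) / (1 + u \<bullet> u)\<^sup>2" "(\<lambda>x :: real^'n. 1 / (1 + x \<bullet> x)) differentiable (at u)"
    using pd_reciprocal(1)[of "\<lambda>x. 1 + x \<bullet> x" u i] pd_reciprocal(2)[of "\<lambda>x. 1 + x \<bullet> x" u] c p d by (simp_all add: differentiable_add)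
  have "stereographic_inv s = (\<lambda>u :: real^'n. ((2 * (1 / (1 + u \<bullet> u))) *\<^sub>R u, s * (1 - 2 * (1 / (1 + u \<bullet> u)))))"
    by (simp add: stereographic_inv_def[abs_def])
  moreover have "pd i (\<lambda>u :: real^'n. ((2 * (1 / (1 + u \<bullet> u))) *\<^sub>R u, s * (1 - 2 * (1 / (1 + u \<bullet> u))))) u =
    (pd i (\<lambda>u. (2 * (1 / (1 + u \<bullet> u))) *\<^sub>R u) u, pd i (\<lambda>u. s * (1 - 2 * (1 / (1 + u \<bullet> u)))) u)"
    by (intro pd_Pair differentiable_bilinear[OF bounded_bilinear_scaleR] differentiable_mult differentiable_diff w) auto
  moreover have "pd i (\<lambda>u. (2 * (1 / (1 + u \<bullet> u))) *\<^sub>R u) u = (2 / (1 + u \<bullet> u)) *\<^sub>R axis i 1 - (4 * u $ i / (1 + u \<bullet> u)\<^sup>2) *\<^sub>R u"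
  proof -
    define v where "v = (\<lambda>x :: real^'n. 1 / (1 + x \<bullet> x))"
    have v: "v differentiable (at u)" "pd i v u = - (2 * u $ i) / (1 + u \<bullet> u)\<^sup>2" "v u = 1 / (1 + u \<bullet> u)"
      using w by (simp_all add: v_def)
    have "pd i (\<lambda>u. (2 * v u) *\<^sub>R u) u = (2 / (1 + u \<bullet> u)) *\<^sub>R axis i 1 - (4 * u $ i / (1 + u \<bullet> u)\<^sup>2) *\<^sub>R u"
      by (simp add: pd_scaleR pd_mult v pi differentiable_mult algebra_simps)
    then show ?thesis by (simp add: v_def)
  qed
  moreover have "pd i (\<lambda>u. s * (1 - 2 * (1 / (1 + u \<bullet> u)))) u = s * (4 * u $ i / (1 + u \<bullet> u)\<^sup>2)"
  proof -
    have "pd i (\<lambda>u. s * (1 - 2 * (1 / (1 + u \<bullet> u)))) u = s * (0 - 2 * pd i (\<lambda>x. 1 / (1 + x \<bullet> x)) u)"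
      by (simp only: pd_mult pd_diff pd_const w(2) differentiable_const differentiable_diff differentiable_mult) simp
    then show ?thesis by (simp add: w)
  qed
  ultimately show ?thesis by simp
qed

text \<open>Conformality of the projection: the terms containing \<open>u $ i * u $ j\<close> cancel
  because \<open>w * (1 + u \<bullet> u) = 1\<close>.\<close>

lemma inner_pd_stereographic_inv:
  fixes u :: "real^'n::finite"
  assumes "s * s = 1"
  shows "pd i (stereographic_inv s) u \<bullet> pd j (stereographic_inv s) u = (if i = j then 4 / (1 + u \<bullet> u)\<^sup>2 else 0)"
proof -
  define w where "w = 1 / (1 + u \<bullet> u)"
  have w: "w * (1 + u \<bullet> u) = 1" using one_plus_inner_pos[of u] by (simp add: w_def)
  have p: "pd i (stereographic_inv s) u = ((2 * w) *\<^sub>R axis i 1 - (4 * u $ i * w\<^sup>2) *\<^sub>R u, s * (4 * u $ i * w\<^sup>2))" for i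
    unfolding pd_stereographic_inv by (simp add: w_def power_divide)
  have e: "(axis i 1 :: real^'n) \<bullet> axis j 1 = (if i = j then 1 else (0::real))" by (simp add: inner_axis_axis inner_real_def)
  have "pd i (stereographic_inv s) u \<bullet> pd j (stereographic_inv s) u =
    4 * w\<^sup>2 * ((axis i 1 :: real^'n) \<bullet> axis j 1) - 16 * (u $ i * u $ j) * (w\<^sup>2 * w) + 16 * (u $ i * u $ j) * (w\<^sup>2 * w\<^sup>2) * (u \<bullet> u + s * s)"
    unfolding p by (simp add: inner_diff_left inner_diff_right inner_axis inner_axis' power2_eq_square algebra_simps)
  also have "\<dots> = 4 * w\<^sup>2 * ((axis i 1 :: real^'n) \<bullet> axis j 1) - 16 * (u $ i * u $ j) * (w\<^sup>2 * w) + 16 * (u $ i * u $ j) * (w\<^sup>2 * w) * (w * (1 + u \<bullet> u))"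
    unfolding assms by (simp add: power2_eq_square algebra_simps)
  finally show ?thesis unfolding w e by (simp add: w_def power_divide)
qed

lemma gram_sphere_chart:
  assumes "s * s = 1"
  shows "gram (sphere_chart s) u = (4 / (1 + (norm u)\<^sup>2)\<^sup>2) *\<^sub>R mat 1"
  by (simp add: sphere_chart_def inv_stereographic[OF assms] Let_def inner_pd_stereographic_inv[OF assms]
      vec_eq_iff mat_def power2_norm_eq_inner)

text \<open>The same constants and the same coordinate expression of the axis serve all charts of
  the atlas. Covering and openness are what the passage from a map to its local representations
  uses.\<close>

definition geometric_target :: "('b, 3) rmanifold \<Rightarrow> real \<Rightarrow> real \<Rightarrow> (real^3 \<Rightarrow> real^3) \<Rightarrow> bool" where
  "geometric_target N \<kappa> \<beta> E \<longleftrightarrow> topspace (top_space N) \<subseteq> (\<Union>d\<in>atlas N. cdom d) \<and>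
     (\<forall>d\<in>atlas N. openin (top_space N) (cdom d) \<and> geometry_domain (coord d ` cdom d) (gram d) \<kappa> \<beta> E)"

lemma geometric_target_open_manifold:
  "geometry_domain D H \<kappa> \<beta> E \<Longrightarrow> geometric_target (open_manifold D H) \<kappa> \<beta> E"
  by (simp add: geometric_target_def open_manifold_def)

lemma geometric_target_euclidean: "geometric_target euclidean_manifold 0 0 (\<lambda>_. 0)"
  unfolding euclidean_manifold_def by (rule geometric_target_open_manifold[OF geometry_domain_euclidean])

lemma geometric_target_hyperbolic: "geometric_target (hyperbolic 3) (- 1) 0 (\<lambda>_. 0)"
  unfolding hyperbolic_def by (rule geometric_target_open_manifold[OF geometry_domain_hyperbolic])

lemma geometric_target_Sol: "geometric_target Sol 1 (- 2) (\<lambda>_. axis 3 1)"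
  unfolding Sol_def by (rule geometric_target_open_manifold[OF geometry_domain_Sol])

lemma geometric_target_BCV:
  "geometric_target (BCV m l) (4 * m - 3 * l\<^sup>2 / 4) (l\<^sup>2 - 4 * m) (\<lambda>_. axis 3 1)"
  unfolding BCV_def by (rule geometric_target_open_manifold[OF geometry_domain_BCV])

lemma sphere_dom_cover: "sphere 0 1 \<subseteq> sphere_dom 1 \<union> sphere_dom (- 1)"
  by (auto simp: sphere_dom_def)

lemma openin_sphere_dom: "openin (top_of_set (sphere 0 1)) (sphere_dom s)"
  unfolding sphere_dom_def by (rule openin_delete) simp

lemma geometric_target_sphere: "geometric_target round_sphere 1 0 (\<lambda>_. 0)"
proof -
  have "geometry_domain (coord (sphere_chart s) ` cdom (sphere_chart s)) (gram (sphere_chart s)) 1 0 (\<lambda>_. 0)"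
    if "s * s = 1" for s
  proof -
    have "gram (sphere_chart s) = (\<lambda>u :: real^3. (4 / (1 + (norm u)\<^sup>2)\<^sup>2) *\<^sub>R mat 1)"
      using gram_sphere_chart[OF that] by blast
    moreover have "coord (sphere_chart s) ` cdom (sphere_chart s) = (UNIV :: (real^3) set)"
      by (simp add: sphere_chart_def stereographic_image[OF that])
    ultimately show ?thesis using geometry_domain_sphere by simp
  qed
  then show ?thesis
    using sphere_dom_cover openin_sphere_dom
    by (auto simp: geometric_target_def round_sphere_def sphere_chart_def)
qed

lemma coord_image_times_line:
  "coord (chart_times_line c) ` cdom (chart_times_line c) = {u. vector [u $ 1, u $ 2] \<in> coord c ` cdom c}"
proof (intro set_eqI iffI)
  fix u :: "real^3" assume "u \<in> coord (chart_times_line c) ` cdom (chart_times_line c)"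
  then obtain p t where "p \<in> cdom c" "u = vector [coord c p $ 1, coord c p $ 2, t]"
    by (auto simp: chart_times_line_def)
  moreover from this have "vector [u $ 1, u $ 2] = coord c p" by (simp add: vec_eq_iff forall_2)
  ultimately show "u \<in> {u. vector [u $ 1, u $ 2] \<in> coord c ` cdom c}" by simp
next
  fix u :: "real^3" assume "u \<in> {u. vector [u $ 1, u $ 2] \<in> coord c ` cdom c}"
  then obtain p where p: "p \<in> cdom c" "vector [u $ 1, u $ 2] = coord c p" by auto
  then have "u = coord (chart_times_line c) (p, u $ 3)"
    by (simp add: chart_times_line_def vec_eq_iff forall_3 forall_2)
  then show "u \<in> coord (chart_times_line c) ` cdom (chart_times_line c)"
    using p by (auto simp: chart_times_line_def intro!: image_eqI[of _ _ "(p, u $ 3)"])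
qed

lemma geometric_target_times_line:
  assumes "topspace (top_space M) \<subseteq> (\<Union>c\<in>atlas M. cdom c)" "\<And>c. c \<in> atlas M \<Longrightarrow> openin (top_space M) (cdom c)"
    and "\<And>c. c \<in> atlas M \<Longrightarrow> geometry_domain {u. vector [u $ 1, u $ 2] \<in> coord c ` cdom c} (gram (chart_times_line c)) \<kappa> \<beta> E"
  shows "geometric_target (times_line M) \<kappa> \<beta> E"
proof -
  have "openin (prod_topology (top_space M) euclideanreal) (cdom (chart_times_line c))" if "c \<in> atlas M" for c
    using assms(2)[OF that] by (simp add: chart_times_line_def openin_prod_Times_iff)
  then show ?thesis
    using assms(1,3) unfolding geometric_target_def
    by (simp add: times_line_def coord_image_times_line) (auto simp: chart_times_line_def)
qed

lemma geometric_target_sphere_line: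
  "geometric_target (times_line round_sphere) 1 (- 1) (\<lambda>_. axis 3 1)"
proof (rule geometric_target_times_line)
  fix c :: "((real^2) \<times> real, 2) rchart" assume "c \<in> atlas round_sphere"
  then obtain s where s: "c = sphere_chart s" "s * s = 1" by (auto simp: round_sphere_def)
  then show "openin (top_space round_sphere) (cdom c)"
    using openin_sphere_dom by (simp add: round_sphere_def sphere_chart_def)
  have "gram (chart_times_line c) = (\<lambda>u. vector [vector [4 / (1 + ((u $ 1)\<^sup>2 + (u $ 2)\<^sup>2))\<^sup>2, 0, 0],
      vector [0, 4 / (1 + ((u $ 1)\<^sup>2 + (u $ 2)\<^sup>2))\<^sup>2, 0], vector [0, 0, 1]])"
  proof -
    have "(norm (vector [x, y] :: real^2))\<^sup>2 = x\<^sup>2 + y\<^sup>2" for x y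
      unfolding power2_norm_eq_inner by (simp add: inner_vec_def sum_2 power2_eq_square)
    then show ?thesis
      by (simp add: chart_times_line_def s gram_sphere_chart Let_def mat_def fun_eq_iff)
  qed
  moreover have "{u :: real^3. vector [u $ 1, u $ 2] \<in> coord c ` cdom c} = UNIV"
    by (simp add: s sphere_chart_def stereographic_image)
  ultimately show "geometry_domain {u. vector [u $ 1, u $ 2] \<in> coord c ` cdom c} (gram (chart_times_line c)) 1 (- 1) (\<lambda>_. axis 3 1)"
    using geometry_domain_sphere_product by simp
qed (use sphere_dom_cover in \<open>auto simp: round_sphere_def sphere_chart_def\<close>)

lemma geometric_target_hyperbolic_line:
  "geometric_target (times_line (hyperbolic 2)) (- 1) 1 (\<lambda>_. axis 3 1)"
proof (rule geometric_target_times_line)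
  fix c :: "(real^2, 2) rchart" assume "c \<in> atlas (hyperbolic 2)"
  then have c: "c = \<lparr>cdom = {u. u $ 2 > 0}, coord = id, gram = (\<lambda>u. (1 / (u $ 2)\<^sup>2) *\<^sub>R mat 1)\<rparr>"
    by (simp add: hyperbolic_def open_manifold_def)
  then show "openin (top_space (hyperbolic 2)) (cdom c)"
    by (simp add: hyperbolic_def open_manifold_def)
  have "gram (chart_times_line c) = (\<lambda>u. vector [vector [1 / (u $ 2)\<^sup>2, 0, 0], vector [0, 1 / (u $ 2)\<^sup>2, 0], vector [0, 0, 1]])"
    by (simp add: chart_times_line_def c Let_def mat_def fun_eq_iff)
  moreover have "{u :: real^3. vector [u $ 1, u $ 2] \<in> coord c ` cdom c} = {u. u $ 2 > 0}"
    by (simp add: c)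
  ultimately show "geometry_domain {u. vector [u $ 1, u $ 2] \<in> coord c ` cdom c} (gram (chart_times_line c)) (- 1) 1 (\<lambda>_. axis 3 1)"
    using geometry_domain_hyperbolic_product by simp
qed (auto simp: hyperbolic_def open_manifold_def)

section \<open>Passing to charts\<close>

lemma chart_inv_coord:
  assumes "riemannian_chart X c" "y \<in> cdom c"
  shows "chart_inv c (coord c y) = y"
proof -
  have "homeomorphic_map (subtopology X (cdom c)) (top_of_set (coord c ` cdom c)) (coord c)"
    and o: "openin X (cdom c)" using assms(1) by (auto simp: riemannian_chart_def)
  then have "inj_on (coord c) (topspace (subtopology X (cdom c)))"
    by (simp add: homeomorphic_map_def bijective_open_imp_homeomorphic_map homeomorphic_imp_injective_map)
  moreover have "topspace (subtopology X (cdom c)) = cdom c"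
    using openin_subset[OF o] by auto
  ultimately show ?thesis using assms(2) by (simp add: chart_inv_def inv_into_f_f)
qed

lemma open_coord_image:
  assumes "riemannian_chart X c" "openin X U" "U \<subseteq> cdom c"
  shows "open (coord c ` U)"
proof -
  have h: "homeomorphic_map (subtopology X (cdom c)) (top_of_set (coord c ` cdom c)) (coord c)"
    and o: "open (coord c ` cdom c)" using assms(1) by (auto simp: riemannian_chart_def)
  have "openin (subtopology X (cdom c)) U"
    using assms(2,3) by (simp add: openin_subtopology) blast
  then have "openin (top_of_set (coord c ` cdom c)) (coord c ` U)"
    using h homeomorphic_imp_open_map open_map_def by blast
  then show ?thesis using o by (rule openin_open_trans)
qed

lemma openin_coord_preimage:
  assumes "riemannian_chart X c" "open B" "B \<subseteq> coord c ` cdom c"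
  shows "openin X (chart_inv c ` B)"
proof -
  have h: "homeomorphic_map (subtopology X (cdom c)) (top_of_set (coord c ` cdom c)) (coord c)"
    and o: "openin X (cdom c)" using assms(1) by (auto simp: riemannian_chart_def)
  have "openin (top_of_set (coord c ` cdom c)) B" using assms(2,3) open_subset by blast
  then have "openin (subtopology X (cdom c)) {x \<in> topspace (subtopology X (cdom c)). coord c x \<in> B}"
    using homeomorphic_imp_continuous_map[OF h] by (auto simp: continuous_map_def)
  moreover have "{x \<in> topspace (subtopology X (cdom c)). coord c x \<in> B} = chart_inv c ` B"
  proof (intro set_eqI iffI)
    fix x assume "x \<in> {x \<in> topspace (subtopology X (cdom c)). coord c x \<in> B}"
    then have "x \<in> cdom c" "coord c x \<in> B" by auto
    then show "x \<in> chart_inv c ` B" using chart_inv_coord[OF assms(1)] by (metis imageI)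
  next
    fix x assume "x \<in> chart_inv c ` B"
    then obtain y where "y \<in> cdom c" "x = chart_inv c (coord c y)" "coord c y \<in> B" using assms(3) by auto
    then show "x \<in> {x \<in> topspace (subtopology X (cdom c)). coord c x \<in> B}"
      using chart_inv_coord[OF assms(1)] openin_subset[OF o] by auto
  qed
  ultimately show ?thesis using openin_trans_full[OF _ o] by metis
qed

lemma local_rep_patch:
  assumes M: "riemannian_manifold M" and imm: "isometric_immersion M N \<phi>"
    and N: "geometric_target N \<kappa> \<beta> E"
    and c: "c \<in> atlas M" and d: "d \<in> atlas N"
  shows "open (rep_dom c d \<phi>)"
    and "riemannian_map (coord d ` cdom d) (gram d) (rep_dom c d \<phi>) (local_rep c d \<phi>)"
    and "u \<in> rep_dom c d \<phi> \<Longrightarrow> gram c u $ i $ j =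
      metric_ip (gram d (local_rep c d \<phi> u)) (pd i (local_rep c d \<phi>) u) (pd j (local_rep c d \<phi>) u)"
    and "u \<in> rep_dom c d \<phi> \<Longrightarrow> v \<noteq> 0 \<Longrightarrow> metric_ip (gram c u) v v > 0"
    and "u \<in> rep_dom c d \<phi> \<Longrightarrow> chart_inv c u \<in> cdom c \<and> coord c (chart_inv c u) = u
      \<and> \<phi> (chart_inv c u) \<in> cdom d \<and> local_rep c d \<phi> u = coord d (\<phi> (chart_inv c u))"
proof -
  have rc: "riemannian_chart (top_space M) c" using M c by (simp add: riemannian_manifold_def)
  have cont: "continuous_map (top_space M) (top_space N) \<phi>"
    and sm: "smooth_on (local_rep c d \<phi>) (rep_dom c d \<phi>)"
    using imm c d by (auto simp: isometric_immersion_def smooth_map_def)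
  have od: "openin (top_space N) (cdom d)" and gd: "geometry_domain (coord d ` cdom d) (gram d) \<kappa> \<beta> E"
    using N d by (auto simp: geometric_target_def)
  have oc: "openin (top_space M) (cdom c)" using rc by (simp add: riemannian_chart_def)
  have "openin (top_space M) {x \<in> topspace (top_space M). \<phi> x \<in> cdom d}"
    by (rule openin_continuous_map_preimage[OF cont od])
  from openin_Int[OF oc this] have "openin (top_space M) (cdom c \<inter> {x \<in> topspace (top_space M). \<phi> x \<in> cdom d})" .
  moreover have "cdom c \<inter> {x \<in> topspace (top_space M). \<phi> x \<in> cdom d} = cdom c \<inter> \<phi> -` cdom d"
    using openin_subset[OF oc] by auto
  ultimately have "openin (top_space M) (cdom c \<inter> \<phi> -` cdom d)" by simp
  then show op: "open (rep_dom c d \<phi>)"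
    unfolding rep_dom_def by (rule open_coord_image[OF rc]) auto
  show u: "chart_inv c u \<in> cdom c \<and> coord c (chart_inv c u) = u
      \<and> \<phi> (chart_inv c u) \<in> cdom d \<and> local_rep c d \<phi> u = coord d (\<phi> (chart_inv c u))"
    if ru: "u \<in> rep_dom c d \<phi>" for u
  proof -
    obtain y where "y \<in> cdom c" "\<phi> y \<in> cdom d" "u = coord c y" using ru unfolding rep_dom_def by blast
    then show ?thesis by (simp add: chart_inv_coord[OF rc] local_rep_def)
  qed
  interpret geometry_domain "coord d ` cdom d" "gram d" \<kappa> \<beta> E by fact
  show "riemannian_map (coord d ` cdom d) (gram d) (rep_dom c d \<phi>) (local_rep c d \<phi>)"
    by unfold_locales (use op sm u in auto)
  show "u \<in> rep_dom c d \<phi> \<Longrightarrow> gram c u $ i $ j =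
      metric_ip (gram d (local_rep c d \<phi> u)) (pd i (local_rep c d \<phi>) u) (pd j (local_rep c d \<phi>) u)"
    using imm c d by (auto simp: isometric_immersion_def)
  show "u \<in> rep_dom c d \<phi> \<Longrightarrow> v \<noteq> 0 \<Longrightarrow> metric_ip (gram c u) v v > 0"
    using rc by (auto simp: riemannian_chart_def rep_dom_def)
qed

lemma surface_patch_at:
  assumes M: "riemannian_manifold M" and imm: "isometric_immersion M N \<phi>"
    and N: "geometric_target N \<kappa> \<beta> E"
    and c: "c \<in> atlas M" and d: "d \<in> atlas N" and p: "p \<in> rep_dom c d \<phi>"
  obtains r \<xi> where "r > 0" "ball p r \<subseteq> rep_dom c d \<phi>"
    "surface_patch (coord d ` cdom d) (gram d) \<kappa> \<beta> E (ball p r) (local_rep c d \<phi>) (gram c) \<xi>"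
proof -
  have "geometry_domain (coord d ` cdom d) (gram d) \<kappa> \<beta> E" using N d by (auto simp: geometric_target_def)
  from unit_normal_exists[OF this local_rep_patch(2)[OF M imm N c d], of "gram c" p]
    local_rep_patch(3,4)[OF M imm N c d] p that show ?thesis by blast
qed

lemma surface_patch_local_unit_normal:
  assumes "surface_patch D H \<kappa> \<beta> E W F G \<xi>"
  shows "local_unit_normal H F W \<xi>"
proof -
  interpret surface_patch D H \<kappa> \<beta> E W F G \<xi> by fact
  show ?thesis
    unfolding local_unit_normal_def
    using open_source normal_smooth normal_unit normal_orthogonal by blast
qed

text \<open>On a ball the mean curvature is continuous with values in {k, -k}, hence constant; if
  the value is -k, the normal is reversed.\<close>

lemma cmc_patch_at:
  assumes M: "riemannian_manifold M" and imm: "isometric_immersion M N \<phi>"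
    and N: "geometric_target N \<kappa> \<beta> E" and k: "has_abs_mean_curvature M N \<phi> k"
    and c: "c \<in> atlas M" and d: "d \<in> atlas N" and p: "p \<in> rep_dom c d \<phi>"
  obtains r \<xi> where "r > 0" "ball p r \<subseteq> rep_dom c d \<phi>" "k \<ge> 0"
    "cmc_patch (coord d ` cdom d) (gram d) \<kappa> \<beta> E (ball p r) (local_rep c d \<phi>) (gram c) \<xi> k"
proof -
  obtain r \<xi> where r: "r > 0" "ball p r \<subseteq> rep_dom c d \<phi>"
    and s: "surface_patch (coord d ` cdom d) (gram d) \<kappa> \<beta> E (ball p r) (local_rep c d \<phi>) (gram c) \<xi>"
    using surface_patch_at[OF M imm N c d p] .
  interpret surface_patch "coord d ` cdom d" "gram d" \<kappa> \<beta> E "ball p r" "local_rep c d \<phi>" "gram c" \<xi> by fact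
  let ?H = "mean_curvature (gram c) (gram d) (local_rep c d \<phi>)"
  have abs: "\<bar>?H \<xi> u\<bar> = k" if "u \<in> ball p r" for u
    using k c d r(2) surface_patch_local_unit_normal[OF s] that unfolding has_abs_mean_curvature_def by blast
  have k0: "k \<ge> 0" using abs[of p] r(1) by auto
  have "?H \<xi> constant_on ball p r"
  proof (rule continuous_finite_range_constant)
    have "?H \<xi> ` ball p r \<subseteq> {k, - k}" using abs by force
    then show "finite (?H \<xi> ` ball p r)" by (rule finite_subset) simp
  qed (simp_all add: mean_curvature_continuous)
  then obtain h where h: "\<And>u. u \<in> ball p r \<Longrightarrow> ?H \<xi> u = h" by (auto simp: constant_on_def)
  have "h = k \<or> - h = k" using abs[of p] h[of p] r(1) by (auto simp: abs_if split: if_splits)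
  then show ?thesis
  proof
    assume "h = k"
    then have "cmc_patch (coord d ` cdom d) (gram d) \<kappa> \<beta> E (ball p r) (local_rep c d \<phi>) (gram c) \<xi> k"
      using h s by (simp add: cmc_patch_def cmc_patch_axioms_def)
    then show ?thesis using that r k0 by blast
  next
    assume "- h = k"
    then have "cmc_patch (coord d ` cdom d) (gram d) \<kappa> \<beta> E (ball p r) (local_rep c d \<phi>) (gram c) (\<lambda>u. - \<xi> u) k"
      using h surface_patch_flip[OF s] by (simp add: cmc_patch_def cmc_patch_axioms_def)
    then show ?thesis using that r k0 by blast
  qed
qed

lemma point_in_rep_dom:
  assumes M: "riemannian_manifold M" and imm: "isometric_immersion M N \<phi>"
    and N: "geometric_target N \<kappa> \<beta> E" and x: "x \<in> topspace (top_space M)"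
  obtains c d where "c \<in> atlas M" "d \<in> atlas N" "x \<in> cdom c" "\<phi> x \<in> cdom d" "coord c x \<in> rep_dom c d \<phi>"
proof -
  have "x \<in> (\<Union>c\<in>atlas M. cdom c)" using M x by (simp add: riemannian_manifold_def)
  then obtain c where c: "c \<in> atlas M" "x \<in> cdom c" by blast
  have "continuous_map (top_space M) (top_space N) \<phi>" using imm by (auto simp: isometric_immersion_def smooth_map_def)
  then have "\<phi> x \<in> topspace (top_space N)" using x by (auto simp: continuous_map_def)
  then obtain d where d: "d \<in> atlas N" "\<phi> x \<in> cdom d" using N by (auto simp: geometric_target_def)
  show ?thesis using that[OF c(1) d(1) c(2) d(2)] c d by (auto simp: rep_dom_def)
qed

lemma not_minimal_nonzero:
  "isometric_immersion M N \<phi> \<Longrightarrow> has_abs_mean_curvature M N \<phi> k \<Longrightarrow> \<not> minimal_surface M N \<phi> \<Longrightarrow> k \<noteq> 0"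
  by (auto simp: minimal_surface_def)

lemma biharmonic_cmc_equations:
  assumes M: "riemannian_manifold M" and N: "geometric_target N \<kappa> \<beta> E" and x: "x \<in> topspace (top_space M)"
    and k: "has_abs_mean_curvature M N \<phi> k" and pb: "proper_biharmonic M N \<phi>"
  obtains c d r \<xi> where "c \<in> atlas M" "d \<in> atlas N" "x \<in> cdom c" "\<phi> x \<in> cdom d"
    "r > 0" "ball (coord c x) r \<subseteq> rep_dom c d \<phi>" "k > 0"
    "cmc_patch (coord d ` cdom d) (gram d) \<kappa> \<beta> E (ball (coord c x) r) (local_rep c d \<phi>) (gram c) \<xi> k"
    "\<And>u. u \<in> ball (coord c x) r \<Longrightarrow> bitension (gram c) (gram d) (local_rep c d \<phi>) u = 0"
proof -
  have imm: "isometric_immersion M N \<phi>" and bi: "biharmonic M N \<phi>" and nm: "\<not> minimal_surface M N \<phi>"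
    using pb by (auto simp: proper_biharmonic_def)
  obtain c d where cd: "c \<in> atlas M" "d \<in> atlas N" "x \<in> cdom c" "\<phi> x \<in> cdom d" "coord c x \<in> rep_dom c d \<phi>"
    using point_in_rep_dom[OF M imm N x] .
  obtain r \<xi> where r: "r > 0" "ball (coord c x) r \<subseteq> rep_dom c d \<phi>" "k \<ge> 0"
    "cmc_patch (coord d ` cdom d) (gram d) \<kappa> \<beta> E (ball (coord c x) r) (local_rep c d \<phi>) (gram c) \<xi> k"
    using cmc_patch_at[OF M imm N k cd(1,2,5)] .
  show ?thesis
    by (rule that[OF cd(1-4) r(1,2) _ r(4)])
      (use not_minimal_nonzero[OF imm k nm] r bi cd in \<open>auto simp: biharmonic_def\<close>)
qed

text \<open>The largest Ricci curvature of a unit normal is \<open>2 * \<kappa> + \<beta>\<close>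
  (normal across the axis) if \<open>\<beta> \<le> 0\<close>, and
  \<open>2 * \<kappa> + 2 * \<beta>\<close> (normal along the axis) otherwise; \<open>ric\<close>
  makes it nonpositive.\<close>

lemma not_proper_biharmonic_nonpositive_ricci:
  assumes M: "riemannian_manifold M" and ne: "topspace (top_space M) \<noteq> {}"
    and N: "geometric_target N \<kappa> \<beta> E" and cmc: "cmc_surface M N \<phi>"
    and ric: "\<beta> \<le> 0 \<and> 2 * \<kappa> + \<beta> \<le> 0 \<or> \<beta> > 0 \<and> 2 * \<kappa> + 2 * \<beta> \<le> 0"
  shows "\<not> proper_biharmonic M N \<phi>"
proof
  assume pb: "proper_biharmonic M N \<phi>"
  obtain k where k: "has_abs_mean_curvature M N \<phi> k" using cmc by (auto simp: cmc_surface_def)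
  obtain x where x: "x \<in> topspace (top_space M)" using ne by blast
  obtain c d r \<xi> where r: "r > 0" "k > 0"
    "cmc_patch (coord d ` cdom d) (gram d) \<kappa> \<beta> E (ball (coord c x) r) (local_rep c d \<phi>) (gram c) \<xi> k"
    "\<And>u. u \<in> ball (coord c x) r \<Longrightarrow> bitension (gram c) (gram d) (local_rep c d \<phi>) u = 0"
    using biharmonic_cmc_equations[OF M N x k pb] by metis
  interpret cmc_patch "coord d ` cdom d" "gram d" \<kappa> \<beta> E "ball (coord c x) r" "local_rep c d \<phi>" "gram c" \<xi> k by fact
  have u: "coord c x \<in> ball (coord c x) r" using r(1) by simp
  have "2 * \<kappa> + \<beta> + \<beta> * (\<eta> (coord c x) (\<xi> (coord c x)))\<^sup>2 \<le> 0"
    using ric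
  proof
    assume "\<beta> \<le> 0 \<and> 2 * \<kappa> + \<beta> \<le> 0"
    then show ?thesis using mult_nonpos_nonneg[of \<beta> "(\<eta> (coord c x) (\<xi> (coord c x)))\<^sup>2"] by simp
  next
    assume b: "\<beta> > 0 \<and> 2 * \<kappa> + 2 * \<beta> \<le> 0"
    then have "\<beta> * (\<eta> (coord c x) (\<xi> (coord c x)))\<^sup>2 \<le> \<beta> * 1"
      using axis_normal_le[OF u] by (intro mult_left_mono) auto
    then show ?thesis using b by linarith
  qed
  then show False using not_biharmonic[OF u] r(2) r(4)[OF u] by simp
qed

text \<open>The Ricci curvature l^2/2 along the axis is positive, so
  \<open>not_proper_biharmonic_nonpositive_ricci\<close> does not apply. As
  \<open>\<beta> > 0\<close>, the tangential equation has full force; it makes the axis normal on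
  all of \<open>W\<close>, and the surface would integrate the contact planes.\<close>

lemma not_proper_biharmonic_BCV:
  assumes M: "riemannian_manifold M" and ne: "topspace (top_space M) \<noteq> {}"
    and ml: "m \<le> 0" "l \<noteq> 0" and cmc: "cmc_surface M (BCV m l) \<phi>"
  shows "\<not> proper_biharmonic M (BCV m l) \<phi>"
proof
  assume pb: "proper_biharmonic M (BCV m l) \<phi>"
  obtain k where k: "has_abs_mean_curvature M (BCV m l) \<phi> k" using cmc by (auto simp: cmc_surface_def)
  obtain x where x: "x \<in> topspace (top_space M)" using ne by blast
  define \<kappa> where "\<kappa> = 4 * m - 3 * l\<^sup>2 / 4"
  define \<beta> where "\<beta> = l\<^sup>2 - 4 * m"
  have N: "geometric_target (BCV m l) \<kappa> \<beta> (\<lambda>_. axis 3 1)"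
    unfolding \<kappa>_def \<beta>_def by (rule geometric_target_BCV)
  have l2: "l\<^sup>2 > 0" using ml by simp
  obtain c d r \<xi> where d: "d \<in> atlas (BCV m l)" and r: "r > 0" "k > 0"
    "cmc_patch (coord d ` cdom d) (gram d) \<kappa> \<beta> (\<lambda>_. axis 3 1) (ball (coord c x) r) (local_rep c d \<phi>) (gram c) \<xi> k"
    "\<And>u. u \<in> ball (coord c x) r \<Longrightarrow> bitension (gram c) (gram d) (local_rep c d \<phi>) u = 0"
    using biharmonic_cmc_equations[OF M N x k pb] by metis
  define F where "F = local_rep c d \<phi>"
  define W where "W = ball (coord c x) r"
  interpret cmc_patch "coord d ` cdom d" "gram d" \<kappa> \<beta> "\<lambda>_. axis 3 1" W F "gram c" \<xi> k
    unfolding F_def W_def by fact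
  have eta_F: "\<eta> u (pd i F u) = 0" if u: "u \<in> W" for u i
  proof (rule ccontr)
    assume "\<eta> u (pd i F u) \<noteq> 0"
    moreover have bi: "bitension (gram c) (gram d) F u = 0" using r(4) u by (simp add: F_def W_def)
    moreover have "\<beta> > 0" using l2 ml(1) unfolding \<beta>_def by linarith
    ultimately have "\<eta> u (\<xi> u) = 0"
      using bitension_zero_iff[OF u] r(2) by (metis less_irrefl mult_eq_0_iff)
    moreover have "8 * m \<le> l\<^sup>2" using l2 ml(1) by linarith
    then have "2 * \<kappa> + \<beta> \<le> 0" by (simp add: \<kappa>_def \<beta>_def)
    ultimately show False using not_biharmonic[OF u] r(2) bi by simp
  qed
  let ?w = "\<lambda>u. 1 + m * ((u $ 1)\<^sup>2 + (u $ 2)\<^sup>2)"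
  have wpos: "?w (F u) > 0" if "u \<in> W" for u
    using map_into[OF that] d by (auto simp: BCV_def open_manifold_def)
  have gr: "gram d y $ 3 $ 1 = l / 2 * (y $ 2 / ?w y)" "gram d y $ 3 $ 2 = - (l / 2 * (y $ 1 / ?w y))" "gram d y $ 3 $ 3 = 1" for y
    using d by (simp_all add: BCV_def open_manifold_def Let_def)
  have ed: "\<eta> u v = l / 2 * (F u $ 2 / ?w (F u)) * v $ 1 - l / 2 * (F u $ 1 / ?w (F u)) * v $ 2 + v $ 3" for u v
    unfolding \<eta>_def metric_ip_def sum_3 gr by (simp add: axis_def)
  define u where "u = coord c x"
  have u: "u \<in> W" using r(1) by (simp add: u_def W_def)
  define q where "q = 2 / l"
  have q: "q \<noteq> 0" using ml(2) by (simp add: q_def)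
  define z where "z i v = F v $ 2 * (pd i F v $ 1) - F v $ 1 * (pd i F v $ 2) + q * (pd i F v $ 3 * ?w (F v))" for i v
    \<comment> \<open>a multiple of the contact form on \<open>\<partial>\<^sub>i F\<close>\<close>
  have z: "z i v = 0" if "v \<in> W" for i v
    using eta_F[OF that, of i] wpos[OF that] ml(2) unfolding ed z_def q_def by (simp add: field_simps)
  have dF: "(\<lambda>x. F x $ a) differentiable (at u)" "(\<lambda>x. pd i F x $ a) differentiable (at u)" for a i
    by (intro differentiable_nth map_differentiable pd_map_differentiable u)+
  \<comment> \<open>The contact form vanishes identically on the coordinate vectors, hence so do its
    derivatives. Their antisymmetrisation in \<open>e0\<close> loses the second derivatives of
    \<open>F\<close> and is the exterior derivative of the form.\<close>
  have pz: "pd j (z i) u = 0" for i j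
  proof -
    have "pd j (z i) u = pd j (\<lambda>_. 0 :: real) u" by (rule pd_cong_open[OF open_source u]) (rule z)
    then show ?thesis by simp
  qed
  have pF: "pd j (\<lambda>x. F x $ a) u = pd j F u $ a" "pd j (\<lambda>x. pd i F x $ a) u = pd j (pd i F) u $ a" for i j a
    by (rule pd_nth; intro map_differentiable pd_map_differentiable u)+
  have pz': "pd j (z i) u = pd j F u $ 2 * (pd i F u $ 1) + F u $ 2 * (pd j (pd i F) u $ 1)
     - (pd j F u $ 1 * (pd i F u $ 2) + F u $ 1 * (pd j (pd i F) u $ 2))
     + q * (pd j (pd i F) u $ 3 * ?w (F u) + pd i F u $ 3 * (m * (2 * F u $ 1 * pd j F u $ 1 + 2 * F u $ 2 * pd j F u $ 2)))" for i j
    unfolding z_def[abs_def]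
    by (simp add: pd_add pd_diff pd_mult pd_power2 dF pF differentiable_add differentiable_diff differentiable_mult differentiable_power)
  have sy: "pd 1 (pd 2 F) u = pd 2 (pd 1 F) u" by (rule pd_pd_commute[OF open_source u map_smooth])
  define x where "x = F u $ 1"
  define y where "y = F u $ 2"
  define a where "a i = pd 1 F u $ i" for i
  define b' where "b' i = pd 2 F u $ i" for i
  define w where "w = 1 + m * (x\<^sup>2 + y\<^sup>2)"
  \<comment> \<open>The area of the tangent plane projected to the x-y plane.\<close>
  define \<delta> where "\<delta> = a 1 * b' 2 - a 2 * b' 1"
  have w: "w > 0" using wpos[OF u] by (simp add: w_def x_def y_def)
  have e0: "\<delta> = q * m * (b' 3 * (x * a 1 + y * a 2) - a 3 * (x * b' 1 + y * b' 2))"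
    using pz[of 1 2] pz[of 2 1] unfolding pz' sy \<delta>_def x_def y_def a_def b'_def
    by (simp add: algebra_simps)
  have za: "q * (a 3 * w) = x * a 2 - y * a 1" and zb: "q * (b' 3 * w) = x * b' 2 - y * b' 1"
    using z[OF u, of 1] z[OF u, of 2] unfolding z_def x_def y_def a_def b'_def w_def by simp_all
  \<comment> \<open>Once the third components are eliminated, the right side is
    \<open>(w - 1) * \<delta>\<close>, so \<open>\<delta>\<close> vanishes.\<close>
  have "\<delta> * w = m * ((q * (b' 3 * w)) * (x * a 1 + y * a 2) - (q * (a 3 * w)) * (x * b' 1 + y * b' 2))"
    unfolding e0 by (simp add: algebra_simps)
  also have "\<dots> = m * (x\<^sup>2 + y\<^sup>2) * \<delta>"
    unfolding za zb \<delta>_def by (simp add: power2_eq_square algebra_simps)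
  finally have \<delta>: "\<delta> = 0" by (simp add: w_def algebra_simps)
  \<comment> \<open>On the kernel of the contact form the third component is determined by the other
    two. A dependence of the projections is therefore one of the coordinate vectors, which the Gram
    determinant forbids.\<close>
  have "c' = 0" if "c' * a 1 = e * b' 1" "c' * a 2 = e * b' 2" for c' e
  proof -
    have "q * w * (c' * a 3) = c' * (q * (a 3 * w))" by simp
    also have "\<dots> = x * (c' * a 2) - y * (c' * a 1)" unfolding za by (simp add: algebra_simps)
    also have "\<dots> = e * (q * (b' 3 * w))" unfolding that zb by (simp add: algebra_simps)
    finally have "q * w * (c' * a 3) = q * w * (e * b' 3)" by simp
    then have "c' * a 3 = e * b' 3" using w q by simp
    then have v: "c' *\<^sub>R pd 1 F u = e *\<^sub>R pd 2 F u"
      using that by (simp add: vec_eq_iff forall_3 a_def b'_def)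
    have "c' * g11 u = e * g12 u" "c' * g12 u = e * g22 u"
      using arg_cong[OF v, of "\<lambda>v. ip u v (pd 1 F u)"] arg_cong[OF v, of "\<lambda>v. ip u v (pd 2 F u)"]
      by (simp_all add: metric_ip_simps ip_pd_pd[OF u])
    then have "c' * gdet u = 0" unfolding gdet_def by algebra
    then show "c' = 0" using g_pos[OF u] by simp
  qed note dep = this
  have "b' 1 = 0" using dep[of "b' 1" "a 1"] \<delta> by (simp add: \<delta>_def mult.commute)
  moreover have "b' 2 = 0" using dep[of "b' 2" "a 2"] \<delta> by (simp add: \<delta>_def mult.commute)
  moreover from calculation have "b' 3 = 0" using zb w q by simp
  ultimately have "pd 2 F u = 0" by (simp add: vec_eq_iff forall_3 b'_def)
  then show False using g_pos(2)[OF u] by (simp add: g22_def)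
qed

section \<open>Surfaces in four-dimensional Euclidean space\<close>

text \<open>Otherwise five pairwise orthogonal nonzero vectors would be independent in dimension
  four.\<close>

lemma orthogonal_frame_zero:
  fixes v :: "'e::euclidean_space"
  assumes "DIM('e) = 4" "a \<noteq> 0" "b \<noteq> 0" "c \<noteq> 0" "d \<noteq> 0"
    and "a \<bullet> b = 0" "a \<bullet> c = 0" "a \<bullet> d = 0" "b \<bullet> c = 0" "b \<bullet> d = 0" "c \<bullet> d = 0"
    and "v \<bullet> a = 0" "v \<bullet> b = 0" "v \<bullet> c = 0" "v \<bullet> d = 0"
  shows "v = 0"
proof (rule ccontr)
  assume v: "v \<noteq> 0"
  have d: "distinct [v, a, b, c, d]" using assms v by auto
  have "pairwise orthogonal {v, a, b, c, d}"
    using assms by (auto simp: pairwise_def orthogonal_def inner_commute)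
  then have "independent {v, a, b, c, d}"
    using assms v by (intro pairwise_orthogonal_independent) auto
  then have "card {v, a, b, c, d} \<le> DIM('e)" using independent_card_le by blast
  then show False using d assms(1) by simp
qed

text \<open>One orthogonalisation step replaces \<open>b\<close> by \<open>b'\<close>, which is
  nonzero because its product with \<open>b\<close> is the Gram determinant.\<close>

lemma tangent_frame_zero:
  fixes v :: "'e::euclidean_space"
  assumes "DIM('e) = 4" "(a \<bullet> a) * (b \<bullet> b) - (a \<bullet> b) * (a \<bullet> b) > 0" "c \<noteq> 0" "d \<noteq> 0"
    and "a \<bullet> c = 0" "a \<bullet> d = 0" "b \<bullet> c = 0" "b \<bullet> d = 0" "c \<bullet> d = 0"
    and "v \<bullet> a = 0" "v \<bullet> b = 0" "v \<bullet> c = 0" "v \<bullet> d = 0"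
  shows "v = 0"
proof -
  have a: "a \<noteq> 0" using assms(2) by auto
  then have aa: "a \<bullet> a > 0" by simp
  define b' where "b' = (a \<bullet> a) *\<^sub>R b - (a \<bullet> b) *\<^sub>R a"
  have "b' \<bullet> b = (a \<bullet> a) * (b \<bullet> b) - (a \<bullet> b) * (a \<bullet> b)" by (simp add: b'_def inner_diff_left)
  then have "b' \<noteq> 0" using assms(2) by auto
  then show ?thesis
    by (intro orthogonal_frame_zero[OF assms(1) a _ assms(3,4), of b'])
      (use assms in \<open>simp_all add: b'_def inner_diff_left inner_diff_right inner_commute\<close>)
qed

lemma singular_2_kernel:
  fixes p q r :: real
  assumes "p * r - q * q = 0"
  obtains y z where "y \<noteq> 0 \<or> z \<noteq> 0" "y * p + z * q = 0" "y * q + z * r = 0"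
proof (cases "p = 0 \<and> q = 0")
  case True
  then show ?thesis using that[of 1 0] by simp
next
  case False
  show ?thesis
  proof (rule that[of q "- p"])
    show "q \<noteq> 0 \<or> - p \<noteq> 0" using False by auto
    show "q * p + - p * q = 0" by simp
    show "q * q + - p * r = 0" using assms by simp
  qed
qed

text \<open>A surface \<open>X\<close> with unit normal \<open>\<xi>\<close> inside the unit sphere of \<open>\<real>\<^sup>4\<close>
  (for \<open>e = 0\<close>) or inside the unit cylinder around the axis \<open>e\<close>: the normal of the
  ambient hypersurface at \<open>X\<close> is the part of \<open>X\<close> orthogonal to \<open>e\<close>.\<close>

locale euclidean_surface =
  fixes e :: "'e::euclidean_space" and W :: "(real^2) set" and X \<xi> :: "real^2 \<Rightarrow> 'e"
  assumes dim4: "DIM('e) = 4"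
    and axis: "e = 0 \<or> e \<bullet> e = 1"
    and open_W: "open W"
    and X_smooth: "smooth_on X W" and \<xi>_smooth: "smooth_on \<xi> W"
    and gram_pos: "u \<in> W \<Longrightarrow> (pd 1 X u \<bullet> pd 1 X u) * (pd 2 X u \<bullet> pd 2 X u)
      - (pd 1 X u \<bullet> pd 2 X u) * (pd 1 X u \<bullet> pd 2 X u) > 0"
    and ambient_unit: "u \<in> W \<Longrightarrow> X u \<bullet> X u - (X u \<bullet> e) * (X u \<bullet> e) = 1"
    and \<xi>_unit: "u \<in> W \<Longrightarrow> \<xi> u \<bullet> \<xi> u = 1"
    and \<xi>_tangent: "u \<in> W \<Longrightarrow> \<xi> u \<bullet> pd i X u = 0"
    and \<xi>_ambient: "u \<in> W \<Longrightarrow> \<xi> u \<bullet> X u - (\<xi> u \<bullet> e) * (X u \<bullet> e) = 0"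
begin

definition P :: "'e \<Rightarrow> 'e" where "P v = v - (v \<bullet> e) *\<^sub>R e"

text \<open>The common consequence of \<open>e = 0\<close> and of \<open>e\<close> being a unit
  vector; it makes \<open>P\<close> an orthogonal projection in both cases.\<close>

lemma axis_cube: "(v \<bullet> e) * (e \<bullet> e) = v \<bullet> e"
  using axis by auto

lemma inner_P: "P v \<bullet> w = v \<bullet> w - (v \<bullet> e) * (w \<bullet> e)" "w \<bullet> P v = w \<bullet> v - (w \<bullet> e) * (v \<bullet> e)"
  by (simp_all add: P_def inner_diff_left inner_diff_right inner_commute)

lemma inner_P_axis: "P v \<bullet> e = 0" "e \<bullet> P v = 0"
  using axis_cube[of v] by (simp_all add: P_def inner_diff_left inner_diff_right inner_commute)

lemma P_linear: "bounded_linear P"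
  unfolding P_def
  by (intro bounded_linear_sub bounded_linear_ident bounded_linear_scaleR_const bounded_linear_inner_left)

lemma X_diff: "u \<in> W \<Longrightarrow> X differentiable (at u)"
  and \<xi>_diff: "u \<in> W \<Longrightarrow> \<xi> differentiable (at u)"
  and dX_diff: "u \<in> W \<Longrightarrow> pd i X differentiable (at u)"
  and d\<xi>_diff: "u \<in> W \<Longrightarrow> pd i \<xi> differentiable (at u)"
  using smooth_on_differentiable[OF X_smooth open_W] smooth_on_differentiable[OF \<xi>_smooth open_W]
    smooth_on_differentiable[OF smooth_on_pd[OF X_smooth] open_W]
    smooth_on_differentiable[OF smooth_on_pd[OF \<xi>_smooth] open_W] by blast+

lemma pd_inner_const:
  assumes u: "u \<in> W" and "f differentiable (at u)" "g differentiable (at u)" "\<And>x. x \<in> W \<Longrightarrow> f x \<bullet> g x = c"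
  shows "pd i f u \<bullet> g u = - (f u \<bullet> pd i g u)"
proof -
  have "pd i (\<lambda>x. f x \<bullet> g x) u = pd i (\<lambda>_. c) u" by (rule pd_cong_open[OF open_W u]) (rule assms(4))
  then show ?thesis using pd_inner[OF assms(2,3), of i] by simp
qed

lemma PX_diff: "u \<in> W \<Longrightarrow> (\<lambda>x. P (X x)) differentiable (at u)"
  by (rule differentiable_bounded_linear[OF P_linear X_diff])

lemma pd_PX: "u \<in> W \<Longrightarrow> pd i (\<lambda>x. P (X x)) u = P (pd i X u)"
  by (rule pd_bounded_linear[OF P_linear X_diff])

lemma PX_unit: assumes "u \<in> W" shows "P (X u) \<bullet> P (X u) = 1"
proof -
  have "P (X u) \<bullet> P (X u) = X u \<bullet> P (X u)" by (simp only: inner_P(1)[of "X u" "P (X u)"] inner_P_axis mult_zero_right diff_zero)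
  then show ?thesis using ambient_unit[OF assms] by (simp only: inner_P(2))
qed

lemma PX_tangent: assumes u: "u \<in> W" shows "P (X u) \<bullet> pd i X u = 0"
proof -
  have "pd i (\<lambda>x. P (X x)) u \<bullet> X u = - (P (X u) \<bullet> pd i X u)"
    by (rule pd_inner_const[OF u PX_diff[OF u] X_diff[OF u], where c = 1]) (use ambient_unit in \<open>simp add: inner_P\<close>)
  then show ?thesis by (simp add: pd_PX[OF u] inner_P inner_commute mult.commute)
qed

lemma PX_\<xi>: "u \<in> W \<Longrightarrow> P (X u) \<bullet> \<xi> u = 0"
  using \<xi>_ambient by (simp add: inner_P inner_commute mult.commute)

lemma frame4:
  assumes u: "u \<in> W" and "v \<bullet> pd 1 X u = 0" "v \<bullet> pd 2 X u = 0" "v \<bullet> \<xi> u = 0" "v \<bullet> P (X u) = 0"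
  shows "v = 0"
proof -
  have "\<xi> u \<noteq> 0" "P (X u) \<noteq> 0" using \<xi>_unit[OF u] PX_unit[OF u] by auto
  moreover have "pd i X u \<bullet> \<xi> u = 0" "pd i X u \<bullet> P (X u) = 0" "\<xi> u \<bullet> P (X u) = 0" for i
    using \<xi>_tangent[OF u] PX_tangent[OF u] PX_\<xi>[OF u] by (metis inner_commute)+
  ultimately show ?thesis
    by (intro tangent_frame_zero[OF dim4 gram_pos[OF u], of "\<xi> u" "P (X u)"] assms(2-)) auto
qed

lemma frame4_eq:
  assumes "u \<in> W" "\<And>i. v \<bullet> pd i X u = w \<bullet> pd i X u" "v \<bullet> \<xi> u = w \<bullet> \<xi> u" "v \<bullet> P (X u) = w \<bullet> P (X u)"
  shows "v = w"
  using frame4[of u "v - w"] assms by (simp add: inner_diff_left)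

lemma d\<xi>_\<xi>: "u \<in> W \<Longrightarrow> pd i \<xi> u \<bullet> \<xi> u = 0"
  using pd_inner_const[OF _ \<xi>_diff \<xi>_diff \<xi>_unit, of u i] by (simp add: inner_commute)

text \<open>For the cylinder the right side is the second fundamental form of the ambient
  hypersurface. It vanishes where the normal is orthogonal to the axis, and there the derivative of
  the normal is tangent to the surface.\<close>

lemma d\<xi>_PX: assumes u: "u \<in> W" shows "pd i \<xi> u \<bullet> P (X u) = (\<xi> u \<bullet> e) * (pd i X u \<bullet> e)"
proof -
  have "pd i \<xi> u \<bullet> P (X u) = - (\<xi> u \<bullet> pd i (\<lambda>x. P (X x)) u)"
    by (rule pd_inner_const[OF u \<xi>_diff[OF u] PX_diff[OF u], where c = 0]) (use PX_\<xi> in \<open>simp add: inner_commute\<close>)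
  then show ?thesis using \<xi>_tangent[OF u] by (simp add: pd_PX[OF u] inner_P)
qed

definition B :: "real^2 \<Rightarrow> 2 \<Rightarrow> 2 \<Rightarrow> real" where "B u i j = - (pd i \<xi> u \<bullet> pd j X u)"

lemma B_eq: assumes u: "u \<in> W" shows "B u i j = \<xi> u \<bullet> pd i (pd j X) u"
  using pd_inner_const[OF u \<xi>_diff[OF u] dX_diff[OF u] \<xi>_tangent, of i] by (simp add: B_def)

lemma B_sym: "u \<in> W \<Longrightarrow> B u i j = B u j i"
  using B_eq pd_pd_commute[OF open_W _ X_smooth] by metis

text \<open>Both exceptional surfaces are characterised by \<open>d\<xi> = - P dX\<close>, which says that
  \<open>P X + \<xi>\<close> is constant.\<close>

lemma constant_normal:
  assumes c: "connected W" and u: "u \<in> W" and eq: "\<And>x i. x \<in> W \<Longrightarrow> pd i \<xi> x = - P (pd i X x)"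
    and h: "\<And>x. x \<in> W \<Longrightarrow> \<xi> x \<bullet> e = 0"
  obtains \<nu> where "norm \<nu> = 1" "\<nu> \<bullet> e = 0" "\<And>x. x \<in> W \<Longrightarrow> \<nu> \<bullet> X x = 1 / sqrt 2"
proof -
  define N where "N x = P (X x) + \<xi> x" for x
  have "(N has_derivative (\<lambda>v. 0)) (at x)" if x: "x \<in> W" for x
  proof -
    have "pd i N x = 0" for i
      unfolding N_def by (subst pd_add[OF PX_diff[OF x] \<xi>_diff[OF x]]) (simp add: pd_PX[OF x] eq[OF x])
    moreover have "N differentiable (at x)" unfolding N_def by (intro differentiable_add PX_diff \<xi>_diff x)
    ultimately show "(N has_derivative (\<lambda>v. 0)) (at x)" using has_derivative_pd[of N x] by simp
  qed
  then have "N x = N u" if "x \<in> W" for x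
    by (rule has_derivative_zero_unique_connected[OF open_W c _ that u])
  then obtain n where n: "\<And>x. x \<in> W \<Longrightarrow> N x = n" by blast
  have "n \<bullet> n = 2"
    using PX_unit[OF u] PX_\<xi>[OF u] \<xi>_unit[OF u]
    by (simp add: n[OF u, symmetric] N_def inner_add_left inner_add_right inner_commute)
  moreover have "n \<bullet> e = 0"
    using h[OF u] by (simp add: n[OF u, symmetric] N_def inner_add_left inner_P_axis)
  moreover have "n \<bullet> X x = 1" if "x \<in> W" for x
    using ambient_unit[OF that] \<xi>_ambient[OF that] h[OF that]
    by (simp add: n[OF that, symmetric] N_def inner_add_left inner_P)
  moreover have "norm n = sqrt 2" using \<open>n \<bullet> n = 2\<close> by (simp add: norm_eq_sqrt_inner)
  \<comment> \<open>\<open>n\<close> is a sum of two orthonormal vectors, hence of length sqrt 2;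
    normalising it turns its product 1 with \<open>X\<close> into 1 / sqrt 2.\<close>
  ultimately show ?thesis using that[of "(1 / sqrt 2) *\<^sub>R n"] by simp
qed


abbreviation "gg u i j \<equiv> pd i X u \<bullet> pd j X u"

abbreviation "gd u \<equiv> gg u 1 1 * gg u 2 2 - gg u 1 2 * gg u 1 2"

text \<open>The third fundamental form computed in 4-space. By \<open>t\<close> the derivative of
  the normal is tangent to the surface and expands in the two coordinate vectors alone.\<close>

lemma inner_d\<xi>_d\<xi>:
  assumes u: "u \<in> W" and t: "\<xi> u \<bullet> e = 0"
  shows "gd u * (pd i \<xi> u \<bullet> pd j \<xi> u) =
    (gg u 2 2 * B u i 1 - gg u 1 2 * B u i 2) * B u j 1 + (gg u 1 1 * B u i 2 - gg u 1 2 * B u i 1) * B u j 2"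
proof -
  let ?a = "gg u 2 2 * B u i 1 - gg u 1 2 * B u i 2" and ?b = "gg u 1 1 * B u i 2 - gg u 1 2 * B u i 1"
  have "gd u *\<^sub>R pd i \<xi> u = - (?a *\<^sub>R pd 1 X u) - ?b *\<^sub>R pd 2 X u"
  proof (rule frame4_eq[OF u])
    fix l :: 2
    have "l = 1 \<or> l = 2" using exhaust_2 by blast
    then show "(gd u *\<^sub>R pd i \<xi> u) \<bullet> pd l X u = (- (?a *\<^sub>R pd 1 X u) - ?b *\<^sub>R pd 2 X u) \<bullet> pd l X u"
      by (elim disjE) (simp_all add: B_def inner_diff_left inner_commute[of "pd 2 X u" "pd 1 X u"] algebra_simps)
  next
    have "pd k X u \<bullet> \<xi> u = 0" "pd k X u \<bullet> P (X u) = 0" for k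
      using \<xi>_tangent[OF u, of k] PX_tangent[OF u, of k] by (simp_all add: inner_commute)
    then show "(gd u *\<^sub>R pd i \<xi> u) \<bullet> \<xi> u = (- (?a *\<^sub>R pd 1 X u) - ?b *\<^sub>R pd 2 X u) \<bullet> \<xi> u"
      "(gd u *\<^sub>R pd i \<xi> u) \<bullet> P (X u) = (- (?a *\<^sub>R pd 1 X u) - ?b *\<^sub>R pd 2 X u) \<bullet> P (X u)"
      by (simp_all add: inner_diff_left d\<xi>_\<xi>[OF u] d\<xi>_PX[OF u] t)
  qed
  then have "(gd u *\<^sub>R pd i \<xi> u) \<bullet> pd j \<xi> u = (- (?a *\<^sub>R pd 1 X u) - ?b *\<^sub>R pd 2 X u) \<bullet> pd j \<xi> u" by simp
  then show ?thesis by (simp add: inner_diff_left B_def inner_commute[of "pd _ X u" "pd j \<xi> u"])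
qed

text \<open>Isoparametric surfaces of the sphere with distinct principal curvatures are flat. Here
  \<open>V\<^sub>j\<close> and \<open>U\<^sub>j\<close> span the two principal line fields. The tensor
  \<open>\<langle>\<partial>\<^sub>i V\<^sub>j, U\<^sub>k\<rangle>\<close> is totally symmetric and vanishes, and one further
  derivative gives the Gauss equation \<open>1 + a c = 0\<close>.\<close>

lemma distinct_principal_curvatures:
  assumes e: "e = 0" and ac: "a \<noteq> c" and u: "u \<in> W"
    and trace: "\<And>x. x \<in> W \<Longrightarrow> gg x 2 2 * B x 1 1 - 2 * gg x 1 2 * B x 1 2 + gg x 1 1 * B x 2 2 = (a + c) * gd x"
    and det: "\<And>x. x \<in> W \<Longrightarrow> B x 1 1 * B x 2 2 - (B x 1 2)\<^sup>2 = a * c * gd x"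
  shows "1 + a * c = 0"
proof -
  define V where "V q j = (\<lambda>x. pd j \<xi> x + q *\<^sub>R pd j X x)" for q j
  have B21: "B x 2 1 = B x 1 2" if "x \<in> W" for x using B_sym[OF that] .
  have g21: "gg x 2 1 = gg x 1 2" for x by (rule inner_commute)
  have gd: "gd x \<noteq> 0" if "x \<in> W" for x using gram_pos[OF that] by simp
  have cases2: "(i = 1 \<or> i = 2)" for i :: 2 using exhaust_2 by blast
  \<comment> \<open>Cayley-Hamilton for the shape operator, whose trace is \<open>a + c\<close> and
    whose determinant is \<open>a * c\<close>.\<close>
  have CH: "pd i \<xi> x \<bullet> pd j \<xi> x = (a + c) * B x i j - a * c * gg x i j" if x: "x \<in> W" for x i j
  proof -
    have 3: "gd x * (pd i \<xi> x \<bullet> pd j \<xi> x) =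
      (gg x 2 2 * B x i 1 - gg x 1 2 * B x i 2) * B x j 1 + (gg x 1 1 * B x i 2 - gg x 1 2 * B x i 1) * B x j 2"
      by (rule inner_d\<xi>_d\<xi>[OF x]) (simp add: e)
    have "(gg x 2 2 * B x i 1 - gg x 1 2 * B x i 2) * B x j 1 + (gg x 1 1 * B x i 2 - gg x 1 2 * B x i 1) * B x j 2
      = (gg x 2 2 * B x 1 1 - 2 * gg x 1 2 * B x 1 2 + gg x 1 1 * B x 2 2) * B x i j
        - (B x 1 1 * B x 2 2 - (B x 1 2)\<^sup>2) * gg x i j"
      using cases2[of i] cases2[of j] by (elim disjE) (simp_all add: B21[OF x] g21 power2_eq_square algebra_simps)
    then have "gd x * (pd i \<xi> x \<bullet> pd j \<xi> x) = gd x * ((a + c) * B x i j - a * c * gg x i j)"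
      unfolding 3 trace[OF x] det[OF x] by (simp add: algebra_simps)
    then show ?thesis using gd[OF x] by simp
  qed
  have VX: "V q j x \<bullet> pd i X x = q * gg x j i - B x j i" for q i j x
    by (simp add: V_def inner_add_left B_def)
  \<comment> \<open>\<open>V a\<close> and \<open>V c\<close> carry the two linear factors of the
    characteristic polynomial; their product vanishes by \<open>CH\<close>.\<close>
  have VU: "V a i x \<bullet> V c j x = 0" if x: "x \<in> W" for x i j
  proof -
    have "pd i X x \<bullet> pd j \<xi> x = - B x i j" using B_sym[OF x, of i j] by (simp add: B_def inner_commute)
    moreover have "pd i \<xi> x \<bullet> pd j X x = - B x i j" by (simp add: B_def)
    ultimately show ?thesis
      by (simp add: V_def inner_add_left inner_add_right CH[OF x] algebra_simps)
  qed
  have ve: "v \<bullet> e = 0" for v by (simp add: e)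
  have PX: "P v = v" for v unfolding P_def by (simp add: e)
  have d\<xi>X: "pd j \<xi> x \<bullet> X x = 0" if "x \<in> W" for x j using d\<xi>_PX[OF that] by (simp add: PX ve)
  have dXX: "pd j X x \<bullet> X x = 0" if "x \<in> W" for x j using PX_tangent[OF that] by (simp add: PX inner_commute)
  have V_X: "V q j x \<bullet> X x = 0" and V_\<xi>: "V q j x \<bullet> \<xi> x = 0" if "x \<in> W" for q j x
    using d\<xi>X[OF that] dXX[OF that] d\<xi>_\<xi>[OF that] \<xi>_tangent[OF that]
    by (simp_all add: V_def inner_add_left inner_commute[of "pd _ X x" "\<xi> x"])
  have frame: "v = 0" if "x \<in> W" "\<And>i. v \<bullet> pd i X x = 0" "v \<bullet> \<xi> x = 0" "v \<bullet> X x = 0" for v x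
    using frame4[OF that(1)] that by (simp add: PX)
  have Vs: "smooth_on (V q j) W" for q j
    unfolding V_def
    by (intro smooth_on_add smooth_on_scaleR smooth_on_const smooth_on_pd X_smooth \<xi>_smooth open_W)
  have Vd: "V q j differentiable (at x)" and dVd: "pd i (V q j) differentiable (at x)" if "x \<in> W" for q i j x
    by (rule smooth_on_differentiable[OF Vs open_W that], rule smooth_on_differentiable[OF smooth_on_pd[OF Vs] open_W that])
  have codazzi: "pd i (V q j) x = pd j (V q i) x" if x: "x \<in> W" for q i j x
  proof -
    have "pd i (V q j) x = pd i (pd j \<xi>) x + q *\<^sub>R pd i (pd j X) x" for i j
      unfolding V_def
      by (subst pd_add[OF d\<xi>_diff[OF x] differentiable_bilinear[OF bounded_bilinear_scaleR differentiable_const dX_diff[OF x]]])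
        (simp add: pd_scaleR[OF differentiable_const dX_diff[OF x]])
    then show ?thesis using pd_pd_commute[OF open_W x] X_smooth \<xi>_smooth by metis
  qed
  define T where "T x i j k = pd i (V a j) x \<bullet> V c k x" for x i j k
  have T12: "T x i j k = T x j i k" if "x \<in> W" for x i j k unfolding T_def using codazzi[OF that] by simp
  have T': "T x i j k = - (V a j x \<bullet> pd i (V c k) x)" if "x \<in> W" for x i j k
    unfolding T_def by (rule pd_inner_const[OF that Vd[OF that] Vd[OF that] VU])
  \<comment> \<open>\<open>T'\<close> exposes the derivative of \<open>V c k\<close>, which is
    symmetric by \<open>codazzi\<close>. Together with \<open>T12\<close> this gives total
    symmetry.\<close>
  have T13: "T x i j k = T x k j i" if "x \<in> W" for x i j k using T'[OF that] codazzi[OF that] by metis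
  \<comment> \<open>\<open>q\<close> is a root of the characteristic polynomial, so the matrix of
    \<open>V q\<close> against the coordinate vectors is singular.\<close>
  have kernel: "\<exists>y z. (y \<noteq> 0 \<or> z \<noteq> 0) \<and> y *\<^sub>R V q 1 x + z *\<^sub>R V q 2 x = 0" if x: "x \<in> W" and q: "q = a \<or> q = c" for x q
  proof -
    have "(q * gg x 1 1 - B x 1 1) * (q * gg x 2 2 - B x 2 2) - (q * gg x 1 2 - B x 1 2) * (q * gg x 1 2 - B x 1 2)
      = q\<^sup>2 * gd x - q * (gg x 2 2 * B x 1 1 - 2 * gg x 1 2 * B x 1 2 + gg x 1 1 * B x 2 2) + (B x 1 1 * B x 2 2 - (B x 1 2)\<^sup>2)"
      by (simp add: power2_eq_square algebra_simps)
    also have "\<dots> = 0" unfolding trace[OF x] det[OF x] using q by (auto simp: power2_eq_square algebra_simps)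
    finally obtain y z where yz: "y \<noteq> 0 \<or> z \<noteq> 0"
      "y * (q * gg x 1 1 - B x 1 1) + z * (q * gg x 1 2 - B x 1 2) = 0"
      "y * (q * gg x 1 2 - B x 1 2) + z * (q * gg x 2 2 - B x 2 2) = 0"
      by (rule singular_2_kernel)
    have "y *\<^sub>R V q 1 x + z *\<^sub>R V q 2 x = 0"
    proof (rule frame[OF x])
      fix i show "(y *\<^sub>R V q 1 x + z *\<^sub>R V q 2 x) \<bullet> pd i X x = 0"
        using cases2[of i] yz(2,3) by (elim disjE) (simp_all add: inner_add_left VX B21[OF x] g21)
    qed (simp_all add: inner_add_left V_X[OF x] V_\<xi>[OF x])
    with yz(1) show ?thesis by blast
  qed
  \<comment> \<open>By symmetry the last slot is annihilated both by the kernel vector of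
    \<open>V c\<close> and by that of \<open>V a\<close>. The two are independent: a common kernel
    vector would be annihilated by (a - c) dX.\<close>
  have T0: "T x i j k = 0" if x: "x \<in> W" for x i j k
  proof -
    obtain y z where y: "y \<noteq> 0 \<or> z \<noteq> 0" "y *\<^sub>R V c 1 x + z *\<^sub>R V c 2 x = 0" using kernel[OF x] by blast
    obtain y' z' where y': "y' \<noteq> 0 \<or> z' \<noteq> 0" "y' *\<^sub>R V a 1 x + z' *\<^sub>R V a 2 x = 0" using kernel[OF x] by blast
    have 1: "y * T x i j 1 + z * T x i j 2 = 0" for i j
      using arg_cong[OF y(2), of "\<lambda>v. pd i (V a j) x \<bullet> v"] by (simp add: T_def inner_add_right)
    have 2: "y' * T x i 1 k + z' * T x i 2 k = 0" for i k
      using arg_cong[OF y'(2), of "\<lambda>v. v \<bullet> pd i (V c k) x"] by (simp add: T'[OF x] inner_add_left)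
    have two: "y' * T x i j 1 + z' * T x i j 2 = 0" for i j
      using 2[of j i] T12[OF x] T13[OF x] by metis
    have ne: "y * z' - z * y' \<noteq> 0"
    proof
      assume D: "y * z' - z * y' = 0"
      have v: "y *\<^sub>R V a 1 x + z *\<^sub>R V a 2 x = 0"
      proof -
        have "y' *\<^sub>R (y *\<^sub>R V a 1 x + z *\<^sub>R V a 2 x) = y *\<^sub>R (y' *\<^sub>R V a 1 x + z' *\<^sub>R V a 2 x) + (z * y' - y * z') *\<^sub>R V a 2 x"
          "z' *\<^sub>R (y *\<^sub>R V a 1 x + z *\<^sub>R V a 2 x) = z *\<^sub>R (y' *\<^sub>R V a 1 x + z' *\<^sub>R V a 2 x) + (y * z' - z * y') *\<^sub>R V a 1 x"
          by (simp_all add: algebra_simps)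
        then show ?thesis using y' D by auto
      qed
      have "(a - c) *\<^sub>R (y *\<^sub>R pd 1 X x + z *\<^sub>R pd 2 X x) = (y *\<^sub>R V a 1 x + z *\<^sub>R V a 2 x) - (y *\<^sub>R V c 1 x + z *\<^sub>R V c 2 x)"
        by (simp add: V_def algebra_simps)
      then have w: "y *\<^sub>R pd 1 X x + z *\<^sub>R pd 2 X x = 0" using v y(2) ac by simp
      have "y * gg x 1 1 + z * gg x 1 2 = 0" "y * gg x 1 2 + z * gg x 2 2 = 0"
        using arg_cong[OF w, of "\<lambda>v. v \<bullet> pd 1 X x"] arg_cong[OF w, of "\<lambda>v. v \<bullet> pd 2 X x"]
        by (simp_all add: inner_add_left g21)
      then have "y * gd x = 0" "z * gd x = 0" by algebra+
      then show False using gd[OF x] y(1) by simp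
    qed
    have "(y * z' - z * y') * T x i j 1 = 0" "(y * z' - z * y') * T x i j 2 = 0"
      using 1[of i j] two[of i j] by algebra+
    then show ?thesis using ne cases2[of k] by auto
  qed
  \<comment> \<open>If \<open>V q\<close> vanished at \<open>u\<close>, the point would be umbilic
    with both curvatures \<open>q\<close>, and the trace would be \<open>2 * q\<close> instead of
    \<open>a + c\<close>.\<close>
  have nonzero: "\<exists>j. V q j u \<noteq> 0" if q: "q = a \<or> q = c" for q
  proof (rule ccontr)
    assume "\<nexists>j. V q j u \<noteq> 0"
    then have "q * gg u i j = B u i j" for i j using VX[of q i u j] by simp
    then have "2 * q * gd u = (a + c) * gd u" unfolding trace[OF u, symmetric] by (simp flip: \<open>\<And>i j. q * gg u i j = B u i j\<close> add: algebra_simps)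
    then show False using gd[OF u] q ac by auto
  qed
  obtain j k where jk: "V a j u \<noteq> 0" "V c k u \<noteq> 0" using nonzero by blast
  let ?v = "V a j u" and ?w = "V c k u"
  have dT: "pd l (pd i (V a j)) u \<bullet> ?w = - (pd i (V a j) u \<bullet> pd l (V c k) u)" for i l
    by (rule pd_inner_const[OF u dVd[OF u] Vd[OF u], where c = 0]) (use T0 in \<open>simp add: T_def\<close>)
  have dV: "pd i (V q j) u \<bullet> X u = - (V q j u \<bullet> pd i X u)" "pd i (V q j) u \<bullet> \<xi> u = - (V q j u \<bullet> pd i \<xi> u)" for i q j
    using pd_inner_const[OF u Vd[OF u] X_diff[OF u] V_X] pd_inner_const[OF u Vd[OF u] \<xi>_diff[OF u] V_\<xi>] by blast+
  have XX: "X u \<bullet> X u = 1" and X\<xi>: "X u \<bullet> \<xi> u = 0" using ambient_unit[OF u] PX_\<xi>[OF u] by (simp_all add: ve PX)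
  \<comment> \<open>The tangential parts \<open>p\<close> and \<open>q\<close> are orthogonal to
    \<open>?w\<close> and \<open>?v\<close> respectively. Since \<open>?v\<close> and
    \<open>?w\<close> are an orthogonal basis of the tangent plane, \<open>p\<close> is orthogonal
    to \<open>q\<close>, and only the components along \<open>X\<close> and \<open>\<xi>\<close>
    contribute.\<close>
  have prod: "pd i (V a j) u \<bullet> pd l (V c k) u = (?v \<bullet> pd i X u) * (?w \<bullet> pd l X u) + (?v \<bullet> pd i \<xi> u) * (?w \<bullet> pd l \<xi> u)" for i l
  proof -
    define p where "p = pd i (V a j) u - (pd i (V a j) u \<bullet> X u) *\<^sub>R X u - (pd i (V a j) u \<bullet> \<xi> u) *\<^sub>R \<xi> u"
    define q where "q = pd l (V c k) u - (pd l (V c k) u \<bullet> X u) *\<^sub>R X u - (pd l (V c k) u \<bullet> \<xi> u) *\<^sub>R \<xi> u"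
    have X: "p \<bullet> X u = 0" "p \<bullet> \<xi> u = 0" "q \<bullet> X u = 0" "q \<bullet> \<xi> u = 0"
      by (simp_all add: p_def q_def inner_diff_left XX X\<xi> \<xi>_unit[OF u] inner_commute[of "\<xi> u" "X u"])
    have pw: "p \<bullet> ?w = 0" using T0[OF u, of i j k] V_X[OF u] V_\<xi>[OF u]
      by (simp add: p_def T_def inner_diff_left inner_commute[of "X u"] inner_commute[of "\<xi> u"])
    have qv: "q \<bullet> ?v = 0" using T0[OF u, of l j k] V_X[OF u] V_\<xi>[OF u]
      by (simp add: q_def T'[OF u] inner_diff_left inner_commute[of "X u"] inner_commute[of "\<xi> u"] inner_commute[of ?v])
    define q' where "q' = (?w \<bullet> ?w) *\<^sub>R q - (q \<bullet> ?w) *\<^sub>R ?w"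
    have "q' = 0"
    proof (rule orthogonal_frame_zero[OF dim4 jk, of "X u" "\<xi> u"])
      show "X u \<noteq> 0" "\<xi> u \<noteq> 0" using XX \<xi>_unit[OF u] by auto
    qed (simp_all add: q'_def inner_diff_left X qv VU[OF u] V_X[OF u] V_\<xi>[OF u] X\<xi> inner_commute[of ?w ?v])
    then have "p \<bullet> q' = 0" by simp
    then have "(?w \<bullet> ?w) * (p \<bullet> q) = 0" unfolding q'_def inner_diff_right using pw by simp
    then have pq: "p \<bullet> q = 0" using jk(2) by simp
    have "pd i (V a j) u = p + (pd i (V a j) u \<bullet> X u) *\<^sub>R X u + (pd i (V a j) u \<bullet> \<xi> u) *\<^sub>R \<xi> u" by (simp add: p_def)
    then have "pd i (V a j) u \<bullet> pd l (V c k) u = p \<bullet> pd l (V c k) u + (pd i (V a j) u \<bullet> X u) * (X u \<bullet> pd l (V c k) u)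
      + (pd i (V a j) u \<bullet> \<xi> u) * (\<xi> u \<bullet> pd l (V c k) u)"
      by (metis inner_add_left inner_scaleR_left)
    moreover have "p \<bullet> pd l (V c k) u = p \<bullet> q" by (simp add: q_def inner_diff_right X)
    ultimately show ?thesis unfolding pq by (simp add: dV inner_commute[of "X u" "pd l _ u"] inner_commute[of "\<xi> u" "pd l _ u"])
  qed
  \<comment> \<open>\<open>?v\<close> and \<open>?w\<close> are principal directions for the
    curvatures \<open>c\<close> and \<open>a\<close>.\<close>
  have v\<xi>: "?v \<bullet> pd i \<xi> u = - c * (?v \<bullet> pd i X u)" for i
    using VU[OF u, of j i] by (simp add: V_def[of c] inner_add_right)
  have w\<xi>: "?w \<bullet> pd i \<xi> u = - a * (?w \<bullet> pd i X u)" for i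
    using VU[OF u, of i k] by (simp add: V_def[of a] inner_add_right inner_commute[of _ ?w])
  define x1 where "x1 = ?v \<bullet> pd 1 X u"
  define x2 where "x2 = ?v \<bullet> pd 2 X u"
  define y1 where "y1 = ?w \<bullet> pd 1 X u"
  define y2 where "y2 = ?w \<bullet> pd 2 X u"
  \<comment> \<open>Commuting second derivatives, tested against \<open>?w\<close>, become the Gauss
    equation through \<open>dT\<close> and \<open>prod\<close>.\<close>
  have "pd 1 (pd 2 (V a j)) u = pd 2 (pd 1 (V a j)) u" by (rule pd_pd_commute[OF open_W u Vs])
  then have "pd 2 (V a j) u \<bullet> pd 1 (V c k) u = pd 1 (V a j) u \<bullet> pd 2 (V c k) u"
    using dT[of 1 2] dT[of 2 1] by simp
  then have "(1 + a * c) * (x2 * y1 - x1 * y2) = 0"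
    unfolding prod v\<xi> w\<xi> x1_def[symmetric] x2_def[symmetric] y1_def[symmetric] y2_def[symmetric]
    by (simp add: algebra_simps)
  moreover have "x2 * y1 - x1 * y2 \<noteq> 0"
  proof
    assume D: "x2 * y1 - x1 * y2 = 0"
    have z: "y = 0 \<and> z = 0" if eq: "y *\<^sub>R ?v = z *\<^sub>R ?w" for y z
    proof -
      have wv: "?w \<bullet> ?v = 0" using VU[OF u, of j k] by (simp add: inner_commute)
      have "y * (?v \<bullet> ?v) = (z *\<^sub>R ?w) \<bullet> ?v" unfolding eq[symmetric] by simp
      moreover have "z * (?w \<bullet> ?w) = (y *\<^sub>R ?v) \<bullet> ?w" unfolding eq by simp
      ultimately show ?thesis using wv VU[OF u, of j k] jk by simp
    qed
    have "y1 *\<^sub>R ?v - x1 *\<^sub>R ?w = 0"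
    proof (rule frame[OF u])
      fix i show "(y1 *\<^sub>R ?v - x1 *\<^sub>R ?w) \<bullet> pd i X u = 0"
        using cases2[of i] D by (elim disjE) (simp_all add: inner_diff_left x1_def x2_def y1_def y2_def algebra_simps)
    qed (simp_all add: inner_diff_left V_X[OF u] V_\<xi>[OF u])
    then have 1: "y1 = 0" "x1 = 0" using z[of y1 x1] by simp_all
    have "y2 *\<^sub>R ?v - x2 *\<^sub>R ?w = 0"
    proof (rule frame[OF u])
      fix i show "(y2 *\<^sub>R ?v - x2 *\<^sub>R ?w) \<bullet> pd i X u = 0"
        using cases2[of i] D by (elim disjE) (simp_all add: inner_diff_left x1_def x2_def y1_def y2_def algebra_simps)
    qed (simp_all add: inner_diff_left V_X[OF u] V_\<xi>[OF u])
    then have 2: "x2 = 0" using z[of y2 x2] by simp_all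
    have "?v = 0"
    proof (rule frame[OF u])
      fix i show "?v \<bullet> pd i X u = 0" using cases2[of i] 1 2 by (auto simp: x1_def x2_def)
    qed (simp_all add: V_X[OF u] V_\<xi>[OF u])
    then show False using jk by simp
  qed
  ultimately show ?thesis by simp
qed

text \<open>A first-order converse of \<open>constant_normal\<close>: the difference of
  \<open>sqrt 2 *\<^sub>R \<nu>\<close> and \<open>P (X u)\<close> is orthogonal to the tangent
  vectors and to \<open>P (X u)\<close> and has length 1, so it is the normal up to sign.\<close>

lemma slice_normal:
  assumes u: "u \<in> W" and \<nu>: "norm \<nu> = 1" "\<nu> \<bullet> e = 0" "\<nu> \<bullet> X u = 1 / sqrt 2" "\<And>i. \<nu> \<bullet> pd i X u = 0"
  obtains \<epsilon> where "\<epsilon> = 1 \<or> \<epsilon> = - 1" "sqrt 2 *\<^sub>R \<nu> = P (X u) + \<epsilon> *\<^sub>R \<xi> u"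
proof -
  define n where "n = sqrt 2 *\<^sub>R \<nu> - P (X u)"
  have \<nu>P: "\<nu> \<bullet> P (X u) = 1 / sqrt 2" using \<nu>(2,3) by (simp add: inner_P)
  have nn: "n \<bullet> pd i X u = 0" "n \<bullet> P (X u) = 0" for i
    using \<nu>(4) PX_tangent[OF u] PX_unit[OF u] \<nu>P by (simp_all add: n_def inner_diff_left)
  have "n \<bullet> n = sqrt 2 * (n \<bullet> \<nu>)" using nn(2) by (simp add: n_def[of] inner_diff_right)
  also have "n \<bullet> \<nu> = sqrt 2 - 1 / sqrt 2"
    using \<nu>(1) \<nu>P by (simp add: n_def inner_diff_left inner_commute[of "P (X u)" \<nu>] norm_eq_1)
  also have "sqrt 2 * (sqrt 2 - 1 / sqrt 2) = 1" by (simp add: right_diff_distrib)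
  finally have n_unit: "n \<bullet> n = 1" .
  have PX\<xi>': "\<xi> u \<bullet> P (X u) = 0" using PX_\<xi>[OF u] by (simp add: inner_commute)
  have n_eq: "n = (n \<bullet> \<xi> u) *\<^sub>R \<xi> u"
    by (rule frame4_eq[OF u]) (simp_all add: nn \<xi>_tangent[OF u] \<xi>_unit[OF u] PX\<xi>')
  have "n \<bullet> n = ((n \<bullet> \<xi> u) *\<^sub>R \<xi> u) \<bullet> ((n \<bullet> \<xi> u) *\<^sub>R \<xi> u)" using n_eq by simp
  then have "(n \<bullet> \<xi> u) * (n \<bullet> \<xi> u) = 1" using n_unit \<xi>_unit[OF u] by simp
  then have "n \<bullet> \<xi> u = 1 \<or> n \<bullet> \<xi> u = - 1" using square_eq_1_iff by blast
  then show ?thesis using that[of "n \<bullet> \<xi> u"] n_eq by (metis add.commute diff_add_cancel n_def)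
qed

lemma inner_pd_X_zero:
  assumes "open W'" "W' \<subseteq> W" "u \<in> W'" "\<And>x. x \<in> W' \<Longrightarrow> \<nu> \<bullet> X x = c"
  shows "\<nu> \<bullet> pd i X u = 0"
proof -
  have "pd i (\<lambda>x. \<nu> \<bullet> X x) u = pd i (\<lambda>_. c) u" by (rule pd_cong_open[OF assms(1,3,4)])
  moreover have "pd i (\<lambda>x. \<nu> \<bullet> X x) u = \<nu> \<bullet> pd i X u"
    by (rule pd_bounded_linear[OF bounded_linear_inner_right X_diff]) (use assms in auto)
  ultimately show ?thesis by simp
qed

end

text \<open>\<open>\<Psi>\<close> is an inverse chart of a hypersurface of 4-space. The coefficient
  \<open>- (e \<bullet> e)\<close> covers the sphere (\<open>e = 0\<close>) and the cylinder (unit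
  \<open>e\<close>) at once, and \<open>embedding_axis\<close> says that \<open>E\<close> represents
  the tangential part of \<open>e\<close>.\<close>

locale embedded_geometry = geometry_domain D H \<kappa> \<beta> E
  for D H \<kappa> \<beta> E +
  fixes \<Psi> :: "real^3 \<Rightarrow> 'e::euclidean_space" and e :: 'e
  assumes ambient_dim: "DIM('e) = 4"
    and ambient_axis: "e = 0 \<or> e \<bullet> e = 1"
    and embedding_smooth: "smooth_on \<Psi> D"
    and embedding_isometric: "x \<in> D \<Longrightarrow> H x $ a $ b = pd a \<Psi> x \<bullet> pd b \<Psi> x"
    and embedding_unit: "x \<in> D \<Longrightarrow> \<Psi> x \<bullet> \<Psi> x - (\<Psi> x \<bullet> e) * (\<Psi> x \<bullet> e) = 1"
    and embedding_axis: "x \<in> D \<Longrightarrow> metric_ip (H x) (E x) v = (\<Sum>a\<in>UNIV. v $ a *\<^sub>R pd a \<Psi> x) \<bullet> e"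
    and embedding_coeff: "\<kappa> = 1" "\<beta> = - (e \<bullet> e)"
begin

definition lift :: "real^3 \<Rightarrow> real^3 \<Rightarrow> 'e" where
  "lift x v = (\<Sum>a\<in>UNIV. v $ a *\<^sub>R pd a \<Psi> x)"

lemma \<Psi>_diff: "x \<in> D \<Longrightarrow> \<Psi> differentiable (at x)"
  and d\<Psi>_diff: "x \<in> D \<Longrightarrow> pd a \<Psi> differentiable (at x)"
  using smooth_on_differentiable[OF embedding_smooth open_domain]
    smooth_on_differentiable[OF smooth_on_pd[OF embedding_smooth] open_domain] by blast+

lemma lift_inner: "x \<in> D \<Longrightarrow> lift x v \<bullet> lift x w = metric_ip (H x) v w"
  unfolding lift_def metric_ip_def inner_sum_left inner_sum_right
  by (subst sum.swap) (simp add: embedding_isometric mult_ac)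

lemma lift_axis: "x \<in> D \<Longrightarrow> lift x v \<bullet> e = metric_ip (H x) (E x) v"
  by (simp add: lift_def embedding_axis)

lemma lift_normal:
  assumes x: "x \<in> D"
  shows "lift x v \<bullet> \<Psi> x - (lift x v \<bullet> e) * (\<Psi> x \<bullet> e) = 0"
proof -
  have "pd a \<Psi> x \<bullet> \<Psi> x - (pd a \<Psi> x \<bullet> e) * (\<Psi> x \<bullet> e) = 0" for a
  proof -
    have "pd a (\<lambda>y. \<Psi> y \<bullet> \<Psi> y - (\<Psi> y \<bullet> e) * (\<Psi> y \<bullet> e)) x = pd a (\<lambda>_. 1 :: real) x"
      by (rule pd_cong_open[OF open_domain x]) (rule embedding_unit)
    moreover have "pd a (\<lambda>y. \<Psi> y \<bullet> e) x = pd a \<Psi> x \<bullet> e"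
      by (rule pd_bounded_linear[OF bounded_linear_inner_left \<Psi>_diff[OF x]])
    moreover note d = \<Psi>_diff[OF x] differentiable_bounded_linear[OF bounded_linear_inner_left \<Psi>_diff[OF x], of e]
    moreover have "(\<lambda>y. \<Psi> y \<bullet> \<Psi> y) differentiable (at x)"
      by (intro differentiable_bilinear[OF bounded_bilinear_inner] d)
    ultimately show ?thesis
      by (simp add: pd_diff pd_inner pd_mult differentiable_mult inner_commute[of "\<Psi> x"] mult.commute)
  qed
  then have "(\<Sum>a\<in>UNIV. v $ a * (pd a \<Psi> x \<bullet> \<Psi> x - (pd a \<Psi> x \<bullet> e) * (\<Psi> x \<bullet> e))) = 0" by simp
  then show ?thesis
    by (simp add: lift_def inner_sum_left right_diff_distrib sum_subtractf sum_distrib_right mult.assoc)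
qed

text \<open>For a metric induced from a flat space the Koszul expression collapses to the tangential
  part of the flat second derivative.\<close>

lemma lowered_christoffel:
  assumes x: "x \<in> D"
  shows "(\<Sum>k\<in>UNIV. H x $ l $ k * christoffel H x k i j) = pd i (pd j \<Psi>) x \<bullet> pd l \<Psi> x"
proof -
  have p: "pd k (\<lambda>y. H y $ i $ j) x = pd k (pd i \<Psi>) x \<bullet> pd j \<Psi> x + pd i \<Psi> x \<bullet> pd k (pd j \<Psi>) x" for k i j
  proof -
    have "pd k (\<lambda>y. H y $ i $ j) x = pd k (\<lambda>y. pd i \<Psi> y \<bullet> pd j \<Psi> y) x"
      by (rule pd_cong_open[OF open_domain x]) (rule embedding_isometric)
    then show ?thesis by (simp add: pd_inner[OF d\<Psi>_diff[OF x] d\<Psi>_diff[OF x]])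
  qed
  have c: "pd i (pd j \<Psi>) x = pd j (pd i \<Psi>) x" for i j
    by (rule pd_pd_commute[OF open_domain x embedding_smooth])
  show ?thesis
    by (subst christoffel_lower, rule metric_positive[OF x], assumption)
      (simp add: p c[of j i] c[of l i] c[of l j] inner_commute[of "pd _ \<Psi> x" "pd _ (pd _ \<Psi>) x"])
qed

end

locale embedded_patch = embedded_geometry D H \<kappa> \<beta> E \<Psi> e + surface_patch D H \<kappa> \<beta> E W F G \<xi>
  for D H \<kappa> \<beta> E and \<Psi> :: "real^3 \<Rightarrow> 'e::euclidean_space" and e W F G \<xi>
begin

definition X :: "real^2 \<Rightarrow> 'e" where "X u = \<Psi> (F u)"
definition N\<^sub>X :: "real^2 \<Rightarrow> 'e" where "N\<^sub>X u = lift (F u) (\<xi> u)"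

lemma pd_X: "u \<in> W \<Longrightarrow> pd i X u = lift (F u) (pd i F u)"
  unfolding X_def[abs_def] lift_def by (rule pd_compose[OF map_differentiable \<Psi>_diff[OF map_into]])

text \<open>The intrinsic covariant derivative is the tangential part of the flat one. This is what
  makes the second fundamental form of the patch computable in 4-space.\<close>

lemma pd_lift:
  assumes u: "u \<in> W" and V: "V differentiable (at u)"
  shows "pd i (\<lambda>x. lift (F x) (V x)) u \<bullet> lift (F u) w = ip u (cov i V u) w"
proof -
  note Fu = map_into[OF u]
  have p: "pd i (\<lambda>x. pd a \<Psi> (F x)) u = (\<Sum>c\<in>UNIV. pd i F u $ c *\<^sub>R pd c (pd a \<Psi>) (F u))" for a
    by (rule pd_compose[OF map_differentiable[OF u] d\<Psi>_diff[OF Fu]])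
  have d: "(\<lambda>x. pd a \<Psi> (F x)) differentiable (at u)" for a
    by (rule differentiable_compose_at[OF map_differentiable[OF u] d\<Psi>_diff[OF Fu]])
  have "pd i (\<lambda>x. lift (F x) (V x)) u = (\<Sum>a\<in>UNIV. pd i (\<lambda>x. V x $ a *\<^sub>R pd a \<Psi> (F x)) u)"
    unfolding lift_def
    by (rule pd_sum) (intro differentiable_bilinear[OF bounded_bilinear_scaleR] differentiable_nth V d)
  also have "\<dots> = lift (F u) (pd i V u) + (\<Sum>a\<in>UNIV. V u $ a *\<^sub>R (\<Sum>c\<in>UNIV. pd i F u $ c *\<^sub>R pd c (pd a \<Psi>) (F u)))"
    by (simp add: pd_scaleR[OF differentiable_nth[OF V] d] pd_nth[OF V] p lift_def sum.distrib)
  finally have 1: "pd i (\<lambda>x. lift (F x) (V x)) u \<bullet> lift (F u) w = ip u (pd i V u) w +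
    (\<Sum>a\<in>UNIV. \<Sum>c\<in>UNIV. \<Sum>d\<in>UNIV. V u $ a * (pd i F u $ c * (w $ d * (pd c (pd a \<Psi>) (F u) \<bullet> pd d \<Psi> (F u)))))"
    by (simp add: inner_add_left lift_inner[OF Fu]) (simp add: lift_def inner_sum_left inner_sum_right sum_distrib_left mult_ac,
        subst sum.swap, rule sum.cong[OF refl], subst sum.swap, rule refl)
  have 2: "ip u (chr (F u) (pd i F u) (V u)) w =
    (\<Sum>c\<in>UNIV. \<Sum>a\<in>UNIV. \<Sum>d\<in>UNIV. V u $ a * (pd i F u $ c * (w $ d * (pd c (pd a \<Psi>) (F u) \<bullet> pd d \<Psi> (F u)))))"
    unfolding metric_ip_chr[OF Fu] lowered_christoffel[OF Fu] by (simp add: mult_ac)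
  show ?thesis unfolding 1 cov_eq metric_ip_add_left 2 by (subst (2) sum.swap) simp
qed

lemma N_smooth: "smooth_on N\<^sub>X W"
  unfolding N\<^sub>X_def[abs_def] lift_def
  by (intro smooth_on_sum smooth_on_scaleR smooth_on_nth open_source normal_smooth
      smooth_on_compose[OF smooth_on_pd[OF embedding_smooth] map_smooth open_source open_domain])
    (use map_into in auto)

lemma pd_X_inner: "u \<in> W \<Longrightarrow> pd i X u \<bullet> pd j X u = ip u (pd i F u) (pd j F u)"
  by (simp add: pd_X lift_inner map_into)

sublocale eu: euclidean_surface e W X N\<^sub>X
proof
  show "DIM('e) = 4" "e = 0 \<or> e \<bullet> e = 1" "open W" "smooth_on N\<^sub>X W"
    by (rule ambient_dim ambient_axis open_source N_smooth)+
  show "smooth_on X W"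
    unfolding X_def[abs_def]
    by (rule smooth_on_compose[OF embedding_smooth map_smooth open_source open_domain]) (use map_into in auto)
  fix u i assume u: "u \<in> W"
  show "(pd 1 X u \<bullet> pd 1 X u) * (pd 2 X u \<bullet> pd 2 X u) - (pd 1 X u \<bullet> pd 2 X u) * (pd 1 X u \<bullet> pd 2 X u) > 0"
    using g_pos(3)[OF u] by (simp add: pd_X_inner[OF u] ip_pd_pd[OF u] gdet_def)
  show "X u \<bullet> X u - (X u \<bullet> e) * (X u \<bullet> e) = 1" unfolding X_def by (rule embedding_unit[OF map_into[OF u]])
  show "N\<^sub>X u \<bullet> N\<^sub>X u = 1" unfolding N\<^sub>X_def by (simp add: lift_inner[OF map_into[OF u]] normal_unit[OF u])
  show "N\<^sub>X u \<bullet> pd i X u = 0"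
    unfolding N\<^sub>X_def by (simp add: pd_X[OF u] lift_inner[OF map_into[OF u]] normal_orthogonal[OF u])
  show "N\<^sub>X u \<bullet> X u - (N\<^sub>X u \<bullet> e) * (X u \<bullet> e) = 0"
    unfolding N\<^sub>X_def X_def by (rule lift_normal[OF map_into[OF u]])
qed

lemma B_eq_b: "u \<in> W \<Longrightarrow> eu.B u i j = b u i j"
  using pd_lift[OF _ normal_differentiable, of u i "pd j F u"]
  by (simp add: eu.B_def b_def pd_X N\<^sub>X_def[abs_def, symmetric])

lemma gg_eq:
  assumes "u \<in> W"
  shows "eu.gg u 1 1 = g11 u" "eu.gg u 1 2 = g12 u" "eu.gg u 2 1 = g12 u" "eu.gg u 2 2 = g22 u" "eu.gd u = gdet u"
  using assms by (simp_all add: pd_X_inner ip_pd_pd gdet_def)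

lemma \<eta>_eq: "u \<in> W \<Longrightarrow> \<eta> u (\<xi> u) = N\<^sub>X u \<bullet> e" "u \<in> W \<Longrightarrow> \<eta> u (pd i F u) = pd i X u \<bullet> e"
  by (simp_all add: \<eta>_def N\<^sub>X_def pd_X lift_axis map_into)

lemma shape_det:
  assumes u: "u \<in> W" and "mean_curvature G H F \<xi> u = h"
  shows "2 * (b u 1 1 * b u 2 2 - (b u 1 2)\<^sup>2) = (4 * h\<^sup>2 - shape_norm2 u) * gdet u"
  using shape_norm2_eq[OF u] assms(2) g_pos(3)[OF u] by (simp add: field_simps power2_eq_square)

text \<open>In the sphere the last hypothesis says umbilic with curvature 1; in the cylinder,
  curvature 0 along the axis and 1 across it. The two sides are compared on the frame of
  4-space.\<close>

lemma umbilic_normal: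
  assumes u: "u \<in> W" and "N\<^sub>X u \<bullet> e = 0"
    and "\<And>i j. b u i j = ip u (pd i F u) (pd j F u) - (pd i X u \<bullet> e) * (pd j X u \<bullet> e)"
  shows "pd i N\<^sub>X u = - eu.P (pd i X u)"
proof (rule eu.frame4_eq[OF u])
  fix j show "pd i N\<^sub>X u \<bullet> pd j X u = - eu.P (pd i X u) \<bullet> pd j X u"
    using B_eq_b[OF u, of i j] assms(3)[of i j] by (simp add: eu.B_def eu.inner_P pd_X_inner[OF u])
next
  show "pd i N\<^sub>X u \<bullet> N\<^sub>X u = - eu.P (pd i X u) \<bullet> N\<^sub>X u"
    using eu.\<xi>_tangent[OF u, of i] assms(2) by (simp add: eu.d\<xi>_\<xi>[OF u] eu.inner_P inner_commute[of "pd i X u"])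
  have "pd i X u \<bullet> eu.P (X u) = 0" using eu.PX_tangent[OF u, of i] by (simp add: inner_commute)
  then show "pd i N\<^sub>X u \<bullet> eu.P (X u) = - eu.P (pd i X u) \<bullet> eu.P (X u)"
    using assms(2) by (simp add: eu.d\<xi>_PX[OF u] eu.inner_P(1)[of "pd i X u"] eu.inner_P_axis)
qed

lemma biharmonic_sphere_normal:
  assumes e: "e = 0" and h: "h > 0" and H: "\<And>u. u \<in> W \<Longrightarrow> mean_curvature G H F \<xi> u = h"
    and S: "\<And>u. u \<in> W \<Longrightarrow> shape_norm2 u = 2" and u: "u \<in> W"
  shows "pd i N\<^sub>X u = - eu.P (pd i X u) \<and> N\<^sub>X u \<bullet> e = 0"
proof -
  have "h\<^sup>2 \<le> 1" using shape_norm2_ge[OF u] S[OF u] H[OF u] by simp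
  moreover have "h\<^sup>2 = 1"
  proof (rule ccontr)
    assume "h\<^sup>2 \<noteq> 1"
    then have lt: "1 - h\<^sup>2 > 0" using \<open>h\<^sup>2 \<le> 1\<close> by simp
    \<comment> \<open>With |A|^2 = 2 the principal curvatures are \<open>h + s\<close> and
      \<open>h - s\<close>; their product \<open>2 * h\<^sup>2 - 1\<close> equals -1 only for
      \<open>h = 0\<close>.\<close>
    define s where "s = sqrt (1 - h\<^sup>2)"
    have s: "s > 0" "s\<^sup>2 = 1 - h\<^sup>2" using lt by (simp_all add: s_def)
    have ac: "(h + s) * (h - s) = 2 * h\<^sup>2 - 1" using s(2) by (simp add: power2_eq_square algebra_simps)
    have "1 + (h + s) * (h - s) = 0"
    proof (rule eu.distinct_principal_curvatures[OF e _ u])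
      show "h + s \<noteq> h - s" using s(1) by simp
      fix x assume x: "x \<in> W"
      show "eu.gg x 2 2 * eu.B x 1 1 - 2 * eu.gg x 1 2 * eu.B x 1 2 + eu.gg x 1 1 * eu.B x 2 2 = (h + s + (h - s)) * eu.gd x"
        unfolding gg_eq(1-4)[OF x] B_eq_b[OF x] gdet_def[symmetric] using mean_curvature_eq[OF x] H[OF x] g_pos(3)[OF x] by (simp add: field_simps)
      show "eu.B x 1 1 * eu.B x 2 2 - (eu.B x 1 2)\<^sup>2 = (h + s) * (h - s) * eu.gd x"
        unfolding gg_eq(1-4)[OF x] B_eq_b[OF x] gdet_def[symmetric] ac using shape_det[OF x H[OF x]] S[OF x] by (simp add: algebra_simps)
    qed
    then show False unfolding ac using h by simp
  qed
  ultimately have h1: "h = 1" using h by (simp add: power2_eq_1_iff)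
  have "N\<^sub>X u \<bullet> e = 0" "pd i X u \<bullet> e = 0" for i using e by simp_all
  moreover have "b u i j = ip u (pd i F u) (pd j F u)" for i j
    using umbilic[OF u, of i j] S[OF u] H[OF u] h1 by simp
  ultimately show ?thesis using umbilic_normal[OF u] by simp
qed

lemma axis_norm_1:
  assumes u: "u \<in> W" and e: "e \<bullet> e = 1"
  shows "g22 u * (pd 1 X u \<bullet> e)\<^sup>2 - 2 * g12 u * (pd 1 X u \<bullet> e) * (pd 2 X u \<bullet> e) + g11 u * (pd 2 X u \<bullet> e)\<^sup>2
    = (1 - (N\<^sub>X u \<bullet> e)\<^sup>2) * gdet u"
  using axis_norm[OF u] g_pos(3)[OF u] e unfolding \<eta>_eq[OF u] embedding_coeff by (simp add: field_simps)

text \<open>If the axis had a normal component, \<open>T\<close> would make it normal and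
  \<open>S\<close> would give A = 0. So it is tangent and, being constant in 4-space, lies in the
  kernel of A; then det A = 0 and 1 = |A|^2 = (2h)^2 fixes \<open>h\<close>.\<close>

lemma biharmonic_cylinder_normal:
  assumes e: "e \<bullet> e = 1" and h: "h > 0" and H: "\<And>u. u \<in> W \<Longrightarrow> mean_curvature G H F \<xi> u = h"
    and S: "\<And>u. u \<in> W \<Longrightarrow> shape_norm2 u = 1 - (N\<^sub>X u \<bullet> e)\<^sup>2"
    and T: "\<And>u i. u \<in> W \<Longrightarrow> (N\<^sub>X u \<bullet> e) * (pd i X u \<bullet> e) = 0" and u: "u \<in> W"
  shows "pd i N\<^sub>X u = - eu.P (pd i X u) \<and> N\<^sub>X u \<bullet> e = 0"
proof -
  have N0: "N\<^sub>X x \<bullet> e = 0" if x: "x \<in> W" for x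
  proof (rule ccontr)
    assume "N\<^sub>X x \<bullet> e \<noteq> 0"
    then have "pd i X x \<bullet> e = 0" for i using T[OF x, of i] by simp
    then have "(1 - (N\<^sub>X x \<bullet> e)\<^sup>2) * gdet x = 0" using axis_norm_1[OF x e] by simp
    then have "shape_norm2 x = 0" using S[OF x] g_pos(3)[OF x] by simp
    moreover have "h\<^sup>2 > 0" using h by simp
    ultimately show False using shape_norm2_ge[OF x] H[OF x] by simp
  qed
  have de: "pd i N\<^sub>X u \<bullet> e = 0" for i
    using eu.pd_inner_const[OF u eu.\<xi>_diff[OF u] differentiable_const, of e 0 i] N0 by simp
  define t1 where "t1 = pd 1 X u \<bullet> e"
  define t2 where "t2 = pd 2 X u \<bullet> e"
  define d where "d = gdet u"
  have d: "d > 0" using g_pos(3)[OF u] by (simp add: d_def)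
  \<comment> \<open>\<open>y\<close> and \<open>z\<close> are \<open>d\<close> times the coordinates
    of \<open>e\<close> in the tangent frame.\<close>
  define y where "y = g22 u * t1 - g12 u * t2"
  define z where "z = g11 u * t2 - g12 u * t1"
  have q: "y * t1 + z * t2 = d"
    using axis_norm_1[OF u e] N0[OF u] by (simp add: y_def z_def t1_def t2_def d_def power2_eq_square algebra_simps)
  have PXe: "e \<bullet> eu.P (X u) = 0" by (rule eu.inner_P_axis)
  have ex: "d *\<^sub>R e = y *\<^sub>R pd 1 X u + z *\<^sub>R pd 2 X u"
  proof (rule eu.frame4_eq[OF u])
    fix l :: 2
    have "l = 1 \<or> l = 2" using exhaust_2 by blast
    then show "(d *\<^sub>R e) \<bullet> pd l X u = (y *\<^sub>R pd 1 X u + z *\<^sub>R pd 2 X u) \<bullet> pd l X u"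
      by (elim disjE) (simp_all add: inner_add_left gg_eq[OF u] y_def z_def d_def gdet_def t1_def t2_def
          inner_commute[of e] algebra_simps)
  next
    have "pd k X u \<bullet> N\<^sub>X u = 0" "pd k X u \<bullet> eu.P (X u) = 0" for k
      using eu.\<xi>_tangent[OF u, of k] eu.PX_tangent[OF u, of k] by (simp_all add: inner_commute)
    then show "(d *\<^sub>R e) \<bullet> N\<^sub>X u = (y *\<^sub>R pd 1 X u + z *\<^sub>R pd 2 X u) \<bullet> N\<^sub>X u"
      "(d *\<^sub>R e) \<bullet> eu.P (X u) = (y *\<^sub>R pd 1 X u + z *\<^sub>R pd 2 X u) \<bullet> eu.P (X u)"
      using N0[OF u] PXe by (simp_all add: inner_add_left inner_commute[of e "N\<^sub>X u"])
  qed
  have ker: "y * b u i 1 + z * b u i 2 = 0" for i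
  proof -
    have "pd i N\<^sub>X u \<bullet> (d *\<^sub>R e) = 0" using de by simp
    then show ?thesis unfolding ex by (simp add: inner_add_right B_eq_b[OF u, symmetric] eu.B_def)
  qed
  have b21: "b u 2 1 = b u 1 2" by (rule b_sym[OF u])
  have yz: "y \<noteq> 0 \<or> z \<noteq> 0" using q d by auto
  have "y * (b u 1 1 * b u 2 2 - (b u 1 2)\<^sup>2) = 0" "z * (b u 1 1 * b u 2 2 - (b u 1 2)\<^sup>2) = 0"
    using ker[of 1] ker[of 2] unfolding b21 by algebra+
  then have "b u 1 1 * b u 2 2 - (b u 1 2)\<^sup>2 = 0" using yz by auto
  then have "(4 * h\<^sup>2 - 1) * d = 0" using shape_det[OF u H[OF u]] S[OF u] N0[OF u] by (simp add: d_def)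
  then have "(2 * h - 1) * (2 * h + 1) = 0" using d by (simp add: power2_eq_square algebra_simps)
  then have h2: "2 * h = 1" using h by simp
  have tr: "g22 u * b u 1 1 - 2 * g12 u * b u 1 2 + g11 u * b u 2 2 = d"
    using mean_curvature_eq[OF u] H[OF u] d h2 by (simp add: d_def field_simps)
  \<comment> \<open>The difference between \<open>b\<close> and its claimed value is a symmetric
    form that annihilates the axis (\<open>k1\<close>, \<open>k2\<close>) and has trace zero
    (\<open>k3\<close>); in dimension two it vanishes.\<close>
  define m11 where "m11 = b u 1 1 - (g11 u - t1 * t1)"
  define m12 where "m12 = b u 1 2 - (g12 u - t1 * t2)"
  define m22 where "m22 = b u 2 2 - (g22 u - t2 * t2)"
  have g1: "y * g11 u + z * g12 u = d * t1" and g2: "y * g12 u + z * g22 u = d * t2"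
    by (simp_all add: y_def z_def d_def gdet_def algebra_simps)
  have "y * m11 + z * m12 = (y * b u 1 1 + z * b u 1 2) - (y * g11 u + z * g12 u) + t1 * (y * t1 + z * t2)"
    by (simp add: m11_def m12_def algebra_simps)
  then have k1: "y * m11 + z * m12 = 0" unfolding ker g1 q by simp
  have "y * m12 + z * m22 = (y * b u 2 1 + z * b u 2 2) - (y * g12 u + z * g22 u) + t2 * (y * t1 + z * t2)"
    by (simp add: m12_def m22_def b21 algebra_simps)
  then have k2: "y * m12 + z * m22 = 0" unfolding ker g2 q by simp
  have "g22 u * m11 - 2 * g12 u * m12 + g11 u * m22 = (g22 u * b u 1 1 - 2 * g12 u * b u 1 2 + g11 u * b u 2 2)
     - 2 * d + (y * t1 + z * t2)"
    by (simp add: m11_def m12_def m22_def y_def z_def d_def gdet_def algebra_simps)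
  then have k3: "g22 u * m11 - 2 * g12 u * m12 + g11 u * m22 = 0" unfolding tr q by simp
  have "y * (y * g11 u + z * g12 u) + z * (y * g12 u + z * g22 u) = d * (y * t1 + z * t2)"
    unfolding g1 g2 by (simp add: algebra_simps)
  then have Q: "g11 u * (y * y) + 2 * g12 u * (y * z) + g22 u * (z * z) = d * d" unfolding q by (simp add: algebra_simps)
  have "m11 * (d * d) = 0" "m12 * (d * d) = 0" "m22 * (d * d) = 0"
    unfolding Q[symmetric] using k1 k2 k3 by algebra+
  then have m: "m11 = 0" "m12 = 0" "m22 = 0" using d by simp_all
  have "b u i j = ip u (pd i F u) (pd j F u) - (pd i X u \<bullet> e) * (pd j X u \<bullet> e)" for i j
  proof -
    have "(i = 1 \<or> i = 2) \<and> (j = 1 \<or> j = 2)" using exhaust_2 by blast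
    then show ?thesis using m b21 by (auto simp: m11_def m12_def m22_def t1_def t2_def ip_pd_pd[OF u])
  qed
  then show ?thesis using umbilic_normal[OF u N0[OF u]] N0[OF u] by blast
qed

lemma biharmonic_normal:
  assumes h: "h > 0" and H: "\<And>u. u \<in> W \<Longrightarrow> mean_curvature G H F \<xi> u = h"
    and bi: "\<And>u. u \<in> W \<Longrightarrow> bitension G H F u = 0" and u: "u \<in> W"
  shows "pd i N\<^sub>X u = - eu.P (pd i X u) \<and> N\<^sub>X u \<bullet> e = 0"
proof -
  interpret cmc_patch D H \<kappa> \<beta> E W F G \<xi> h by unfold_locales (rule H)
  have eq: "shape_norm2 x = 2 - (e \<bullet> e) * (1 + (N\<^sub>X x \<bullet> e)\<^sup>2)" "(e \<bullet> e) * (N\<^sub>X x \<bullet> e) * (pd i X x \<bullet> e) = 0"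
    if "x \<in> W" for x i
  proof -
    have c: "shape_norm2 x = 2 * \<kappa> + \<beta> + \<beta> * (\<eta> x (\<xi> x))\<^sup>2"
      "\<beta> * \<eta> x (\<xi> x) * \<eta> x (pd i F x) = 0"
      using iffD1[OF bitension_zero_iff[OF that] bi[OF that]] h by blast+
    show "shape_norm2 x = 2 - (e \<bullet> e) * (1 + (N\<^sub>X x \<bullet> e)\<^sup>2)"
      using c(1) unfolding \<eta>_eq[OF that] embedding_coeff by (simp add: algebra_simps)
    show "(e \<bullet> e) * (N\<^sub>X x \<bullet> e) * (pd i X x \<bullet> e) = 0"
      using c(2) unfolding \<eta>_eq[OF that] embedding_coeff by simp
  qed
  show ?thesis
  proof (cases "e = 0")
    case True
    then show ?thesis using biharmonic_sphere_normal[OF True h H _ u] eq by simp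
  next
    case False
    then have e: "e \<bullet> e = 1" using ambient_axis by simp
    show ?thesis by (rule biharmonic_cylinder_normal[OF e h H _ _ u]) (use eq e in simp_all)
  qed
qed

text \<open>Differentiating the hyperplane equation twice gives the second fundamental form of
  \<open>umbilic_normal\<close> up to the sign \<open>\<epsilon>\<close>. The mean curvature is then
  \<open>\<epsilon>\<close> in the sphere and \<open>\<epsilon> / 2\<close> in the cylinder.\<close>

lemma hyperplane_section:
  assumes u: "u \<in> W" and \<nu>: "norm \<nu> = 1" "\<nu> \<bullet> e = 0" and sec: "\<And>x. x \<in> W \<Longrightarrow> \<nu> \<bullet> X x = 1 / sqrt 2"
  shows "mean_curvature G H F \<xi> u \<noteq> 0"
    and "shape_norm2 u = 2 * \<kappa> + \<beta> + \<beta> * (\<eta> u (\<xi> u))\<^sup>2 \<and> (\<forall>l. \<beta> * \<eta> u (\<xi> u) * \<eta> u (pd l F u) = 0)"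
proof -
  have n1: "\<nu> \<bullet> pd i X x = 0" if "x \<in> W" for x i
    by (rule eu.inner_pd_X_zero[OF open_source order_refl that sec])
  have n2: "\<nu> \<bullet> pd i (pd j X) u = 0" for i j
    using eu.pd_inner_const[OF u differentiable_const eu.dX_diff[OF u] n1, of i] by simp
  obtain \<epsilon> where \<epsilon>: "\<epsilon> = 1 \<or> \<epsilon> = - 1" "sqrt 2 *\<^sub>R \<nu> = eu.P (X u) + \<epsilon> *\<^sub>R N\<^sub>X u"
    using eu.slice_normal[OF u \<nu> sec[OF u] n1[OF u]] by blast
  then have \<epsilon>2: "\<epsilon> * \<epsilon> = 1" and \<epsilon>0: "\<epsilon> \<noteq> 0" by auto
  define n where "n = sqrt 2 *\<^sub>R \<nu> - eu.P (X u)"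
  have "\<epsilon> *\<^sub>R n = (\<epsilon> * \<epsilon>) *\<^sub>R N\<^sub>X u" by (simp add: n_def \<epsilon>(2))
  then have N_eq: "N\<^sub>X u = \<epsilon> *\<^sub>R n" using \<epsilon>2 by simp
  have "n \<bullet> e = 0" using \<nu>(2) by (simp add: n_def inner_diff_left eu.inner_P_axis)
  then have N0: "N\<^sub>X u \<bullet> e = 0" by (simp add: N_eq)
  have b: "b u i j = \<epsilon> * (ip u (pd i F u) (pd j F u) - (pd i X u \<bullet> e) * (pd j X u \<bullet> e))" for i j
  proof -
    have "eu.P (pd i X u) \<bullet> pd j X u = - (eu.P (X u) \<bullet> pd i (pd j X) u)"
      using eu.pd_inner_const[OF u eu.PX_diff[OF u] eu.dX_diff[OF u] eu.PX_tangent, of i] by (simp add: eu.pd_PX[OF u])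
    then have "n \<bullet> pd i (pd j X) u = eu.P (pd i X u) \<bullet> pd j X u"
      using n2[of i j] by (simp add: n_def inner_diff_left)
    then show ?thesis
      unfolding B_eq_b[OF u, symmetric] eu.B_eq[OF u] N_eq by (simp add: eu.inner_P pd_X_inner[OF u])
  qed
  define t1 where "t1 = pd 1 X u \<bullet> e"
  define t2 where "t2 = pd 2 X u \<bullet> e"
  have gd: "gdet u > 0" by (rule g_pos(3)[OF u])
  have q: "g22 u * t1\<^sup>2 - 2 * g12 u * t1 * t2 + g11 u * t2\<^sup>2 = (e \<bullet> e) * gdet u"
  proof (cases "e = 0")
    case True
    then show ?thesis by (simp add: t1_def t2_def)
  next
    case False
    then have "e \<bullet> e = 1" using ambient_axis by simp
    then show ?thesis using axis_norm_1[OF u] N0 by (simp add: t1_def t2_def)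
  qed
  have bs: "b u 1 1 = \<epsilon> * (g11 u - t1 * t1)" "b u 1 2 = \<epsilon> * (g12 u - t1 * t2)" "b u 2 2 = \<epsilon> * (g22 u - t2 * t2)"
    by (simp_all add: b ip_pd_pd[OF u] t1_def t2_def)
  have "g22 u * b u 1 1 - 2 * g12 u * b u 1 2 + g11 u * b u 2 2
    = \<epsilon> * (2 * gdet u - (g22 u * t1\<^sup>2 - 2 * g12 u * t1 * t2 + g11 u * t2\<^sup>2))"
    unfolding bs by (simp add: gdet_def power2_eq_square algebra_simps)
  then have tr: "g22 u * b u 1 1 - 2 * g12 u * b u 1 2 + g11 u * b u 2 2 = \<epsilon> * (2 - e \<bullet> e) * gdet u"
    unfolding q by (simp add: algebra_simps)
  have m: "mean_curvature G H F \<xi> u = \<epsilon> * (2 - e \<bullet> e) / 2"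
    unfolding mean_curvature_eq[OF u] tr using gd by simp
  have ee: "e \<bullet> e = 0 \<or> e \<bullet> e = 1" using ambient_axis by auto
  then show "mean_curvature G H F \<xi> u \<noteq> 0" unfolding m using \<epsilon>0 by auto
  have "b u 1 1 * b u 2 2 - (b u 1 2)\<^sup>2 = (\<epsilon> * \<epsilon>) * (gdet u - (g22 u * t1\<^sup>2 - 2 * g12 u * t1 * t2 + g11 u * t2\<^sup>2))"
    unfolding bs by (simp add: gdet_def power2_eq_square algebra_simps)
  then have "b u 1 1 * b u 2 2 - (b u 1 2)\<^sup>2 = (1 - e \<bullet> e) * gdet u"
    unfolding q \<epsilon>2 by (simp add: algebra_simps)
  then have "shape_norm2 u = (2 * (\<epsilon> * (2 - e \<bullet> e) / 2))\<^sup>2 - 2 * (1 - e \<bullet> e)"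
    unfolding shape_norm2_eq[OF u] m using gd by simp
  also have "(2 * (\<epsilon> * (2 - e \<bullet> e) / 2))\<^sup>2 = (\<epsilon> * \<epsilon>) * (2 - e \<bullet> e)\<^sup>2" by (simp add: power2_eq_square)
  finally have "shape_norm2 u = 2 - e \<bullet> e" unfolding \<epsilon>2 using ee by auto
  then show "shape_norm2 u = 2 * \<kappa> + \<beta> + \<beta> * (\<eta> u (\<xi> u))\<^sup>2 \<and> (\<forall>l. \<beta> * \<eta> u (\<xi> u) * \<eta> u (pd l F u) = 0)"
    unfolding \<eta>_eq[OF u] N0 embedding_coeff by simp
qed

end

text \<open>For \<open>e = 0\<close> this is the small sphere with normal \<open>\<nu>\<close>, for a unit vector \<open>e\<close> it is the
  cylinder over a small circle.\<close>

definition hyperplane_slice :: "'e::euclidean_space \<Rightarrow> 'e \<Rightarrow> 'e set" where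
  "hyperplane_slice e \<nu> = {y. y \<bullet> y - (y \<bullet> e) * (y \<bullet> e) = 1 \<and> \<nu> \<bullet> y = 1 / sqrt 2}"

context euclidean_surface begin

text \<open>Distinct normals would need opposite signs in \<open>slice_normal\<close>. Adding the
  two equations makes \<open>P (X x)\<close> constant, so the differential of \<open>X\<close> would
  have rank at most one.\<close>

lemma slice_unique:
  assumes W': "open W'" "W' \<subseteq> W" "u \<in> W'"
    and \<nu>: "norm \<nu> = 1" "\<nu> \<bullet> e = 0" "\<And>x. x \<in> W' \<Longrightarrow> \<nu> \<bullet> X x = 1 / sqrt 2"
    and \<nu>': "norm \<nu>' = 1" "\<nu>' \<bullet> e = 0" "\<And>x. x \<in> W' \<Longrightarrow> \<nu>' \<bullet> X x = 1 / sqrt 2"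
  shows "\<nu> = \<nu>'"
proof (rule ccontr)
  assume ne: "\<nu> \<noteq> \<nu>'"
  have sum: "P (X x) = (sqrt 2 / 2) *\<^sub>R (\<nu> + \<nu>')" if x: "x \<in> W'" for x
  proof -
    have xW: "x \<in> W" using x W'(2) by blast
    obtain \<epsilon> where \<epsilon>: "\<epsilon> = 1 \<or> \<epsilon> = - 1" "sqrt 2 *\<^sub>R \<nu> = P (X x) + \<epsilon> *\<^sub>R \<xi> x"
      using slice_normal[OF xW \<nu>(1,2) \<nu>(3)[OF x] inner_pd_X_zero[OF W'(1,2) x \<nu>(3)]] by blast
    obtain \<epsilon>' where \<epsilon>': "\<epsilon>' = 1 \<or> \<epsilon>' = - 1" "sqrt 2 *\<^sub>R \<nu>' = P (X x) + \<epsilon>' *\<^sub>R \<xi> x"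
      using slice_normal[OF xW \<nu>'(1,2) \<nu>'(3)[OF x] inner_pd_X_zero[OF W'(1,2) x \<nu>'(3)]] by blast
    have "\<epsilon> \<noteq> \<epsilon>'"
    proof
      assume "\<epsilon> = \<epsilon>'"
      then have "sqrt 2 *\<^sub>R \<nu> = sqrt 2 *\<^sub>R \<nu>'" using \<epsilon>(2) \<epsilon>'(2) by simp
      then show False using ne by simp
    qed
    then have "\<epsilon> + \<epsilon>' = 0" using \<epsilon>(1) \<epsilon>'(1) by auto
    then have "sqrt 2 *\<^sub>R (\<nu> + \<nu>') = 2 *\<^sub>R P (X x)"
      using \<epsilon>(2) \<epsilon>'(2) by (simp add: scaleR_add_right scaleR_2 algebra_simps flip: scaleR_left_distrib)
    then have "(1 / 2) *\<^sub>R (sqrt 2 *\<^sub>R (\<nu> + \<nu>')) = P (X x)" by simp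
    then show ?thesis by simp
  qed
  have u: "u \<in> W" using W' by blast
  have "P (pd i X u) = 0" for i
  proof -
    have "pd i (\<lambda>x. P (X x)) u = pd i (\<lambda>_. (sqrt 2 / 2) *\<^sub>R (\<nu> + \<nu>')) u"
      by (rule pd_cong_open[OF W'(1,3) sum])
    then show ?thesis by (simp add: pd_PX[OF u])
  qed
  then have X: "pd i X u = (pd i X u \<bullet> e) *\<^sub>R e" for i by (simp add: P_def)
  have "pd i X u \<bullet> pd j X u = (pd i X u \<bullet> e) * (pd j X u \<bullet> e)" for i j
    by (subst X[of i]) (simp add: inner_commute)
  then show False using gram_pos[OF u] by simp
qed

text \<open>The projection \<open>p\<close> to the tangent directions at \<open>u\<close> is
  injective on the part of the slice where \<open>q \<bullet> y > 0\<close>, and its composition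
  with \<open>X\<close> has a surjective derivative at \<open>u\<close>. The image of that
  composition contains a neighbourhood of \<open>p (X u)\<close>, which \<open>T\<close> pulls back
  to the slice.\<close>

lemma slice_locally_open:
  assumes u: "u \<in> W" and \<nu>: "norm \<nu> = 1" "\<nu> \<bullet> e = 0" "\<And>x. x \<in> W \<Longrightarrow> \<nu> \<bullet> X x = 1 / sqrt 2"
  obtains T where "openin (top_of_set (hyperplane_slice e \<nu>)) T" "X u \<in> T" "T \<subseteq> X ` W"
proof -
  define p where "p y = (vector [y \<bullet> pd 1 X u, y \<bullet> pd 2 X u] :: real^2)" for y
  \<comment> \<open>The radial direction inside the slice at \<open>X u\<close>: orthogonal to the
    tangent vectors, to \<open>\<nu>\<close> and to \<open>e\<close>.\<close>
  define q where "q = P (X u) - (1 / sqrt 2) *\<^sub>R \<nu>"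
  have \<nu>P: "\<nu> \<bullet> P (X u) = 1 / sqrt 2" using \<nu>(2) \<nu>(3)[OF u] by (simp add: inner_P)
  have \<nu>X: "\<nu> \<bullet> pd i X u = 0" for i by (rule inner_pd_X_zero[OF open_W order_refl u \<nu>(3)])
  have \<nu>\<nu>: "\<nu> \<bullet> \<nu> = 1" using \<nu>(1) by (simp add: norm_eq_1)
  have half: "1 / sqrt 2 * (1 / sqrt 2) = (1 / 2 :: real)" by simp
  have q\<nu>: "q \<bullet> \<nu> = 0" using \<nu>P \<nu>\<nu> by (simp add: q_def inner_diff_left inner_commute[of "P (X u)" \<nu>])
  have qe: "q \<bullet> e = 0" using \<nu>(2) by (simp add: q_def inner_diff_left inner_P_axis)
  have qX: "q \<bullet> pd i X u = 0" for i using PX_tangent[OF u] \<nu>X by (simp add: q_def inner_diff_left)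
  have "q \<bullet> X u = P (X u) \<bullet> X u - 1 / sqrt 2 * (1 / sqrt 2)"
    using \<nu>(3)[OF u] by (simp add: q_def inner_diff_left)
  then have qXu: "q \<bullet> X u > 0" using ambient_unit[OF u] unfolding half by (simp add: inner_P)
  then have q0: "q \<noteq> 0" by auto
  have p_lin: "bounded_linear p"
    unfolding p_def
    by (rule linear_conv_bounded_linear[THEN iffD1], rule linearI)
      (simp_all add: vec_eq_iff forall_2 inner_add_left)
  \<comment> \<open>Two points of the slice with equal projection differ by a multiple
    \<open>t *\<^sub>R q\<close>. The hypersurface equation gives
    \<open>t * (q \<bullet> (y + y')) = 0\<close>, and the half-space condition excludes the second
    intersection.\<close>
  have p_inj: "y = y'" if y: "y \<in> hyperplane_slice e \<nu>" "y' \<in> hyperplane_slice e \<nu>" "q \<bullet> y > 0" "q \<bullet> y' > 0" "p y = p y'" for y y'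
  proof -
    define z where "z = y - y'"
    define t where "t = (z \<bullet> q) / (q \<bullet> q)"
    have qq: "q \<bullet> q \<noteq> 0" using q0 by simp
    have zX: "z \<bullet> pd 1 X u = 0" "z \<bullet> pd 2 X u = 0"
      using y(5) by (simp_all add: p_def vec_eq_iff forall_2 z_def inner_diff_left)
    have "\<nu> \<bullet> z = 0"
      using y(1,2) by (simp add: hyperplane_slice_def z_def inner_diff_right)
    then have z\<nu>: "z \<bullet> \<nu> = 0" by (simp add: inner_commute)
    have "z - t *\<^sub>R q = 0"
    proof (rule tangent_frame_zero[OF dim4 gram_pos[OF u], of \<nu> q])
      show "\<nu> \<noteq> 0" using \<nu>\<nu> by auto
    qed (use q0 \<nu>X qX q\<nu> zX z\<nu> qq in \<open>simp_all add: inner_diff_left inner_commute[of "pd _ X u" \<nu>]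
        inner_commute[of "pd _ X u" q] inner_commute[of \<nu> q] t_def\<close>)
    then have yz: "y = y' + t *\<^sub>R q" by (simp add: z_def algebra_simps)
    have yy: "y \<bullet> y - (y \<bullet> e) * (y \<bullet> e) = y' \<bullet> y' - (y' \<bullet> e) * (y' \<bullet> e)"
      using y(1,2) by (simp add: hyperplane_slice_def)
    have "y \<bullet> e = y' \<bullet> e" by (simp add: yz inner_add_left qe)
    then have "y \<bullet> y = y' \<bullet> y'" using yy by simp
    moreover have "y \<bullet> y - y' \<bullet> y' = t * (q \<bullet> (y + y'))"
      unfolding yz by (simp add: inner_add_left inner_add_right inner_commute[of y' q] algebra_simps)
    ultimately have "t * (q \<bullet> (y + y')) = 0" by simp
    moreover have "q \<bullet> (y + y') > 0" using y(3,4) by (simp add: inner_add_right)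
    ultimately show ?thesis using yz by simp
  qed
  have Xc: "continuous_on W X" by (rule smooth_on_continuous_on[OF X_smooth])
  define W' where "W' = {x \<in> W. q \<bullet> X x > 0}"
  have oW': "open W'"
    using continuous_open_preimage[OF continuous_on_inner[OF continuous_on_const Xc] open_W, of "{0<..}" q]
    by (simp add: W'_def vimage_def Int_def)
  have uW': "u \<in> W'" using u qXu by (simp add: W'_def)
  have der: "((\<lambda>x. p (X x)) has_derivative (\<lambda>v. p (\<Sum>i\<in>UNIV. v $ i *\<^sub>R pd i X u))) (at u)"
    by (rule bounded_linear.has_derivative[OF p_lin has_derivative_pd[OF X_diff[OF u]]])
  let ?a = "pd 1 X u" and ?b = "pd 2 X u"
  define D where "D = (?a \<bullet> ?a) * (?b \<bullet> ?b) - (?a \<bullet> ?b) * (?a \<bullet> ?b)"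
  have D: "D > 0" unfolding D_def by (rule gram_pos[OF u])
  \<comment> \<open>In coordinates the derivative of \<open>p (X x)\<close> at \<open>u\<close> is
    the first fundamental form; \<open>g\<close> is its inverse.\<close>
  define g where "g v = (vector [((?b \<bullet> ?b) * v $ 1 - (?a \<bullet> ?b) * v $ 2) / D, ((?a \<bullet> ?a) * v $ 2 - (?a \<bullet> ?b) * v $ 1) / D] :: real^2)" for v :: "real^2"
  have g_lin: "bounded_linear g"
    unfolding g_def
    by (rule linear_conv_bounded_linear[THEN iffD1], rule linearI)
      (simp_all add: vec_eq_iff forall_2 add_divide_distrib diff_divide_distrib algebra_simps)
  have inv: "(\<lambda>v. p (\<Sum>i\<in>UNIV. v $ i *\<^sub>R pd i X u)) \<circ> g = id"
  proof
    fix v :: "real^2"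
    have "((?b \<bullet> ?b) * x - (?a \<bullet> ?b) * y) / D * (?a \<bullet> ?a) + ((?a \<bullet> ?a) * y - (?a \<bullet> ?b) * x) / D * (?a \<bullet> ?b) = x"
      "((?b \<bullet> ?b) * x - (?a \<bullet> ?b) * y) / D * (?a \<bullet> ?b) + ((?a \<bullet> ?a) * y - (?a \<bullet> ?b) * x) / D * (?b \<bullet> ?b) = y" for x y
    proof -
      have "((?b \<bullet> ?b) * x - (?a \<bullet> ?b) * y) * (?a \<bullet> ?a) + ((?a \<bullet> ?a) * y - (?a \<bullet> ?b) * x) * (?a \<bullet> ?b) = x * D"
        "((?b \<bullet> ?b) * x - (?a \<bullet> ?b) * y) * (?a \<bullet> ?b) + ((?a \<bullet> ?a) * y - (?a \<bullet> ?b) * x) * (?b \<bullet> ?b) = y * D"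
        by (simp_all add: D_def algebra_simps)
      then show "((?b \<bullet> ?b) * x - (?a \<bullet> ?b) * y) / D * (?a \<bullet> ?a) + ((?a \<bullet> ?a) * y - (?a \<bullet> ?b) * x) / D * (?a \<bullet> ?b) = x"
        "((?b \<bullet> ?b) * x - (?a \<bullet> ?b) * y) / D * (?a \<bullet> ?b) + ((?a \<bullet> ?a) * y - (?a \<bullet> ?b) * x) / D * (?b \<bullet> ?b) = y"
        using D by (simp_all add: divide_simps)
    qed
    then show "((\<lambda>v. p (\<Sum>i\<in>UNIV. v $ i *\<^sub>R pd i X u)) \<circ> g) v = id v"
      by (simp add: p_def g_def sum_2 inner_add_left vec_eq_iff forall_2 inner_commute[of ?b ?a])
  qed
  have "p (X u) \<in> interior ((\<lambda>x. p (X x)) ` W')"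
  proof (rule sussmann_open_mapping[OF open_W _ u der g_lin inv])
    show "continuous_on W (\<lambda>x. p (X x))"
      by (intro bounded_linear.continuous_on[OF p_lin] Xc)
    show "W' \<subseteq> W" by (auto simp: W'_def)
    show "u \<in> interior W'" using oW' uW' by (simp add: interior_open)
  qed
  note int = this
  define T where "T = hyperplane_slice e \<nu> \<inter> ({y. q \<bullet> y > 0} \<inter> p -` interior ((\<lambda>x. p (X x)) ` W'))"
  have slice: "X x \<in> hyperplane_slice e \<nu>" if "x \<in> W" for x
    using ambient_unit[OF that] \<nu>(3)[OF that] by (simp add: hyperplane_slice_def)
  show ?thesis
  proof
    have "open ({y. q \<bullet> y > 0} \<inter> p -` interior ((\<lambda>x. p (X x)) ` W'))"
      by (intro open_Int open_halfspace_gt continuous_open_vimage open_interior)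
        (simp add: linear_continuous_at[OF p_lin])
    then show "openin (top_of_set (hyperplane_slice e \<nu>)) T" unfolding T_def by blast
    show "X u \<in> T" using slice[OF u] qXu int by (simp add: T_def)
    show "T \<subseteq> X ` W"
    proof
      fix y assume y: "y \<in> T"
      then obtain x where x: "x \<in> W'" "p y = p (X x)" using interior_subset by (auto simp: T_def)
      then have "x \<in> W" "q \<bullet> X x > 0" by (auto simp: W'_def)
      then have "y = X x" using y x(2) slice by (intro p_inj) (auto simp: T_def)
      then show "y \<in> X ` W" using \<open>x \<in> W\<close> by blast
    qed
  qed
qed

end

section \<open>The two exceptional surfaces\<close>

definition embedded_target :: "('e::euclidean_space, 3) rmanifold \<Rightarrow> 'e \<Rightarrow> (real^3 \<Rightarrow> real^3) \<Rightarrow> bool" where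
  "embedded_target N e E \<longleftrightarrow> geometric_target N 1 (- (e \<bullet> e)) E \<and>
     (\<forall>d\<in>atlas N. embedded_geometry (coord d ` cdom d) (gram d) 1 (- (e \<bullet> e)) E (chart_inv d) e
        \<and> (\<forall>p\<in>cdom d. chart_inv d (coord d p) = p))"

lemma embedded_patchI:
  assumes "embedded_target N e E" "d \<in> atlas N"
    "surface_patch (coord d ` cdom d) (gram d) 1 (- (e \<bullet> e)) E W (local_rep c d \<phi>) G \<xi>"
  shows "embedded_patch (coord d ` cdom d) (gram d) 1 (- (e \<bullet> e)) E (chart_inv d) e W (local_rep c d \<phi>) G \<xi>"
  using assms by (simp add: embedded_patch_def embedded_target_def)

lemma embedded_representation:
  fixes M :: "('m, 2) rmanifold"
  assumes M: "riemannian_manifold M" and imm: "isometric_immersion M N \<phi>" and N: "embedded_target N e E"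
    and c: "c \<in> atlas M" and d: "d \<in> atlas N" and u: "u \<in> rep_dom c d \<phi>"
  shows "chart_inv d (local_rep c d \<phi> u) = \<phi> (chart_inv c u)" "chart_inv c u \<in> topspace (top_space M)"
proof -
  have gt: "geometric_target N 1 (- (e \<bullet> e)) E" using N by (simp add: embedded_target_def)
  note r = local_rep_patch(5)[OF M imm gt c d u]
  show "chart_inv d (local_rep c d \<phi> u) = \<phi> (chart_inv c u)" using r N d by (simp add: embedded_target_def)
  have "cdom c \<subseteq> topspace (top_space M)"
    using M c openin_subset by (auto simp: riemannian_manifold_def riemannian_chart_def)
  then show "chart_inv c u \<in> topspace (top_space M)" using r by blast
qed

text \<open>The patch lives on a ball, while an equation known on \<open>U\<close> holds only on the
  smaller \<open>W'\<close>; \<open>slice_unique\<close> takes both.\<close>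

lemma embedded_target_slice:
  fixes M :: "('m, 2) rmanifold"
  assumes M: "riemannian_manifold M" and imm: "isometric_immersion M N \<phi>" and N: "embedded_target N e E"
    and U: "openin (top_space M) U" "x \<in> U"
  obtains c d r \<xi> W' where "c \<in> atlas M" "d \<in> atlas N" "x \<in> cdom c" "r > 0" "ball (coord c x) r \<subseteq> rep_dom c d \<phi>"
    "embedded_patch (coord d ` cdom d) (gram d) 1 (- (e \<bullet> e)) E (chart_inv d) e (ball (coord c x) r) (local_rep c d \<phi>) (gram c) \<xi>"
    "open W'" "coord c x \<in> W'" "W' \<subseteq> ball (coord c x) r" "chart_inv c ` W' \<subseteq> U"
proof -
  have gt: "geometric_target N 1 (- (e \<bullet> e)) E" using N by (simp add: embedded_target_def)
  have x: "x \<in> topspace (top_space M)" using U openin_subset by blast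
  obtain c d where cd: "c \<in> atlas M" "d \<in> atlas N" "x \<in> cdom c" "\<phi> x \<in> cdom d" "coord c x \<in> rep_dom c d \<phi>"
    using point_in_rep_dom[OF M imm gt x] .
  obtain r \<xi> where r: "r > 0" "ball (coord c x) r \<subseteq> rep_dom c d \<phi>"
    and s: "surface_patch (coord d ` cdom d) (gram d) 1 (- (e \<bullet> e)) E (ball (coord c x) r) (local_rep c d \<phi>) (gram c) \<xi>"
    using surface_patch_at[OF M imm gt cd(1,2,5)] .
  have rc: "riemannian_chart (top_space M) c" using M cd(1) by (simp add: riemannian_manifold_def)
  have oc: "openin (top_space M) (cdom c)" using rc by (simp add: riemannian_chart_def)
  define W' where "W' = ball (coord c x) r \<inter> coord c ` (U \<inter> cdom c)"
  have "open (coord c ` (U \<inter> cdom c))" by (rule open_coord_image[OF rc openin_Int[OF U(1) oc]]) simp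
  then have 1: "open W'" by (simp add: W'_def open_Int)
  have 2: "coord c x \<in> W'" using r U cd by (simp add: W'_def)
  have 3: "chart_inv c ` W' \<subseteq> U" using chart_inv_coord[OF rc] by (auto simp: W'_def)
  show ?thesis
    by (rule that[OF cd(1-3) r embedded_patchI[OF N cd(2) s] 1 2 _ 3]) (simp add: W'_def)
qed

lemma slice_normal_unique:
  fixes M :: "('m, 2) rmanifold"
  assumes M: "riemannian_manifold M" and imm: "isometric_immersion M N \<phi>" and N: "embedded_target N e E"
    and U: "openin (top_space M) U" "x \<in> U"
    and \<nu>: "norm \<nu> = 1" "\<nu> \<bullet> e = 0" "\<And>y. y \<in> U \<Longrightarrow> \<nu> \<bullet> \<phi> y = 1 / sqrt 2"
    and \<nu>': "norm \<nu>' = 1" "\<nu>' \<bullet> e = 0" "\<And>y. y \<in> U \<Longrightarrow> \<nu>' \<bullet> \<phi> y = 1 / sqrt 2"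
  shows "\<nu> = \<nu>'"
proof -
  obtain c d r \<xi> W' where cd: "c \<in> atlas M" "d \<in> atlas N" "ball (coord c x) r \<subseteq> rep_dom c d \<phi>"
    "embedded_patch (coord d ` cdom d) (gram d) 1 (- (e \<bullet> e)) E (chart_inv d) e (ball (coord c x) r) (local_rep c d \<phi>) (gram c) \<xi>"
    and W': "open W'" "coord c x \<in> W'" "W' \<subseteq> ball (coord c x) r" "chart_inv c ` W' \<subseteq> U"
    using embedded_target_slice[OF M imm N U] by metis
  interpret embedded_patch "coord d ` cdom d" "gram d" 1 "- (e \<bullet> e)" E "chart_inv d" e "ball (coord c x) r" "local_rep c d \<phi>" "gram c" \<xi>
    by fact
  have X: "X u = \<phi> (chart_inv c u)" "chart_inv c u \<in> U" if "u \<in> W'" for u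
    using embedded_representation(1)[OF M imm N cd(1,2)] that W'(3,4) cd(3) by (auto simp: X_def)
  show ?thesis
    by (rule eu.slice_unique[OF W'(1,3,2) \<nu>(1,2) _ \<nu>'(1,2)]) (use X \<nu>(3) \<nu>'(3) in auto)
qed

lemma biharmonic_locally_in_slice:
  fixes M :: "('m, 2) rmanifold"
  assumes M: "riemannian_manifold M" and N: "embedded_target N e E"
    and k: "has_abs_mean_curvature M N \<phi> k" and pb: "proper_biharmonic M N \<phi>" and x: "x \<in> topspace (top_space M)"
  obtains \<nu> U where "norm \<nu> = 1" "\<nu> \<bullet> e = 0" "openin (top_space M) U" "x \<in> U"
    "\<forall>y\<in>U. \<nu> \<bullet> \<phi> y = 1 / sqrt 2"
proof -
  have gt: "geometric_target N 1 (- (e \<bullet> e)) E" using N by (simp add: embedded_target_def)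
  have imm: "isometric_immersion M N \<phi>" using pb by (simp add: proper_biharmonic_def)
  obtain c d r \<xi> where cd: "c \<in> atlas M" "d \<in> atlas N" "x \<in> cdom c" "\<phi> x \<in> cdom d"
    and r: "r > 0" "ball (coord c x) r \<subseteq> rep_dom c d \<phi>" "k > 0"
    and cm: "cmc_patch (coord d ` cdom d) (gram d) 1 (- (e \<bullet> e)) E (ball (coord c x) r) (local_rep c d \<phi>) (gram c) \<xi> k"
    and bi: "\<And>u. u \<in> ball (coord c x) r \<Longrightarrow> bitension (gram c) (gram d) (local_rep c d \<phi>) u = 0"
    using biharmonic_cmc_equations[OF M gt x k pb] by metis
  interpret cmc_patch "coord d ` cdom d" "gram d" 1 "- (e \<bullet> e)" E "ball (coord c x) r" "local_rep c d \<phi>" "gram c" \<xi> k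
    by fact
  interpret embedded_patch "coord d ` cdom d" "gram d" 1 "- (e \<bullet> e)" E "chart_inv d" e "ball (coord c x) r" "local_rep c d \<phi>" "gram c" \<xi>
    by (rule embedded_patchI[OF N cd(2) surface_patch_axioms])
  have eq: "pd i N\<^sub>X u = - eu.P (pd i X u) \<and> N\<^sub>X u \<bullet> e = 0" if "u \<in> ball (coord c x) r" for u i
    by (rule biharmonic_normal[OF r(3) mean_curvature_const bi that])
  have x0: "coord c x \<in> ball (coord c x) r" using r(1) by simp
  obtain \<nu> where \<nu>: "norm \<nu> = 1" "\<nu> \<bullet> e = 0" "\<And>u. u \<in> ball (coord c x) r \<Longrightarrow> \<nu> \<bullet> X u = 1 / sqrt 2"
    using eu.constant_normal[OF connected_ball x0] eq by metis
  have rc: "riemannian_chart (top_space M) c" using M cd(1) by (simp add: riemannian_manifold_def)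
  have "openin (top_space M) (chart_inv c ` ball (coord c x) r)"
    by (rule openin_coord_preimage[OF rc open_ball]) (use r(2) in \<open>auto simp: rep_dom_def\<close>)
  moreover have "x \<in> chart_inv c ` ball (coord c x) r" using chart_inv_coord[OF rc cd(3)] x0 by (metis imageI)
  moreover have "\<nu> \<bullet> \<phi> y = 1 / sqrt 2" if y: "y \<in> chart_inv c ` ball (coord c x) r" for y
  proof -
    obtain u where u: "u \<in> ball (coord c x) r" "y = chart_inv c u" using y by blast
    then have "X u = \<phi> y" using embedded_representation(1)[OF M imm N cd(1,2)] r(2) by (auto simp: X_def)
    then show ?thesis using \<nu>(3)[OF u(1)] by simp
  qed
  ultimately show ?thesis using that[OF \<nu>(1,2)] by blast
qed

text \<open>The open sets \<open>O' \<nu>\<close> of points near which \<open>\<nu>\<close> is the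
  hyperplane normal cover the surface and are pairwise disjoint by
  \<open>slice_normal_unique\<close>; connectedness leaves just one.\<close>

lemma biharmonic_in_slice:
  fixes M :: "('m, 2) rmanifold"
  assumes M: "riemannian_manifold M" and con: "connected_space (top_space M)" and ne: "topspace (top_space M) \<noteq> {}"
    and N: "embedded_target N e E" and k: "has_abs_mean_curvature M N \<phi> k" and pb: "proper_biharmonic M N \<phi>"
  obtains \<nu> where "norm \<nu> = 1" "\<nu> \<bullet> e = 0" "\<forall>y\<in>topspace (top_space M). \<nu> \<bullet> \<phi> y = 1 / sqrt 2"
proof -
  let ?X = "top_space M"
  have imm: "isometric_immersion M N \<phi>" using pb by (simp add: proper_biharmonic_def)
  define O' where "O' \<nu> = \<Union>{U. openin ?X U \<and> (\<forall>y\<in>U. \<nu> \<bullet> \<phi> y = 1 / sqrt 2)}" for \<nu>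
  define V where "V = {\<nu>. norm \<nu> = 1 \<and> \<nu> \<bullet> e = 0}"
  have cover: "\<exists>\<nu>\<in>V. x \<in> O' \<nu>" if x: "x \<in> topspace ?X" for x
  proof -
    obtain \<nu> U where "norm \<nu> = 1" "\<nu> \<bullet> e = 0" "openin ?X U" "x \<in> U" "\<forall>y\<in>U. \<nu> \<bullet> \<phi> y = 1 / sqrt 2"
      using biharmonic_locally_in_slice[OF M N k pb x] .
    then have "\<nu> \<in> V" "x \<in> O' \<nu>" by (auto simp: O'_def V_def)
    then show ?thesis by blast
  qed
  have open': "openin ?X (O' \<nu>)" for \<nu> unfolding O'_def by (rule openin_Union) blast
  have disj: "O' \<nu> \<inter> O' \<nu>' = {}" if "\<nu> \<in> V" "\<nu>' \<in> V" "\<nu> \<noteq> \<nu>'" for \<nu> \<nu>'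
  proof (rule ccontr)
    assume "O' \<nu> \<inter> O' \<nu>' \<noteq> {}"
    then obtain x where x: "x \<in> O' \<nu> \<inter> O' \<nu>'" by blast
    have "openin ?X (O' \<nu> \<inter> O' \<nu>')" by (intro openin_Int open')
    then have "\<nu> = \<nu>'"
      by (rule slice_normal_unique[OF M imm N _ x]) (use that in \<open>auto simp: O'_def V_def\<close>)
    then show False using that by simp
  qed
  obtain x0 where x0: "x0 \<in> topspace ?X" using ne by blast
  obtain \<nu> where \<nu>: "\<nu> \<in> V" "x0 \<in> O' \<nu>" using cover[OF x0] by blast
  define B where "B = \<Union>(O' ` (V - {\<nu>}))"
  have oB: "openin ?X B" unfolding B_def by (rule openin_Union) (use open' in blast)
  have "O' \<nu> \<inter> B = {}" using disj[OF \<nu>(1)] by (auto simp: B_def)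
  moreover have "topspace ?X \<subseteq> O' \<nu> \<union> B" using cover by (auto simp: B_def)
  ultimately have "B = {}"
    using con open'[of \<nu>] oB \<nu>(2) unfolding connected_space_def by blast
  then have "topspace ?X \<subseteq> O' \<nu>" using \<open>topspace ?X \<subseteq> O' \<nu> \<union> B\<close> by simp
  then have "\<nu> \<bullet> \<phi> y = 1 / sqrt 2" if "y \<in> topspace ?X" for y using that by (auto simp: O'_def)
  then show ?thesis using that[of \<nu>] \<nu>(1) by (simp add: V_def)
qed

lemma open_in_slice:
  fixes M :: "('m, 2) rmanifold"
  assumes M: "riemannian_manifold M" and imm: "isometric_immersion M N \<phi>" and N: "embedded_target N e E"
    and \<nu>: "norm \<nu> = 1" "\<nu> \<bullet> e = 0" "\<And>y. y \<in> topspace (top_space M) \<Longrightarrow> \<nu> \<bullet> \<phi> y = 1 / sqrt 2"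
  shows "openin (top_of_set (hyperplane_slice e \<nu>)) (\<phi> ` topspace (top_space M))"
proof (subst openin_subopen, intro ballI)
  fix y assume "y \<in> \<phi> ` topspace (top_space M)"
  then obtain x where x: "x \<in> topspace (top_space M)" "y = \<phi> x" by blast
  obtain c d r \<xi> W' where cd: "c \<in> atlas M" "d \<in> atlas N" "x \<in> cdom c" and r: "r > 0" "ball (coord c x) r \<subseteq> rep_dom c d \<phi>"
    and em: "embedded_patch (coord d ` cdom d) (gram d) 1 (- (e \<bullet> e)) E (chart_inv d) e (ball (coord c x) r) (local_rep c d \<phi>) (gram c) \<xi>"
    using embedded_target_slice[OF M imm N openin_topspace x(1)] by metis
  interpret embedded_patch "coord d ` cdom d" "gram d" 1 "- (e \<bullet> e)" E "chart_inv d" e "ball (coord c x) r" "local_rep c d \<phi>" "gram c" \<xi>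
    by fact
  have X: "X u = \<phi> (chart_inv c u)" "chart_inv c u \<in> topspace (top_space M)" if "u \<in> ball (coord c x) r" for u
    using embedded_representation[OF M imm N cd(1,2)] that r(2) by (auto simp: X_def)
  have x0: "coord c x \<in> ball (coord c x) r" using r(1) by simp
  have rc: "riemannian_chart (top_space M) c" using M cd(1) by (simp add: riemannian_manifold_def)
  have "\<nu> \<bullet> X u = 1 / sqrt 2" if "u \<in> ball (coord c x) r" for u using X[OF that] \<nu>(3) by simp
  then obtain T where T: "openin (top_of_set (hyperplane_slice e \<nu>)) T" "X (coord c x) \<in> T" "T \<subseteq> X ` ball (coord c x) r"
    using eu.slice_locally_open[OF x0 \<nu>(1,2)] by blast
  have "X (coord c x) = y" using X(1)[OF x0] chart_inv_coord[OF rc cd(3)] x(2) by simp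
  moreover have "X ` ball (coord c x) r \<subseteq> \<phi> ` topspace (top_space M)" using X by auto
  ultimately show "\<exists>T. openin (top_of_set (hyperplane_slice e \<nu>)) T \<and> y \<in> T \<and> T \<subseteq> \<phi> ` topspace (top_space M)"
    using T by (intro exI[of _ T]) simp
qed

lemma slice_proper_biharmonic:
  fixes M :: "('m, 2) rmanifold"
  assumes M: "riemannian_manifold M" and ne: "topspace (top_space M) \<noteq> {}" and N: "embedded_target N e E"
    and imm: "isometric_immersion M N \<phi>" and k: "has_abs_mean_curvature M N \<phi> k"
    and \<nu>: "norm \<nu> = 1" "\<nu> \<bullet> e = 0" "\<And>y. y \<in> topspace (top_space M) \<Longrightarrow> \<nu> \<bullet> \<phi> y = 1 / sqrt 2"
  shows "proper_biharmonic M N \<phi>"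
proof -
  have gt: "geometric_target N 1 (- (e \<bullet> e)) E" using N by (simp add: embedded_target_def)
  \<comment> \<open>Stated for every admissible constant \<open>k'\<close> because it serves twice:
    with \<open>k\<close> for the bitension field, and with 0 to refute minimality.\<close>
  have point: "k' \<noteq> 0 \<and> bitension (gram c) (gram d) (local_rep c d \<phi>) p = 0"
    if c: "c \<in> atlas M" and d: "d \<in> atlas N" and p: "p \<in> rep_dom c d \<phi>" and k': "has_abs_mean_curvature M N \<phi> k'" for c d p k'
  proof -
    obtain r \<xi> where r: "r > 0" "ball p r \<subseteq> rep_dom c d \<phi>"
      and cm: "cmc_patch (coord d ` cdom d) (gram d) 1 (- (e \<bullet> e)) E (ball p r) (local_rep c d \<phi>) (gram c) \<xi> k'"
      using cmc_patch_at[OF M imm gt k' c d p] by metis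
    interpret cmc_patch "coord d ` cdom d" "gram d" 1 "- (e \<bullet> e)" E "ball p r" "local_rep c d \<phi>" "gram c" \<xi> k' by fact
    interpret embedded_patch "coord d ` cdom d" "gram d" 1 "- (e \<bullet> e)" E "chart_inv d" e "ball p r" "local_rep c d \<phi>" "gram c" \<xi>
      by (rule embedded_patchI[OF N d surface_patch_axioms])
    have "\<nu> \<bullet> X u = 1 / sqrt 2" if "u \<in> ball p r" for u
      using embedded_representation[OF M imm N c d] that r(2) \<nu>(3) by (auto simp: X_def)
    moreover have p0: "p \<in> ball p r" using r(1) by simp
    ultimately have h: "k' \<noteq> 0" and eq: "shape_norm2 p = 2 * 1 + - (e \<bullet> e) + - (e \<bullet> e) * (\<eta> p (\<xi> p))\<^sup>2
      \<and> (\<forall>l. - (e \<bullet> e) * \<eta> p (\<xi> p) * \<eta> p (pd l (local_rep c d \<phi>) p) = 0)"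
      using hyperplane_section[OF p0 \<nu>(1,2)] mean_curvature_const[OF p0] by blast+
    then show ?thesis using bitension_zero_iff[OF p0 h] by blast
  qed
  have "\<not> minimal_surface M N \<phi>"
  proof
    assume "minimal_surface M N \<phi>"
    then have 0: "has_abs_mean_curvature M N \<phi> 0" by (simp add: minimal_surface_def)
    obtain x where x: "x \<in> topspace (top_space M)" using ne by blast
    obtain c d where "c \<in> atlas M" "d \<in> atlas N" "coord c x \<in> rep_dom c d \<phi>"
      using point_in_rep_dom[OF M imm gt x] .
    then show False using point[OF _ _ _ 0] by blast
  qed
  moreover have "biharmonic M N \<phi>"
    using imm point[OF _ _ _ k] by (auto simp: biharmonic_def isometric_immersion_def)
  ultimately show ?thesis using imm by (simp add: proper_biharmonic_def)
qed

lemma proper_biharmonic_iff_slice: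
  fixes M :: "('m, 2) rmanifold"
  assumes M: "riemannian_manifold M" and con: "connected_space (top_space M)" and ne: "topspace (top_space M) \<noteq> {}"
    and N: "embedded_target N e E" and cmc: "cmc_surface M N \<phi>"
  shows "proper_biharmonic M N \<phi> \<longleftrightarrow> (\<exists>\<nu>. norm \<nu> = 1 \<and> \<nu> \<bullet> e = 0 \<and> part_of M \<phi> (hyperplane_slice e \<nu>))"
proof -
  obtain k where k: "has_abs_mean_curvature M N \<phi> k" and imm: "isometric_immersion M N \<phi>"
    using cmc by (auto simp: cmc_surface_def)
  show ?thesis
  proof
    assume pb: "proper_biharmonic M N \<phi>"
    obtain \<nu> where \<nu>: "norm \<nu> = 1" "\<nu> \<bullet> e = 0" "\<forall>y\<in>topspace (top_space M). \<nu> \<bullet> \<phi> y = 1 / sqrt 2"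
      using biharmonic_in_slice[OF M con ne N k pb] .
    show "\<exists>\<nu>. norm \<nu> = 1 \<and> \<nu> \<bullet> e = 0 \<and> part_of M \<phi> (hyperplane_slice e \<nu>)"
      using open_in_slice[OF M imm N \<nu>(1,2) bspec[OF \<nu>(3)]] \<nu>(1,2) unfolding part_of_def by blast
  next
    assume "\<exists>\<nu>. norm \<nu> = 1 \<and> \<nu> \<bullet> e = 0 \<and> part_of M \<phi> (hyperplane_slice e \<nu>)"
    then obtain \<nu> where \<nu>: "norm \<nu> = 1" "\<nu> \<bullet> e = 0" "part_of M \<phi> (hyperplane_slice e \<nu>)" by blast
    then have "\<phi> ` topspace (top_space M) \<subseteq> hyperplane_slice e \<nu>"
      unfolding part_of_def using openin_imp_subset by blast
    then have "\<nu> \<bullet> \<phi> y = 1 / sqrt 2" if "y \<in> topspace (top_space M)" for y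
      using that by (auto simp: hyperplane_slice_def)
    then show "proper_biharmonic M N \<phi>" by (rule slice_proper_biharmonic[OF M ne N imm k \<nu>(1,2)])
  qed
qed

section \<open>Inverse charts of the sphere and of sphere times line as embeddings in
  4-space\<close>

lemma chart_inv_sphere_chart: "s * s = 1 \<Longrightarrow> chart_inv (sphere_chart s) = stereographic_inv s"
  by (simp add: chart_inv_def sphere_chart_def inv_stereographic)

lemma stereographic_inv_unit: "s * s = 1 \<Longrightarrow> stereographic_inv s u \<bullet> stereographic_inv s u = 1"
  using stereographic_inv(1)[of s u] by (simp add: sphere_dom_def norm_eq_1)

lemma gram_sphere_chart_inner:
  "s * s = 1 \<Longrightarrow> gram (sphere_chart s) u $ a $ b = pd a (stereographic_inv s) u \<bullet> pd b (stereographic_inv s) u"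
  by (simp add: sphere_chart_def inv_stereographic Let_def)

lemma embedded_target_sphere: "embedded_target (round_sphere :: ((real^3) \<times> real, 3) rmanifold) 0 (\<lambda>_. 0)"
  unfolding embedded_target_def
proof (intro conjI ballI)
  show gt: "geometric_target round_sphere 1 (- ((0 :: (real^3) \<times> real) \<bullet> 0)) (\<lambda>_. 0)"
    using geometric_target_sphere by simp
  fix d :: "((real^3) \<times> real, 3) rchart" assume d: "d \<in> atlas round_sphere"
  then obtain s where s: "d = sphere_chart s" "s * s = 1" by (auto simp: round_sphere_def)
  have "embedded_geometry (coord d ` cdom d) (gram d) 1 (- ((0 :: (real^3) \<times> real) \<bullet> 0)) (\<lambda>_. 0) (stereographic_inv s) 0"
  proof (intro embedded_geometry.intro embedded_geometry_axioms.intro)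
    show "geometry_domain (coord d ` cdom d) (gram d) 1 (- ((0 :: (real^3) \<times> real) \<bullet> 0)) (\<lambda>_. 0)"
      using gt d by (simp add: geometric_target_def)
    show "smooth_on (stereographic_inv s) (coord d ` cdom d)"
      using smooth_stereographic_inv[of s] by (simp add: s sphere_chart_def stereographic_image)
  qed (simp_all add: s gram_sphere_chart_inner stereographic_inv_unit)
  then show "embedded_geometry (coord d ` cdom d) (gram d) 1 (- ((0 :: (real^3) \<times> real) \<bullet> 0)) (\<lambda>_. 0) (chart_inv d) 0"
    by (simp add: s chart_inv_sphere_chart)
  fix p assume "p \<in> cdom d"
  then show "chart_inv d (coord d p) = p"
    using s(2) by (simp add: s(1) chart_inv_sphere_chart) (simp add: sphere_chart_def stereographic_inv_stereographic)
qed

lemma vec3_eq_iff: "v = w \<longleftrightarrow> v $ 1 = w $ 1 \<and> v $ 2 = w $ 2 \<and> v $ 3 = w $ (3::3)"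
  by (simp add: vec_eq_iff forall_3)

lemma chart_inv_times_line:
  assumes s: "s * s = 1"
  shows "chart_inv (chart_times_line (sphere_chart s)) = (\<lambda>u. (stereographic_inv s (vector [u $ 1, u $ 2]), u $ 3))"
    and "p \<in> cdom (chart_times_line (sphere_chart s)) \<Longrightarrow>
      chart_inv (chart_times_line (sphere_chart s)) (coord (chart_times_line (sphere_chart s)) p) = p"
proof -
  let ?c = "chart_times_line (sphere_chart s)" and ?g = "\<lambda>u :: real^3. (stereographic_inv s (vector [u $ 1, u $ 2]), u $ 3)"
  have gi: "?g (coord ?c p) = p" if "p \<in> cdom ?c" for p
  proof -
    obtain q t where qt: "p = (q, t)" "q \<in> sphere_dom s" using \<open>p \<in> cdom ?c\<close> by (auto simp: chart_times_line_def sphere_chart_def)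
    have "vector [stereographic s q $ 1, stereographic s q $ 2] = stereographic s q" by (simp add: vec_eq_iff forall_2)
    then show ?thesis by (simp add: chart_times_line_def sphere_chart_def qt stereographic_inv_stereographic[OF s])
  qed
  have inj: "inj_on (coord ?c) (cdom ?c)" by (rule inj_on_inverseI) (rule gi)
  have "coord ?c (?g u) = u" "?g u \<in> cdom ?c" for u
    by (simp_all add: chart_times_line_def sphere_chart_def vec3_eq_iff stereographic_inv[OF s])
  then show 1: "chart_inv ?c = ?g" unfolding chart_inv_def by (intro ext inv_into_f_eq inj)
  show "p \<in> cdom ?c \<Longrightarrow> chart_inv ?c (coord ?c p) = p" unfolding 1 by (rule gi)
qed

lemma embedded_target_sphere_line:
  "embedded_target (times_line (round_sphere :: ((real^2) \<times> real, 2) rmanifold)) (0, 1) (\<lambda>_. axis 3 1)"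
  unfolding embedded_target_def
proof (intro conjI ballI)
  let ?e = "(0, 1) :: ((real^2) \<times> real) \<times> real"
  show gt: "geometric_target (times_line round_sphere) 1 (- (?e \<bullet> ?e)) (\<lambda>_. axis 3 1)"
    using geometric_target_sphere_line by (simp add: inner_prod_def)
  fix d :: "(((real^2) \<times> real) \<times> real, 3) rchart" assume d: "d \<in> atlas (times_line round_sphere)"
  then obtain s where s: "d = chart_times_line (sphere_chart s)" "s * s = 1" by (auto simp: times_line_def round_sphere_def)
  define L where "L u = (vector [u $ 1, u $ 2] :: real^2)" for u :: "real^3"
  define \<psi> where "\<psi> = (stereographic_inv s :: real^2 \<Rightarrow> (real^2) \<times> real)"
  have ci: "chart_inv d = (\<lambda>u. (\<psi> (L u), u $ 3))" unfolding s(1) chart_inv_times_line(1)[OF s(2)] \<psi>_def L_def ..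
  have L: "bounded_linear L"
    unfolding L_def
    by (rule linear_conv_bounded_linear[THEN iffD1], rule linearI) (simp_all add: vec_eq_iff forall_2)
  have Ls: "smooth_on L UNIV" by (rule smooth_on_linear[OF L open_UNIV])
  have \<psi>s: "smooth_on \<psi> UNIV" unfolding \<psi>_def by (rule smooth_stereographic_inv)
  have \<psi>L: "smooth_on (\<lambda>u. \<psi> (L u)) UNIV" by (rule smooth_on_compose[OF \<psi>s Ls]) auto
  have dL: "L differentiable (at u)" for u by (rule smooth_on_differentiable[OF Ls open_UNIV]) simp
  have d\<psi>: "\<psi> differentiable (at u)" for u by (rule smooth_on_differentiable[OF \<psi>s open_UNIV]) simp
  have pL: "pd a L u $ b = pd a (\<lambda>u. L u $ b) u" for a b u by (rule pd_nth[OF dL, symmetric])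
  have "pd a (\<lambda>u. \<psi> (L u)) u = (if a = 1 then pd 1 \<psi> (L u) else if a = 2 then pd 2 \<psi> (L u) else 0)" for a u
    unfolding pd_compose[OF dL d\<psi>] sum_2 pL by (simp add: L_def)
  then have pd: "pd a (\<lambda>u. (\<psi> (L u), u $ 3)) u =
    (if a = 1 then (pd 1 \<psi> (L u), 0) else if a = 2 then (pd 2 \<psi> (L u), 0) else (0, 1))" for a u
    using exhaust_3[of a] by (auto simp: pd_Pair differentiable_compose_at[OF dL d\<psi>])
  have G: "gram d u = vector [vector [pd 1 \<psi> (L u) \<bullet> pd 1 \<psi> (L u), pd 1 \<psi> (L u) \<bullet> pd 2 \<psi> (L u), 0],
      vector [pd 2 \<psi> (L u) \<bullet> pd 1 \<psi> (L u), pd 2 \<psi> (L u) \<bullet> pd 2 \<psi> (L u), 0], vector [0, 0, 1]]" for u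
    by (simp add: s(1) chart_times_line_def Let_def gram_sphere_chart_inner[OF s(2)] L_def \<psi>_def)
  have D: "coord d ` cdom d = UNIV"
    unfolding s(1) coord_image_times_line by (simp add: sphere_chart_def stereographic_image[OF s(2)])
  have "embedded_geometry (coord d ` cdom d) (gram d) 1 (- (?e \<bullet> ?e)) (\<lambda>_. axis 3 1) (\<lambda>u. (\<psi> (L u), u $ 3)) ?e"
  proof (intro embedded_geometry.intro embedded_geometry_axioms.intro)
    show "geometry_domain (coord d ` cdom d) (gram d) 1 (- (?e \<bullet> ?e)) (\<lambda>_. axis 3 1)"
      using gt d by (simp add: geometric_target_def)
    show "smooth_on (\<lambda>u. (\<psi> (L u), u $ 3)) (coord d ` cdom d)"
      unfolding D by (intro smooth_on_Pair \<psi>L smooth_on_coord open_UNIV)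
    fix x v and a b :: 3
    show "gram d x $ a $ b = pd a (\<lambda>u. (\<psi> (L u), u $ 3)) x \<bullet> pd b (\<lambda>u. (\<psi> (L u), u $ 3)) x"
      unfolding pd G using exhaust_3[of a] exhaust_3[of b] by (elim disjE) (simp_all add: inner_prod_def[of "(_, _)"])
    show "(\<psi> (L x), x $ 3) \<bullet> (\<psi> (L x), x $ 3) - ((\<psi> (L x), x $ 3) \<bullet> ?e) * ((\<psi> (L x), x $ 3) \<bullet> ?e) = 1"
      using stereographic_inv_unit[OF s(2), of "L x"] by (simp add: \<psi>_def)
    show "metric_ip (gram d x) (axis 3 1) v = (\<Sum>a\<in>UNIV. v $ a *\<^sub>R pd a (\<lambda>u. (\<psi> (L u), u $ 3)) x) \<bullet> ?e"
      unfolding pd G by (simp add: metric_ip_def sum_3 axis_def inner_add_left)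
  qed (simp_all add: inner_prod_def)
  then show "embedded_geometry (coord d ` cdom d) (gram d) 1 (- (?e \<bullet> ?e)) (\<lambda>_. axis 3 1) (chart_inv d) ?e"
    unfolding ci .
  fix p assume "p \<in> cdom d"
  then show "chart_inv d (coord d p) = p" unfolding s(1) by (rule chart_inv_times_line(2)[OF s(2)])
qed

section \<open>The exceptional surfaces as hyperplane slices\<close>

lemma small_sphere_eq: "small_sphere n = hyperplane_slice 0 n"
  by (auto simp: small_sphere_def hyperplane_slice_def norm_eq_1)

text \<open>If \<open>n \<bullet> p = 1 / sqrt 2\<close>, the squared distance of \<open>p\<close>
  to the centre is \<open>p \<bullet> p - 1 / 2\<close>, so radius 1 / sqrt 2 means that
  \<open>p\<close> is a unit vector.\<close>

lemma small_circle_eq: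
  fixes n :: "'e::euclidean_space"
  assumes "norm n = 1"
  shows "circle n ((1 / sqrt 2) *\<^sub>R n) (1 / sqrt 2) = {p. p \<bullet> p = 1 \<and> n \<bullet> p = 1 / sqrt 2}"
proof -
  define c :: real where "c = 1 / sqrt 2"
  have c: "c > 0" "c * c = 1 / 2" by (simp_all add: c_def)
  have nn: "n \<bullet> n = 1" using assms by (simp add: norm_eq_1)
  have "dist (c *\<^sub>R n) p = c \<longleftrightarrow> p \<bullet> p = 1" if np: "n \<bullet> p = c" for p
  proof -
    have "(dist (c *\<^sub>R n) p)\<^sup>2 = p \<bullet> p - 1 / 2"
      unfolding dist_norm power2_norm_eq_inner
      by (simp add: inner_diff_left inner_diff_right inner_commute[of p n] nn np c(2))
    moreover have "dist (c *\<^sub>R n) p = c \<longleftrightarrow> (dist (c *\<^sub>R n) p)\<^sup>2 = c\<^sup>2"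
      by (rule power2_eq_iff_nonneg[symmetric]) (use c in simp_all)
    ultimately show ?thesis using c(2) by (auto simp: power2_eq_square)
  qed
  moreover have "n \<bullet> (p - c *\<^sub>R n) = 0 \<longleftrightarrow> n \<bullet> p = c" for p
    by (simp add: inner_diff_right nn)
  ultimately show ?thesis by (auto simp: circle_def c_def[symmetric])
qed

text \<open>The points \<open>a + w\<close> and \<open>a - w\<close> of the circle are unit vectors;
  comparing norms makes \<open>a\<close> orthogonal to every \<open>w\<close> orthogonal to
  \<open>n\<close> and gives \<open>a \<bullet> a = 1 - r\<^sup>2\<close>. So \<open>a\<close> is a
  multiple of \<open>n\<close>, with undetermined sign.\<close>

lemma circle_in_sphere:
  fixes n a :: "'e::euclidean_space"
  assumes dim: "DIM('e) \<ge> 2" and n: "norm n = 1" and sub: "circle n a r \<subseteq> sphere 0 1" and r: "r = 1 / sqrt 2"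
  shows "a = (1 / sqrt 2) *\<^sub>R n \<or> a = (1 / sqrt 2) *\<^sub>R (- n)"
proof -
  have nn: "n \<bullet> n = 1" using n by (simp add: norm_eq_1)
  have r0: "r > 0" using r by simp
  have w: "a \<bullet> w = 0 \<and> a \<bullet> a + r\<^sup>2 = 1" if w: "n \<bullet> w = 0" "norm w = r" for w
  proof -
    have ww: "w \<bullet> w = r\<^sup>2" using w(2) by (metis power2_norm_eq_inner)
    have "a + w \<in> circle n a r" "a - w \<in> circle n a r" using w by (simp_all add: circle_def dist_norm)
    then have "(a + w) \<bullet> (a + w) = 1" "(a - w) \<bullet> (a - w) = 1" using sub by (auto simp: norm_eq_1)
    then have "a \<bullet> a + 2 * (a \<bullet> w) + r\<^sup>2 = 1" "a \<bullet> a - 2 * (a \<bullet> w) + r\<^sup>2 = 1"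
      by (simp_all add: inner_add_left inner_add_right inner_diff_left inner_diff_right inner_commute[of w a] ww)
    then show ?thesis by linarith
  qed
  have scale: "n \<bullet> ((r / norm b) *\<^sub>R b) = 0" "norm ((r / norm b) *\<^sub>R b) = r" if "b \<noteq> 0" "n \<bullet> b = 0" for b
    using that r0 by simp_all
  define b where "b = a - (n \<bullet> a) *\<^sub>R n"
  have nb: "n \<bullet> b = 0" by (simp add: b_def inner_diff_right nn)
  have "b = 0"
  proof (rule ccontr)
    assume b: "b \<noteq> 0"
    have "a \<bullet> ((r / norm b) *\<^sub>R b) = 0" using w[OF scale[OF b nb]] by simp
    then have "a \<bullet> b = 0" using r0 b by simp
    moreover have "b \<bullet> b = a \<bullet> b - (n \<bullet> a) * (n \<bullet> b)" by (subst (1) b_def) (simp add: inner_diff_left)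
    ultimately have "b \<bullet> b = 0" using nb by simp
    then show False using b by simp
  qed
  then have a: "a = (n \<bullet> a) *\<^sub>R n" by (simp add: b_def)
  obtain y where "y \<noteq> 0" "n \<bullet> y = 0"
    using orthogonal_to_vector_exists[OF dim, of n] by (auto simp: orthogonal_def)
  then have "a \<bullet> a + r\<^sup>2 = 1" using w[OF scale] by blast
  moreover have "a \<bullet> a = (n \<bullet> a)\<^sup>2" using arg_cong[OF a, of "\<lambda>y. a \<bullet> y"]
    by (simp add: inner_commute[of a n] power2_eq_square)
  ultimately have "(n \<bullet> a)\<^sup>2 = (1 / sqrt 2)\<^sup>2" by (simp add: r power_divide)
  then have "n \<bullet> a = 1 / sqrt 2 \<or> n \<bullet> a = - (1 / sqrt 2)" using power2_eq_iff by blast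
  then show ?thesis using a by auto
qed

text \<open>A vector orthogonal to the line factor has the form \<open>(n, 0)\<close>. Where the
  centre is a negative multiple of \<open>n\<close>, the vector \<open>- n\<close> describes the
  same circle.\<close>

lemma part_of_small_circle_times_line_iff:
  "part_of_small_circle_times_line M \<phi> \<longleftrightarrow>
    (\<exists>\<nu>. norm \<nu> = 1 \<and> \<nu> \<bullet> (0, 1) = 0 \<and> part_of M \<phi> (hyperplane_slice (0, 1) \<nu>))"
proof -
  have slice: "circle n ((1 / sqrt 2) *\<^sub>R n) (1 / sqrt 2) \<times> (UNIV :: real set) = hyperplane_slice (0, 1) (n, 0)"
    if "norm n = 1" for n :: "(real^2) \<times> real"
    unfolding small_circle_eq[OF that] by (auto simp: hyperplane_slice_def inner_prod_def)
  show ?thesis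
  proof
    assume "part_of_small_circle_times_line M \<phi>"
    then obtain n a where n: "norm n = 1" "circle n a (1 / sqrt 2) \<subseteq> sphere 0 1"
      "part_of M \<phi> (circle n a (1 / sqrt 2) \<times> UNIV)"
      by (auto simp: part_of_small_circle_times_line_def)
    have "\<exists>n'. norm n' = 1 \<and> circle n a (1 / sqrt 2) = circle n' ((1 / sqrt 2) *\<^sub>R n') (1 / sqrt 2)"
      using circle_in_sphere[OF _ n(1,2) refl]
    proof
      assume "a = (1 / sqrt 2) *\<^sub>R (- n)"
      then show ?thesis using n(1) by (intro exI[of _ "- n"]) (simp add: circle_def)
    qed (simp, use n(1) in blast)
    then obtain n' where "norm n' = 1" "circle n a (1 / sqrt 2) = circle n' ((1 / sqrt 2) *\<^sub>R n') (1 / sqrt 2)" by blast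
    then show "\<exists>\<nu>. norm \<nu> = 1 \<and> \<nu> \<bullet> (0, 1) = 0 \<and> part_of M \<phi> (hyperplane_slice (0, 1) \<nu>)"
      using n(3) slice[of n'] by (intro exI[of _ "(n', 0)"]) (simp add: norm_Pair)
  next
    assume "\<exists>\<nu>. norm \<nu> = 1 \<and> \<nu> \<bullet> (0, 1) = 0 \<and> part_of M \<phi> (hyperplane_slice (0, 1) \<nu>)"
    then obtain \<nu> where \<nu>: "norm \<nu> = 1" "\<nu> \<bullet> (0, 1) = 0" "part_of M \<phi> (hyperplane_slice (0, 1) \<nu>)" by blast
    then have e: "\<nu> = (fst \<nu>, 0)" by (cases \<nu>) simp
    then have n: "norm (fst \<nu>) = 1" using \<nu>(1) by (metis norm_Pair norm_zero power_zero_numeral add.right_neutral real_sqrt_abs abs_norm_cancel)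
    have "circle (fst \<nu>) ((1 / sqrt 2) *\<^sub>R fst \<nu>) (1 / sqrt 2) \<subseteq> sphere 0 1"
      unfolding small_circle_eq[OF n] by (auto simp: norm_eq_1)
    moreover have "part_of M \<phi> (circle (fst \<nu>) ((1 / sqrt 2) *\<^sub>R fst \<nu>) (1 / sqrt 2) \<times> UNIV)"
      unfolding slice[OF n] using \<nu>(3) e by metis
    ultimately show "part_of_small_circle_times_line M \<phi>"
      unfolding part_of_small_circle_times_line_def using n by blast
  qed
qed

theorem corollary2p4:
  fixes M :: "('m, 2) rmanifold"
  assumes "riemannian_manifold M"
    and "connected_space (top_space M)"
    and "topspace (top_space M) \<noteq> {}"
  shows
    "(\<forall>\<phi>. cmc_surface M (euclidean_manifold :: (real^3, 3) rmanifold) \<phi> \<longrightarrow>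
        \<not> proper_biharmonic M (euclidean_manifold :: (real^3, 3) rmanifold) \<phi>) \<and>
     (\<forall>\<phi>. cmc_surface M (round_sphere :: ((real^3) \<times> real, 3) rmanifold) \<phi> \<longrightarrow>
        (proper_biharmonic M round_sphere \<phi> \<longleftrightarrow> part_of_small_sphere M \<phi>)) \<and>
     (\<forall>\<phi>. cmc_surface M (hyperbolic (3::3)) \<phi> \<longrightarrow>
        \<not> proper_biharmonic M (hyperbolic (3::3)) \<phi>) \<and>
     (\<forall>\<phi>. cmc_surface M (times_line (round_sphere :: ((real^2) \<times> real, 2) rmanifold)) \<phi> \<longrightarrow>
        (proper_biharmonic M (times_line round_sphere) \<phi> \<longleftrightarrow> part_of_small_circle_times_line M \<phi>)) \<and>
     (\<forall>\<phi>. cmc_surface M (times_line (hyperbolic (2::2))) \<phi> \<longrightarrow>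
        \<not> proper_biharmonic M (times_line (hyperbolic (2::2))) \<phi>) \<and>
     (\<forall>m l. m < 0 \<and> l \<noteq> 0 \<longrightarrow>
        (\<forall>\<phi>. cmc_surface M (BCV m l) \<phi> \<longrightarrow> \<not> proper_biharmonic M (BCV m l) \<phi>)) \<and>
     (\<forall>l. l \<noteq> 0 \<longrightarrow>
        (\<forall>\<phi>. cmc_surface M (BCV 0 l) \<phi> \<longrightarrow> \<not> proper_biharmonic M (BCV 0 l) \<phi>)) \<and>
     (\<forall>\<phi>. cmc_surface M Sol \<phi> \<longrightarrow> \<not> proper_biharmonic M Sol \<phi>)"
proof -
  \<comment> \<open>The pairs of \<open>\<kappa>\<close> and \<open>\<beta>\<close> fed to
    \<open>neg\<close> are (0, 0), (-1, 0), (-1, 1) and (1, -2). The hyperbolic product is the one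
    with positive \<open>\<beta>\<close>, where the bound
    \<open>2 * \<kappa> + 2 * \<beta> \<le> 0\<close> holds with equality.\<close>
  note neg = not_proper_biharmonic_nonpositive_ricci[OF assms(1,3)]
  have sphere: "proper_biharmonic M round_sphere \<phi> \<longleftrightarrow> part_of_small_sphere M \<phi>"
    if "cmc_surface M (round_sphere :: ((real^3) \<times> real, 3) rmanifold) \<phi>" for \<phi>
    using proper_biharmonic_iff_slice[OF assms embedded_target_sphere that]
    by (simp add: part_of_small_sphere_def small_sphere_eq)
  have cylinder: "proper_biharmonic M (times_line round_sphere) \<phi> \<longleftrightarrow> part_of_small_circle_times_line M \<phi>"
    if "cmc_surface M (times_line (round_sphere :: ((real^2) \<times> real, 2) rmanifold)) \<phi>" for \<phi>
    unfolding part_of_small_circle_times_line_iff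
    by (rule proper_biharmonic_iff_slice[OF assms embedded_target_sphere_line that])
  show ?thesis
    using neg[OF geometric_target_euclidean] neg[OF geometric_target_hyperbolic]
      neg[OF geometric_target_hyperbolic_line] neg[OF geometric_target_Sol]
      not_proper_biharmonic_BCV[OF assms(1,3)] sphere cylinder
    by simp
qed

end
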